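(* Let $K$ be a totally real number field of degree $n$ such that the Galois group of the Galois closure of $K/\mathbb{Q}$ is isomorphic to $S_n$, and let $d_K$ be the discriminant of $K$. Let $d_s, d_f$ be coprime positive integers such that $d_K = d_s d_f$ and $d_f$ is squarefree. Suppose that $n \ge d_s^2$. If $L$ is an $S_n$ number field, then \[(O_K, \mathrm{tr}_{K/\mathbb{Q}}) \cong (O_L, \mathrm{tr}_{L/\mathbb{Q}}) \quad\text{if and only if}\quad K \cong L.\] Furthermore, if either $K$ has no wild ramification, or $d_K$ is a fundamental discriminant, then the same conclusion holds under the weaker hypothesis $n \ge \mathrm{rad}(d_s)^2$ in place of $n \ge d_s^2$.
   Context: An $S_n$ number field is a number field of degree $n$ whose Galois closure over $\mathbb{Q}$ has Galois group isomorphic to the symmetric group $S_n$. For a number field $K$ with ring of integers $O_K$, $(O_K,\mathrm{tr}_{K/\mathbb{Q}})$ denotes the $\mathbb{Z}$-lattice $O_K$ with the integral bilinear form $(x,y)\mapsto \mathrm{Tr}_{K/\mathbb{Q}}(xy)$; $\cong$ between such lattices means there is a $\mathbb{Z}$-linear bijection $O_K\to O_L$ preserving these forms. $\mathrm{rad}(m)$ is the product of the distinct primes dividing the nonzero integer $m$ (so $\mathrm{rad}(1)=1$). *)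

theory Defs
  imports
    "HOL-Algebra.Algebra"
    "HOL-Algebra.Algebraic_Closure_Type"
    "HOL-Computational_Algebra.Computational_Algebra"
    "Jordan_Normal_Form.Determinant"
begin

text \<open>
  Number fields are subfields (as sets) of an arbitrary ambient field of characteristic 0, given
  as a type; they are not assumed to be embedded in the complex numbers. The ambient type is
  viewed as a ring record through \<^const>\<open>ring_of_type_algebra\<close>.
\<close>

abbreviation subring_of_type :: "'a::field_char_0 set \<Rightarrow> 'a ring" where
  "subring_of_type S \<equiv> ring_of_type_algebra\<lparr>carrier := S\<rparr>"

global_interpretation rat_vs: vector_space "\<lambda>(q::rat) (x::'a::field_char_0). of_rat q * x"
  by unfold_locales (simp_all add: algebra_simps of_rat_add of_rat_mult)

definition rat_basis :: "'a::field_char_0 set \<Rightarrow> 'a set \<Rightarrow> bool" where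
  "rat_basis K B \<longleftrightarrow> finite B \<and> rat_vs.independent B \<and> rat_vs.span B = K"

definition number_field :: "'a::field_char_0 set \<Rightarrow> bool" where
  "number_field K \<longleftrightarrow> subfield K ring_of_type_algebra \<and> (\<exists>B. rat_basis K B)"

definition nf_degree :: "'a::field_char_0 set \<Rightarrow> nat" where
  "nf_degree K = rat_vs.dim K"

definition nf_iso :: "'a::field_char_0 set \<Rightarrow> 'b::field_char_0 set \<Rightarrow> bool" where
  "nf_iso K L \<longleftrightarrow> subring_of_type K \<simeq> subring_of_type L"


text \<open>The Galois closure is realised inside the complex numbers, as the compositum of the images
  of all embeddings.\<close>

definition embeddings :: "'a::field_char_0 set \<Rightarrow> ('a \<Rightarrow> complex) set" where
  "embeddings K = Ring.ring_hom (subring_of_type K) ring_of_type_algebra"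

definition totally_real :: "'a::field_char_0 set \<Rightarrow> bool" where
  "totally_real K \<longleftrightarrow> (\<forall>\<sigma>\<in>embeddings K. \<sigma> ` K \<subseteq> \<real>)"

definition galois_closure :: "'a::field_char_0 set \<Rightarrow> complex set" where
  "galois_closure K = generate_field ring_of_type_algebra (\<Union>\<sigma>\<in>embeddings K. \<sigma> ` K)"

text \<open>As in \<^const>\<open>AutoGroup\<close>, membership in \<^const>\<open>Bij\<close> makes the automorphisms extensional, so
  that each one is counted once.\<close>

definition galois_group :: "'a::field_char_0 set \<Rightarrow> ('a \<Rightarrow> 'a) monoid" where
  "galois_group E = BijGroup E\<lparr>carrier :=
     {\<sigma> \<in> Bij E. \<sigma> \<in> ring_iso (subring_of_type E) (subring_of_type E) \<and> (\<forall>x\<in>\<rat>. \<sigma> x = x)}\<rparr>"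

definition Sn_number_field :: "nat \<Rightarrow> 'a::field_char_0 set \<Rightarrow> bool" where
  "Sn_number_field n K \<longleftrightarrow>
     number_field K \<and> nf_degree K = n \<and> galois_group (galois_closure K) \<cong> sym_group n"


definition ring_of_integers :: "'a::field_char_0 set \<Rightarrow> 'a set" where
  "ring_of_integers K = {x \<in> K. algebraic_int x}"

text \<open>The trace of the endomorphism \<open>y \<mapsto> x * y\<close> of the rational vector space \<open>K\<close>, i.e. the sum
  of the diagonal entries of its matrix; it does not depend on the chosen basis.\<close>

definition nf_trace :: "'a::field_char_0 set \<Rightarrow> 'a \<Rightarrow> rat" where
  "nf_trace K x =
     (let B = (SOME B. rat_basis K B) in \<Sum>b\<in>B. rat_vs.representation B (x * b) b)"

definition trace_lattice_iso :: "'a::field_char_0 set \<Rightarrow> 'b::field_char_0 set \<Rightarrow> bool" where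
  "trace_lattice_iso K L \<longleftrightarrow>
     (\<exists>\<phi>. bij_betw \<phi> (ring_of_integers K) (ring_of_integers L) \<and>
        (\<forall>x\<in>ring_of_integers K. \<forall>y\<in>ring_of_integers K. \<phi> (x + y) = \<phi> x + \<phi> y) \<and>
        (\<forall>x\<in>ring_of_integers K. \<forall>y\<in>ring_of_integers K.
           nf_trace L (\<phi> x * \<phi> y) = nf_trace K (x * y)))"

definition integral_basis :: "'a::field_char_0 set \<Rightarrow> 'a list \<Rightarrow> bool" where
  "integral_basis K w \<longleftrightarrow> set w \<subseteq> ring_of_integers K \<and>
     (\<forall>x\<in>ring_of_integers K. \<exists>!c::int list.
        length c = length w \<and> x = (\<Sum>i<length w. of_int (c ! i) * w ! i))"

text \<open>The Gram determinant is a rational integer and is the same for all integral bases.\<close>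

definition nf_disc :: "'a::field_char_0 set \<Rightarrow> int" where
  "nf_disc K = (THE d. \<exists>w. integral_basis K w \<and>
     of_int d = det (mat (length w) (length w) (\<lambda>(i, j). nf_trace K (w ! i * w ! j))))"


text \<open>For a prime ideal \<open>P\<close> of the ring of integers above \<open>p\<close>: the exponent of \<open>P\<close> in the
  factorisation of \<open>(p)\<close>. Containment of \<open>(p)\<close> in \<open>P ^ e\<close> is membership of \<open>p\<close>.\<close>

definition ramification_index :: "'a::field_char_0 set \<Rightarrow> nat \<Rightarrow> 'a set \<Rightarrow> nat" where
  "ramification_index K p P =
     (GREATEST e::nat. of_nat p \<in> P [^]\<^bsub>ideals_set (subring_of_type (ring_of_integers K))\<^esub> e)"

text \<open>Residue field extensions are extensions of finite fields, hence separable, so wild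
  ramification at \<open>P\<close> over \<open>p\<close> just means that \<open>p\<close> divides the ramification index.\<close>

definition no_wild_ramification :: "'a::field_char_0 set \<Rightarrow> bool" where
  "no_wild_ramification K \<longleftrightarrow>
     (\<forall>p P. Factorial_Ring.prime p \<and> primeideal P (subring_of_type (ring_of_integers K)) \<and> of_nat p \<in> P \<longrightarrow>
        \<not> p dvd ramification_index K p P)"


text \<open>The discriminants of quadratic fields, together with 1.\<close>

definition fundamental_discriminant :: "int \<Rightarrow> bool" where
  "fundamental_discriminant D \<longleftrightarrow>
     D mod 4 = 1 \<and> squarefree D \<or>
     (\<exists>m. D = 4 * m \<and> (m mod 4 = 2 \<or> m mod 4 = 3) \<and> squarefree m)"

definition rad :: "nat \<Rightarrow> nat" where
  "rad m = \<Prod>(prime_factors m)"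

end

theory Submission
  imports Defs "Jordan_Normal_Form.Char_Poly"
begin

text \<open>In the coordinates given by the embeddings \<open>\<sigma> i\<close> of \<open>K\<close> and \<open>\<tau> j\<close> of \<open>L\<close>, an isometry of
  the trace lattices is an orthogonal matrix \<open>U\<close>. If \<open>K\<close> and \<open>L\<close> are not isomorphic, then \<open>K\<close> is
  linearly disjoint from every conjugate of \<open>L\<close>: otherwise their tensor product contains an
  idempotent with \<open>1 \<le> k < n\<close> nonzero coordinates, and since the Galois group permutes the
  coordinates arbitrarily, this makes the conjugate of \<open>L\<close> too large (\<open>1 < k < n - 1\<close>) or a conjugate
  of \<open>K\<close>. Hence \<open>U\<close> has no zero entry, and a row with one rational entry is constant.

  Diagonalising the trace form over \<open>\<int>\<close> bounds the denominators: \<open>d U\<close> has algebraic integer entries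
  for \<open>d = d\<^sub>s\<close>, or \<open>d = rad d\<^sub>s\<close>. A prime dividing exactly one elementary divisor costs nothing, which
  removes \<open>d\<^sub>f\<close>; and \<open>p\<^sup>2\<close> divides no elementary divisor if the ramification at \<open>p\<close> is tame. So the
  product of the positive numbers \<open>(d U j i)\<^sup>2\<close> is a positive integer, while their sum is
  \<open>d\<^sup>2 n \<le> n\<^sup>2\<close>. By the inequality of means all of them are \<open>1\<close>, so all entries of \<open>U\<close> are
  rational and all rows are constant, which contradicts orthogonality.\<close>

text \<open>The matrix \<open>U\<close> is one element of the tensor product of \<open>L\<close> and
  \<open>K\<close>, the sum of the \<open>\<phi> (w k)\<close> tensored with the dual
  \<open>v k\<close>, read through all pairs of embeddings. Hence a zero entry is a question about
  zero divisors, and the product of all entries is a norm, so rational. An idempotent supported on a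
  set T of embeddings has as coordinates the sums of \<open>\<sigma> i (v k)\<close> over i in T;
  Galois elements carry them to the sums over any other set of the same size, and this binomial
  coefficient exceeds n unless T or its complement is a single embedding. Total reality of
  \<open>K\<close> makes \<open>U\<close> real, and only then are the squares positive, as the
  inequality of means demands. Two bases \<open>e\<close>, \<open>f\<close> diagonalise the trace
  form because a symmetric integral form need not have an orthogonal basis. For tame
  \<open>p\<close>, a divisor divisible by \<open>p^2\<close> would give an element outside some
  prime \<open>P\<close> above \<open>p\<close> whose multiples all have trace divisible by
  \<open>p\<close> and which kills \<open>P^e\<close> modulo \<open>p\<close>. Traces are then e
  times traces of the residue field, so \<open>p\<close> divides e. The residue field trace is
  computed by character sums over all residues instead of a basis, and one element \<open>y\<close>
  of valuation -1 replaces the factorisation of ideals.\<close>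

lemma mat_mult_index:
  assumes "A \<in> carrier_mat n n" "B \<in> carrier_mat n n" "i < n" "j < n"
  shows "(A * B) $$ (i, j) = (\<Sum>k<n. A $$ (i, k) * B $$ (k, j))"
  using assms by (auto simp: scalar_prod_def atLeast0LessThan intro!: sum.cong)

text \<open>A kernel vector of the transposed matrix is a relation between the rows. The hypothesis
  has the form in which Dedekind independence and nondegeneracy of the trace form are
  available.\<close>

lemma det_nonzero_if_rows_independent:
  fixes S :: "nat \<Rightarrow> nat \<Rightarrow> 'c::field"
  assumes "\<And>c. (\<And>k. k < n \<Longrightarrow> (\<Sum>i<n. c i * S i k) = 0) \<Longrightarrow> \<forall>i<n. c i = 0"
  shows "det (mat n n (\<lambda>(i, k). S i k)) \<noteq> 0"
proof
  let ?A = "mat n n (\<lambda>(i, k). S i k)"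
  assume "det ?A = 0"
  then have "det (transpose_mat ?A) = 0"
    by (subst det_transpose[of _ n]) auto
  then obtain v where v: "v \<in> carrier_vec n" "v \<noteq> 0\<^sub>v n" "transpose_mat ?A *\<^sub>v v = 0\<^sub>v n"
    using det_0_iff_vec_prod_zero_field[of "transpose_mat ?A" n] by auto
  have "(\<Sum>i<n. v $ i * S i k) = 0" if "k < n" for k
  proof -
    have "(transpose_mat ?A *\<^sub>v v) $ k = (\<Sum>i<n. v $ i * S i k)"
      using that v(1) by (auto simp: scalar_prod_def atLeast0LessThan mult.commute intro!: sum.cong)
    then show ?thesis using v(3) that by simp
  qed
  then have "\<forall>i<n. v $ i = 0" by (rule assms)
  then have "v = 0\<^sub>v n" using v(1) by auto
  with v(2) show False by simp
qed

lemma inverse_if_det_nonzero: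
  fixes S :: "nat \<Rightarrow> nat \<Rightarrow> 'c::field"
  assumes "det (mat n n (\<lambda>(i, k). S i k)) \<noteq> 0"
  obtains R where "\<forall>i<n. \<forall>j<n. (\<Sum>k<n. S i k * R k j) = of_bool (i = j)"
    and "\<forall>k<n. \<forall>l<n. (\<Sum>i<n. R k i * S i l) = of_bool (k = l)"
proof -
  let ?A = "mat n n (\<lambda>(i, k). S i k)"
  define R where "R k j = adj_mat ?A $$ (k, j) / det ?A" for k j
  have A: "?A \<in> carrier_mat n n" by simp
  note adj = adj_mat[OF A]
  have "(\<Sum>k<n. S i k * R k j) = of_bool (i = j)" if "i < n" "j < n" for i j
  proof -
    have "(?A * adj_mat ?A) $$ (i, j) = (\<Sum>k<n. S i k * adj_mat ?A $$ (k, j))"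
      using that by (subst mat_mult_index[OF A adj(1)]) auto
    moreover have "(?A * adj_mat ?A) $$ (i, j) = det ?A * of_bool (i = j)"
      unfolding adj(2) using that by simp
    moreover have "(\<Sum>k<n. S i k * R k j) = (\<Sum>k<n. S i k * adj_mat ?A $$ (k, j)) / det ?A"
      by (simp add: R_def sum_divide_distrib)
    ultimately show ?thesis using assms by (metis nonzero_mult_div_cancel_left)
  qed
  moreover have "(\<Sum>i<n. R k i * S i l) = of_bool (k = l)" if "k < n" "l < n" for k l
  proof -
    have "(adj_mat ?A * ?A) $$ (k, l) = (\<Sum>i<n. adj_mat ?A $$ (k, i) * S i l)"
      using that by (subst mat_mult_index[OF adj(1) A]) auto
    moreover have "(adj_mat ?A * ?A) $$ (k, l) = det ?A * of_bool (k = l)"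
      unfolding adj(3) using that by simp
    moreover have "(\<Sum>i<n. R k i * S i l) = (\<Sum>i<n. adj_mat ?A $$ (k, i) * S i l) / det ?A"
      by (simp add: R_def sum_divide_distrib)
    ultimately show ?thesis using assms by (metis nonzero_mult_div_cancel_left)
  qed
  ultimately show ?thesis using that[of R] by simp
qed

lemma right_inverse_if_left_inverse:
  fixes S :: "nat \<Rightarrow> nat \<Rightarrow> 'c::field"
  assumes "\<forall>k<n. \<forall>l<n. (\<Sum>i<n. R k i * S i l) = of_bool (k = l)"
    and "i < n" "j < n"
  shows "(\<Sum>k<n. S i k * R k j) = of_bool (i = j)"
proof -
  let ?S = "mat n n (\<lambda>(i, k). S i k)" and ?R = "mat n n (\<lambda>(i, k). R i k)"
  have C: "?S \<in> carrier_mat n n" "?R \<in> carrier_mat n n" by auto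
  have "?R * ?S = 1\<^sub>m n"
    by (rule eq_matI) (use assms(1) in \<open>auto simp: scalar_prod_def atLeast0LessThan\<close>)
  from mat_mult_left_right_inverse[OF C(2,1) this] have "(?S * ?R) $$ (i, j) = of_bool (i = j)"
    using assms(2,3) by simp
  then show ?thesis using assms(2,3) by (subst (asm) mat_mult_index[OF C]) auto
qed

text \<open>Subtracting \<open>\<chi> a x0\<close> times the relation at \<open>x\<close> from the
  relation at \<open>x0 * x\<close> cancels the term of \<open>a\<close>; what remains is a shorter
  relation with coefficients \<open>c i * (\<chi> i x0 - \<chi> a x0)\<close>. \<open>H\<close> is
  merely multiplicatively closed, so that maps which are multiplicative on a subfield of the type
  qualify.\<close>

lemma dedekind_independence:
  fixes \<chi> :: "'i \<Rightarrow> 'a::monoid_mult \<Rightarrow> 'c::field"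
  assumes "finite I" and H: "1 \<in> H" "\<And>x y. x \<in> H \<Longrightarrow> y \<in> H \<Longrightarrow> x * y \<in> H"
    and \<chi>: "\<And>i. i \<in> I \<Longrightarrow> \<chi> i 1 = 1"
      "\<And>i x y. i \<in> I \<Longrightarrow> x \<in> H \<Longrightarrow> y \<in> H \<Longrightarrow> \<chi> i (x * y) = \<chi> i x * \<chi> i y"
    and distinct: "\<And>i j. i \<in> I \<Longrightarrow> j \<in> I \<Longrightarrow> i \<noteq> j \<Longrightarrow> \<exists>x\<in>H. \<chi> i x \<noteq> \<chi> j x"
    and "\<And>x. x \<in> H \<Longrightarrow> (\<Sum>i\<in>I. c i * \<chi> i x) = 0"
    and "i \<in> I"
  shows "c i = 0"
proof -
  have "\<forall>i\<in>I. c i = 0"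
    using assms(1) \<chi> distinct assms(7)
  proof (induction I arbitrary: c rule: finite_induct)
    case (insert a I)
    have c0: "c j = 0" if j: "j \<in> I" for j
    proof -
      have "a \<noteq> j" using insert.hyps j by auto
      then obtain x0 where x0: "x0 \<in> H" "\<chi> a x0 \<noteq> \<chi> j x0"
        using insert.prems(3)[of a j] j by auto
      have "(\<Sum>i\<in>I. (c i * (\<chi> i x0 - \<chi> a x0)) * \<chi> i x) = 0" if x: "x \<in> H" for x
      proof -
        have "0 = (\<Sum>i\<in>insert a I. c i * \<chi> i (x0 * x)) - \<chi> a x0 * (\<Sum>i\<in>insert a I. c i * \<chi> i x)"
          using insert.prems(4) x x0(1) H(2) by simp
        also have "\<dots> = (\<Sum>i\<in>insert a I. (c i * (\<chi> i x0 - \<chi> a x0)) * \<chi> i x)"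
          unfolding sum_distrib_left sum_subtractf[symmetric]
          by (rule sum.cong) (use insert.prems(2) x x0(1) in \<open>auto simp: algebra_simps\<close>)
        also have "\<dots> = (\<Sum>i\<in>I. (c i * (\<chi> i x0 - \<chi> a x0)) * \<chi> i x)"
          using insert.hyps by simp
        finally show ?thesis by simp
      qed
      from insert.IH[OF _ _ _ this] have "\<forall>i\<in>I. c i * (\<chi> i x0 - \<chi> a x0) = 0"
        using insert.prems(1-3) by blast
      then show ?thesis using x0(2) j by auto
    qed
    have "c a * \<chi> a 1 + (\<Sum>i\<in>I. c i * \<chi> i 1) = 0"
      using insert.prems(4)[OF H(1)] insert.hyps by simp
    moreover have "(\<Sum>i\<in>I. c i * \<chi> i 1) = 0" using c0 by simp
    ultimately have "c a = 0" using insert.prems(1) by simp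
    with c0 show ?case by auto
  qed simp
  then show ?thesis using assms(8) by blast
qed

section \<open>Algebraic integers\<close>

text \<open>Coefficients are indexed by the elements of \<open>V\<close> themselves. The intended
  \<open>V\<close> are finite, since a sum over an infinite set is 0.\<close>

definition zspan :: "'a::ring_1 set \<Rightarrow> 'a set" where
  "zspan V = {\<Sum>v\<in>V. of_int (c v) * v |c. True}"

lemma zspanI: "x = (\<Sum>v\<in>V. of_int (c v) * v) \<Longrightarrow> x \<in> zspan V"
  unfolding zspan_def by auto

lemma zspanE:
  assumes "x \<in> zspan V"
  obtains c where "x = (\<Sum>v\<in>V. of_int (c v) * v)"
  using assms unfolding zspan_def by auto

lemma zspan_add: "x \<in> zspan V \<Longrightarrow> y \<in> zspan V \<Longrightarrow> x + y \<in> zspan V"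
proof -
  assume "x \<in> zspan V" "y \<in> zspan V"
  then obtain c d where "x = (\<Sum>v\<in>V. of_int (c v) * v)" "y = (\<Sum>v\<in>V. of_int (d v) * v)"
    by (auto simp: zspan_def)
  then have "x + y = (\<Sum>v\<in>V. of_int (c v + d v) * v)"
    by (simp add: sum.distrib algebra_simps)
  then show ?thesis by (rule zspanI)
qed

lemma zspan_0 [simp]: "0 \<in> zspan V"
  unfolding zspan_def by (auto intro!: exI[of _ "\<lambda>_. 0"])

lemma zspan_scale: "x \<in> zspan V \<Longrightarrow> of_int k * x \<in> zspan V"
proof -
  assume "x \<in> zspan V"
  then obtain c where "x = (\<Sum>v\<in>V. of_int (c v) * v)" by (auto simp: zspan_def)
  then have "of_int k * x = (\<Sum>v\<in>V. of_int (k * c v) * v)"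
    by (simp add: sum_distrib_left mult.assoc)
  then show ?thesis by (rule zspanI)
qed

lemma zspan_sum: "(\<And>i. i \<in> I \<Longrightarrow> f i \<in> zspan V) \<Longrightarrow> (\<Sum>i\<in>I. f i) \<in> zspan V"
  by (induction I rule: infinite_finite_induct) (auto intro: zspan_add)

lemma zspan_base: "finite V \<Longrightarrow> v \<in> V \<Longrightarrow> v \<in> zspan V"
proof -
  assume "finite V" "v \<in> V"
  then have "v = (\<Sum>u\<in>V. of_int (of_bool (u = v)) * u)" by simp
  then show ?thesis by (rule zspanI)
qed

lemma zspan_mult:
  fixes y :: "'a::comm_ring_1"
  assumes "\<And>v. v \<in> V \<Longrightarrow> y * v \<in> zspan V" "x \<in> zspan V"
  shows "y * x \<in> zspan V"
proof -
  obtain c where "x = (\<Sum>v\<in>V. of_int (c v) * v)" using assms(2) by (auto simp: zspan_def)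
  then have "y * x = (\<Sum>v\<in>V. of_int (c v) * (y * v))"
    by (simp add: sum_distrib_left mult.left_commute)
  then show ?thesis using assms(1) by (simp add: zspan_sum zspan_scale)
qed

text \<open>The determinant trick: the generators form an eigenvector, with eigenvalue
  \<open>y\<close>, of an integer matrix, so \<open>y\<close> is a root of the monic characteristic
  polynomial of that matrix. The element \<open>v0\<close> makes the eigenvector nonzero.\<close>

lemma algebraic_int_if_zspan_invariant:
  fixes y :: "'a::field_char_0"
  assumes "finite V" "v0 \<in> V" "v0 \<noteq> 0" and inv: "\<And>v. v \<in> V \<Longrightarrow> y * v \<in> zspan V"
  shows "algebraic_int y"
proof -
  define N where "N = card V"
  obtain e where e: "bij_betw e {0..<N} V"
    using ex_bij_betw_nat_finite[OF assms(1)] by (auto simp: N_def)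
  have "\<exists>c::'a \<Rightarrow> int. y * v = (\<Sum>u\<in>V. of_int (c u) * u)" if "v \<in> V" for v
    using inv[OF that] by (auto simp: zspan_def)
  then obtain c where c: "\<And>v. v \<in> V \<Longrightarrow> y * v = (\<Sum>u\<in>V. of_int (c v u :: int) * u)"
    by metis
  define M where "M = mat N N (\<lambda>(i, j). c (e i) (e j))"
  define A where "A = map_mat (of_int :: int \<Rightarrow> 'a) M"
  have M: "M \<in> carrier_mat N N" and A: "A \<in> carrier_mat N N" by (auto simp: M_def A_def)
  define w where "w = vec N e"
  have eV: "e i \<in> V" if "i < N" for i using e that by (auto simp: bij_betw_def)
  have "A *\<^sub>v w = y \<cdot>\<^sub>v w"
  proof (rule eq_vecI)
    fix i assume "i < dim_vec (y \<cdot>\<^sub>v w)"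
    then have i: "i < N" by (simp add: w_def)
    have "(A *\<^sub>v w) $ i = (\<Sum>j\<in>{0..<N}. of_int (c (e i) (e j)) * e j)"
      using i by (auto simp: A_def M_def w_def scalar_prod_def intro!: sum.cong)
    also have "\<dots> = (\<Sum>u\<in>V. of_int (c (e i) u) * u)"
      using sum.reindex_bij_betw[OF e, of "\<lambda>u. of_int (c (e i) u) * u"] by simp
    also have "\<dots> = y * e i" using c[OF eV[OF i]] by simp
    finally show "(A *\<^sub>v w) $ i = (y \<cdot>\<^sub>v w) $ i" using i by (simp add: w_def)
  qed (auto simp: A_def M_def w_def)
  moreover have "w \<noteq> 0\<^sub>v N"
  proof
    assume w0: "w = 0\<^sub>v N"
    obtain i where "i < N" "e i = v0" using e assms(2) by (auto simp: bij_betw_def)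
    then have "w $ i = v0" by (simp add: w_def)
    then show False using w0 \<open>i < N\<close> assms(3) by simp
  qed
  ultimately have "eigenvalue A y"
    unfolding eigenvalue_def eigenvector_def using A by (intro exI[of _ w]) (auto simp: w_def)
  then have "poly (char_poly A) y = 0" using eigenvalue_root_char_poly[OF A] by simp
  moreover have "char_poly A = map_poly of_int (char_poly M)"
    unfolding A_def by (rule of_int_hom.char_poly_hom[OF M])
  moreover have "lead_coeff (char_poly M) = 1" using degree_monic_char_poly[OF M] by simp
  ultimately show ?thesis unfolding algebraic_int_altdef_ipoly by auto
qed

lemma algebraic_int_power_in_zspan:
  fixes x :: "'a::field_char_0"
  assumes "algebraic_int x"
  obtains d where "d > 0" "x ^ d \<in> zspan ((\<lambda>i. x ^ i) ` {..<d})"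
proof -
  obtain p where p: "poly (map_poly of_int p) x = 0" "lead_coeff p = 1"
    using assms unfolding algebraic_int_altdef_ipoly by auto
  define d where "d = Polynomial.degree p"
  have d: "Polynomial.degree (map_poly (of_int :: int \<Rightarrow> 'a) p) = d" by (simp add: d_def degree_map_poly)
  have "0 = (\<Sum>i\<le>d. of_int (Polynomial.coeff p i) * x ^ i)"
    using p(1) unfolding poly_altdef d by (simp add: coeff_map_poly)
  also have "\<dots> = (\<Sum>i<d. of_int (Polynomial.coeff p i) * x ^ i) + x ^ d"
    using p(2) by (simp add: d_def flip: lessThan_Suc_atMost)
  finally have eq: "x ^ d = (\<Sum>i<d. of_int (- Polynomial.coeff p i) * x ^ i)"
    by (simp add: eq_neg_iff_add_eq_0 add.commute sum_negf)
  have "d > 0"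
  proof (rule ccontr)
    assume "\<not> d > 0"
    then have "x ^ d = 1" "(\<Sum>i<d. of_int (- Polynomial.coeff p i) * x ^ i) = 0" by auto
    with eq show False by simp
  qed
  moreover have "x ^ d \<in> zspan ((\<lambda>i. x ^ i) ` {..<d})"
    unfolding eq by (intro zspan_sum zspan_scale zspan_base) auto
  ultimately show ?thesis using that by blast
qed

text \<open>\<open>V\<close> consists of the monomials \<open>x ^ i * y ^ j\<close> below the
  degrees of monic equations for \<open>x\<close> and \<open>y\<close>. Multiplication leaves this
  range only at \<open>x ^ a\<close> or \<open>y ^ b\<close>, where the equations bring it
  back.\<close>

lemma zspan_two_algebraic_ints:
  fixes x y :: "'a::field_char_0"
  assumes "algebraic_int x" "algebraic_int y"
  obtains V where "finite V" "1 \<in> V"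
    "\<And>v. v \<in> V \<Longrightarrow> x * v \<in> zspan V" "\<And>v. v \<in> V \<Longrightarrow> y * v \<in> zspan V"
proof -
  obtain a where a: "a > 0" "x ^ a \<in> zspan ((\<lambda>i. x ^ i) ` {..<a})"
    using algebraic_int_power_in_zspan[OF assms(1)] .
  obtain b where b: "b > 0" "y ^ b \<in> zspan ((\<lambda>i. y ^ i) ` {..<b})"
    using algebraic_int_power_in_zspan[OF assms(2)] .
  define V where "V = (\<lambda>(i, j). x ^ i * y ^ j) ` ({..<a} \<times> {..<b})"
  have fin: "finite V" by (simp add: V_def)
  have base: "x ^ i * y ^ j \<in> zspan V" if "i < a" "j < b" for i j
    by (rule zspan_base[OF fin]) (use that in \<open>auto simp: V_def\<close>)
  have mult_mem: "u * z \<in> zspan V"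
    if z: "z \<in> zspan W" and W: "\<And>w. w \<in> W \<Longrightarrow> u * w \<in> zspan V" for u z W
  proof -
    obtain c where "z = (\<Sum>v\<in>W. of_int (c v) * v)" using zspanE[OF z] .
    then have "u * z = (\<Sum>v\<in>W. of_int (c v) * (u * v))"
      by (simp add: sum_distrib_left mult.left_commute)
    then show ?thesis using W by (simp add: zspan_sum zspan_scale)
  qed
  have "x * v \<in> zspan V" if v: "v \<in> V" for v
  proof -
    obtain i j where ij: "v = x ^ i * y ^ j" "i < a" "j < b" using v by (auto simp: V_def)
    show ?thesis
    proof (cases "Suc i < a")
      case True
      then show ?thesis using base[of "Suc i" j] ij by (simp add: mult.assoc)
    next
      case False
      then have "Suc i = a" using ij(2) by simp
      then have "x * v = y ^ j * x ^ a" using ij(1) by (auto simp: mult_ac)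
      moreover have "y ^ j * x ^ a \<in> zspan V"
        by (rule mult_mem[OF a(2)]) (use base ij in \<open>auto simp: mult.commute\<close>)
      ultimately show ?thesis by simp
    qed
  qed
  moreover have "y * v \<in> zspan V" if v: "v \<in> V" for v
  proof -
    obtain i j where ij: "v = x ^ i * y ^ j" "i < a" "j < b" using v by (auto simp: V_def)
    show ?thesis
    proof (cases "Suc j < b")
      case True
      then show ?thesis using base[of i "Suc j"] ij by (simp add: mult.left_commute)
    next
      case False
      then have "Suc j = b" using ij(3) by simp
      then have "y * v = x ^ i * y ^ b" using ij(1) by (auto simp: mult.left_commute)
      moreover have "x ^ i * y ^ b \<in> zspan V"
        by (rule mult_mem[OF b(2)]) (use base ij in auto)
      ultimately show ?thesis by simp
    qed
  qed
  moreover have "1 \<in> V"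
    unfolding V_def by (rule image_eqI[of _ _ "(0, 0)"]) (use a(1) b(1) in auto)
  ultimately show ?thesis using that[OF fin] by blast
qed

lemma algebraic_int_plus:
  fixes x y :: "'a::field_char_0"
  assumes "algebraic_int x" "algebraic_int y"
  shows "algebraic_int (x + y)"
proof -
  obtain V where V: "finite V" "1 \<in> V"
    "\<And>v. v \<in> V \<Longrightarrow> x * v \<in> zspan V" "\<And>v. v \<in> V \<Longrightarrow> y * v \<in> zspan V"
    using zspan_two_algebraic_ints[OF assms] by blast
  show ?thesis
    by (rule algebraic_int_if_zspan_invariant[OF V(1,2)]) (use V in \<open>auto simp: distrib_right intro: zspan_add\<close>)
qed

lemma algebraic_int_times:
  fixes x y :: "'a::field_char_0"
  assumes "algebraic_int x" "algebraic_int y"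
  shows "algebraic_int (x * y)"
proof -
  obtain V where V: "finite V" "1 \<in> V"
    "\<And>v. v \<in> V \<Longrightarrow> x * v \<in> zspan V" "\<And>v. v \<in> V \<Longrightarrow> y * v \<in> zspan V"
    using zspan_two_algebraic_ints[OF assms] by blast
  show ?thesis
  proof (rule algebraic_int_if_zspan_invariant[OF V(1,2)])
    fix v assume "v \<in> V"
    then show "x * y * v \<in> zspan V"
      using zspan_mult[OF V(3) V(4)[OF \<open>v \<in> V\<close>]] by (simp add: mult.assoc)
  qed simp
qed

lemma algebraic_int_diff:
  fixes x y :: "'a::field_char_0"
  shows "algebraic_int x \<Longrightarrow> algebraic_int y \<Longrightarrow> algebraic_int (x - y)"
  using algebraic_int_plus[of x "- y"] by simp

lemma algebraic_int_of_int: "algebraic_int (of_int k :: 'a::field_char_0)"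
  by (rule int_imp_algebraic_int) simp

lemma algebraic_int_of_nat: "algebraic_int (of_nat k :: 'a::field_char_0)"
  by (rule int_imp_algebraic_int) simp

lemma algebraic_int_1: "algebraic_int (1 :: 'a::field_char_0)"
  by (rule int_imp_algebraic_int) simp

lemma algebraic_int_sum:
  fixes f :: "'i \<Rightarrow> 'a::field_char_0"
  shows "(\<And>i. i \<in> I \<Longrightarrow> algebraic_int (f i)) \<Longrightarrow> algebraic_int (\<Sum>i\<in>I. f i)"
  by (induction I rule: infinite_finite_induct) (auto intro: algebraic_int_plus)

lemma algebraic_int_prod:
  fixes f :: "'i \<Rightarrow> 'a::field_char_0"
  shows "(\<And>i. i \<in> I \<Longrightarrow> algebraic_int (f i)) \<Longrightarrow> algebraic_int (\<Prod>i\<in>I. f i)"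
  by (induction I rule: infinite_finite_induct) (auto intro: algebraic_int_times algebraic_int_1)

lemma algebraic_int_power:
  fixes x :: "'a::field_char_0"
  shows "algebraic_int x \<Longrightarrow> algebraic_int (x ^ k)"
  by (induction k) (auto intro: algebraic_int_times algebraic_int_1)

text \<open>The monic integer polynomial \<open>X^2 - a X\<close> takes the algebraic integer value
  \<open>z\<close> at \<open>x\<close>.\<close>

lemma algebraic_int_if_quadratic:
  fixes x :: "'a::field_char_0"
  assumes "x ^ 2 = of_int a * x + z" "algebraic_int z"
  shows "algebraic_int x"
proof (rule algebraic_int_root[OF assms(2)])
  show "poly [:0, - of_int a, 1:] x = z"
    using assms(1) by (simp add: power2_eq_square algebra_simps)
  show "\<forall>i. Polynomial.coeff [:0, - of_int a, 1 :: 'a:] i \<in> \<int>"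
    by (auto simp: coeff_pCons split: nat.splits)
qed auto

section \<open>Subfields and embeddings\<close>

text \<open>Since \<open>inverse 0 = 0\<close>, closure under \<open>inverse\<close> is stated
  without an exception for 0. The predicate replaces the record operations of
  \<open>subfield\<close> by those of the type.\<close>

definition subfield_set :: "'a::field_char_0 set \<Rightarrow> bool" where
  "subfield_set K \<longleftrightarrow> 1 \<in> K \<and> (\<forall>x\<in>K. \<forall>y\<in>K. x + y \<in> K \<and> x * y \<in> K) \<and>
     (\<forall>x\<in>K. - x \<in> K \<and> inverse x \<in> K)"

lemma subfield_setD:
  assumes "subfield_set K"
  shows "1 \<in> K" "0 \<in> K" "x \<in> K \<Longrightarrow> y \<in> K \<Longrightarrow> x + y \<in> K" "x \<in> K \<Longrightarrow> y \<in> K \<Longrightarrow> x * y \<in> K"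
    "x \<in> K \<Longrightarrow> - x \<in> K" "x \<in> K \<Longrightarrow> inverse x \<in> K" "x \<in> K \<Longrightarrow> y \<in> K \<Longrightarrow> x - y \<in> K"
    "x \<in> K \<Longrightarrow> y \<in> K \<Longrightarrow> x / y \<in> K"
proof -
  note * = assms[unfolded subfield_set_def]
  show "1 \<in> K" using * by blast
  then have "1 + - 1 \<in> K" using * by blast
  then show "0 \<in> K" by simp
  show "x \<in> K \<Longrightarrow> y \<in> K \<Longrightarrow> x + y \<in> K" "x \<in> K \<Longrightarrow> y \<in> K \<Longrightarrow> x * y \<in> K"
    "x \<in> K \<Longrightarrow> - x \<in> K" "x \<in> K \<Longrightarrow> inverse x \<in> K" using * by blast+
  show "x \<in> K \<Longrightarrow> y \<in> K \<Longrightarrow> x - y \<in> K"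
    using * by (metis diff_conv_add_uminus)
  show "x \<in> K \<Longrightarrow> y \<in> K \<Longrightarrow> x / y \<in> K"
    using * by (metis divide_inverse)
qed

lemma subfield_set_sum: "subfield_set K \<Longrightarrow> (\<And>i. i \<in> I \<Longrightarrow> f i \<in> K) \<Longrightarrow> (\<Sum>i\<in>I. f i) \<in> K"
  by (induction I rule: infinite_finite_induct) (auto intro: subfield_setD)

lemma subfield_set_prod: "subfield_set K \<Longrightarrow> (\<And>i. i \<in> I \<Longrightarrow> f i \<in> K) \<Longrightarrow> (\<Prod>i\<in>I. f i) \<in> K"
  by (induction I rule: infinite_finite_induct) (auto intro: subfield_setD)

lemma subfield_set_power: "subfield_set K \<Longrightarrow> x \<in> K \<Longrightarrow> x ^ k \<in> K"
  by (induction k) (auto intro: subfield_setD)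

lemma subfield_set_of_nat: "subfield_set K \<Longrightarrow> of_nat k \<in> K"
  by (induction k) (auto intro: subfield_setD)

lemma subfield_set_of_int: "subfield_set K \<Longrightarrow> of_int k \<in> K"
  by (cases k) (auto intro!: subfield_setD(5) subfield_setD(7) subfield_setD(1) subfield_set_of_nat)

lemma subfield_set_of_rat: "subfield_set K \<Longrightarrow> of_rat q \<in> K"
  by (cases q) (auto simp: of_rat_rat intro!: subfield_setD(8) subfield_set_of_int)

text \<open>Nothing is said outside \<open>K\<close>, so different functions may be the same
  embedding; distinctness is therefore always witnessed by a point of \<open>K\<close>.\<close>

definition hom_on :: "'a::field_char_0 set \<Rightarrow> ('a \<Rightarrow> 'b::field_char_0) \<Rightarrow> bool" where
  "hom_on K \<sigma> \<longleftrightarrow> \<sigma> 1 = 1 \<and> (\<forall>x\<in>K. \<forall>y\<in>K. \<sigma> (x + y) = \<sigma> x + \<sigma> y \<and> \<sigma> (x * y) = \<sigma> x * \<sigma> y)"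

lemma hom_onD:
  assumes "hom_on K \<sigma>"
  shows "\<sigma> 1 = 1" "x \<in> K \<Longrightarrow> y \<in> K \<Longrightarrow> \<sigma> (x + y) = \<sigma> x + \<sigma> y"
    "x \<in> K \<Longrightarrow> y \<in> K \<Longrightarrow> \<sigma> (x * y) = \<sigma> x * \<sigma> y"
  using assms unfolding hom_on_def by blast+

locale field_hom_on =
  fixes K :: "'a::field_char_0 set" and \<sigma> :: "'a \<Rightarrow> 'b::field_char_0"
  assumes K: "subfield_set K" and hom: "hom_on K \<sigma>"
begin

lemmas add = hom_onD(2)[OF hom] and mult = hom_onD(3)[OF hom] and one = hom_onD(1)[OF hom]

lemma zero: "\<sigma> 0 = 0"
  using add[of 0 0] subfield_setD(2)[OF K] by simp

lemma minus: "x \<in> K \<Longrightarrow> \<sigma> (- x) = - \<sigma> x"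
  using add[of x "- x"] subfield_setD(5)[OF K] zero by (simp add: eq_neg_iff_add_eq_0 add.commute)

lemma diff: "x \<in> K \<Longrightarrow> y \<in> K \<Longrightarrow> \<sigma> (x - y) = \<sigma> x - \<sigma> y"
  using add[of x "- y"] minus[of y] subfield_setD(5)[OF K] by simp

lemma inverse_hom: "x \<in> K \<Longrightarrow> \<sigma> (inverse x) = inverse (\<sigma> x)"
proof (cases "x = 0")
  case False
  assume "x \<in> K"
  then have "\<sigma> x * \<sigma> (inverse x) = 1"
    using mult[of x "inverse x"] subfield_setD(6)[OF K] False one by simp
  then show ?thesis by (metis inverse_unique)
qed (simp add: zero)

lemma divide: "x \<in> K \<Longrightarrow> y \<in> K \<Longrightarrow> \<sigma> (x / y) = \<sigma> x / \<sigma> y"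
  by (simp add: divide_inverse mult inverse_hom subfield_setD(6)[OF K])

lemma sum: "(\<And>i. i \<in> I \<Longrightarrow> f i \<in> K) \<Longrightarrow> \<sigma> (\<Sum>i\<in>I. f i) = (\<Sum>i\<in>I. \<sigma> (f i))"
  by (induction I rule: infinite_finite_induct) (auto simp: zero add subfield_set_sum[OF K])

lemma prod: "(\<And>i. i \<in> I \<Longrightarrow> f i \<in> K) \<Longrightarrow> \<sigma> (\<Prod>i\<in>I. f i) = (\<Prod>i\<in>I. \<sigma> (f i))"
  by (induction I rule: infinite_finite_induct) (auto simp: one mult subfield_set_prod[OF K])

lemma power: "x \<in> K \<Longrightarrow> \<sigma> (x ^ k) = \<sigma> x ^ k"
  by (induction k) (auto simp: one mult subfield_set_power[OF K])

lemma of_nat: "\<sigma> (of_nat k) = of_nat k"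
  by (induction k) (auto simp: zero one add subfield_setD(1)[OF K] subfield_set_of_nat[OF K])

lemma of_int: "\<sigma> (of_int k) = of_int k"
proof (cases k)
  case (neg m)
  then have "(of_int k :: 'a) = - of_nat (Suc m)" by simp
  then have "\<sigma> (of_int k) = - of_nat (Suc m)"
    by (metis minus of_nat subfield_set_of_nat[OF K])
  then show ?thesis using neg by simp
qed (simp add: of_nat)

lemma of_rat: "\<sigma> (of_rat q) = of_rat q"
  by (cases q) (simp add: of_rat_rat divide of_int subfield_set_of_int[OF K])

lemma eq_0_iff: "x \<in> K \<Longrightarrow> \<sigma> x = 0 \<longleftrightarrow> x = 0"
proof
  assume "x \<in> K" "\<sigma> x = 0"
  show "x = 0"
  proof (rule ccontr)
    assume "x \<noteq> 0"
    then have "\<sigma> (x * inverse x) = 1" using one by simp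
    then have "\<sigma> x * \<sigma> (inverse x) = 1"
      using mult \<open>x \<in> K\<close> subfield_setD(6)[OF K] by simp
    then show False using \<open>\<sigma> x = 0\<close> by simp
  qed
qed (simp add: zero)

lemma inj: "inj_on \<sigma> K"
proof (rule inj_onI)
  fix x y assume "x \<in> K" "y \<in> K" "\<sigma> x = \<sigma> y"
  then have "\<sigma> (x - y) = 0" by (simp add: diff)
  then show "x = y" using eq_0_iff[of "x - y"] subfield_setD(7)[OF K] \<open>x \<in> K\<close> \<open>y \<in> K\<close> by simp
qed

lemma lincomb:
  "(\<And>i. i \<in> I \<Longrightarrow> w i \<in> K) \<Longrightarrow>
    \<sigma> (\<Sum>i\<in>I. Rat.of_rat (c i) * w i) = (\<Sum>i\<in>I. Rat.of_rat (c i) * \<sigma> (w i))"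
  by (subst sum) (auto simp: subfield_setD(4)[OF K] subfield_set_of_rat[OF K] mult of_rat)

text \<open>Integer polynomials commute with \<open>\<sigma>\<close>, and \<open>\<sigma>\<close> is
  injective on \<open>K\<close>, so \<open>x\<close> and \<open>\<sigma> x\<close> satisfy the same
  integer equations.\<close>

lemma algebraic_int_iff: "x \<in> K \<Longrightarrow> algebraic_int (\<sigma> x) \<longleftrightarrow> algebraic_int x"
proof -
  assume x: "x \<in> K"
  have *: "poly (map_poly Int.of_int p) (\<sigma> x) = \<sigma> (poly (map_poly Int.of_int p) x)" for p
    unfolding poly_altdef
    by (subst sum)
       (auto simp: degree_map_poly coeff_map_poly mult of_int power x
         subfield_setD(4)[OF K] subfield_set_of_int[OF K] subfield_set_power[OF K])
  have "poly (map_poly Int.of_int p) x \<in> K" for p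
    unfolding poly_altdef
    by (intro subfield_set_sum[OF K] subfield_setD(4)[OF K] subfield_set_power[OF K] x)
       (auto simp: coeff_map_poly subfield_set_of_int[OF K])
  then have "poly (map_poly Int.of_int p) (\<sigma> x) = 0 \<longleftrightarrow> poly (map_poly Int.of_int p) x = 0" for p
    unfolding * by (rule eq_0_iff)
  then show ?thesis unfolding algebraic_int_altdef_ipoly by simp
qed

end

section \<open>Translation from ring records to closure conditions\<close>

lemma ring_of_type_simps [simp]:
  "carrier ring_of_type_algebra = UNIV" "x \<otimes>\<^bsub>ring_of_type_algebra\<^esub> y = x * y"
  "x \<oplus>\<^bsub>ring_of_type_algebra\<^esub> y = x + y" "\<one>\<^bsub>ring_of_type_algebra\<^esub> = 1"
  "\<zero>\<^bsub>ring_of_type_algebra\<^esub> = 0"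
  by (simp_all add: ring_of_type_algebra_def)

lemma field_ring_of_type: "field (ring_of_type_algebra :: 'a::field_char_0 ring)"
  by (rule field_from_type_algebra)

lemma ring_of_type_minus: "\<ominus>\<^bsub>ring_of_type_algebra\<^esub> x = - (x :: 'a::field_char_0)"
proof -
  interpret field "ring_of_type_algebra :: 'a ring" by (rule field_ring_of_type)
  show ?thesis by (rule minus_equality) auto
qed

lemma ring_of_type_inv: "x \<noteq> 0 \<Longrightarrow> inv\<^bsub>ring_of_type_algebra\<^esub> x = inverse (x :: 'a::field_char_0)"
proof -
  assume "x \<noteq> 0"
  interpret field "ring_of_type_algebra :: 'a ring" by (rule field_ring_of_type)
  show ?thesis by (rule inv_unique'[symmetric]) (use \<open>x \<noteq> 0\<close> in auto)
qed

lemma subfield_set_if_subfield: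
  assumes "subfield K (ring_of_type_algebra :: 'a::field_char_0 ring)"
  shows "subfield_set K"
proof -
  interpret field "ring_of_type_algebra :: 'a ring" by (rule field_ring_of_type)
  interpret K: subfield K "ring_of_type_algebra :: 'a ring" by (rule assms)
  have "inverse x \<in> K" if "x \<in> K" for x
  proof (cases "x = 0")
    case False
    then have "inv\<^bsub>ring_of_type_algebra\<^esub> x \<in> K" using subfield_m_inv(1)[OF assms, of x] that by auto
    then show ?thesis using False by (simp add: ring_of_type_inv)
  qed (use that in simp)
  moreover have "- x \<in> K" if "x \<in> K" for x
    using K.m_inv_closed[OF that] by (simp flip: ring_of_type_minus add: a_inv_def)
  ultimately show ?thesis
    using K.m_closed K.one_closed K.subgroup_axioms subgroup.m_closed[OF K.subgroup_axioms]
    unfolding subfield_set_def by (simp add: ring_of_type_algebra_def)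
qed

lemma subfield_set_generate_field:
  "subfield_set (generate_field (ring_of_type_algebra :: 'a::field_char_0 ring) H)" (is "subfield_set ?E")
proof -
  have "1 \<in> ?E" using generate_field.one[of "ring_of_type_algebra :: 'a ring" H] by simp
  moreover have "- x \<in> ?E" if "x \<in> ?E" for x
    using generate_field.a_inv[OF that] by (simp add: ring_of_type_minus)
  then have "0 \<in> ?E" using \<open>1 \<in> ?E\<close> generate_field.eng_add[of 1 ring_of_type_algebra H "- 1"] by force
  moreover have "inverse x \<in> ?E" if "x \<in> ?E" for x
    using generate_field.m_inv[OF that] \<open>0 \<in> ?E\<close> by (cases "x = 0") (auto simp: ring_of_type_inv)
  ultimately show ?thesis
    unfolding subfield_set_def
    using \<open>\<And>x. x \<in> ?E \<Longrightarrow> - x \<in> ?E\<close> generate_field.eng_add[of _ ring_of_type_algebra H]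
      generate_field.eng_mult[of _ ring_of_type_algebra H] by fastforce
qed

lemma embeddings_iff: "\<sigma> \<in> embeddings K \<longleftrightarrow> hom_on K \<sigma>"
  unfolding embeddings_def Ring.ring_hom_def hom_on_def by auto

lemma ring_iso_iff:
  "f \<in> ring_iso (subring_of_type K) (subring_of_type L) \<longleftrightarrow> hom_on K f \<and> bij_betw f K L"
  unfolding ring_iso_def Ring.ring_hom_def hom_on_def by (auto simp: bij_betw_def)

lemma nf_iso_iff: "nf_iso K L \<longleftrightarrow> (\<exists>f. hom_on K f \<and> bij_betw f K L)"
  unfolding nf_iso_def is_ring_iso_def using ring_iso_iff[of _ K L] by blast

text \<open>With more than \<open>m\<close> homomorphisms, the matrix of values
  \<open>\<chi> i (w k)\<close>, filled up with zero columns to a square one, would be nonsingular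
  by Dedekind independence although its column \<open>m\<close> is zero.\<close>

lemma card_homs_le:
  fixes \<chi> :: "'i \<Rightarrow> 'a::field_char_0 \<Rightarrow> 'b::field_char_0"
  assumes "finite I" and H: "subfield_set H" and \<chi>: "\<And>i. i \<in> I \<Longrightarrow> hom_on H (\<chi> i)"
    and distinct: "\<And>i j. i \<in> I \<Longrightarrow> j \<in> I \<Longrightarrow> i \<noteq> j \<Longrightarrow> \<exists>x\<in>H. \<chi> i x \<noteq> \<chi> j x"
    and w: "\<And>k. k < m \<Longrightarrow> w k \<in> H"
    and span: "\<And>x. x \<in> H \<Longrightarrow> \<exists>c::nat \<Rightarrow> rat. x = (\<Sum>k<m. of_rat (c k) * w k)"
  shows "card I \<le> m"
proof (rule ccontr)
  assume "\<not> card I \<le> m"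
  define N where "N = card I"
  have mN: "m < N" using \<open>\<not> card I \<le> m\<close> by (simp add: N_def)
  obtain e where e: "bij_betw e {0..<N} I"
    using ex_bij_betw_nat_finite[OF assms(1)] by (auto simp: N_def)
  define S where "S i k = (if k < m then \<chi> (e i) (w k) else 0)" for i k
  have eI: "e i \<in> I" if "i < N" for i using e that by (auto simp: bij_betw_def)
  have det: "det (mat N N (\<lambda>(i, k). S i k)) \<noteq> 0"
  proof (rule det_nonzero_if_rows_independent)
    fix c :: "nat \<Rightarrow> 'b"
    assume c: "(\<Sum>i<N. c i * S i k) = 0" if "k < N" for k
    have rel: "(\<Sum>i<N. c i * \<chi> (e i) x) = 0" if x: "x \<in> H" for x
    proof -
      obtain q :: "nat \<Rightarrow> rat" where q: "x = (\<Sum>k<m. of_rat (q k) * w k)" using span[OF x] by blast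
      have "\<chi> (e i) x = (\<Sum>k<m. of_rat (q k) * S i k)" if "i < N" for i
      proof -
        interpret field_hom_on H "\<chi> (e i)" by unfold_locales (use H \<chi> eI that in auto)
        show ?thesis unfolding q by (subst lincomb) (auto simp: w S_def)
      qed
      then have "(\<Sum>i<N. c i * \<chi> (e i) x) = (\<Sum>i<N. \<Sum>k<m. of_rat (q k) * (c i * S i k))"
        by (auto simp: sum_distrib_left mult.left_commute intro!: sum.cong)
      also have "\<dots> = (\<Sum>k<m. of_rat (q k) * (\<Sum>i<N. c i * S i k))"
        by (subst sum.swap) (simp add: sum_distrib_left)
      also have "\<dots> = 0" using c mN by simp
      finally show ?thesis .
    qed
    have dist: "\<exists>x\<in>H. \<chi> (e i) x \<noteq> \<chi> (e j) x" if "i < N" "j < N" "i \<noteq> j" for i j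
    proof (rule distinct[OF eI[OF that(1)] eI[OF that(2)]])
      show "e i \<noteq> e j"
        using bij_betw_imp_inj_on[OF e, THEN inj_onD, of i j] that by auto
    qed
    have "c i = 0" if "i < N" for i
    proof (rule dedekind_independence[of "{..<N}" H "\<lambda>i. \<chi> (e i)" c i])
      show "\<chi> (e j) (x * y) = \<chi> (e j) x * \<chi> (e j) y" if "j \<in> {..<N}" "x \<in> H" "y \<in> H" for j x y
        by (rule hom_onD(3)[OF \<chi>[OF eI]]) (use that in auto)
      show "\<chi> (e j) 1 = 1" if "j \<in> {..<N}" for j
        by (rule hom_onD(1)[OF \<chi>[OF eI]]) (use that in auto)
      show "\<exists>x\<in>H. \<chi> (e j) x \<noteq> \<chi> (e k) x" if "j \<in> {..<N}" "k \<in> {..<N}" "j \<noteq> k" for j k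
        by (rule dist) (use that in auto)
    qed (use subfield_setD(1,4)[OF H] rel that in auto)
    then show "\<forall>i<N. c i = 0" by blast
  qed
  obtain R where "\<forall>i<N. \<forall>j<N. (\<Sum>k<N. S i k * R k j) = of_bool (i = j)"
    and R: "\<forall>k<N. \<forall>l<N. (\<Sum>i<N. R k i * S i l) = of_bool (k = l)"
    using inverse_if_det_nonzero[OF det] .
  have "(\<Sum>i<N. R m i * S i m) = 0" by (simp add: S_def)
  with R mN show False by force
qed

text \<open>Row \<open>i\<close> of \<open>S\<close>, written as a column, is an eigenvector of
  \<open>M\<close> for \<open>d i\<close>. As \<open>S\<close> is invertible, the transpose of
  \<open>M\<close> is similar to the diagonal matrix of \<open>d\<close>. The applications are to
  multiplication matrices, whose eigenvalues are the coordinates at the embeddings.\<close>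

lemma eigen_matrix:
  fixes S M :: "nat \<Rightarrow> nat \<Rightarrow> 'c::field"
  assumes det: "det (mat n n (\<lambda>(i, k). S i k)) \<noteq> 0"
    and eigen: "\<And>i k. i < n \<Longrightarrow> k < n \<Longrightarrow> d i * S i k = (\<Sum>l<n. M k l * S i l)"
  shows "char_poly (mat n n (\<lambda>(k, l). M k l)) = (\<Prod>i<n. [:- d i, 1:])"
    and "det (mat n n (\<lambda>(k, l). M k l)) = (\<Prod>i<n. d i)"
proof -
  obtain R where R: "\<forall>i<n. \<forall>j<n. (\<Sum>k<n. S i k * R k j) = of_bool (i = j)"
    "\<forall>k<n. \<forall>l<n. (\<Sum>i<n. R k i * S i l) = of_bool (k = l)"
    using inverse_if_det_nonzero[OF det] .
  define S' where "S' = mat n n (\<lambda>(i, k). S i k)"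
  define R' where "R' = mat n n (\<lambda>(i, k). R i k)"
  define M' where "M' = mat n n (\<lambda>(k, l). M k l)"
  define D where "D = mat n n (\<lambda>(i, k). if i = k then d i else 0)"
  have C: "S' \<in> carrier_mat n n" "R' \<in> carrier_mat n n" "M' \<in> carrier_mat n n"
    "D \<in> carrier_mat n n" "transpose_mat M' \<in> carrier_mat n n"
    by (auto simp: S'_def R'_def M'_def D_def)
  have SR: "S' * R' = 1\<^sub>m n"
    by (rule eq_matI) (use R(1) in \<open>auto simp: S'_def R'_def scalar_prod_def atLeast0LessThan\<close>)
  have RS: "R' * S' = 1\<^sub>m n"
    by (rule eq_matI) (use R(2) in \<open>auto simp: S'_def R'_def scalar_prod_def atLeast0LessThan\<close>)
  have "D * S' = S' * transpose_mat M'"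
  proof (rule eq_matI)
    fix i k assume "i < dim_row (S' * transpose_mat M')" "k < dim_col (S' * transpose_mat M')"
    then have ik: "i < n" "k < n" using C by auto
    have "(D * S') $$ (i, k) = (\<Sum>j<n. (if i = j then d i else 0) * S j k)"
      using ik by (subst mat_mult_index[OF C(4,1)]) (auto simp: D_def S'_def)
    also have "\<dots> = (\<Sum>j<n. if i = j then d i * S i k else 0)" by (rule sum.cong) auto
    also have "\<dots> = (\<Sum>l<n. M k l * S i l)" using ik eigen by simp
    also have "\<dots> = (S' * transpose_mat M') $$ (i, k)"
      using ik by (subst mat_mult_index[OF C(1,5)]) (auto simp: M'_def S'_def mult.commute)
    finally show "(D * S') $$ (i, k) = (S' * transpose_mat M') $$ (i, k)" .
  qed (use C in auto)
  then have "R' * (D * S') = R' * S' * transpose_mat M'" using C by simp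
  then have eq: "transpose_mat M' = R' * D * S'" using C by (simp add: RS)
  have sim: "similar_mat (transpose_mat M') D"
    by (rule similar_matI[OF _ RS SR eq]) (use C in auto)
  have ut: "upper_triangular D" by (auto simp: D_def)
  have diag: "diag_mat D = map d [0..<n]" using C by (auto simp: diag_mat_def D_def)
  have "char_poly M' = (\<Prod>a\<leftarrow>map d [0..<n]. [:- a, 1:])"
    using char_poly_similar[OF sim] char_poly_upper_triangular[OF C(4) ut] C(3) diag by simp
  also have "\<dots> = (\<Prod>i<n. [:- d i, 1:])"
    by (simp add: prod.list_conv_set_nth atLeast0LessThan o_def)
  finally show "char_poly (mat n n (\<lambda>(k, l). M k l)) = (\<Prod>i<n. [:- d i, 1:])" unfolding M'_def .
  have "det M' = det D" using det_similar[OF sim] det_transpose[OF C(3)] by simp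
  also have "\<dots> = prod_list (map d [0..<n])" using det_upper_triangular[OF ut C(4)] diag by simp
  also have "\<dots> = (\<Prod>i<n. d i)" by (simp add: prod.list_conv_set_nth atLeast0LessThan)
  finally show "det (mat n n (\<lambda>(k, l). M k l)) = (\<Prod>i<n. d i)" unfolding M'_def .
qed

text \<open>Only spanning is demanded. When \<open>n\<close> is the degree and \<open>n\<close>
  distinct embeddings are given, uniqueness of coordinates follows
  (\<open>coords_unique\<close>).\<close>

definition qbasis :: "'a::field_char_0 set \<Rightarrow> nat \<Rightarrow> (nat \<Rightarrow> 'a) \<Rightarrow> bool" where
  "qbasis K n w \<longleftrightarrow> (\<forall>i<n. w i \<in> K) \<and> (\<forall>x\<in>K. \<exists>c::nat \<Rightarrow> rat. x = (\<Sum>i<n. of_rat (c i) * w i))"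

lemma qbasisD:
  assumes "qbasis K n w"
  shows "i < n \<Longrightarrow> w i \<in> K" "x \<in> K \<Longrightarrow> \<exists>c::nat \<Rightarrow> rat. x = (\<Sum>i<n. of_rat (c i) * w i)"
  using assms by (auto simp: qbasis_def)

lemma rat_basis_card:
  assumes "rat_basis K B"
  shows "card B = nf_degree K"
proof -
  have "rat_vs.span B = rat_vs.span K" "rat_vs.independent B"
    using assms by (auto simp: rat_basis_def rat_vs.span_span)
  then show ?thesis unfolding nf_degree_def by (simp add: rat_vs.dim_eq_card)
qed

lemma rat_basis_enum:
  assumes "rat_basis K B"
  obtains e where "bij_betw e {..<nf_degree K} B" "qbasis K (nf_degree K) e"
proof -
  have fin: "finite B" and span: "rat_vs.span B = K" using assms by (auto simp: rat_basis_def)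
  obtain e where e: "bij_betw e {0..<card B} B"
    using ex_bij_betw_nat_finite[OF fin] by auto
  then have e: "bij_betw e {..<nf_degree K} B"
    using rat_basis_card[OF assms] by (simp add: atLeast0LessThan)
  have "e i \<in> K" if "i < nf_degree K" for i
    using e that rat_vs.span_base[of "e i" B] span by (auto simp: bij_betw_def)
  moreover have "\<exists>c::nat \<Rightarrow> rat. x = (\<Sum>i<nf_degree K. of_rat (c i) * e i)" if "x \<in> K" for x
  proof -
    have "x \<in> rat_vs.span B" using that span by simp
    then obtain u where "x = (\<Sum>v\<in>B. of_rat (u v) * v)"
      unfolding rat_vs.span_finite[OF fin] by auto
    then have "x = (\<Sum>i<nf_degree K. of_rat (u (e i)) * e i)"
      by (simp add: sum.reindex_bij_betw[OF e, symmetric])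
    then show ?thesis by (rule exI[of _ "\<lambda>i. u (e i)"])
  qed
  ultimately have "qbasis K (nf_degree K) e" by (auto simp: qbasis_def)
  then show ?thesis using that e by blast
qed

text \<open>The \<open>n\<close> distinct embeddings are part of the data. For symmetric Galois
  group their existence is a consequence of the group order, shown in
  \<open>Sn_number_field_imp_sn_field\<close>.\<close>

locale emb_field =
  fixes K :: "'a::field_char_0 set" and n :: nat and \<sigma> :: "nat \<Rightarrow> 'a \<Rightarrow> complex"
  assumes nf: "number_field K" and deg: "nf_degree K = n"
    and hom: "\<And>i. i < n \<Longrightarrow> hom_on K (\<sigma> i)"
    and distinct: "\<And>i j. i < n \<Longrightarrow> j < n \<Longrightarrow> i \<noteq> j \<Longrightarrow> \<exists>x\<in>K. \<sigma> i x \<noteq> \<sigma> j x"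
begin

lemma K: "subfield_set K"
  using nf unfolding number_field_def by (auto intro: subfield_set_if_subfield)

lemmas K_closed = subfield_setD[OF K]
lemmas K_intros = K_closed subfield_set_sum[OF K] subfield_set_prod[OF K] subfield_set_power[OF K]
  subfield_set_of_nat[OF K] subfield_set_of_int[OF K] subfield_set_of_rat[OF K]

lemma h: "i < n \<Longrightarrow> field_hom_on K (\<sigma> i)"
  by unfold_locales (use K hom in auto)

definition S_mat :: "(nat \<Rightarrow> 'a) \<Rightarrow> complex mat" where
  "S_mat w = mat n n (\<lambda>(i, k). \<sigma> i (w k))"

lemma S_det:
  assumes w: "qbasis K n w"
  shows "det (S_mat w) \<noteq> 0"
  unfolding S_mat_def
proof (rule det_nonzero_if_rows_independent)
  fix c :: "nat \<Rightarrow> complex"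
  assume c: "(\<Sum>i<n. c i * \<sigma> i (w k)) = 0" if "k < n" for k
  have rel: "(\<Sum>i<n. c i * \<sigma> i x) = 0" if x: "x \<in> K" for x
  proof -
    obtain q :: "nat \<Rightarrow> rat" where q: "x = (\<Sum>k<n. of_rat (q k) * w k)"
      using qbasisD(2)[OF w x] by blast
    have "\<sigma> i x = (\<Sum>k<n. of_rat (q k) * \<sigma> i (w k))" if "i < n" for i
      unfolding q by (rule field_hom_on.lincomb[OF h[OF that]]) (use qbasisD(1)[OF w] in auto)
    then have "(\<Sum>i<n. c i * \<sigma> i x) = (\<Sum>i<n. \<Sum>k<n. of_rat (q k) * (c i * \<sigma> i (w k)))"
      by (auto simp: sum_distrib_left mult.left_commute intro!: sum.cong)
    also have "\<dots> = (\<Sum>k<n. of_rat (q k) * (\<Sum>i<n. c i * \<sigma> i (w k)))"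
      by (subst sum.swap) (simp add: sum_distrib_left)
    also have "\<dots> = 0" using c by simp
    finally show ?thesis .
  qed
  have "c i = 0" if "i < n" for i
  proof (rule dedekind_independence[of "{..<n}" K \<sigma> c i])
    show "\<sigma> j (x * y) = \<sigma> j x * \<sigma> j y" if "j \<in> {..<n}" "x \<in> K" "y \<in> K" for j x y
      by (rule hom_onD(3)[OF hom]) (use that in auto)
    show "\<sigma> j 1 = 1" if "j \<in> {..<n}" for j
      by (rule hom_onD(1)[OF hom]) (use that in auto)
    show "\<exists>x\<in>K. \<sigma> j x \<noteq> \<sigma> k x" if "j \<in> {..<n}" "k \<in> {..<n}" "j \<noteq> k" for j k
      by (rule distinct) (use that in auto)
  qed (use K_closed(1,4) rel that in auto)
  then show "\<forall>i<n. c i = 0" by blast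
qed

lemma S_inverse:
  assumes w: "qbasis K n w"
  obtains R where "\<forall>i<n. \<forall>j<n. (\<Sum>k<n. \<sigma> i (w k) * R k j) = of_bool (i = j)"
    and "\<forall>k<n. \<forall>l<n. (\<Sum>i<n. R k i * \<sigma> i (w l)) = of_bool (k = l)"
  using inverse_if_det_nonzero[OF S_det[OF w, unfolded S_mat_def]] .

text \<open>The left inverse \<open>R\<close> of the matrix of embeddings recovers the coordinates
  of an element from its values under the \<open>\<sigma> i\<close>.\<close>

lemma coords_unique:
  assumes w: "qbasis K n w" and eq: "(\<Sum>k<n. of_rat (c k) * w k) = (\<Sum>k<n. of_rat (d k) * w k)"
    and "k < n"
  shows "c k = d k"
proof -
  obtain R where R: "\<forall>i<n. \<forall>j<n. (\<Sum>k<n. \<sigma> i (w k) * R k j) = of_bool (i = j)"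
    "\<forall>k<n. \<forall>l<n. (\<Sum>i<n. R k i * \<sigma> i (w l)) = of_bool (k = l)"
    using S_inverse[OF w] .
  have *: "of_rat (c k) = (\<Sum>i<n. R k i * \<sigma> i (\<Sum>l<n. of_rat (c l) * w l))" for c :: "nat \<Rightarrow> rat"
  proof -
    have "(\<Sum>i<n. R k i * \<sigma> i (\<Sum>l<n. of_rat (c l) * w l)) =
        (\<Sum>i<n. R k i * (\<Sum>l<n. of_rat (c l) * \<sigma> i (w l)))"
      by (rule sum.cong[OF refl], subst field_hom_on.lincomb[OF h]) (use qbasisD(1)[OF w] in auto)
    also have "\<dots> = (\<Sum>i<n. \<Sum>l<n. of_rat (c l) * (R k i * \<sigma> i (w l)))"
      by (simp add: sum_distrib_left mult.left_commute)
    also have "\<dots> = (\<Sum>l<n. of_rat (c l) * (\<Sum>i<n. R k i * \<sigma> i (w l)))"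
      by (subst sum.swap) (simp add: sum_distrib_left)
    also have "\<dots> = (\<Sum>l<n. of_rat (c l) * of_bool (k = l))"
      by (rule sum.cong) (use R(2) \<open>k < n\<close> in auto)
    also have "\<dots> = of_rat (c k)" using \<open>k < n\<close> by simp
    finally show ?thesis by simp
  qed
  have "(of_rat (c k) :: complex) = of_rat (d k)"
    unfolding *[of c] *[of d] eq ..
  then show ?thesis by simp
qed

lemma mult_matrix:
  assumes w: "qbasis K n w" and x: "x \<in> K"
  obtains m :: "nat \<Rightarrow> nat \<Rightarrow> rat" where "\<forall>k<n. x * w k = (\<Sum>l<n. of_rat (m k l) * w l)"
proof -
  have "\<exists>c::nat \<Rightarrow> rat. x * w k = (\<Sum>l<n. of_rat (c l) * w l)" if "k < n" for k
    using qbasisD[OF w] x that K_closed(4) by blast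
  then obtain m :: "nat \<Rightarrow> nat \<Rightarrow> rat" where "\<forall>k<n. x * w k = (\<Sum>l<n. of_rat (m k l) * w l)"
    by metis
  then show ?thesis using that by blast
qed

lemma mult_matrix_eigen:
  assumes w: "qbasis K n w" and x: "x \<in> K"
    and m: "\<And>k. k < n \<Longrightarrow> x * w k = (\<Sum>l<n. of_rat (m k l) * w l)"
    and "i < n" "k < n"
  shows "\<sigma> i x * \<sigma> i (w k) = (\<Sum>l<n. of_rat (m k l) * \<sigma> i (w l))"
proof -
  interpret field_hom_on K "\<sigma> i" using h \<open>i < n\<close> .
  have "\<sigma> i x * \<sigma> i (w k) = \<sigma> i (x * w k)" using mult x qbasisD(1)[OF w] \<open>k < n\<close> by simp
  also have "\<dots> = (\<Sum>l<n. of_rat (m k l) * \<sigma> i (w l))"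
    unfolding m[OF \<open>k < n\<close>] by (rule lincomb) (use qbasisD(1)[OF w] in auto)
  finally show ?thesis .
qed

text \<open>The \<open>\<sigma> i x\<close> are the eigenvalues of the multiplication matrix;
  inserting a right inverse \<open>R\<close> of the matrix of embeddings into their sum and using
  the left inverse property leaves the diagonal.\<close>

lemma sum_embeddings:
  assumes w: "qbasis K n w" and x: "x \<in> K"
    and m: "\<And>k. k < n \<Longrightarrow> x * w k = (\<Sum>l<n. of_rat (m k l) * w l)"
  shows "(\<Sum>i<n. \<sigma> i x) = of_rat (\<Sum>k<n. m k k)"
proof -
  obtain R where R: "\<forall>i<n. \<forall>j<n. (\<Sum>k<n. \<sigma> i (w k) * R k j) = of_bool (i = j)"
    "\<forall>k<n. \<forall>l<n. (\<Sum>i<n. R k i * \<sigma> i (w l)) = of_bool (k = l)"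
    using S_inverse[OF w] .
  have "(\<Sum>i<n. \<sigma> i x) = (\<Sum>i<n. \<sigma> i x * (\<Sum>k<n. \<sigma> i (w k) * R k i))"
    by (rule sum.cong) (auto simp: R(1))
  also have "\<dots> = (\<Sum>i<n. \<Sum>k<n. R k i * (\<sigma> i x * \<sigma> i (w k)))"
    by (simp add: sum_distrib_left mult_ac)
  also have "\<dots> = (\<Sum>i<n. \<Sum>k<n. R k i * (\<Sum>l<n. of_rat (m k l) * \<sigma> i (w l)))"
    by (intro sum.cong refl) (simp add: mult_matrix_eigen[OF w x m])
  also have "\<dots> = (\<Sum>k<n. \<Sum>i<n. \<Sum>l<n. of_rat (m k l) * (R k i * \<sigma> i (w l)))"
    by (subst sum.swap) (simp add: sum_distrib_left mult.left_commute)
  also have "\<dots> = (\<Sum>k<n. \<Sum>l<n. of_rat (m k l) * (\<Sum>i<n. R k i * \<sigma> i (w l)))"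
    by (rule sum.cong[OF refl], subst sum.swap) (simp add: sum_distrib_left)
  also have "\<dots> = (\<Sum>k<n. \<Sum>l<n. of_rat (m k l) * of_bool (k = l))"
    by (intro sum.cong refl) (simp add: R(2))
  also have "\<dots> = (\<Sum>k<n. of_rat (m k k))" by (intro sum.cong refl) simp
  finally show ?thesis by (simp add: of_rat_sum)
qed

lemma prod_embeddings:
  assumes x: "x \<in> K"
  shows "\<exists>q. (\<Prod>i<n. \<sigma> i x) = of_rat q"
proof -
  obtain B where "rat_basis K B" using nf by (auto simp: number_field_def)
  then obtain w where w: "qbasis K n w" using rat_basis_enum deg by metis
  obtain m where m: "\<forall>k<n. x * w k = (\<Sum>l<n. of_rat (m k l) * w l)"
    using mult_matrix[OF w x] .
  have "(\<Prod>i<n. \<sigma> i x) = det (mat n n (\<lambda>(k, l). of_rat (m k l)))"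
    by (rule eigen_matrix(2)[symmetric, OF S_det[OF w, unfolded S_mat_def]])
       (rule mult_matrix_eigen[OF w x], use m in auto)
  also have "mat n n (\<lambda>(k, l). of_rat (m k l) :: complex) = map_mat of_rat (mat n n (\<lambda>(k, l). m k l))"
    by (rule eq_matI) auto
  also have "det \<dots> = of_rat (det (mat n n (\<lambda>(k, l). m k l)))"
    by (rule of_rat_hom.hom_det)
  finally show ?thesis by blast
qed

lemma ex_qbasis: "\<exists>w. qbasis K n w"
proof -
  obtain B where "rat_basis K B" using nf by (auto simp: number_field_def)
  then show ?thesis using rat_basis_enum deg by metis
qed

text \<open>Whichever basis \<open>SOME\<close> selects in \<open>nf_trace\<close>, the diagonal sum
  is the sum over the embeddings. From here on the trace is handled through this formula.\<close>

lemma trace_eq: "x \<in> K \<Longrightarrow> of_rat (nf_trace K x) = (\<Sum>i<n. \<sigma> i x)"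
proof -
  assume x: "x \<in> K"
  define B where "B = (SOME B. rat_basis K B)"
  have B: "rat_basis K B" unfolding B_def by (rule someI_ex) (use nf in \<open>auto simp: number_field_def\<close>)
  obtain e where e: "bij_betw e {..<n} B" "qbasis K n e" using rat_basis_enum[OF B] deg by auto
  define m where "m k l = rat_vs.representation B (x * e k) (e l)" for k l
  have "x * e k = (\<Sum>l<n. of_rat (m k l) * e l)" if "k < n" for k
  proof -
    have "x * e k \<in> rat_vs.span B"
      using B qbasisD(1)[OF e(2) that] K_closed(4) x by (simp add: rat_basis_def)
    then have "x * e k = (\<Sum>b\<in>B. of_rat (rat_vs.representation B (x * e k) b) * b)"
      using B by (subst rat_vs.sum_representation_eq) (auto simp: rat_basis_def)
    also have "\<dots> = (\<Sum>l<n. of_rat (m k l) * e l)"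
      unfolding m_def by (simp add: sum.reindex_bij_betw[OF e(1), symmetric])
    finally show ?thesis .
  qed
  then have "(\<Sum>i<n. \<sigma> i x) = of_rat (\<Sum>k<n. m k k)" by (rule sum_embeddings[OF e(2) x])
  also have "(\<Sum>k<n. m k k) = nf_trace K x"
    unfolding nf_trace_def B_def[symmetric] m_def Let_def
    by (rule sum.reindex_bij_betw[OF e(1), of "\<lambda>b. rat_vs.representation B (x * b) b"])
  finally show ?thesis by simp
qed

lemma trace_eq_diag:
  assumes w: "qbasis K n w" and x: "x \<in> K"
    and m: "\<And>k. k < n \<Longrightarrow> x * w k = (\<Sum>l<n. of_rat (m k l) * w l)"
  shows "nf_trace K x = (\<Sum>k<n. m k k)"
proof -
  have "(of_rat (nf_trace K x) :: complex) = of_rat (\<Sum>k<n. m k k)"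
    using sum_embeddings[OF w x m] trace_eq[OF x] by simp
  then show ?thesis by simp
qed

lemma trace_add: "x \<in> K \<Longrightarrow> y \<in> K \<Longrightarrow> nf_trace K (x + y) = nf_trace K x + nf_trace K y"
proof -
  assume xy: "x \<in> K" "y \<in> K"
  have "(of_rat (nf_trace K (x + y)) :: complex) = of_rat (nf_trace K x + nf_trace K y)"
    using xy K_closed(3) field_hom_on.add[OF h]
    by (simp add: trace_eq of_rat_add sum.distrib)
  then show ?thesis by simp
qed

lemma trace_scale: "x \<in> K \<Longrightarrow> nf_trace K (of_rat q * x) = q * nf_trace K x"
proof -
  assume x: "x \<in> K"
  have "(of_rat (nf_trace K (of_rat q * x)) :: complex) = of_rat (q * nf_trace K x)"
    using x field_hom_on.mult[OF h] field_hom_on.of_rat[OF h] K_closed(4) subfield_set_of_rat[OF K]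
    by (simp add: trace_eq of_rat_mult sum_distrib_left)
  then show ?thesis by simp
qed

lemma trace_0: "nf_trace K 0 = 0"
  using trace_scale[of 0 0] K_closed(2) by simp

lemma trace_sum: "(\<And>i. i \<in> I \<Longrightarrow> f i \<in> K) \<Longrightarrow> nf_trace K (\<Sum>i\<in>I. f i) = (\<Sum>i\<in>I. nf_trace K (f i))"
  by (induction I rule: infinite_finite_induct) (auto simp: trace_0 trace_add K_intros)

lemma trace_lincomb:
  "(\<And>i. i \<in> I \<Longrightarrow> f i \<in> K) \<Longrightarrow>
    nf_trace K (\<Sum>i\<in>I. of_rat (c i) * f i) = (\<Sum>i\<in>I. c i * nf_trace K (f i))"
  by (subst trace_sum) (auto simp: trace_scale K_intros)

lemma n_pos: "n > 0"
proof (rule ccontr)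
  assume "\<not> n > 0"
  moreover obtain w where "qbasis K n w" using ex_qbasis by blast
  ultimately show False using qbasisD(2)[of K n w 1] K_closed(1) by simp
qed

lemma trace_1: "nf_trace K 1 = of_nat n"
proof -
  have "(of_rat (nf_trace K 1) :: complex) = of_nat n"
    using trace_eq[OF K_closed(1)] field_hom_on.one[OF h] by simp
  then show ?thesis by (metis of_rat_eq_iff of_rat_of_nat_eq)
qed

text \<open>The test element is \<open>inverse x\<close>: the trace of 1 is \<open>n\<close>, which
  is nonzero in characteristic 0.\<close>

lemma trace_nondegenerate:
  assumes x: "x \<in> K" and "\<And>y. y \<in> K \<Longrightarrow> nf_trace K (x * y) = 0"
  shows "x = 0"
proof (rule ccontr)
  assume "x \<noteq> 0"
  then have "nf_trace K (x * inverse x) = of_nat n" using trace_1 by simp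
  then show False using assms(2)[of "inverse x"] K_closed(6)[OF x] n_pos by simp
qed

lemma trace_nondegenerate_basis:
  assumes w: "qbasis K n w" and x: "x \<in> K" and 0: "\<And>k. k < n \<Longrightarrow> nf_trace K (x * w k) = 0"
  shows "x = 0"
proof (rule trace_nondegenerate[OF x])
  fix y assume "y \<in> K"
  then obtain c :: "nat \<Rightarrow> rat" where "y = (\<Sum>k<n. of_rat (c k) * w k)" using qbasisD(2)[OF w] by blast
  then have "x * y = (\<Sum>k<n. of_rat (c k) * (x * w k))" by (simp add: sum_distrib_left mult.left_commute)
  then have "nf_trace K (x * y) = (\<Sum>k<n. c k * nf_trace K (x * w k))"
    using qbasisD(1)[OF w] x by (simp only:) (rule trace_lincomb, auto intro: K_closed)
  then show "nf_trace K (x * y) = 0" using 0 by simp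
qed

text \<open>\<open>v\<close> is built with the inverse Gram matrix. The last property is duality
  read in the other order: the matrices of the \<open>\<sigma> i (w k)\<close> and of the
  \<open>\<sigma> i (v k)\<close> are inverse up to transposition, and a left inverse of a square
  matrix is a right inverse.\<close>

lemma dual_basis:
  assumes w: "qbasis K n w"
  obtains v where "qbasis K n v"
    "\<forall>k<n. \<forall>l<n. nf_trace K (w k * v l) = of_bool (k = l)"
    "\<forall>i<n. \<forall>j<n. (\<Sum>k<n. \<sigma> i (w k) * \<sigma> j (v k)) = of_bool (i = j)"
proof -
  define G where "G k l = nf_trace K (w k * w l)" for k l
  have wK: "w k \<in> K" if "k < n" for k using qbasisD(1)[OF w that] .
  have det: "det (mat n n (\<lambda>(k, l). G k l)) \<noteq> 0"
  proof (rule det_nonzero_if_rows_independent)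
    fix c :: "nat \<Rightarrow> rat"
    assume c: "(\<Sum>i<n. c i * G i k) = 0" if "k < n" for k
    define x where "x = (\<Sum>i<n. of_rat (c i) * w i)"
    have "nf_trace K (x * w k) = 0" if "k < n" for k
    proof -
      have "x * w k = (\<Sum>i<n. of_rat (c i) * (w i * w k))"
        by (simp add: x_def sum_distrib_right mult.assoc)
      then have "nf_trace K (x * w k) = (\<Sum>i<n. c i * nf_trace K (w i * w k))"
        using wK that by (simp only:) (rule trace_lincomb, auto intro: K_closed)
      then show ?thesis using c[OF that] by (simp add: G_def)
    qed
    then have "x = 0" using wK by (intro trace_nondegenerate_basis[OF w]) (auto simp: x_def intro!: K_intros)
    then have "(\<Sum>i<n. of_rat (c i) * w i) = (\<Sum>i<n. of_rat 0 * w i)" by (simp add: x_def)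
    then show "\<forall>i<n. c i = 0" using coords_unique[OF w, of c "\<lambda>_. 0"] by blast
  qed
  obtain R where R: "\<forall>i<n. \<forall>j<n. (\<Sum>k<n. G i k * R k j) = of_bool (i = j)"
    "\<forall>k<n. \<forall>l<n. (\<Sum>i<n. R k i * G i l) = of_bool (k = l)"
    using inverse_if_det_nonzero[OF det] .
  define v where "v l = (\<Sum>m<n. of_rat (R m l) * w m)" for l
  have vK: "v l \<in> K" for l unfolding v_def by (intro K_intros wK) auto
  have wv: "nf_trace K (w k * v l) = of_bool (k = l)" if "k < n" "l < n" for k l
  proof -
    have "w k * v l = (\<Sum>m<n. of_rat (R m l) * (w k * w m))"
      by (simp add: v_def sum_distrib_left mult.left_commute)
    then have "nf_trace K (w k * v l) = (\<Sum>m<n. R m l * nf_trace K (w k * w m))"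
      using wK that by (simp only:) (rule trace_lincomb, auto intro: K_closed)
    also have "\<dots> = (\<Sum>m<n. G k m * R m l)"
      by (rule sum.cong) (auto simp: G_def)
    finally have "nf_trace K (w k * v l) = (\<Sum>m<n. G k m * R m l)" .
    then show ?thesis using R(1) that by simp
  qed
  have "\<exists>c::nat \<Rightarrow> rat. x = (\<Sum>i<n. of_rat (c i) * v i)" if x: "x \<in> K" for x
  proof -
    define y where "y = (\<Sum>i<n. of_rat (nf_trace K (x * w i)) * v i)"
    have yK: "y \<in> K" unfolding y_def by (intro K_intros vK)
    have "nf_trace K ((x - y) * w k) = 0" if k: "k < n" for k
    proof -
      have "y * w k = (\<Sum>i<n. of_rat (nf_trace K (x * w i)) * (w k * v i))"
        unfolding y_def sum_distrib_right
        by (rule sum.cong) (simp_all add: mult.assoc mult.left_commute[of "w k"] mult.commute[of _ "w k"])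
      then have "nf_trace K (y * w k) = (\<Sum>i<n. nf_trace K (x * w i) * nf_trace K (w k * v i))"
        using k wK vK by (simp only:) (rule trace_lincomb, auto intro: K_closed)
      also have "\<dots> = (\<Sum>i<n. nf_trace K (x * w i) * of_bool (k = i))"
        by (rule sum.cong) (use k wv in auto)
      also have "\<dots> = nf_trace K (x * w k)" using k by simp
      finally have "nf_trace K (y * w k) = nf_trace K (x * w k)" .
      moreover have "nf_trace K ((x - y) * w k + y * w k) = nf_trace K ((x - y) * w k) + nf_trace K (y * w k)"
        using k wK x yK by (intro trace_add K_intros)
      ultimately show ?thesis by (simp add: algebra_simps)
    qed
    then have "x - y = 0" using x yK by (intro trace_nondegenerate_basis[OF w] K_intros)
    then show ?thesis unfolding y_def by (intro exI[of _ "\<lambda>i. nf_trace K (x * w i)"]) simp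
  qed
  then have v: "qbasis K n v" using vK by (auto simp: qbasis_def)
  have "(\<Sum>k<n. \<sigma> i (w k) * \<sigma> j (v k)) = of_bool (i = j)" if "i < n" "j < n" for i j
  proof -
    have "(\<Sum>i<n. \<sigma> i (w k) * \<sigma> i (v l)) = of_bool (k = l)" if "k < n" "l < n" for k l
    proof -
      have "(\<Sum>i<n. \<sigma> i (w k) * \<sigma> i (v l)) = (\<Sum>i<n. \<sigma> i (w k * v l))"
        by (rule sum.cong) (use field_hom_on.mult[OF h] wK vK that in auto)
      also have "\<dots> = of_rat (nf_trace K (w k * v l))" using wK vK that by (simp add: trace_eq K_intros)
      finally show ?thesis using wv that by simp
    qed
    then have "(\<Sum>k<n. \<sigma> j (v k) * \<sigma> i (w k)) = of_bool (j = i)"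
      by (intro right_inverse_if_left_inverse[of n "\<lambda>k i. \<sigma> i (w k)" "\<lambda>i l. \<sigma> i (v l)"] that) auto
    then show ?thesis by (simp add: mult.commute eq_commute)
  qed
  then show ?thesis using that[of v] v wv by simp
qed

end

section \<open>Embeddings of fields with symmetric Galois group\<close>

lemma rat_field_elem:
  assumes K: "subfield_set K" and w: "qbasis K 1 w" and x: "x \<in> K"
  shows "\<exists>q. x = of_rat q"
proof -
  obtain c0 :: rat where c0: "1 = of_rat c0 * w 0"
    using qbasisD(2)[OF w subfield_setD(1)[OF K]] by auto
  obtain c :: rat where c: "x = of_rat c * w 0"
    using qbasisD(2)[OF w x] by auto
  have "w 0 = inverse (of_rat c0)" using c0 by (metis inverse_unique)
  then have "x = of_rat (c * inverse c0)" using c by (simp add: of_rat_mult of_rat_inverse)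
  then show ?thesis by blast
qed

text \<open>Serves the degree 1 case, where counting automorphisms cannot produce an embedding
  because 0! = 1!.\<close>

lemma hom_on_rat_field:
  assumes K: "subfield_set K" and w: "qbasis K 1 w"
  shows "\<exists>f. hom_on K (f :: 'a::field_char_0 \<Rightarrow> 'b::field_char_0)"
proof -
  have rat: "\<exists>q. x = of_rat q" if "x \<in> K" for x using rat_field_elem[OF K w that] .
  define f :: "'a \<Rightarrow> 'b" where "f x = of_rat (THE q. x = of_rat q)" for x
  have f: "f (of_rat q) = of_rat q" for q by (simp add: f_def)
  have "f 1 = 1" using f[of 1] by simp
  moreover have "f (x + y) = f x + f y \<and> f (x * y) = f x * f y" if xy: "x \<in> K" "y \<in> K" for x y
  proof -
    obtain p q where "x = of_rat p" "y = of_rat q" using rat xy by metis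
    then show ?thesis using f by (metis of_rat_add of_rat_mult)
  qed
  ultimately show ?thesis unfolding hom_on_def by blast
qed

text \<open>\<open>E\<close> stands for the Galois closure; the symmetric Galois group enters only
  through the homomorphisms on \<open>E\<close> that permute the embeddings arbitrarily.\<close>

locale sn_field = emb_field +
  fixes E :: "complex set"
  assumes E: "subfield_set E" and \<sigma>_E: "\<And>i x. i < n \<Longrightarrow> x \<in> K \<Longrightarrow> \<sigma> i x \<in> E"
    and perm: "\<And>\<pi>. \<pi> permutes {..<n} \<Longrightarrow>
      \<exists>g :: complex \<Rightarrow> complex. hom_on E g \<and> (\<forall>i<n. \<forall>x\<in>K. g (\<sigma> i x) = \<sigma> (\<pi> i) x)"

text \<open>The Galois group acts faithfully on the embeddings, since their images generate the
  closure. So \<open>n!\<close> is at most the factorial of their number, and that number is at most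
  \<open>n\<close> by Dedekind. Equality holds throughout: there are exactly \<open>n\<close>
  embeddings and every permutation of them occurs.\<close>

lemma Sn_number_field_imp_sn_field:
  assumes "Sn_number_field n K"
  obtains \<sigma> E where "sn_field K n \<sigma> E"
proof -
  have nf: "number_field K" and deg: "nf_degree K = n"
    and gal: "galois_group (galois_closure K) \<cong> sym_group n"
    using assms by (auto simp: Sn_number_field_def)
  have K: "subfield_set K" using nf by (auto simp: number_field_def intro: subfield_set_if_subfield)
  obtain B where "rat_basis K B" using nf by (auto simp: number_field_def)
  then obtain w where w: "qbasis K n w" using rat_basis_enum deg by metis
  \<comment> \<open>Restriction to \<open>K\<close> makes the embeddings extensional, so that each
    is counted once.\<close>
  define Emb :: "('a \<Rightarrow> complex) set" where "Emb = (\<lambda>\<sigma>. restrict \<sigma> K) ` {\<sigma>. hom_on K \<sigma>}"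
  define E where "E = galois_closure K"
  define A where "A = carrier (galois_group E)"
  have hom_restrict: "hom_on K (restrict \<sigma> K) \<longleftrightarrow> hom_on K \<sigma>" for \<sigma> :: "'a \<Rightarrow> complex"
    using subfield_setD[OF K] unfolding hom_on_def by auto
  have Emb_iff: "\<tau> \<in> Emb \<longleftrightarrow> hom_on K \<tau> \<and> \<tau> \<in> extensional K" for \<tau>
    unfolding Emb_def using hom_restrict by (auto simp: image_iff extensional_restrict intro!: exI[of _ \<tau>])
  have Emb_eqI: "\<tau> = \<rho>" if "\<tau> \<in> Emb" "\<rho> \<in> Emb" "\<And>x. x \<in> K \<Longrightarrow> \<tau> x = \<rho> x" for \<tau> \<rho>
    by (rule extensionalityI[of _ K]) (use that in \<open>auto simp: Emb_iff\<close>)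
  have card_le: "card I \<le> n" if "finite I" "I \<subseteq> Emb" for I
  proof (rule card_homs_le[of I K "\<lambda>\<tau>. \<tau>", OF that(1) K])
    show "\<exists>x\<in>K. \<tau> x \<noteq> \<rho> x" if "\<tau> \<in> I" "\<rho> \<in> I" "\<tau> \<noteq> \<rho>" for \<tau> \<rho>
      using that Emb_eqI[of \<tau> \<rho>] \<open>I \<subseteq> Emb\<close> by auto
  qed (use qbasisD[OF w] that Emb_iff in auto)
  have fin: "finite Emb"
  proof (rule ccontr)
    assume "infinite Emb"
    then obtain I where "finite I" "card I = Suc n" "I \<subseteq> Emb" using infinite_arbitrarily_large by metis
    then show False using card_le[of I] by simp
  qed
  have E: "subfield_set E" unfolding E_def galois_closure_def by (rule subfield_set_generate_field)
  have Emb_E: "\<tau> x \<in> E" if "\<tau> \<in> Emb" "x \<in> K" for \<tau> x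
    unfolding E_def galois_closure_def
    by (rule generate_field.incl) (use that in \<open>auto simp: Emb_iff embeddings_iff\<close>)
  have A: "g \<in> A \<longleftrightarrow> g \<in> extensional E \<and> bij_betw g E E \<and> hom_on E g \<and> (\<forall>x\<in>\<rat>. g x = x)" for g
    unfolding A_def galois_group_def by (auto simp: ring_iso_iff Bij_def)
  have "card A = card (carrier (sym_group n))"
    using gal unfolding is_iso_def iso_def A_def E_def by (auto intro: bij_betw_same_card)
  then have card_A: "card A = fact n" by (simp add: sym_group_def card_permutations)
  define \<Phi> where "\<Phi> g \<tau> = (if \<tau> \<in> Emb then restrict (g \<circ> \<tau>) K else \<tau>)" for g :: "complex \<Rightarrow> complex" and \<tau>
  have \<Phi>_Emb: "\<Phi> g \<tau> \<in> Emb" if g: "g \<in> A" and \<tau>: "\<tau> \<in> Emb" for g \<tau>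
  proof -
    interpret g: field_hom_on E g by unfold_locales (use E g A in auto)
    interpret \<tau>: field_hom_on K \<tau> by unfold_locales (use K \<tau> Emb_iff in auto)
    have "hom_on K (g \<circ> \<tau>)"
      unfolding hom_on_def using Emb_E[OF \<tau>]
      by (simp add: g.add g.mult g.one \<tau>.one \<tau>.add \<tau>.mult)
    then show ?thesis using \<tau> by (simp add: \<Phi>_def Emb_iff hom_restrict)
  qed
  have perm: "\<Phi> g permutes Emb" if g: "g \<in> A" for g
  proof (rule bij_imp_permutes)
    interpret g: field_hom_on E g by unfold_locales (use E g A in auto)
    have inj: "inj_on (\<Phi> g) Emb"
    proof (rule inj_onI)
      fix \<tau> \<rho> assume *: "\<tau> \<in> Emb" "\<rho> \<in> Emb" "\<Phi> g \<tau> = \<Phi> g \<rho>"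
      show "\<tau> = \<rho>"
      proof (rule Emb_eqI[OF *(1,2)])
        fix x assume x: "x \<in> K"
        have "g (\<tau> x) = g (\<rho> x)" using fun_cong[OF *(3), of x] * x by (simp add: \<Phi>_def)
        then show "\<tau> x = \<rho> x" using inj_onD[OF g.inj] Emb_E * x by blast
      qed
    qed
    then show "bij_betw (\<Phi> g) Emb Emb"
      using endo_inj_surj[OF fin _ inj] \<Phi>_Emb[OF g] by (auto simp: bij_betw_def)
  qed (simp add: \<Phi>_def)
  have inj: "inj_on \<Phi> A"
  proof (rule inj_onI)
    fix g h assume *: "g \<in> A" "h \<in> A" "\<Phi> g = \<Phi> h"
    interpret g: field_hom_on E g by unfold_locales (use E * A in auto)
    interpret h: field_hom_on E h by unfold_locales (use E * A in auto)
    have "g x = h x" if "x \<in> E" for x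
      using that unfolding E_def galois_closure_def
    proof (induction x rule: generate_field.induct)
      case one
      then show ?case using g.one h.one by simp
    next
      case (incl x)
      then obtain \<tau> y where \<tau>: "hom_on K \<tau>" "y \<in> K" "x = \<tau> y" by (auto simp: embeddings_iff)
      then have "restrict \<tau> K \<in> Emb" by (auto simp: Emb_def)
      then show ?case
        using fun_cong[OF fun_cong[OF *(3), of "restrict \<tau> K"], of y] \<tau> by (simp add: \<Phi>_def)
    next
      case (a_inv x)
      then show ?case
        using g.minus h.minus unfolding E_def galois_closure_def by (simp add: ring_of_type_minus)
    next
      case (m_inv x)
      then show ?case
        using g.inverse_hom h.inverse_hom unfolding E_def galois_closure_def by (simp add: ring_of_type_inv)
    next
      case (eng_add x y)
      then show ?case using g.add h.add unfolding E_def galois_closure_def by simp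
    next
      case (eng_mult x y)
      then show ?case using g.mult h.mult unfolding E_def galois_closure_def by simp
    qed
    then show "g = h" using extensionalityI[of g E h] * A by blast
  qed
  let ?P = "{p. p permutes Emb}"
  have finP: "finite ?P" using fin by (rule finite_permutations)
  have "fact n \<le> (fact (card Emb) :: nat)"
    using card_inj_on_le[OF inj _ finP] perm card_A card_permutations[OF refl fin] by auto
  moreover have "card Emb \<le> n" using card_le fin by blast
  moreover have "n \<noteq> 0"
  proof
    assume "n = 0"
    then show False using qbasisD(2)[OF w subfield_setD(1)[OF K]] by simp
  qed
  \<comment> \<open>The inequality of factorials does not exclude \<open>card Emb = 0\<close> here,
    so an embedding is exhibited.\<close>
  moreover have "card Emb = 1" if n1: "n = 1"
  proof -
    obtain f :: "'a \<Rightarrow> complex" where "hom_on K f" using hom_on_rat_field[OF K, of w] w n1 by blast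
    then have "restrict f K \<in> Emb" by (auto simp: Emb_def)
    then have "card Emb \<noteq> 0" using fin by auto
    then show ?thesis using card_le[OF fin] that by simp
  qed
  ultimately have card: "card Emb = n"
  proof (cases "n = 1")
    case False
    assume *: "fact n \<le> (fact (card Emb) :: nat)" "card Emb \<le> n" "n \<noteq> 0"
    have "\<not> card Emb < n"
    proof
      assume "card Emb < n"
      then have "fact (card Emb) \<le> (fact (n - 1) :: nat)" by (intro fact_mono_nat) simp
      also have "\<dots> < fact n" using False *(3) by (intro fact_less_mono_nat) auto
      finally show False using *(1) by simp
    qed
    then show ?thesis using *(2) by simp
  qed simp
  have "card (\<Phi> ` A) = card ?P"
    using card_image[OF inj] card_A card_permutations[OF card fin] by simp
  then have img: "\<Phi> ` A = ?P" using card_subset_eq[OF finP, of "\<Phi> ` A"] perm by blast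
  obtain \<sigma> where \<sigma>: "bij_betw \<sigma> {0..<n} Emb" using ex_bij_betw_nat_finite[OF fin] card by auto
  have \<sigma>_Emb: "\<sigma> i \<in> Emb" if "i < n" for i using \<sigma> that by (auto simp: bij_betw_def)
  have \<sigma>_inj: "\<sigma> i \<noteq> \<sigma> j" if "i < n" "j < n" "i \<noteq> j" for i j
    using bij_betw_imp_inj_on[OF \<sigma>, THEN inj_onD, of i j] that by auto
  have "sn_field K n \<sigma> E"
  proof
    show "number_field K" "nf_degree K = n" "subfield_set E" by fact+
    show "hom_on K (\<sigma> i)" if "i < n" for i using \<sigma>_Emb[OF that] Emb_iff by blast
    show "\<exists>x\<in>K. \<sigma> i x \<noteq> \<sigma> j x" if "i < n" "j < n" "i \<noteq> j" for i j
      using Emb_eqI[OF \<sigma>_Emb[OF that(1)] \<sigma>_Emb[OF that(2)]] \<sigma>_inj[OF that] by blast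
    show "\<sigma> i x \<in> E" if "i < n" "x \<in> K" for i x using Emb_E \<sigma>_Emb that by blast
    fix \<pi> assume \<pi>: "\<pi> permutes {..<n}"
    define s where "s = the_inv_into {0..<n} \<sigma>"
    have s: "s (\<sigma> i) = i" if "i < n" for i
      unfolding s_def using bij_betw_imp_inj_on[OF \<sigma>] that by (simp add: the_inv_into_f_f)
    define \<rho> where "\<rho> \<tau> = (if \<tau> \<in> Emb then \<sigma> (\<pi> (s \<tau>)) else \<tau>)" for \<tau>
    have "bij_betw \<rho> Emb Emb"
    proof -
      have "bij_betw s Emb {..<n}" unfolding s_def using bij_betw_the_inv_into[OF \<sigma>] by (simp add: atLeast0LessThan)
      then have "bij_betw (\<sigma> \<circ> (\<pi> \<circ> s)) Emb Emb"
        using \<sigma> permutes_imp_bij[OF \<pi>] by (intro bij_betw_trans) (auto simp: atLeast0LessThan)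
      then show ?thesis by (rule bij_betw_cong[THEN iffD1, rotated]) (auto simp: \<rho>_def)
    qed
    then have "\<rho> permutes Emb" by (rule bij_imp_permutes) (simp add: \<rho>_def)
    then have "\<rho> \<in> \<Phi> ` A" unfolding img by simp
    then obtain g where g: "\<rho> = \<Phi> g" "g \<in> A" by (rule imageE)
    have "g (\<sigma> i x) = \<sigma> (\<pi> i) x" if "i < n" "x \<in> K" for i x
    proof -
      have "\<Phi> g (\<sigma> i) x = \<rho> (\<sigma> i) x" using g(1) by simp
      then show ?thesis using \<sigma>_Emb that s by (simp add: \<Phi>_def \<rho>_def)
    qed
    then show "\<exists>g. hom_on E g \<and> (\<forall>i<n. \<forall>x\<in>K. g (\<sigma> i x) = \<sigma> (\<pi> i) x)" using g(2) A by blast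
  qed
  then show ?thesis by (rule that)
qed

text \<open>Pascal's rule, with the border case \<open>a = n - 2\<close> computed as a triangular
  number. It leaves only idempotents supported on one embedding or on all but one.\<close>

lemma choose_greater:
  assumes "2 \<le> a" "a + 2 \<le> n"
  shows "n < n choose a"
  using assms
proof (induction n arbitrary: a)
  case (Suc n)
  show ?case
  proof (cases "a + 2 \<le> n")
    case True
    then have "n < n choose a" using Suc by blast
    moreover have "n choose (a - 1) \<ge> 1" using True by (simp add: Suc_leI)
    moreover have "Suc n choose a = (n choose (a - 1)) + (n choose a)" using Suc.prems(1) by (cases a) auto
    ultimately show ?thesis by linarith
  next
    case False
    then have a: "a + 2 = Suc n" using Suc.prems by simp
    then have "Suc n choose a = Suc n choose (Suc n - a)" by (intro binomial_symmetric) simp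
    also have "Suc n - a = 2" using a by simp
    finally have eq: "Suc n choose a = Suc n * n div 2" by (simp add: choose_two)
    have "n \<ge> 3" using a Suc.prems by simp
    then have "2 * (Suc n + 1) \<le> Suc n * n"
    proof (cases "n = 3")
      case False
      then have "Suc n * 4 \<le> Suc n * n" using \<open>n \<ge> 3\<close> by (intro mult_le_mono2) simp
      then show ?thesis using \<open>n \<ge> 3\<close> by simp
    qed simp
    then have "2 * (Suc n + 1) div 2 \<le> Suc n * n div 2" by (rule div_le_mono)
    then show ?thesis unfolding eq by simp
  qed
qed simp

lemma ex_permutes_image:
  assumes "finite S" "T \<subseteq> S" "T' \<subseteq> S" "card T = card T'"
  shows "\<exists>p. p permutes S \<and> p ` T = T'"
proof -
  have fin: "finite T" "finite T'" using assms finite_subset by auto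
  obtain f where f: "bij_betw f T T'" using finite_same_card_bij[OF fin assms(4)] by blast
  have "card (S - T) = card (S - T')" using assms fin by (simp add: card_Diff_subset)
  then obtain h where h: "bij_betw h (S - T) (S - T')"
    using finite_same_card_bij[of "S - T" "S - T'"] assms(1) by auto
  define p where "p x = (if x \<in> T then f x else if x \<in> S then h x else x)" for x
  have "bij_betw p T T'" using f by (rule bij_betw_cong[THEN iffD1, rotated]) (simp add: p_def)
  moreover have "bij_betw p (S - T) (S - T')"
    using h by (rule bij_betw_cong[THEN iffD1, rotated]) (simp add: p_def)
  ultimately have "bij_betw p (T \<union> (S - T)) (T' \<union> (S - T'))" by (rule bij_betw_combine) auto
  moreover have "T \<union> (S - T) = S" "T' \<union> (S - T') = S" using assms by auto
  ultimately have "bij_betw p S S" by simp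
  then have "p permutes S" by (rule bij_imp_permutes) (use assms in \<open>auto simp: p_def\<close>)
  moreover have "p ` T = T'" using \<open>bij_betw p T T'\<close> by (simp add: bij_betw_def)
  ultimately show ?thesis by blast
qed

section \<open>Polynomials with coefficients in a subfield\<close>

definition poly_over :: "'a::field_char_0 set \<Rightarrow> 'a poly \<Rightarrow> bool" where
  "poly_over F p \<longleftrightarrow> (\<forall>m. Polynomial.coeff p m \<in> F)"

lemma poly_over_sum:
  assumes F: "subfield_set F" and "\<And>i. i \<in> I \<Longrightarrow> poly_over F (p i)"
  shows "poly_over F (\<Sum>i\<in>I. p i)"
  using assms(2) unfolding poly_over_def by (simp add: Polynomial.coeff_sum subfield_set_sum[OF F])

lemma poly_over_mult:
  assumes F: "subfield_set F" and "poly_over F p" "poly_over F q"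
  shows "poly_over F (p * q)"
  using assms(2,3) unfolding poly_over_def
  by (simp add: coeff_mult subfield_set_sum[OF F] subfield_setD[OF F])

lemma poly_over_pCons: "subfield_set F \<Longrightarrow> a \<in> F \<Longrightarrow> poly_over F p \<Longrightarrow> poly_over F (pCons a p)"
  unfolding poly_over_def by (auto simp: coeff_pCons split: nat.splits)

lemma poly_over_0: "subfield_set F \<Longrightarrow> poly_over F 0"
  unfolding poly_over_def by (simp add: subfield_setD)

lemma poly_over_1: "subfield_set F \<Longrightarrow> poly_over F 1"
  using poly_over_pCons[of F 1 0] poly_over_0 subfield_setD(1) by (metis one_pCons)

lemma poly_over_prod:
  assumes F: "subfield_set F" and "\<And>i. i \<in> I \<Longrightarrow> poly_over F (p i)"
  shows "poly_over F (\<Prod>i\<in>I. p i)"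
  using assms(2) by (induction I rule: infinite_finite_induct) (auto intro: poly_over_mult poly_over_1 F)

lemma poly_over_char_poly:
  assumes F: "subfield_set F" and M: "\<And>k l. k < n \<Longrightarrow> l < n \<Longrightarrow> M k l \<in> F"
  shows "poly_over F (char_poly (mat n n (\<lambda>(k, l). M k l)))"
proof -
  let ?C = "char_poly_matrix (mat n n (\<lambda>(k, l). M k l))"
  have C: "?C \<in> carrier_mat n n" by simp
  have entry: "poly_over F (?C $$ (i, j))" if "i < n" "j < n" for i j
    using that M[OF that] F
    by (auto simp: char_poly_matrix_def intro!: poly_over_pCons poly_over_0 poly_over_1 subfield_setD)
  have sign: "poly_over F (signof p)" for p :: "nat \<Rightarrow> nat"
  proof -
    have "(signof p :: 'a poly) = [:signof p:]" by (simp add: sign_def one_pCons)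
    then show ?thesis
      using F by (auto intro!: poly_over_pCons poly_over_0 subfield_set_of_int)
  qed
  have dims: "dim_row ?C = n" "dim_col ?C = n" by (rule carrier_matD[OF C])+
  show ?thesis
    unfolding char_poly_def det_def dims
    by (auto intro!: poly_over_sum[OF F] poly_over_mult[OF F] poly_over_prod[OF F] sign entry
        simp: permutes_in_image)
qed

section \<open>Zero divisors in the tensor product of a field with K\<close>

context sn_field
begin

text \<open>The tensor product \<open>F \<otimes> K\<close>, realised inside \<open>\<complex>\<^sup>n\<close>; a nonzero zero divisor in it
  yields an idempotent, and the coordinates of that idempotent generate a subfield of \<open>F\<close> of
  degree a binomial coefficient.\<close>

definition tensor :: "complex set \<Rightarrow> (nat \<Rightarrow> 'a) \<Rightarrow> (nat \<Rightarrow> complex) set" where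
  "tensor F w = {y. \<exists>c. (\<forall>k<n. c k \<in> F) \<and> (\<forall>i<n. y i = (\<Sum>k<n. c k * \<sigma> i (w k)))}"

lemma tensorI:
  "(\<And>k. k < n \<Longrightarrow> c k \<in> F) \<Longrightarrow> (\<And>i. i < n \<Longrightarrow> y i = (\<Sum>k<n. c k * \<sigma> i (w k))) \<Longrightarrow> y \<in> tensor F w"
  unfolding tensor_def by blast

lemma tensorE:
  assumes "y \<in> tensor F w"
  obtains c where "\<forall>k<n. c k \<in> F" "\<forall>i<n. y i = (\<Sum>k<n. c k * \<sigma> i (w k))"
  using assms unfolding tensor_def by blast

lemma tensor_add:
  assumes F: "subfield_set F" and "y \<in> tensor F w" "z \<in> tensor F w"
  shows "(\<lambda>i. y i + z i) \<in> tensor F w"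
proof -
  obtain c where c: "\<forall>k<n. c k \<in> F" "\<forall>i<n. y i = (\<Sum>k<n. c k * \<sigma> i (w k))" using tensorE[OF assms(2)] .
  obtain d where d: "\<forall>k<n. d k \<in> F" "\<forall>i<n. z i = (\<Sum>k<n. d k * \<sigma> i (w k))" using tensorE[OF assms(3)] .
  show ?thesis
    by (rule tensorI[of "\<lambda>k. c k + d k"])
       (use c d subfield_setD(3)[OF F] in \<open>auto simp: sum.distrib distrib_right\<close>)
qed

lemma tensor_scale:
  assumes F: "subfield_set F" and "y \<in> tensor F w" "a \<in> F"
  shows "(\<lambda>i. a * y i) \<in> tensor F w"
proof -
  obtain c where c: "\<forall>k<n. c k \<in> F" "\<forall>i<n. y i = (\<Sum>k<n. c k * \<sigma> i (w k))" using tensorE[OF assms(2)] .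
  show ?thesis
    by (rule tensorI[of "\<lambda>k. a * c k"])
       (use c assms(3) subfield_setD(4)[OF F] in \<open>auto simp: sum_distrib_left mult.assoc\<close>)
qed

lemma tensor_0: "subfield_set F \<Longrightarrow> (\<lambda>i. 0) \<in> tensor F w"
  by (rule tensorI[of "\<lambda>k. 0"]) (auto simp: subfield_setD)

lemma tensor_sum:
  assumes F: "subfield_set F" and "\<And>m. m \<in> I \<Longrightarrow> y m \<in> tensor F w"
  shows "(\<lambda>i. \<Sum>m\<in>I. y m i) \<in> tensor F w"
  using assms(2)
  by (induction I rule: infinite_finite_induct) (auto intro: tensor_add[OF F] tensor_0[OF F])

lemma tensor_K:
  assumes F: "subfield_set F" and w: "qbasis K n w" and x: "x \<in> K"
  shows "(\<lambda>i. \<sigma> i x) \<in> tensor F w"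
proof -
  obtain q :: "nat \<Rightarrow> rat" where q: "x = (\<Sum>k<n. of_rat (q k) * w k)" using qbasisD(2)[OF w x] by blast
  show ?thesis
  proof (rule tensorI[of "\<lambda>k. of_rat (q k)"])
    show "\<sigma> i x = (\<Sum>k<n. of_rat (q k) * \<sigma> i (w k))" if "i < n" for i
      unfolding q by (rule field_hom_on.lincomb[OF h[OF that]]) (use qbasisD(1)[OF w] in auto)
  qed (use subfield_set_of_rat[OF F] in auto)
qed

lemma tensor_mult:
  assumes F: "subfield_set F" and w: "qbasis K n w" and "y \<in> tensor F w" "z \<in> tensor F w"
  shows "(\<lambda>i. y i * z i) \<in> tensor F w"
proof -
  obtain c where c: "\<forall>k<n. c k \<in> F" "\<forall>i<n. y i = (\<Sum>k<n. c k * \<sigma> i (w k))" using tensorE[OF assms(3)] .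
  obtain d where d: "\<forall>k<n. d k \<in> F" "\<forall>i<n. z i = (\<Sum>k<n. d k * \<sigma> i (w k))" using tensorE[OF assms(4)] .
  have wK: "w k \<in> K" if "k < n" for k using qbasisD(1)[OF w that] .
  let ?t = "\<lambda>i. \<Sum>k<n. \<Sum>m<n. (c k * d m) * \<sigma> i (w k * w m)"
  have "?t \<in> tensor F w"
    by (intro tensor_sum[OF F] tensor_scale[OF F] tensor_K[OF F w])
       (use c(1) d(1) wK K_closed(4) subfield_setD(4)[OF F] in auto)
  then obtain e where e: "\<forall>k<n. e k \<in> F" "\<forall>i<n. ?t i = (\<Sum>k<n. e k * \<sigma> i (w k))" using tensorE by blast
  have "y i * z i = ?t i" if "i < n" for i
  proof -
    have "y i * z i = (\<Sum>k<n. \<Sum>m<n. (c k * \<sigma> i (w k)) * (d m * \<sigma> i (w m)))"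
      using c(2) d(2) that by (simp add: sum_product)
    also have "\<dots> = ?t i"
      by (intro sum.cong refl) (use field_hom_on.mult[OF h[OF that]] wK in \<open>auto simp: mult_ac\<close>)
    finally show ?thesis .
  qed
  then show ?thesis using e by (intro tensorI[of e]) auto
qed

lemma tensor_1: "subfield_set F \<Longrightarrow> qbasis K n w \<Longrightarrow> \<exists>y\<in>tensor F w. \<forall>i<n. y i = 1"
  by (rule bexI[of _ "\<lambda>i. \<sigma> i 1"]) (auto simp: field_hom_on.one[OF h] intro: tensor_K K_closed(1))

lemma tensor_cong:
  assumes "y \<in> tensor F w" "\<And>i. i < n \<Longrightarrow> z i = y i"
  shows "z \<in> tensor F w"
proof -
  obtain c where c: "\<forall>k<n. c k \<in> F" "\<forall>i<n. y i = (\<Sum>k<n. c k * \<sigma> i (w k))" using tensorE[OF assms(1)] .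
  show ?thesis by (rule tensorI[of c]) (use c assms(2) in auto)
qed

lemma tensor_power:
  assumes F: "subfield_set F" and w: "qbasis K n w" and "y \<in> tensor F w"
  shows "(\<lambda>i. y i ^ m) \<in> tensor F w"
proof (induction m)
  case 0
  obtain u where u: "u \<in> tensor F w" "\<forall>i<n. u i = 1" using tensor_1[OF F w] by (rule bexE)
  show ?case by (rule tensor_cong[OF u(1)]) (use u(2) in simp)
next
  case (Suc m)
  then show ?case using tensor_mult[OF F w assms(3)] by simp
qed

text \<open>Multiplication by \<open>x\<close> is a matrix over \<open>F\<close> with eigenvalues
  \<open>x i\<close>. Its characteristic polynomial, a polynomial over \<open>F\<close>, is a power
  of X times a polynomial \<open>q\<close> with nonzero constant term that vanishes at all nonzero
  \<open>x i\<close>. Then \<open>1 - q(x) / q(0)\<close> is the indicator of the support, and it is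
  a polynomial in \<open>x\<close> over \<open>F\<close>.\<close>

lemma tensor_support:
  assumes F: "subfield_set F" and w: "qbasis K n w" and x: "x \<in> tensor F w"
  shows "(\<lambda>i. of_bool (x i \<noteq> 0)) \<in> tensor F w"
proof -
  obtain l where l: "\<forall>k<n. l k \<in> F" "\<forall>i<n. x i = (\<Sum>k<n. l k * \<sigma> i (w k))" using tensorE[OF x] .
  have wK: "w k \<in> K" if "k < n" for k using qbasisD(1)[OF w that] .
  have "\<exists>s::nat \<Rightarrow> nat \<Rightarrow> rat. \<forall>k<n. w m * w k = (\<Sum>r<n. of_rat (s k r) * w r)" if "m < n" for m
    using mult_matrix[OF w wK[OF that]] by blast
  then obtain s :: "nat \<Rightarrow> nat \<Rightarrow> nat \<Rightarrow> rat"
    where s: "\<And>m k. m < n \<Longrightarrow> k < n \<Longrightarrow> w m * w k = (\<Sum>r<n. of_rat (s m k r) * w r)"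
    by metis
  define M where "M k r = (\<Sum>m<n. l m * of_rat (s m k r))" for k r
  have MF: "M k r \<in> F" for k r
    unfolding M_def
    by (intro subfield_set_sum[OF F] subfield_setD(4)[OF F] subfield_set_of_rat[OF F]) (use l in auto)
  have eigen: "x i * \<sigma> i (w k) = (\<Sum>r<n. M k r * \<sigma> i (w r))" if "i < n" "k < n" for i k
  proof -
    have "x i * \<sigma> i (w k) = (\<Sum>m<n. l m * (\<sigma> i (w m) * \<sigma> i (w k)))"
      using l(2) that by (simp add: sum_distrib_right mult.assoc)
    also have "\<dots> = (\<Sum>m<n. l m * (\<Sum>r<n. of_rat (s m k r) * \<sigma> i (w r)))"
      by (intro sum.cong refl, subst mult_matrix_eigen[OF w wK s that]) (use that in auto)
    also have "\<dots> = (\<Sum>m<n. \<Sum>r<n. l m * of_rat (s m k r) * \<sigma> i (w r))"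
      by (simp add: sum_distrib_left mult.assoc)
    also have "\<dots> = (\<Sum>r<n. M k r * \<sigma> i (w r))"
      unfolding M_def by (subst sum.swap) (simp add: sum_distrib_right)
    finally show ?thesis .
  qed
  have cp: "poly_over F (\<Prod>i<n. [:- x i, 1:])"
    using eigen_matrix(1)[OF S_det[OF w, unfolded S_mat_def] eigen] poly_over_char_poly[of F n M, OF F MF] by simp
  define T where "T = {i\<in>{..<n}. x i \<noteq> 0}"
  define q where "q = (\<Prod>i\<in>T. [:- x i, 1:])"
  have finT: "finite T" "T \<subseteq> {..<n}" by (auto simp: T_def)
  have "(\<Prod>i<n. [:- x i, 1:]) = (\<Prod>i\<in>{..<n} - T. [:- x i, 1:]) * q"
    unfolding q_def using finT by (intro prod.subset_diff) auto
  also have "(\<Prod>i\<in>{..<n} - T. [:- x i, 1:]) = (\<Prod>i\<in>{..<n} - T. Polynomial.monom 1 1)"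
    by (rule prod.cong) (auto simp: T_def Polynomial.monom_altdef)
  also have "\<dots> = Polynomial.monom 1 (card ({..<n} - T))"
    by (simp add: monom_power)
  finally have eq: "(\<Prod>i<n. [:- x i, 1:]) = Polynomial.monom 1 (card ({..<n} - T)) * q" .
  \<comment> \<open>Dividing by a power of X only shifts the coefficients.\<close>
  have qF: "Polynomial.coeff q m \<in> F" for m
  proof -
    have "Polynomial.coeff (\<Prod>i<n. [:- x i, 1:]) (m + card ({..<n} - T)) = Polynomial.coeff q m"
      unfolding eq by (simp add: coeff_monom_mult)
    then show ?thesis using cp unfolding poly_over_def by metis
  qed
  have q0: "poly q 0 \<noteq> 0" unfolding q_def using finT by (auto simp: poly_prod T_def)
  have qT: "poly q (x i) = 0" if "i \<in> T" for i unfolding q_def using finT that by (auto simp: poly_prod)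
  have "(\<lambda>i. \<Sum>m\<le>Polynomial.degree q. Polynomial.coeff q m * x i ^ m) \<in> tensor F w"
    by (intro tensor_sum[OF F] tensor_scale[OF F] tensor_power[OF F w] x qF)
  then have "(\<lambda>i. poly q (x i)) \<in> tensor F w" by (simp add: poly_altdef)
  moreover have "- inverse (poly q 0) \<in> F"
    using qF[of 0] by (intro subfield_setD[OF F]) (simp add: poly_0_coeff_0)
  ultimately have "(\<lambda>i. - inverse (poly q 0) * poly q (x i)) \<in> tensor F w" by (rule tensor_scale[OF F])
  moreover obtain y where y: "y \<in> tensor F w" "\<forall>i<n. y i = 1" using tensor_1[OF F w] by (rule bexE)
  ultimately have "(\<lambda>i. y i + - inverse (poly q 0) * poly q (x i)) \<in> tensor F w"
    by (intro tensor_add[OF F])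
  then show ?thesis
  proof (rule tensor_cong)
    fix i assume "i < n"
    then show "of_bool (x i \<noteq> 0) = y i + - inverse (poly q 0) * poly q (x i)"
      using y(2) qT[of i] q0 by (cases "x i = 0") (auto simp: T_def)
  qed
qed

text \<open>The relation is an element \<open>x\<close> of the tensor product whose support
  \<open>T\<close> is nonempty and misses \<open>i0\<close>. The coordinates of the idempotent of
  \<open>T\<close> lie in \<open>F\<close> and generate a field with at least as many homomorphisms
  as there are sets of the size of \<open>T\<close>. Their number is at most \<open>n\<close>, so
  \<open>T\<close> or its complement is a single embedding, and \<open>F\<close> contains a
  conjugate of \<open>K\<close>.\<close>

lemma dichotomy:
  assumes F: "subfield_set F" "qbasis F n f" and w: "qbasis K n w" and l: "\<And>k. k < n \<Longrightarrow> l k \<in> F"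
    and i0: "i0 < n" "(\<Sum>k<n. l k * \<sigma> i0 (w k)) = 0" and k0: "k0 < n" "l k0 \<noteq> 0"
  shows "\<exists>i<n. \<sigma> i ` K \<subseteq> F"
proof -
  define x where "x i = (\<Sum>k<n. l k * \<sigma> i (w k))" for i
  define T where "T = {i\<in>{..<n}. x i \<noteq> 0}"
  have T: "T \<subseteq> {..<n}" "finite T" by (auto simp: T_def)
  have i0T: "i0 \<notin> T" using i0 by (simp add: T_def x_def)
  have Tne: "T \<noteq> {}"
  proof
    assume "T = {}"
    then have x0: "x i = 0" if "i < n" for i using that by (auto simp: T_def)
    obtain R where R: "\<forall>i<n. \<forall>j<n. (\<Sum>k<n. \<sigma> i (w k) * R k j) = of_bool (i = j)"
      "\<forall>k<n. \<forall>l<n. (\<Sum>i<n. R k i * \<sigma> i (w l)) = of_bool (k = l)"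
      using S_inverse[OF w] .
    have "0 = (\<Sum>i<n. R k0 i * x i)" using x0 by simp
    also have "\<dots> = (\<Sum>k<n. l k * (\<Sum>i<n. R k0 i * \<sigma> i (w k)))"
      unfolding x_def sum_distrib_left by (subst sum.swap) (simp add: mult_ac)
    also have "\<dots> = (\<Sum>k<n. l k * of_bool (k0 = k))" using R(2) k0(1) by (intro sum.cong) auto
    also have "\<dots> = l k0" using k0(1) by simp
    finally show False using k0(2) by simp
  qed
  have "x \<in> tensor F w" by (rule tensorI[of l]) (use l in \<open>auto simp: x_def\<close>)
  then have "(\<lambda>i. of_bool (x i \<noteq> 0)) \<in> tensor F w" by (rule tensor_support[OF F(1) w])
  then obtain s where s: "\<forall>k<n. s k \<in> F" "\<forall>i<n. of_bool (x i \<noteq> 0) = (\<Sum>k<n. s k * \<sigma> i (w k))"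
    using tensorE by blast
  obtain v where v: "qbasis K n v" "\<forall>k<n. \<forall>l<n. nf_trace K (w k * v l) = of_bool (k = l)"
    "\<forall>i<n. \<forall>j<n. (\<Sum>k<n. \<sigma> i (w k) * \<sigma> j (v k)) = of_bool (i = j)"
    using dual_basis[OF w] .
  have vK: "v k \<in> K" if "k < n" for k using qbasisD(1)[OF v(1) that] .
  have wK: "w k \<in> K" if "k < n" for k using qbasisD(1)[OF w that] .
  \<comment> \<open>By duality these are the coordinates of the indicator of \<open>T\<close> in the
    basis \<open>w\<close>.\<close>
  define t where "t T k = (\<Sum>i\<in>T. \<sigma> i (v k))" for T k
  have t_eq: "t T k = s k" if k: "k < n" for k
  proof -
    have "t T k = (\<Sum>i<n. of_bool (x i \<noteq> 0) * \<sigma> i (v k))"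
      unfolding t_def by (rule sum.mono_neutral_cong_left) (auto simp: T_def)
    also have "\<dots> = (\<Sum>i<n. (\<Sum>m<n. s m * \<sigma> i (w m)) * \<sigma> i (v k))"
      using s(2) by (intro sum.cong refl) (metis lessThan_iff)
    also have "\<dots> = (\<Sum>m<n. s m * (\<Sum>i<n. \<sigma> i (w m) * \<sigma> i (v k)))"
      unfolding sum_distrib_left sum_distrib_right by (subst sum.swap) (simp add: mult_ac)
    also have "\<dots> = (\<Sum>m<n. s m * of_bool (m = k))"
    proof (intro sum.cong refl arg_cong2[of _ _ _ _ "(*)"])
      fix m assume m: "m \<in> {..<n}"
      have "(\<Sum>i<n. \<sigma> i (w m) * \<sigma> i (v k)) = (\<Sum>i<n. \<sigma> i (w m * v k))"
        by (rule sum.cong) (use field_hom_on.mult[OF h] wK vK m k in auto)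
      also have "\<dots> = of_rat (nf_trace K (w m * v k))" using wK vK m k by (simp add: trace_eq K_closed)
      finally show "(\<Sum>i<n. \<sigma> i (w m) * \<sigma> i (v k)) = of_bool (m = k)" using v(2) m k by simp
    qed
    also have "\<dots> = s k" using k by simp
    finally show ?thesis .
  qed
  define a where "a = card T"
  have "T \<subset> {..<n}" using T i0T i0(1) by auto
  then have a: "0 < a" "a < n"
    using Tne T psubset_card_mono[of "{..<n}" T] by (auto simp: a_def card_gt_0_iff)
  \<comment> \<open>The Galois homomorphisms are defined on \<open>E\<close> only, while the degree
    bound comes from \<open>F\<close>.\<close>
  define H where "H = F \<inter> E"
  have H: "subfield_set H" using F(1) E unfolding H_def subfield_set_def by auto
  have tE: "t T' k \<in> E" if "T' \<subseteq> {..<n}" "k < n" for T' k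
    unfolding t_def by (intro subfield_set_sum[OF E] \<sigma>_E vK) (use that in auto)
  have tH: "t T k \<in> H" if "k < n" for k
    unfolding H_def using tE[OF T(1) that] t_eq[OF that] s(1) that by auto
  obtain B where B: "B \<subseteq> H" "rat_vs.independent B" "H \<subseteq> rat_vs.span B"
      "card B = rat_vs.dim H"
    using rat_vs.basis_exists[of H] .
  have "H \<subseteq> rat_vs.span (f ` {..<n})"
  proof
    fix y assume "y \<in> H"
    then obtain c :: "nat \<Rightarrow> rat" where "y = (\<Sum>i<n. of_rat (c i) * f i)"
      using qbasisD(2)[OF F(2)] by (auto simp: H_def)
    then show "y \<in> rat_vs.span (f ` {..<n})"
      by (simp only:) (intro rat_vs.span_sum rat_vs.span_scale rat_vs.span_base imageI)
  qed
  then have "finite B \<and> card B \<le> card (f ` {..<n})"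
    using B(1,2) by (intro rat_vs.independent_span_bound) auto
  then have finB: "finite B" "card B \<le> n" using card_image_le[of "{..<n}" f] by auto
  have "rat_vs.subspace H"
    unfolding rat_vs.subspace_def using subfield_setD[OF H] subfield_set_of_rat[OF H] by auto
  then have "rat_vs.span B \<subseteq> H" using B(1) by (rule rat_vs.span_minimal[rotated])
  then have rB: "rat_basis H B" using B finB by (auto simp: rat_basis_def)
  then obtain e where e: "qbasis H (nf_degree H) e" using rat_basis_enum by metis
  have degH: "nf_degree H \<le> n" using rat_basis_card[OF rB] finB by simp
  define I where "I = {T'. T' \<subseteq> {..<n} \<and> card T' = a}"
  have cardI: "card I = n choose a" unfolding I_def using n_subsets[of "{..<n}" a] by simp
  have finI: "finite I" unfolding I_def by (rule finite_subset[of _ "Pow {..<n}"]) auto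
  have "\<exists>g :: complex \<Rightarrow> complex. hom_on E g \<and> (\<forall>k<n. g (t T k) = t T' k)" if T': "T' \<in> I" for T'
  proof -
    obtain \<pi> where \<pi>: "\<pi> permutes {..<n}" "\<pi> ` T = T'"
      using ex_permutes_image[of "{..<n}" T T'] T T' by (auto simp: I_def a_def)
    obtain g :: "complex \<Rightarrow> complex"
      where g: "hom_on E g" "\<forall>i<n. \<forall>x\<in>K. g (\<sigma> i x) = \<sigma> (\<pi> i) x" using perm[OF \<pi>(1)] by blast
    interpret g: field_hom_on E g by unfold_locales (use E g in auto)
    have "g (t T k) = t T' k" if k: "k < n" for k
    proof -
      have "g (t T k) = (\<Sum>i\<in>T. g (\<sigma> i (v k)))"
        unfolding t_def by (rule g.sum) (use T k vK \<sigma>_E in auto)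
      also have "\<dots> = (\<Sum>i\<in>T. \<sigma> (\<pi> i) (v k))"
        by (rule sum.cong) (use g(2) T k vK in auto)
      also have "\<dots> = (\<Sum>j\<in>\<pi> ` T. \<sigma> j (v k))"
        by (subst sum.reindex) (auto intro: inj_on_subset[OF permutes_inj[OF \<pi>(1)]])
      finally show ?thesis using \<pi>(2) by (simp add: t_def)
    qed
    then show ?thesis using g(1) by blast
  qed
  then obtain G :: "nat set \<Rightarrow> complex \<Rightarrow> complex"
    where G: "\<And>T'. T' \<in> I \<Longrightarrow> hom_on E (G T')" "\<And>T' k. T' \<in> I \<Longrightarrow> k < n \<Longrightarrow> G T' (t T k) = t T' k"
    by metis
  have "card I \<le> nf_degree H"
  proof (rule card_homs_le[of I H G, OF finI H])
    show "hom_on H (G T')" if "T' \<in> I" for T' using G(1)[OF that] by (auto simp: hom_on_def H_def)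
    fix T1 T2 assume T12: "T1 \<in> I" "T2 \<in> I" "T1 \<noteq> T2"
    show "\<exists>x\<in>H. G T1 x \<noteq> G T2 x"
    proof (rule ccontr)
      assume "\<not> (\<exists>x\<in>H. G T1 x \<noteq> G T2 x)"
      then have eq: "t T1 k = t T2 k" if "k < n" for k
        using G(2)[of _ k] T12 tH[OF that] that by metis
      \<comment> \<open>The sums over \<open>T'\<close> determine \<open>T'\<close>, being the
        coordinates of its indicator; so different sets give different homomorphisms of
        \<open>H\<close>.\<close>
      have ind: "(\<Sum>k<n. \<sigma> i (w k) * t T' k) = of_bool (i \<in> T')" if "i < n" "T' \<in> I" for i T'
      proof -
        have "(\<Sum>k<n. \<sigma> i (w k) * t T' k) = (\<Sum>j\<in>T'. \<Sum>k<n. \<sigma> i (w k) * \<sigma> j (v k))"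
          unfolding t_def sum_distrib_left by (rule sum.swap)
        also have "\<dots> = (\<Sum>j\<in>T'. of_bool (i = j))"
          by (rule sum.cong) (use v(3) that in \<open>auto simp: I_def\<close>)
        also have "\<dots> = of_bool (i \<in> T')"
          using that finite_subset[of T' "{..<n}"] by (auto simp: I_def of_bool_def)
        finally show ?thesis .
      qed
      have "i \<in> T1 \<longleftrightarrow> i \<in> T2" if "i < n" for i
      proof -
        have "(\<Sum>k<n. \<sigma> i (w k) * t T1 k) = (\<Sum>k<n. \<sigma> i (w k) * t T2 k)"
          by (rule sum.cong) (use eq in auto)
        then have "(of_bool (i \<in> T1) :: complex) = of_bool (i \<in> T2)" using ind[OF that] T12 by simp
        then show ?thesis by (simp split: if_splits add: of_bool_def)
      qed
      then have "T1 = T2" using T12(1,2) by (auto simp: I_def)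
      then show False using T12(3) by simp
    qed
  qed (use qbasisD[OF e] in auto)
  then have "n choose a \<le> n" using cardI degH by simp
  then have a': "a = 1 \<or> Suc a = n" using choose_greater[of a n] a by linarith
  have "\<exists>i<n. \<forall>k<n. \<sigma> i (v k) \<in> F"
    using a'
  proof
    assume "a = 1"
    then obtain i where i: "T = {i}" by (auto simp: a_def card_1_singleton_iff)
    then have "\<sigma> i (v k) = s k" if "k < n" for k using t_eq[OF that] by (simp add: t_def)
    then show ?thesis using s(1) T(1) i by auto
  next
    assume "Suc a = n"
    then have "card ({..<n} - T) = 1" using T by (simp add: card_Diff_subset a_def)
    then obtain i where i: "{..<n} - T = {i}" by (auto simp: card_1_singleton_iff)
    \<comment> \<open>If \<open>T\<close> misses only \<open>i\<close>, then
      \<open>\<sigma> i (v k)\<close> is the rational trace minus the sum over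
      \<open>T\<close>.\<close>
    have "\<sigma> i (v k) \<in> F" if k: "k < n" for k
    proof -
      have "(\<Sum>j<n. \<sigma> j (v k)) = (\<Sum>j\<in>{..<n} - T. \<sigma> j (v k)) + t T k"
        unfolding t_def using T by (intro sum.subset_diff) auto
      then have "\<sigma> i (v k) = of_rat (nf_trace K (v k)) - s k"
        using i t_eq[OF k] trace_eq[OF vK[OF k]] by simp
      then show ?thesis using s(1) k subfield_setD(7)[OF F(1)] subfield_set_of_rat[OF F(1)] by auto
    qed
    moreover have "i < n" using i by auto
    ultimately show ?thesis by blast
  qed
  then obtain i where i: "i < n" "\<forall>k<n. \<sigma> i (v k) \<in> F" by blast
  have "\<sigma> i y \<in> F" if y: "y \<in> K" for y
  proof -
    obtain c :: "nat \<Rightarrow> rat" where c: "y = (\<Sum>k<n. of_rat (c k) * v k)" using qbasisD(2)[OF v(1) y] by blast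
    have "\<sigma> i y = (\<Sum>k<n. of_rat (c k) * \<sigma> i (v k))"
      unfolding c by (rule field_hom_on.lincomb[OF h[OF i(1)]]) (use vK in auto)
    then show ?thesis
      using i(2) by (auto intro!: subfield_set_sum[OF F(1)] subfield_setD(4)[OF F(1)] subfield_set_of_rat[OF F(1)])
  qed
  then show ?thesis using i(1) by blast
qed

end

section \<open>Integral bases\<close>

lemma common_denominator:
  assumes "finite (Q :: rat set)"
  shows "\<exists>D::int. D > 0 \<and> (\<forall>q\<in>Q. of_int D * q \<in> \<int>)"
  using assms
proof induction
  case (insert q Q)
  then obtain D :: int where D: "D > 0" "\<forall>q\<in>Q. of_int D * q \<in> \<int>" by auto
  obtain a b where ab: "quotient_of q = (a, b)" by fastforce
  then have b: "b > 0" and q: "q = of_int a / of_int b"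
    using quotient_of_denom_pos quotient_of_div by auto
  have "of_int (D * b) * q = (of_int (D * a) :: rat)" using b unfolding q by simp
  then have "of_int (D * b) * q \<in> \<int>" by (metis Ints_of_int)
  moreover have "of_int (D * b) * r \<in> \<int>" if "r \<in> Q" for r :: rat
  proof -
    have "of_int (D * b) * r = of_int b * (of_int D * r)" by simp
    then show ?thesis using D(2) that by (metis Ints_mult Ints_of_int)
  qed
  ultimately show ?case using D(1) b by (intro exI[of _ "D * b"]) auto
qed (auto intro!: exI[of _ 1])

lemma sum_update:
  fixes f :: "nat \<Rightarrow> 'b::ab_group_add"
  assumes "k < n" "\<And>i. i < n \<Longrightarrow> i \<noteq> k \<Longrightarrow> g i = f i"
  shows "(\<Sum>i<n. g i) = (\<Sum>i<n. f i) - f k + g k"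
proof -
  have "(\<Sum>i<n. h i) = h k + (\<Sum>i\<in>{..<n} - {k}. h i)" for h :: "nat \<Rightarrow> 'b"
    using assms(1) by (intro sum.remove) auto
  moreover have "(\<Sum>i\<in>{..<n} - {k}. g i) = (\<Sum>i\<in>{..<n} - {k}. f i)"
    using assms(2) by (intro sum.cong) auto
  ultimately show ?thesis by (metis add.commute add_diff_cancel_left')
qed

context emb_field
begin

abbreviation "OK \<equiv> ring_of_integers K"

lemma OK_iff: "x \<in> OK \<longleftrightarrow> x \<in> K \<and> algebraic_int x"
  by (simp add: ring_of_integers_def)

lemma OK_K: "x \<in> OK \<Longrightarrow> x \<in> K"
  by (simp add: OK_iff)

lemma OK_closed:
  "0 \<in> OK" "1 \<in> OK" "x \<in> OK \<Longrightarrow> y \<in> OK \<Longrightarrow> x + y \<in> OK" "x \<in> OK \<Longrightarrow> y \<in> OK \<Longrightarrow> x - y \<in> OK"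
  "x \<in> OK \<Longrightarrow> y \<in> OK \<Longrightarrow> x * y \<in> OK" "x \<in> OK \<Longrightarrow> - x \<in> OK" "of_int k \<in> OK" "of_nat m \<in> OK"
  "x \<in> OK \<Longrightarrow> x ^ m \<in> OK"
  by (auto simp: OK_iff intro!: K_intros algebraic_int_plus algebraic_int_diff algebraic_int_times
      algebraic_int_of_int algebraic_int_of_nat algebraic_int_power algebraic_int_1)

lemma OK_sum: "(\<And>i. i \<in> I \<Longrightarrow> g i \<in> OK) \<Longrightarrow> (\<Sum>i\<in>I. g i) \<in> OK"
  by (induction I rule: infinite_finite_induct) (auto intro: OK_closed)

lemma trace_int: "x \<in> OK \<Longrightarrow> nf_trace K x \<in> \<int>"
proof -
  assume x: "x \<in> OK"
  have "algebraic_int (\<Sum>i<n. \<sigma> i x)"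
    by (rule algebraic_int_sum) (use field_hom_on.algebraic_int_iff[OF h] x in \<open>auto simp: OK_iff\<close>)
  then have "algebraic_int (of_rat (nf_trace K x) :: complex)" using trace_eq[OF OK_K[OF x]] by simp
  then have "(of_rat (nf_trace K x) :: complex) \<in> \<int>" by (rule rational_algebraic_int_is_int) simp
  then obtain k where "(of_rat (nf_trace K x) :: complex) = of_int k" by (auto elim: Ints_cases)
  then have "nf_trace K x = of_int k" by (metis of_rat_eq_iff of_rat_of_int_eq)
  then show ?thesis by simp
qed

definition tr :: "'a \<Rightarrow> int" where "tr x = \<lfloor>nf_trace K x\<rfloor>"

lemma tr_eq: "x \<in> OK \<Longrightarrow> of_int (tr x) = nf_trace K x"
  using trace_int unfolding tr_def by (auto elim!: Ints_cases)

lemma tr_eqI: "nf_trace K x = of_int k \<Longrightarrow> tr x = k"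
  by (simp add: tr_def)

lemma tr_add: "x \<in> OK \<Longrightarrow> y \<in> OK \<Longrightarrow> tr (x + y) = tr x + tr y"
  by (rule tr_eqI) (simp add: trace_add OK_K tr_eq)

lemma tr_scale: "x \<in> OK \<Longrightarrow> tr (of_int k * x) = k * tr x"
proof (rule tr_eqI)
  assume "x \<in> OK"
  then show "nf_trace K (of_int k * x) = of_int (k * tr x)"
    using trace_scale[of x "of_int k"] by (simp add: OK_K tr_eq)
qed

lemma tr_diff: "x \<in> OK \<Longrightarrow> y \<in> OK \<Longrightarrow> tr (x - y) = tr x - tr y"
  using tr_add[of x "of_int (-1) * y"] tr_scale[of y "-1"] OK_closed(6)[of y] by simp

lemma tr_sum: "(\<And>i. i \<in> I \<Longrightarrow> f i \<in> OK) \<Longrightarrow> tr (\<Sum>i\<in>I. f i) = (\<Sum>i\<in>I. tr (f i))"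
proof (induction I rule: infinite_finite_induct)
  case (insert i I)
  then show ?case by (simp add: tr_add OK_sum)
qed (simp_all add: tr_def trace_0)

lemma tr_lincomb:
  "(\<And>i. i \<in> I \<Longrightarrow> f i \<in> OK) \<Longrightarrow> tr (\<Sum>i\<in>I. of_int (c i) * f i) = (\<Sum>i\<in>I. c i * tr (f i))"
  by (subst tr_sum) (auto simp: tr_scale OK_closed)

text \<open>A common denominator \<open>D\<close> of the multiplication matrix of \<open>x\<close>
  makes the integer span of a rational basis stable under \<open>D * x\<close>.\<close>

lemma ex_denominator:
  assumes x: "x \<in> K"
  shows "\<exists>m::int. m > 0 \<and> of_int m * x \<in> OK"
proof -
  obtain w where w: "qbasis K n w" using ex_qbasis by blast
  obtain m where m: "\<forall>k<n. x * w k = (\<Sum>l<n. of_rat (m k l) * w l)" using mult_matrix[OF w x] .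
  obtain D :: int where D: "D > 0" "\<forall>q\<in>(\<lambda>(k, l). m k l) ` ({..<n} \<times> {..<n}). of_int D * q \<in> \<int>"
    using common_denominator[of "(\<lambda>(k, l). m k l) ` ({..<n} \<times> {..<n})"] by auto
  have "\<exists>a::int. of_int D * m k l = of_int a" if "k < n" "l < n" for k l
    using D(2) that by (auto elim!: Ints_cases)
  then obtain a :: "nat \<Rightarrow> nat \<Rightarrow> int" where a: "\<And>k l. k < n \<Longrightarrow> l < n \<Longrightarrow> of_int D * m k l = of_int (a k l)"
    by metis
  have "\<exists>k<n. w k \<noteq> 0"
  proof (rule ccontr)
    assume "\<not> (\<exists>k<n. w k \<noteq> 0)"
    then show False using qbasisD(2)[OF w K_closed(1)] by simp
  qed
  then obtain k0 where k0: "k0 < n" "w k0 \<noteq> 0" by blast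
  have "algebraic_int (of_int D * x)"
  proof (rule algebraic_int_if_zspan_invariant[of "w ` {..<n}" "w k0"])
    fix v assume "v \<in> w ` {..<n}"
    then obtain k where k: "k < n" "v = w k" by auto
    have "of_int D * x * v = (\<Sum>l<n. of_rat (of_int D * m k l) * w l)"
      using m k by (simp add: sum_distrib_left of_rat_mult mult.assoc)
    also have "\<dots> = (\<Sum>l<n. of_int (a k l) * w l)"
      by (rule sum.cong) (use a k in auto)
    also have "\<dots> \<in> zspan (w ` {..<n})" by (intro zspan_sum zspan_scale zspan_base) auto
    finally show "of_int D * x * v \<in> zspan (w ` {..<n})" .
  qed (use k0 in auto)
  then show ?thesis using D(1) x by (auto simp: OK_iff intro!: K_intros)
qed

text \<open>In contrast to \<open>integral_basis\<close>, the length is fixed to \<open>n\<close>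
  and uniqueness of coordinates is derived. Both notions are matched in
  \<open>integral_basis_zbasis\<close> and \<open>nf_disc_eq\<close>.\<close>

definition zbasis :: "(nat \<Rightarrow> 'a) \<Rightarrow> bool" where
  "zbasis w \<longleftrightarrow> (\<forall>i<n. w i \<in> OK) \<and> (\<forall>x\<in>OK. \<exists>c::nat \<Rightarrow> int. x = (\<Sum>i<n. of_int (c i) * w i))"

lemma zbasisD:
  assumes "zbasis w"
  shows "i < n \<Longrightarrow> w i \<in> OK" "x \<in> OK \<Longrightarrow> \<exists>c::nat \<Rightarrow> int. x = (\<Sum>i<n. of_int (c i) * w i)"
  using assms by (auto simp: zbasis_def)

lemma zbasis_qbasis:
  assumes "zbasis w"
  shows "qbasis K n w"
proof -
  have "\<exists>c::nat \<Rightarrow> rat. x = (\<Sum>i<n. of_rat (c i) * w i)" if "x \<in> K" for x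
  proof -
    obtain m :: int where m: "m > 0" "of_int m * x \<in> OK" using ex_denominator[OF \<open>x \<in> K\<close>] by blast
    obtain c :: "nat \<Rightarrow> int" where c: "of_int m * x = (\<Sum>i<n. of_int (c i) * w i)"
      using zbasisD(2)[OF assms m(2)] by blast
    have "x = inverse (of_int m) * (of_int m * x)" using m(1) by simp
    also have "\<dots> = (\<Sum>i<n. of_rat (of_int (c i) / of_int m) * w i)"
      unfolding c sum_distrib_left by (simp add: of_rat_mult of_rat_inverse divide_inverse mult_ac)
    finally show ?thesis by (intro exI[of _ "\<lambda>i. of_int (c i) / of_int m"])
  qed
  then show ?thesis using zbasisD(1)[OF assms] OK_K by (auto simp: qbasis_def)
qed

lemma zcoords_unique:
  assumes "zbasis w" "(\<Sum>k<n. of_int (c k) * w k) = (\<Sum>k<n. of_int (d k) * w k)" "k < n"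
  shows "c k = d k"
  using coords_unique[OF zbasis_qbasis[OF assms(1)], of "\<lambda>k. of_int (c k)" "\<lambda>k. of_int (d k)" k] assms(2,3)
  by simp

definition gram :: "(nat \<Rightarrow> 'a) \<Rightarrow> rat mat" where
  "gram w = mat n n (\<lambda>(i, j). nf_trace K (w i * w j))"

lemma S_mat_mult:
  assumes "\<And>i. i < n \<Longrightarrow> v i \<in> K" "\<And>i. i < n \<Longrightarrow> w i \<in> K"
  shows "transpose_mat (S_mat v) * S_mat w = mat n n (\<lambda>(k, l). of_rat (nf_trace K (v k * w l)))"
proof (rule eq_matI)
  fix k l assume "k < dim_row (mat n n (\<lambda>(k, l). of_rat (nf_trace K (v k * w l)) :: complex))"
    "l < dim_col (mat n n (\<lambda>(k, l). of_rat (nf_trace K (v k * w l)) :: complex))"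
  then have kl: "k < n" "l < n" by auto
  have "(transpose_mat (S_mat v) * S_mat w) $$ (k, l) = (\<Sum>i<n. \<sigma> i (v k) * \<sigma> i (w l))"
    using kl by (subst mat_mult_index[of _ n]) (auto simp: S_mat_def)
  also have "\<dots> = (\<Sum>i<n. \<sigma> i (v k * w l))"
    by (rule sum.cong) (use field_hom_on.mult[OF h] assms kl in auto)
  also have "\<dots> = of_rat (nf_trace K (v k * w l))" using assms kl by (simp add: trace_eq K_closed)
  finally show "(transpose_mat (S_mat v) * S_mat w) $$ (k, l) =
      mat n n (\<lambda>(k, l). of_rat (nf_trace K (v k * w l))) $$ (k, l)" using kl by simp
qed (auto simp: S_mat_def)

lemma det_S_mat_mult:
  assumes "\<And>i. i < n \<Longrightarrow> v i \<in> K" "\<And>i. i < n \<Longrightarrow> w i \<in> K"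
  shows "det (S_mat v) * det (S_mat w) = det (mat n n (\<lambda>(k, l). of_rat (nf_trace K (v k * w l))))"
proof -
  have C: "S_mat u \<in> carrier_mat n n" for u by (simp add: S_mat_def)
  have "det (S_mat v) * det (S_mat w) = det (transpose_mat (S_mat v) * S_mat w)"
    by (subst det_mult[of _ n]) (use C det_transpose[OF C] in auto)
  also have "transpose_mat (S_mat v) * S_mat w = mat n n (\<lambda>(k, l). of_rat (nf_trace K (v k * w l)))"
    by (rule S_mat_mult) (use assms in auto)
  finally show ?thesis .
qed

lemma det_gram:
  assumes "\<And>i. i < n \<Longrightarrow> w i \<in> K"
  shows "of_rat (det (gram w)) = (det (S_mat w))\<^sup>2"
proof -
  have "mat n n (\<lambda>(k, l). of_rat (nf_trace K (w k * w l)) :: complex) = map_mat of_rat (gram w)"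
    by (rule eq_matI) (auto simp: gram_def)
  then show ?thesis
    using det_S_mat_mult[OF assms assms] by (simp add: power2_eq_square of_rat_hom.hom_det)
qed

lemma det_gram_int:
  assumes "\<And>i. i < n \<Longrightarrow> w i \<in> OK"
  shows "det (gram w) \<in> \<int>"
proof -
  have "gram w = map_mat of_int (mat n n (\<lambda>(i, j). tr (w i * w j)))"
    by (rule eq_matI) (use assms in \<open>auto simp: gram_def tr_eq OK_closed\<close>)
  then show ?thesis by (simp add: of_int_hom.hom_det)
qed

text \<open>Among the rational bases consisting of algebraic integers, one of least absolute
  discriminant is integral. If an algebraic integer \<open>x\<close> had a coordinate
  \<open>c k\<close> outside the integers, replacing \<open>w k\<close> by
  \<open>x - \<lfloor>c k\<rfloor> w k\<close> would multiply the discriminant by the square of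
  \<open>frac (c k)\<close>, by Cramer's rule.\<close>

lemma ex_zbasis: "\<exists>w. zbasis w"
proof -
  define P where "P w \<longleftrightarrow> qbasis K n w \<and> (\<forall>i<n. w i \<in> OK)" for w
  obtain b where b: "qbasis K n b" using ex_qbasis by blast
  have "\<exists>m::int. m > 0 \<and> of_int m * b i \<in> OK" if "i < n" for i
    using ex_denominator qbasisD(1)[OF b that] by blast
  then obtain m :: "nat \<Rightarrow> int" where m: "\<And>i. i < n \<Longrightarrow> m i > 0 \<and> of_int (m i) * b i \<in> OK" by metis
  have P0: "P (\<lambda>i. of_int (m i) * b i)"
  proof -
    have "\<exists>c::nat \<Rightarrow> rat. x = (\<Sum>i<n. of_rat (c i) * (of_int (m i) * b i))" if x: "x \<in> K" for x
    proof -
      obtain c :: "nat \<Rightarrow> rat" where c: "x = (\<Sum>i<n. of_rat (c i) * b i)" using qbasisD(2)[OF b x] by blast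
      have "x = (\<Sum>i<n. of_rat (c i / of_int (m i)) * (of_int (m i) * b i))"
        unfolding c
      proof (rule sum.cong)
        fix i assume "i \<in> {..<n}"
        then have "m i \<noteq> 0" using m[of i] by auto
        then show "of_rat (c i) * b i = of_rat (c i / of_int (m i)) * (of_int (m i) * b i)"
          by (simp add: of_rat_divide)
      qed simp
      then show ?thesis by (intro exI[of _ "\<lambda>i. c i / of_int (m i)"])
    qed
    then show ?thesis using m OK_K by (auto simp: P_def qbasis_def)
  qed
  \<comment> \<open>Discriminants of such bases are integers, so rounding in the measure loses
    nothing.\<close>
  obtain w where w': "P w \<and> (\<forall>v. P v \<longrightarrow> nat \<lfloor>\<bar>det (gram w)\<bar>\<rfloor> \<le> nat \<lfloor>\<bar>det (gram v)\<bar>\<rfloor>)"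
    using ex_has_least_nat[of P, OF P0, of "\<lambda>w. nat \<lfloor>\<bar>det (gram w)\<bar>\<rfloor>"] by (rule exE)
  have w: "P w" using w' by (rule conjunct1)
  have min: "nat \<lfloor>\<bar>det (gram w)\<bar>\<rfloor> \<le> nat \<lfloor>\<bar>det (gram v)\<bar>\<rfloor>" if "P v" for v
    using w'[THEN conjunct2, rule_format, OF that] .
  have qw: "qbasis K n w" and wO: "\<And>i. i < n \<Longrightarrow> w i \<in> OK" using w by (auto simp: P_def)
  have "\<exists>c::nat \<Rightarrow> int. x = (\<Sum>i<n. of_int (c i) * w i)" if x: "x \<in> OK" for x
  proof -
    obtain c :: "nat \<Rightarrow> rat" where c: "x = (\<Sum>i<n. of_rat (c i) * w i)"
      using qbasisD(2)[OF qw OK_K[OF x]] by blast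
    have "frac (c k) = 0" if k: "k < n" for k
    proof (rule ccontr)
      assume f0: "frac (c k) \<noteq> 0"
      define d where "d = c(k := frac (c k))"
      define v where "v = w(k := x - of_int \<lfloor>c k\<rfloor> * w k)"
      have vk: "v k = (\<Sum>i<n. of_rat (d i) * w i)"
      proof -
        have "(\<Sum>i<n. of_rat (d i) * w i) = x - of_rat (c k) * w k + of_rat (frac (c k)) * w k"
          unfolding c by (subst sum_update[OF k, of _ "\<lambda>i. of_rat (c i) * w i"]) (auto simp: d_def)
        also have "\<dots> = x - of_int \<lfloor>c k\<rfloor> * w k"
          by (simp add: frac_def of_rat_diff algebra_simps)
        finally show ?thesis by (simp add: v_def)
      qed
      have vO: "v i \<in> OK" if "i < n" for i using wO[OF that] wO[OF k] x by (auto simp: v_def OK_closed)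
      have dk: "d k = frac (c k)" by (simp add: d_def)
      have "P v"
      proof -
        have "\<exists>e::nat \<Rightarrow> rat. y = (\<Sum>i<n. of_rat (e i) * v i)" if y: "y \<in> K" for y
        proof -
          obtain a :: "nat \<Rightarrow> rat" where a: "y = (\<Sum>i<n. of_rat (a i) * w i)" using qbasisD(2)[OF qw y] by blast
          define r where "r = a k / d k"
          define e where "e i = (if i = k then r else a i - r * d i)" for i
          have "(\<Sum>i<n. of_rat (e i) * v i) =
              (\<Sum>i<n. of_rat (a i - r * d i) * w i) - of_rat (a k - r * d k) * w k + of_rat (e k) * v k"
            by (rule sum_update[OF k]) (auto simp: e_def v_def)
          also have "a k - r * d k = 0" using f0 by (simp add: r_def dk)
          also have "(\<Sum>i<n. of_rat (a i - r * d i) * w i) =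
              (\<Sum>i<n. of_rat (a i) * w i - of_rat r * (of_rat (d i) * w i))"
            by (rule sum.cong) (simp_all add: of_rat_diff of_rat_mult algebra_simps)
          also have "\<dots> = y - of_rat r * v k"
            by (simp only: sum_subtractf sum_distrib_left[symmetric] a[symmetric] vk[symmetric])
          finally show ?thesis by (intro exI[of _ e]) (simp add: e_def)
        qed
        then show ?thesis using vO OK_K by (auto simp: P_def qbasis_def)
      qed
      define dv where "dv = vec n (\<lambda>i. of_rat (d i) :: complex)"
      have "S_mat v = replace_col (S_mat w) (S_mat w *\<^sub>v dv) k"
      proof (rule eq_matI)
        fix i j assume "i < dim_row (replace_col (S_mat w) (S_mat w *\<^sub>v dv) k)"
          "j < dim_col (replace_col (S_mat w) (S_mat w *\<^sub>v dv) k)"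
        then have ij: "i < n" "j < n" by (auto simp: replace_col_def S_mat_def)
        have "(S_mat w *\<^sub>v dv) $ i = \<sigma> i (v k)"
          unfolding vk
          by (subst field_hom_on.lincomb[OF h[OF ij(1)]])
             (use ij wO OK_K in \<open>auto simp: S_mat_def dv_def scalar_prod_def atLeast0LessThan mult.commute intro!: sum.cong\<close>)
        then show "S_mat v $$ (i, j) = replace_col (S_mat w) (S_mat w *\<^sub>v dv) k $$ (i, j)"
          using ij by (auto simp: replace_col_def S_mat_def v_def)
      qed (auto simp: replace_col_def S_mat_def)
      moreover have "dv $ k = of_rat (d k)" using k by (simp add: dv_def)
      ultimately have "det (S_mat v) = of_rat (d k) * det (S_mat w)"
        using cramer_lemma_mat[of "S_mat w" n dv k] k by (simp add: S_mat_def dv_def)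
      then have "(of_rat (det (gram v)) :: complex) = of_rat ((d k)\<^sup>2 * det (gram w))"
        using det_gram[of v] det_gram[of w] vO wO OK_K
        by (simp add: of_rat_mult of_rat_power power_mult_distrib)
      then have eq: "det (gram v) = (d k)\<^sup>2 * det (gram w)" by simp
      have "det (S_mat w) \<noteq> 0" by (rule S_det[OF qw])
      then have g0: "det (gram w) \<noteq> 0" using det_gram[of w] wO OK_K by auto
      have fr: "0 < d k" "d k < 1" using f0 frac_ge_0[of "c k"] frac_lt_1[of "c k"] by (auto simp: dk)
      then have "(d k)\<^sup>2 < 1" by (simp add: power_less_one_iff)
      then have lt: "\<bar>det (gram v)\<bar> < \<bar>det (gram w)\<bar>"
        unfolding eq using g0 fr by (simp add: abs_mult)
      obtain a b where ab: "det (gram v) = of_int a" "det (gram w) = of_int b"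
        using det_gram_int[of v] det_gram_int[of w] vO wO by (auto elim!: Ints_cases)
      have "\<bar>a\<bar> < \<bar>b\<bar>" using lt unfolding ab by linarith
      moreover have "nat \<bar>b\<bar> \<le> nat \<bar>a\<bar>"
        using min[OF \<open>P v\<close>] unfolding ab by (simp flip: of_int_abs)
      ultimately show False by simp
    qed
    then have "c k = of_int \<lfloor>c k\<rfloor>" if "k < n" for k using that by (simp add: frac_def)
    then have "x = (\<Sum>i<n. of_int \<lfloor>c i\<rfloor> * w i)"
      unfolding c by (intro sum.cong refl) (metis lessThan_iff of_rat_of_int_eq)
    then show ?thesis by (intro exI[of _ "\<lambda>i. \<lfloor>c i\<rfloor>"])
  qed
  then show ?thesis using wO by (auto simp: zbasis_def)
qed

text \<open>Each basis is an integer matrix times the other; the two integer determinants have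
  product 1, and the sign disappears in the square.\<close>

lemma det_gram_eq:
  assumes w: "zbasis w" and v: "zbasis v"
  shows "det (gram w) = det (gram v)"
proof -
  have C: "S_mat u \<in> carrier_mat n n" for u by (simp add: S_mat_def)
  have ex: "\<exists>d::int. det (S_mat v) = of_int d * det (S_mat w)" if w: "zbasis w" and v: "zbasis v" for v w
  proof -
    have "\<exists>c::nat \<Rightarrow> int. v j = (\<Sum>i<n. of_int (c i) * w i)" if "j < n" for j
      using zbasisD(2)[OF w zbasisD(1)[OF v that]] .
    then obtain c :: "nat \<Rightarrow> nat \<Rightarrow> int" where c: "\<And>j. j < n \<Longrightarrow> v j = (\<Sum>i<n. of_int (c j i) * w i)"
      by metis
    define M where "M = mat n n (\<lambda>(i, j). c j i)"
    have M: "map_mat of_int M \<in> carrier_mat n n" by (simp add: M_def)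
    have "S_mat v = S_mat w * map_mat of_int M"
    proof (rule eq_matI)
      fix i j assume "i < dim_row (S_mat w * map_mat of_int M)" "j < dim_col (S_mat w * map_mat of_int M)"
      then have ij: "i < n" "j < n" by (auto simp: S_mat_def M_def)
      have "(S_mat w * map_mat of_int M) $$ (i, j) = (\<Sum>k<n. \<sigma> i (w k) * of_int (c j k))"
        using ij by (subst mat_mult_index[OF C M]) (auto simp: S_mat_def M_def)
      also have "\<dots> = \<sigma> i (v j)"
        unfolding c[OF ij(2)]
        using field_hom_on.lincomb[OF h[OF ij(1)], of "{..<n}" w "\<lambda>k. of_int (c j k)"] zbasisD(1)[OF w] OK_K
        by (simp add: mult.commute)
      finally show "S_mat v $$ (i, j) = (S_mat w * map_mat of_int M) $$ (i, j)" using ij by (simp add: S_mat_def)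
    qed (auto simp: S_mat_def M_def)
    then have "det (S_mat v) = det (S_mat w) * of_int (det M)"
      using det_mult[OF C M] by (simp add: of_int_hom.hom_det)
    then show ?thesis by (metis mult.commute)
  qed
  obtain d e :: int where de: "det (S_mat v) = of_int d * det (S_mat w)" "det (S_mat w) = of_int e * det (S_mat v)"
    using ex[OF w v] ex[OF v w] by blast
  have cancel: "a * b = 1" if "x = a * (b * x)" "x \<noteq> 0" for a b x :: complex
  proof -
    have "(a * b) * x = 1 * x" using that(1)[symmetric] by (simp add: mult.assoc)
    then show ?thesis using that(2) by (simp only: mult_cancel_right) simp
  qed
  have "det (S_mat w) \<noteq> 0" by (rule S_det[OF zbasis_qbasis[OF w]])
  moreover have "det (S_mat w) = of_int e * (of_int d * det (S_mat w))"
    by (subst de(1)[symmetric]) (rule de(2))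
  ultimately have "of_int e * of_int d = (1 :: complex)" by (intro cancel)
  then have "of_int (e * d) = (1 :: complex)" by simp
  then have "e * d = 1" by (metis of_int_eq_1_iff)
  then have "d = 1 \<or> d = -1" by (metis zmult_eq_1_iff)
  then have "(det (S_mat v))\<^sup>2 = (det (S_mat w))\<^sup>2" unfolding de(1) by auto
  then have "(of_rat (det (gram w)) :: complex) = of_rat (det (gram v))"
    using det_gram[of v] det_gram[of w] zbasisD(1)[OF v] zbasisD(1)[OF w] OK_K by simp
  then show ?thesis by simp
qed

lemma integral_basis_zbasis:
  assumes "integral_basis K ws"
  shows "length ws = n" "zbasis (nth ws)"
proof -
  define m where "m = length ws"
  have wsO: "ws ! i \<in> OK" if "i < m" for i
    using assms that by (auto simp: integral_basis_def m_def)
  have uniq: "c = d" if "length c = m" "length d = m"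
    "(\<Sum>i<m. of_int (c ! i) * ws ! i) = (\<Sum>i<m. of_int (d ! i) * ws ! i)" for c d :: "int list"
  proof -
    have "(\<Sum>i<m. of_int (c ! i) * ws ! i) \<in> OK" by (intro OK_sum OK_closed wsO) auto
    then show ?thesis using assms that unfolding integral_basis_def m_def by metis
  qed
  have span: "\<exists>c::nat \<Rightarrow> int. x = (\<Sum>i<m. of_int (c i) * ws ! i)" if "x \<in> OK" for x
    using assms that unfolding integral_basis_def m_def by metis
  have uniq': "c k = d k" if "(\<Sum>i<m. of_int (c i) * ws ! i) = (\<Sum>i<m. of_int (d i) * ws ! i)" "k < m"
    for c d :: "nat \<Rightarrow> int" and k
  proof -
    have "map c [0..<m] = map d [0..<m]" by (rule uniq) (use that in auto)
    then show ?thesis using \<open>k < m\<close> by (metis add_0 diff_zero length_upt nth_map nth_upt)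
  qed
  obtain w where w: "zbasis w" using ex_zbasis by blast
  have "\<exists>c::nat \<Rightarrow> int. w i = (\<Sum>j<m. of_int (c j) * ws ! j)" if "i < n" for i
    using span zbasisD(1)[OF w that] by blast
  then obtain A :: "nat \<Rightarrow> nat \<Rightarrow> int" where A: "\<And>i. i < n \<Longrightarrow> w i = (\<Sum>j<m. of_int (A i j) * ws ! j)"
    by metis
  have "\<exists>c::nat \<Rightarrow> int. ws ! j = (\<Sum>i<n. of_int (c i) * w i)" if "j < m" for j
    using zbasisD(2)[OF w wsO[OF that]] .
  then obtain B :: "nat \<Rightarrow> nat \<Rightarrow> int" where B: "\<And>j. j < m \<Longrightarrow> ws ! j = (\<Sum>i<n. of_int (B j i) * w i)"
    by metis
  have AB: "(\<Sum>j<m. A i j * B j k) = of_bool (i = k)" if "i < n" "k < n" for i k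
  proof (rule zcoords_unique[OF w _ that(2), of "\<lambda>k. \<Sum>j<m. A i j * B j k" "\<lambda>k. of_bool (i = k)"])
    have "(\<Sum>k<n. of_int (\<Sum>j<m. A i j * B j k) * w k) = (\<Sum>j<m. of_int (A i j) * (\<Sum>k<n. of_int (B j k) * w k))"
      unfolding of_int_sum sum_distrib_right sum_distrib_left of_int_mult
      by (subst sum.swap) (simp add: mult.assoc)
    also have "\<dots> = (\<Sum>j<m. of_int (A i j) * ws ! j)"
      by (rule sum.cong) (use B in auto)
    also have "\<dots> = w i" using A[OF that(1)] by simp
    also have "\<dots> = (\<Sum>k<n. of_int (of_bool (i = k)) * w k)" using that by simp
    finally show "(\<Sum>k<n. of_int (\<Sum>j<m. A i j * B j k) * w k) = (\<Sum>k<n. of_int (of_bool (i = k)) * w k)" .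
  qed
  have BA: "(\<Sum>i<n. B j i * A i k) = of_bool (j = k)" if "j < m" "k < m" for j k
  proof (rule uniq'[of "\<lambda>k. \<Sum>i<n. B j i * A i k" "\<lambda>k. of_bool (j = k)", OF _ that(2)])
    have "(\<Sum>k<m. of_int (\<Sum>i<n. B j i * A i k) * ws ! k) = (\<Sum>i<n. of_int (B j i) * (\<Sum>k<m. of_int (A i k) * ws ! k))"
      unfolding of_int_sum sum_distrib_right sum_distrib_left of_int_mult
      by (subst sum.swap) (simp add: mult.assoc)
    also have "\<dots> = (\<Sum>i<n. of_int (B j i) * w i)"
      by (rule sum.cong) (use A in auto)
    also have "\<dots> = ws ! j" using B[OF that(1)] by simp
    also have "\<dots> = (\<Sum>k<m. of_int (of_bool (j = k)) * ws ! k)" using that by simp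
    finally show "(\<Sum>k<m. of_int (\<Sum>i<n. B j i * A i k) * ws ! k) = (\<Sum>k<m. of_int (of_bool (j = k)) * ws ! k)" .
  qed
  \<comment> \<open>The lengths agree because the trace of \<open>A B\<close> equals the trace of
    \<open>B A\<close>, and both products are identity matrices.\<close>
  have "int n = (\<Sum>i<n. \<Sum>j<m. A i j * B j i)" using AB by simp
  also have "\<dots> = (\<Sum>j<m. \<Sum>i<n. B j i * A i j)" by (subst sum.swap) (simp add: mult.commute)
  also have "\<dots> = int m" using BA by simp
  finally have nm: "n = m" by simp
  then show "length ws = n" by (simp add: m_def)
  show "zbasis (nth ws)" unfolding zbasis_def using wsO span nm by simp
qed

lemma nf_disc_eq:
  assumes w: "zbasis w"
  shows "of_int (nf_disc K) = det (gram w)" "nf_disc K \<noteq> 0"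
proof -
  have gram: "mat (length ws) (length ws) (\<lambda>(i, j). nf_trace K (ws ! i * ws ! j)) = gram (nth ws)"
    if "length ws = n" for ws using that by (simp add: gram_def)
  define ws where "ws = map w [0..<n]"
  have len: "length ws = n" and nth: "\<And>i. i < n \<Longrightarrow> ws ! i = w i" by (auto simp: ws_def)
  have "integral_basis K ws"
    unfolding integral_basis_def len
  proof (intro conjI ballI)
    show "set ws \<subseteq> OK" using zbasisD(1)[OF w] by (auto simp: ws_def)
    fix x assume "x \<in> OK"
    then obtain c :: "nat \<Rightarrow> int" where c: "x = (\<Sum>i<n. of_int (c i) * w i)" using zbasisD(2)[OF w] by blast
    show "\<exists>!c::int list. length c = n \<and> x = (\<Sum>i<n. of_int (c ! i) * ws ! i)"
    proof (rule ex1I[of _ "map c [0..<n]"])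
      fix d :: "int list" assume d: "length d = n \<and> x = (\<Sum>i<n. of_int (d ! i) * ws ! i)"
      have "d ! k = c k" if "k < n" for k
        by (rule zcoords_unique[OF w _ that]) (use d c nth in simp)
      then show "d = map c [0..<n]" using d by (intro nth_equalityI) auto
    qed (use c nth in auto)
  qed
  obtain k where k: "det (gram w) = of_int k"
    using det_gram_int[of w] zbasisD(1)[OF w] by (auto elim!: Ints_cases)
  have "nf_disc K = k"
    unfolding nf_disc_def
  proof (rule the_equality)
    have "gram (nth ws) = gram w" unfolding gram_def by (rule eq_matI) (auto simp: nth)
    then show "\<exists>w. integral_basis K w \<and>
        of_int k = det (mat (length w) (length w) (\<lambda>(i, j). nf_trace K (w ! i * w ! j)))"
      using \<open>integral_basis K ws\<close> gram[OF len] k by (intro exI[of _ ws]) simp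
    fix d :: int
    assume "\<exists>w. integral_basis K w \<and>
        of_int d = det (mat (length w) (length w) (\<lambda>(i, j). nf_trace K (w ! i * w ! j)))"
    then obtain v where v: "integral_basis K v"
      "of_int d = det (mat (length v) (length v) (\<lambda>(i, j). nf_trace K (v ! i * v ! j)))" by blast
    then have "of_int d = det (gram (nth v))" using gram integral_basis_zbasis(1) by simp
    also have "\<dots> = of_int k" using det_gram_eq[OF integral_basis_zbasis(2)[OF v(1)] w] k by simp
    finally show "d = k" by simp
  qed
  then show "of_int (nf_disc K) = det (gram w)" using k by simp
  moreover have "det (gram w) \<noteq> 0"
    using det_gram[of w] S_det[OF zbasis_qbasis[OF w]] zbasisD(1)[OF w] OK_K by auto
  ultimately show "nf_disc K \<noteq> 0" by auto
qed

section \<open>Diagonalising the trace form over the integers\<close>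

lemma zbasis_permute:
  assumes w: "zbasis w" and p: "p permutes {..<n}"
  shows "zbasis (w \<circ> p)"
proof -
  have "\<exists>c::nat \<Rightarrow> int. x = (\<Sum>i<n. of_int (c i) * (w \<circ> p) i)" if "x \<in> OK" for x
  proof -
    obtain c :: "nat \<Rightarrow> int" where c: "x = (\<Sum>i<n. of_int (c i) * w i)" using zbasisD(2)[OF w \<open>x \<in> OK\<close>] by blast
    also have "\<dots> = (\<Sum>i<n. of_int (c (p i)) * w (p i))"
      by (rule sum.permute[OF p, unfolded o_def])
    finally show ?thesis by (intro exI[of _ "c \<circ> p"]) simp
  qed
  moreover have "(w \<circ> p) i \<in> OK" if "i < n" for i
    using zbasisD(1)[OF w] permutes_in_image[OF p, of i] that by simp
  ultimately show ?thesis by (auto simp: zbasis_def)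
qed

lemma zbasis_shear:
  assumes w: "zbasis w" and m: "m < n"
  shows "zbasis (\<lambda>j. if m < j then w j - of_int (q j) * w m else w j)" (is "zbasis ?v")
proof -
  have "\<exists>c::nat \<Rightarrow> int. x = (\<Sum>i<n. of_int (c i) * ?v i)" if "x \<in> OK" for x
  proof -
    obtain c :: "nat \<Rightarrow> int" where c: "x = (\<Sum>i<n. of_int (c i) * w i)" using zbasisD(2)[OF w \<open>x \<in> OK\<close>] by blast
    define s where "s = (\<Sum>i<n. if m < i then c i * q i else 0)"
    define d where "d = c(m := c m + s)"
    have "(\<Sum>i<n. of_int (d i) * ?v i) = (\<Sum>i<n. of_int (c i) * ?v i) - of_int (c m) * ?v m + of_int (d m) * ?v m"
      by (rule sum_update[OF m]) (auto simp: d_def)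
    also have "\<dots> = (\<Sum>i<n. of_int (c i) * ?v i) + of_int s * w m"
      by (simp add: d_def algebra_simps)
    also have "(\<Sum>i<n. of_int (c i) * ?v i) =
        (\<Sum>i<n. of_int (c i) * w i - of_int (if m < i then c i * q i else 0) * w m)"
      by (rule sum.cong) (auto simp: algebra_simps)
    also have "\<dots> = x - of_int s * w m"
      unfolding c s_def sum_subtractf of_int_sum sum_distrib_right ..
    finally show ?thesis by (intro exI[of _ d]) simp
  qed
  moreover have "?v i \<in> OK" if "i < n" for i
    using zbasisD(1)[OF w that] zbasisD(1)[OF w m] by (simp add: OK_closed)
  ultimately show ?thesis by (auto simp: zbasis_def)
qed

text \<open>Elimination as for the Smith normal form: row operations act on \<open>e\<close> and
  column operations on \<open>f\<close>, independently of each other. The diagonal entries are not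
  asked to divide one another.\<close>

definition diag_upto :: "nat \<Rightarrow> (nat \<Rightarrow> 'a) \<Rightarrow> (nat \<Rightarrow> 'a) \<Rightarrow> bool" where
  "diag_upto m e f \<longleftrightarrow> zbasis e \<and> zbasis f \<and>
     (\<forall>i<n. \<forall>j<n. i \<noteq> j \<and> (i < m \<or> j < m) \<longrightarrow> tr (e i * f j) = 0)"

lemma diag_upto_commute: "diag_upto m e f \<longleftrightarrow> diag_upto m f e"
proof -
  have "diag_upto m f e" if d: "diag_upto m e f" for e f
    unfolding diag_upto_def
  proof (intro conjI allI impI)
    fix i j assume "i < n" "j < n" "i \<noteq> j \<and> (i < m \<or> j < m)"
    then have "tr (e j * f i) = 0" using d by (auto simp: diag_upto_def)
    then show "tr (f i * e j) = 0" by (simp add: mult.commute)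
  qed (use d in \<open>auto simp: diag_upto_def\<close>)
  then show ?thesis by (intro iffI)
qed

lemma diag_upto_shear:
  assumes d: "diag_upto m e f" and m: "m < n"
  shows "diag_upto m e (\<lambda>j. if m < j then f j - of_int (q j) * f m else f j)" (is "diag_upto m e ?f")
proof -
  have e: "zbasis e" and f: "zbasis f" using d by (auto simp: diag_upto_def)
  have eO: "e i \<in> OK" if "i < n" for i using zbasisD(1)[OF e that] .
  have fO: "f i \<in> OK" if "i < n" for i using zbasisD(1)[OF f that] .
  have "tr (e i * ?f j) = 0" if ij: "i < n" "j < n" "i \<noteq> j" "i < m \<or> j < m" for i j
  proof (cases "m < j")
    case True
    then have "i < m" using ij by auto
    then have 0: "tr (e i * f j) = 0" "tr (e i * f m) = 0" using d ij m by (auto simp: diag_upto_def)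
    have "e i * ?f j = e i * f j - of_int (q j) * (e i * f m)" using True by (simp add: algebra_simps)
    then show ?thesis using 0 ij m by (simp add: tr_diff tr_scale eO fO OK_closed)
  next
    case False
    then show ?thesis using d ij by (auto simp: diag_upto_def)
  qed
  then show ?thesis using e zbasis_shear[OF f m] by (auto simp: diag_upto_def)
qed

text \<open>The pivot is a nonzero entry of least absolute value over all admissible pairs of bases
  and all positions from \<open>m\<close> on, not just for the given pair. Hence a remainder left by
  a shear, which would be a smaller entry of another admissible pair, must be zero.\<close>

lemma diag_upto_step:
  assumes d: "diag_upto m e f" and m: "m < n"
  shows "\<exists>e f. diag_upto (Suc m) e f"
proof -
  define Q where "Q = (\<lambda>(e, f, i, j). diag_upto m e f \<and> m \<le> i \<and> i < n \<and> m \<le> j \<and> j < n \<and> tr (e i * f j) \<noteq> 0)"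
  define \<mu> where "\<mu> = (\<lambda>(e :: nat \<Rightarrow> 'a, f :: nat \<Rightarrow> 'a, i :: nat, j :: nat). nat \<bar>tr (e i * f j)\<bar>)"
  \<comment> \<open>A nonzero entry exists: a zero column would make \<open>f m\<close> orthogonal
    to a whole basis.\<close>
  have "\<exists>i. m \<le> i \<and> i < n \<and> tr (e i * f m) \<noteq> 0"
  proof (rule ccontr)
    assume none: "\<not> (\<exists>i. m \<le> i \<and> i < n \<and> tr (e i * f m) \<noteq> 0)"
    have e: "zbasis e" and f: "zbasis f" using d by (auto simp: diag_upto_def)
    have "tr (e i * f m) = 0" if "i < n" for i
      using none d m that by (cases "m \<le> i") (auto simp: diag_upto_def)
    then have "nf_trace K (f m * e i) = 0" if "i < n" for i
      using that zbasisD(1)[OF e that] zbasisD(1)[OF f m] tr_eq[of "e i * f m"]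
      by (simp add: OK_closed mult.commute)
    then have "f m = 0"
      using zbasisD(1)[OF f m] OK_K by (intro trace_nondegenerate_basis[OF zbasis_qbasis[OF e]]) auto
    then have "(\<Sum>k<n. of_int (of_bool (k = m)) * f k) = (\<Sum>k<n. of_int 0 * f k)" using m by simp
    then have "of_bool (m = m) = (0::int)" by (rule zcoords_unique[OF f _ m])
    then show False by simp
  qed
  then obtain i0 where i0: "m \<le> i0 \<and> i0 < n \<and> tr (e i0 * f m) \<noteq> 0" by (rule exE)
  then have Q0: "Q (e, f, i0, m)" using d m by (simp add: Q_def)
  obtain s where s': "Q s \<and> (\<forall>s'. Q s' \<longrightarrow> \<mu> s \<le> \<mu> s')" using ex_has_least_nat[of Q, OF Q0, of \<mu>] by (rule exE)
  have s: "Q s" "\<And>s'. Q s' \<Longrightarrow> \<mu> s \<le> \<mu> s'"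
    using s'[THEN conjunct1] s'[THEN conjunct2, rule_format] .
  obtain e1 f1 i j where s_eq: "s = (e1, f1, i, j)" by (metis prod_cases4)
  have ef1: "diag_upto m e1 f1" "m \<le> i" "i < n" "m \<le> j" "j < n" "tr (e1 i * f1 j) \<noteq> 0"
    using s(1) by (auto simp: Q_def s_eq)
  have swap: "diag_upto m e (f \<circ> transpose a m)" if d: "diag_upto m e f" and a: "m \<le> a" "a < n" for e f a
  proof -
    have "transpose a m permutes {..<n}" using a m by (intro permutes_swap_id) auto
    then have "zbasis (f \<circ> transpose a m)" using d by (intro zbasis_permute) (auto simp: diag_upto_def)
    moreover have "tr (e i * (f \<circ> transpose a m) j) = 0" if ij: "i < n" "j < n" "i \<noteq> j" "i < m \<or> j < m" for i j
    proof -
      have "transpose a m j < n" using ij a m by (auto simp: transpose_def)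
      moreover have "i \<noteq> transpose a m j" "i < m \<or> transpose a m j < m"
        using ij a by (auto simp: transpose_def)
      ultimately show ?thesis using d ij by (auto simp: diag_upto_def)
    qed
    ultimately show ?thesis using d by (auto simp: diag_upto_def)
  qed
  define e2 where "e2 = e1 \<circ> transpose i m"
  define f2 where "f2 = f1 \<circ> transpose j m"
  have "diag_upto m e1 f2" unfolding f2_def using ef1 by (intro swap)
  then have ef2: "diag_upto m e2 f2"
    unfolding e2_def using swap[of f2 e1 i] ef1 by (simp add: diag_upto_commute[of m _ f2])
  define t where "t = tr (e2 m * f2 m)"
  have t_eq: "t = tr (e1 i * f1 j)" by (simp add: t_def e2_def f2_def)
  then have t0: "t \<noteq> 0" using ef1 by simp
  have min: "\<bar>t\<bar> \<le> \<bar>tr (e i * f j)\<bar>"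
    if "diag_upto m e f" "m \<le> i" "i < n" "m \<le> j" "j < n" "tr (e i * f j) \<noteq> 0" for e f i j
    using s(2)[of "(e, f, i, j)"] that unfolding s_eq \<mu>_def Q_def t_eq by (simp add: nat_le_eq_zle)
  \<comment> \<open>Stated for arbitrary bases with pivot \<open>t\<close>, so that it clears the
    row and, with \<open>e\<close> and \<open>f\<close> exchanged, the column.\<close>
  have clear: "tr (e m * (f j - of_int (tr (e m * f j) div t) * f m)) = 0"
    if d: "diag_upto m e f" and t: "tr (e m * f m) = t" and j: "m < j" "j < n" for e f j
  proof (rule ccontr)
    let ?q = "\<lambda>j. tr (e m * f j) div t"
    let ?f = "\<lambda>j. if m < j then f j - of_int (?q j) * f m else f j"
    assume ne: "tr (e m * (f j - of_int (?q j) * f m)) \<noteq> 0"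
    have O: "e m \<in> OK" "f j \<in> OK" "f m \<in> OK"
      using d j m zbasisD(1) by (auto simp: diag_upto_def)
    have "e m * (f j - of_int (?q j) * f m) = e m * f j - of_int (?q j) * (e m * f m)"
      by (simp add: algebra_simps)
    then have eq: "tr (e m * (f j - of_int (?q j) * f m)) = tr (e m * f j) mod t"
      using O t by (simp add: tr_diff tr_scale OK_closed minus_div_mult_eq_mod)
    have "\<bar>t\<bar> \<le> \<bar>tr (e m * ?f j)\<bar>"
      by (rule min) (use diag_upto_shear[OF d m] j m ne in auto)
    then have "\<bar>t\<bar> \<le> \<bar>tr (e m * f j) mod t\<bar>" using j eq by simp
    then show False using abs_mod_less[OF t0, of "tr (e m * f j)"] by simp
  qed
  define f3 where "f3 = (\<lambda>j. if m < j then f2 j - of_int (tr (e2 m * f2 j) div t) * f2 m else f2 j)"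
  define e3 where "e3 = (\<lambda>j. if m < j then e2 j - of_int (tr (f2 m * e2 j) div t) * e2 m else e2 j)"
  have "diag_upto m e2 f3" unfolding f3_def by (rule diag_upto_shear[OF ef2 m])
  then have "diag_upto m f3 e2" by (rule diag_upto_commute[THEN iffD1])
  from diag_upto_shear[OF this m] have "diag_upto m f3 e3" unfolding e3_def .
  then have d3: "diag_upto m e3 f3" by (rule diag_upto_commute[THEN iffD1])
  have "tr (e3 i * f3 j) = 0" if ij: "i < n" "j < n" "i \<noteq> j" "i < Suc m \<or> j < Suc m" for i j
  proof (cases "i < m \<or> j < m")
    case True
    then show ?thesis using d3 ij by (auto simp: diag_upto_def)
  next
    case False
    then have "i = m \<and> m < j \<or> j = m \<and> m < i" using ij by auto
    then show ?thesis
    proof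
      assume *: "i = m \<and> m < j"
      then show ?thesis using clear[OF ef2 t_def[symmetric], of j] ij by (simp add: e3_def f3_def)
    next
      assume *: "j = m \<and> m < i"
      have "tr (f2 m * e2 m) = t" by (simp add: t_def mult.commute)
      moreover have "diag_upto m f2 e2" using ef2 by (rule diag_upto_commute[THEN iffD1])
      ultimately show ?thesis using clear[of f2 e2 i] * ij by (simp add: e3_def f3_def mult.commute)
    qed
  qed
  then have "diag_upto (Suc m) e3 f3" using d3 by (auto simp: diag_upto_def)
  then show ?thesis by (intro exI)
qed

lemma ex_diag_bases:
  obtains e f D where "zbasis e" "zbasis f" "\<forall>i<n. \<forall>j<n. tr (e i * f j) = (if i = j then D i else 0)"
    "\<bar>\<Prod>i<n. D i\<bar> = \<bar>nf_disc K\<bar>"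
proof -
  have "m \<le> n \<Longrightarrow> \<exists>e f. diag_upto m e f" for m
  proof (induction m)
    case 0
    obtain w where "zbasis w" using ex_zbasis by (rule exE)
    then show ?case by (intro exI[of _ w]) (simp add: diag_upto_def)
  next
    case (Suc m)
    have "m \<le> n" using Suc.prems by simp
    from Suc.IH[OF this] obtain e f where d: "diag_upto m e f" by (elim exE)
    show ?case by (rule diag_upto_step[OF d]) (use Suc.prems in simp)
  qed
  from this[OF order_refl] obtain e f where d: "diag_upto n e f" by (elim exE)
  define D where "D i = tr (e i * f i)" for i
  have e: "zbasis e" and f: "zbasis f" and ef: "\<forall>i<n. \<forall>j<n. tr (e i * f j) = (if i = j then D i else 0)"
    using d by (auto simp: diag_upto_def D_def)
  have eO: "e i \<in> OK" if "i < n" for i using zbasisD(1)[OF e that] .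
  have fO: "f i \<in> OK" if "i < n" for i using zbasisD(1)[OF f that] .
  let ?M = "mat n n (\<lambda>(k, l). of_rat (nf_trace K (e k * f l)) :: complex)"
  have M: "?M \<in> carrier_mat n n" by simp
  have entry: "nf_trace K (e i * f j) = of_int (if i = j then D i else 0)" if "i < n" "j < n" for i j
  proof -
    have "nf_trace K (e i * f j) = of_int (tr (e i * f j))" using that by (simp add: tr_eq eO fO OK_closed)
    then show ?thesis using that ef by simp
  qed
  have "det ?M = prod_list (diag_mat ?M)"
    by (rule det_upper_triangular[OF _ M]) (auto simp: entry)
  also have "\<dots> = (\<Prod>i<n. of_int (D i))"
    by (simp add: diag_mat_def prod.list_conv_set_nth atLeast0LessThan entry)
  finally have detM: "det ?M = of_int (\<Prod>i<n. D i)" by simp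
  \<comment> \<open>The two bases may differ by a determinant -1, so only squares can be compared;
    hence the absolute values in the claim.\<close>
  have "det (S_mat e) * det (S_mat f) = det ?M" using det_S_mat_mult[of e f] eO fO OK_K by simp
  then have "(det (S_mat e))\<^sup>2 * (det (S_mat f))\<^sup>2 = (of_int (\<Prod>i<n. D i))\<^sup>2"
    unfolding detM by (simp flip: power_mult_distrib)
  moreover have "(det (S_mat u))\<^sup>2 = of_int (nf_disc K)" if "zbasis u" for u
    using det_gram[of u] nf_disc_eq(1)[OF that] zbasisD(1)[OF that] OK_K
    by (metis of_rat_of_int_eq)
  ultimately have "of_int (nf_disc K) * of_int (nf_disc K) = (of_int ((\<Prod>i<n. D i)\<^sup>2) :: complex)"
    using e f by simp
  then have "(of_int (nf_disc K * nf_disc K) :: complex) = of_int ((\<Prod>i<n. D i)\<^sup>2)" by simp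
  then have "nf_disc K * nf_disc K = (\<Prod>i<n. D i)\<^sup>2" by (simp only: of_int_eq_iff)
  then have "(nf_disc K)\<^sup>2 = (\<Prod>i<n. D i)\<^sup>2" by (simp add: power2_eq_square)
  then have "\<bar>\<Prod>i<n. D i\<bar> = \<bar>nf_disc K\<bar>" unfolding power2_eq_iff by auto
  then show ?thesis by (rule that[OF e f ef])
qed

end

section \<open>Traces modulo a prime\<close>

context emb_field
begin

definition pO :: "int \<Rightarrow> 'a set" where
  "pO q = (\<lambda>z. of_int q * z) ` OK"

lemma pO_E:
  assumes "x \<in> pO q"
  obtains z where "z \<in> OK" "x = of_int q * z"
  using assms by (auto simp: pO_def)

lemma pO_I: "z \<in> OK \<Longrightarrow> of_int q * z \<in> pO q"
  by (auto simp: pO_def)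

lemma pO_0: "0 \<in> pO q"
  using pO_I[OF OK_closed(1), of q] by simp

lemma pO_add: "x \<in> pO q \<Longrightarrow> y \<in> pO q \<Longrightarrow> x + y \<in> pO q"
  by (elim pO_E) (metis pO_I OK_closed(3) distrib_left)

lemma pO_diff: "x \<in> pO q \<Longrightarrow> y \<in> pO q \<Longrightarrow> x - y \<in> pO q"
  by (elim pO_E) (metis pO_I OK_closed(4) right_diff_distrib)

lemma pO_mult: "x \<in> pO q \<Longrightarrow> y \<in> OK \<Longrightarrow> x * y \<in> pO q"
  by (elim pO_E) (metis pO_I OK_closed(5) mult.assoc)

lemma pO_sum: "(\<And>i. i \<in> I \<Longrightarrow> f i \<in> pO q) \<Longrightarrow> (\<Sum>i\<in>I. f i) \<in> pO q"
  by (induction I rule: infinite_finite_induct) (auto intro: pO_add pO_0)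

lemma pO_dvd: "q dvd k \<Longrightarrow> x \<in> OK \<Longrightarrow> of_int k * x \<in> pO q"
proof (elim dvdE)
  fix m assume "x \<in> OK" "k = q * m"
  then show "of_int k * x \<in> pO q"
    using pO_I[of "of_int m * x" q] by (simp add: OK_closed mult.assoc)
qed

lemma pO_zcoords:
  assumes w: "zbasis w" and x: "(\<Sum>i<n. of_int (c i) * w i) \<in> pO q" and k: "k < n"
  shows "q dvd c k"
proof -
  obtain z where z: "z \<in> OK" "(\<Sum>i<n. of_int (c i) * w i) = of_int q * z" using pO_E[OF x] .
  obtain d :: "nat \<Rightarrow> int" where d: "z = (\<Sum>i<n. of_int (d i) * w i)" using zbasisD(2)[OF w z(1)] by (rule exE)
  have "(\<Sum>i<n. of_int (c i) * w i) = (\<Sum>i<n. of_int (q * d i) * w i)"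
    unfolding z(2) d by (simp add: sum_distrib_left mult.assoc)
  then have "c k = q * d k" by (rule zcoords_unique[OF w _ k])
  then show ?thesis by simp
qed

lemma zbasis_delta:
  assumes "k < n"
  shows "(\<Sum>i<n. of_int (a * of_bool (i = k)) * w i) = of_int a * w k"
proof -
  have "(\<Sum>i<n. of_int (a * of_bool (i = k)) * w i) = (\<Sum>i<n. if i = k then of_int a * w k else 0)"
    by (rule sum.cong) auto
  then show ?thesis using assms by simp
qed

lemma pO_basis_element:
  assumes w: "zbasis w" and x: "of_int a * w k \<in> pO q" and k: "k < n"
  shows "q dvd a"
  using pO_zcoords[OF w, of "\<lambda>i. a * of_bool (i = k)" q k] x k unfolding zbasis_delta[OF k] by simp

lemma finite_residues:
  assumes "q > 0"
  obtains R where "finite R" "R \<subseteq> OK" "\<forall>x\<in>OK. \<exists>r\<in>R. x - r \<in> pO q"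
proof -
  obtain w where w: "zbasis w" using ex_zbasis by (rule exE)
  define R where "R = (\<lambda>c. \<Sum>i<n. of_int (c i) * w i) ` (PiE {..<n} (\<lambda>_. {0..<q}))"
  have "finite R" unfolding R_def by (intro finite_imageI finite_PiE) auto
  moreover have "R \<subseteq> OK"
    unfolding R_def using zbasisD(1)[OF w] by (auto intro!: OK_sum OK_closed)
  moreover have "\<exists>r\<in>R. x - r \<in> pO q" if x: "x \<in> OK" for x
  proof -
    obtain c :: "nat \<Rightarrow> int" where c: "x = (\<Sum>i<n. of_int (c i) * w i)" using zbasisD(2)[OF w x] by (rule exE)
    define d where "d = restrict (\<lambda>i. c i mod q) {..<n}"
    have "d \<in> PiE {..<n} (\<lambda>_. {0..<q})" using assms by (auto simp: d_def)
    then have "(\<Sum>i<n. of_int (d i) * w i) \<in> R" unfolding R_def by (rule imageI)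
    moreover have "x - (\<Sum>i<n. of_int (d i) * w i) = (\<Sum>i<n. of_int (q * (c i div q)) * w i)"
      unfolding c sum_subtractf[symmetric]
    proof (rule sum.cong)
      fix i assume "i \<in> {..<n}"
      then have "c i - d i = q * (c i div q)" by (simp add: d_def minus_mod_eq_mult_div)
      then show "of_int (c i) * w i - of_int (d i) * w i = of_int (q * (c i div q)) * w i"
        by (metis left_diff_distrib of_int_diff)
    qed simp
    moreover have "\<dots> \<in> pO q" using zbasisD(1)[OF w] by (intro pO_sum pO_dvd) auto
    ultimately show ?thesis by (intro bexI[of _ "\<Sum>i<n. of_int (d i) * w i"]) auto
  qed
  ultimately show ?thesis using that[of R] by simp
qed

text \<open>A linear functional on \<open>OK\<close> with values modulo \<open>q\<close>,
  represented by an integer-valued function that is meaningful only modulo \<open>q\<close>. This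
  avoids residue rings as separate structures.\<close>

definition addmod :: "int \<Rightarrow> ('a \<Rightarrow> int) \<Rightarrow> bool" where
  "addmod q g \<longleftrightarrow> (\<forall>x\<in>OK. \<forall>y\<in>OK. q dvd g (x + y) - (g x + g y))"

lemma addmodD: "addmod q g \<Longrightarrow> x \<in> OK \<Longrightarrow> y \<in> OK \<Longrightarrow> q dvd g (x + y) - (g x + g y)"
  by (simp add: addmod_def)

lemma addmod_0: "addmod q g \<Longrightarrow> q dvd g 0"
  using addmodD[of q g 0 0] OK_closed(1) by simp

lemma addmod_minus: "addmod q g \<Longrightarrow> x \<in> OK \<Longrightarrow> q dvd g (- x) + g x"
proof -
  assume g: "addmod q g" and x: "x \<in> OK"
  have "q dvd g 0 - (g x + g (- x))" using addmodD[OF g x OK_closed(6)[OF x]] by simp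
  from dvd_diff[OF addmod_0[OF g] this] show ?thesis by (simp add: algebra_simps)
qed

lemma addmod_nat: "addmod q g \<Longrightarrow> x \<in> OK \<Longrightarrow> q dvd g (of_nat k * x) - int k * g x"
proof (induction k)
  case (Suc k)
  have "q dvd g (x + of_nat k * x) - (g x + g (of_nat k * x))"
    using Suc.prems by (intro addmodD) (auto simp: OK_closed)
  then have "q dvd (g (x + of_nat k * x) - (g x + g (of_nat k * x))) + (g (of_nat k * x) - int k * g x)"
    using Suc by (intro dvd_add) auto
  then show ?case by (simp add: algebra_simps)
qed (simp add: addmod_0)

lemma addmod_int: "addmod q g \<Longrightarrow> x \<in> OK \<Longrightarrow> q dvd g (of_int k * x) - k * g x"
proof (cases k rule: int_cases2)
  case (nonneg m)
  assume "addmod q g" "x \<in> OK"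
  then show ?thesis using nonneg addmod_nat[of q g x m] by simp
next
  case (nonpos m)
  assume g: "addmod q g" "x \<in> OK"
  have "q dvd (g (- (of_nat m * x)) + g (of_nat m * x)) - (g (of_nat m * x) - int m * g x)"
    using g by (intro dvd_diff addmod_minus addmod_nat) (auto simp: OK_closed)
  then show ?thesis using nonpos by simp
qed

lemma addmod_diff: "addmod q g \<Longrightarrow> x \<in> OK \<Longrightarrow> y \<in> OK \<Longrightarrow> q dvd g (x - y) - (g x - g y)"
proof -
  assume g: "addmod q g" "x \<in> OK" "y \<in> OK"
  have "q dvd (g (x + - y) - (g x + g (- y))) + (g (- y) + g y)"
    using g by (intro dvd_add addmodD addmod_minus) (auto simp: OK_closed)
  then show ?thesis by (simp add: algebra_simps)
qed

lemma addmod_sum: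
  assumes "addmod q g" "\<And>i. i \<in> I \<Longrightarrow> f i \<in> OK"
  shows "q dvd g (\<Sum>i\<in>I. f i) - (\<Sum>i\<in>I. g (f i))"
  using assms(2)
proof (induction I rule: infinite_finite_induct)
  case (insert i I)
  have "q dvd (g (f i + (\<Sum>i\<in>I. f i)) - (g (f i) + g (\<Sum>i\<in>I. f i))) + (g (\<Sum>i\<in>I. f i) - (\<Sum>i\<in>I. g (f i)))"
    using insert by (intro dvd_add addmodD[OF assms(1)] OK_sum) auto
  then show ?case using insert.hyps by (simp add: algebra_simps)
qed (simp_all add: addmod_0[OF assms(1)])

lemma addmod_lincomb:
  assumes "addmod q g" "\<And>i. i \<in> I \<Longrightarrow> f i \<in> OK"
  shows "q dvd g (\<Sum>i\<in>I. of_int (c i) * f i) - (\<Sum>i\<in>I. c i * g (f i))"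
proof -
  have "q dvd (g (\<Sum>i\<in>I. of_int (c i) * f i) - (\<Sum>i\<in>I. g (of_int (c i) * f i))) +
      (\<Sum>i\<in>I. g (of_int (c i) * f i) - c i * g (f i))"
    using assms by (intro dvd_add addmod_sum[OF assms(1)] dvd_sum addmod_int) (auto simp: OK_closed)
  then show ?thesis by (simp add: sum_subtractf)
qed

text \<open>The trace of an operator written as a sum of rank one operators, each given by a
  functional \<open>g j\<close> and a vector \<open>v j\<close>, is the sum of the
  \<open>g j (v j)\<close>. The \<open>v j\<close> may be dependent, which later allows sums over
  all residues in place of a basis of the residue field.\<close>

lemma trace_mod:
  assumes y: "y \<in> OK" and "finite J"
    and g: "\<And>j. j \<in> J \<Longrightarrow> addmod q (g j)" and v: "\<And>j. j \<in> J \<Longrightarrow> v j \<in> OK"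
    and rel: "\<And>x. x \<in> OK \<Longrightarrow> y * x - (\<Sum>j\<in>J. of_int (g j x) * v j) \<in> pO q"
  shows "q dvd tr y - (\<Sum>j\<in>J. g j (v j))"
proof -
  obtain w where w: "zbasis w" using ex_zbasis by (rule exE)
  have wO: "w i \<in> OK" if "i < n" for i using zbasisD(1)[OF w that] .
  have "\<exists>c::nat \<Rightarrow> int. v j = (\<Sum>l<n. of_int (c l) * w l)" if "j \<in> J" for j
    using zbasisD(2)[OF w v[OF that]] .
  then obtain V where V: "\<And>j. j \<in> J \<Longrightarrow> v j = (\<Sum>l<n. of_int (V j l) * w l)" by metis
  have "\<exists>c::nat \<Rightarrow> int. y * w k - (\<Sum>j\<in>J. of_int (g j (w k)) * v j) = of_int q * (\<Sum>l<n. of_int (c l) * w l)"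
    if k: "k < n" for k
  proof -
    obtain z where z: "z \<in> OK" "y * w k - (\<Sum>j\<in>J. of_int (g j (w k)) * v j) = of_int q * z"
      using pO_E[OF rel[OF wO[OF k]]] .
    show ?thesis using zbasisD(2)[OF w z(1)] z(2) by metis
  qed
  then obtain Z where Z: "\<And>k. k < n \<Longrightarrow>
      y * w k - (\<Sum>j\<in>J. of_int (g j (w k)) * v j) = of_int q * (\<Sum>l<n. of_int (Z k l) * w l)" by metis
  define m where "m k l = (\<Sum>j\<in>J. g j (w k) * V j l) + q * Z k l" for k l
  have "y * w k = (\<Sum>l<n. of_rat (of_int (m k l)) * w l)" if "k < n" for k
  proof -
    have "y * w k = (\<Sum>j\<in>J. of_int (g j (w k)) * v j) + of_int q * (\<Sum>l<n. of_int (Z k l) * w l)"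
      using Z[OF that] by (simp add: algebra_simps)
    also have "(\<Sum>j\<in>J. of_int (g j (w k)) * v j) = (\<Sum>j\<in>J. \<Sum>l<n. of_int (g j (w k) * V j l) * w l)"
      by (rule sum.cong) (auto simp: V sum_distrib_left mult.assoc)
    also have "\<dots> = (\<Sum>l<n. of_int (\<Sum>j\<in>J. g j (w k) * V j l) * w l)"
      by (subst sum.swap) (simp add: sum_distrib_right)
    also have "\<dots> + of_int q * (\<Sum>l<n. of_int (Z k l) * w l) = (\<Sum>l<n. of_int (m k l) * w l)"
      by (simp add: m_def sum_distrib_left distrib_right sum.distrib mult.assoc)
    finally show ?thesis by simp
  qed
  then have "nf_trace K y = (\<Sum>k<n. of_int (m k k))"
    by (rule trace_eq_diag[OF zbasis_qbasis[OF w] OK_K[OF y]])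
  then have "tr y = (\<Sum>k<n. m k k)" by (intro tr_eqI) simp
  also have "\<dots> = (\<Sum>j\<in>J. \<Sum>k<n. V j k * g j (w k)) + q * (\<Sum>k<n. Z k k)"
    unfolding m_def sum.distrib sum_distrib_left by (subst sum.swap) (simp add: mult.commute)
  finally have "tr y - (\<Sum>j\<in>J. g j (v j)) =
      q * (\<Sum>k<n. Z k k) - (\<Sum>j\<in>J. g j (v j) - (\<Sum>k<n. V j k * g j (w k)))"
    by (simp add: sum_subtractf)
  moreover have "q dvd (\<Sum>j\<in>J. g j (v j) - (\<Sum>k<n. V j k * g j (w k)))"
  proof (rule dvd_sum)
    fix j assume j: "j \<in> J"
    show "q dvd g j (v j) - (\<Sum>k<n. V j k * g j (w k))"
      unfolding V[OF j] by (rule addmod_lincomb[OF g[OF j]]) (use wO in auto)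
  qed
  ultimately show ?thesis by simp
qed

text \<open>Pairing with \<open>e k\<close> isolates the coordinate of \<open>y\<close> at
  \<open>f k\<close>, multiplied by \<open>D k\<close>.\<close>

lemma diag_coords:
  assumes e: "zbasis e" and f: "zbasis f"
    and diag: "\<forall>i<n. \<forall>j<n. tr (e i * f j) = (if i = j then D i else 0)"
    and y: "y = (\<Sum>k<n. of_int (c k) * f k)" and m: "\<And>x. x \<in> OK \<Longrightarrow> m dvd tr (x * y)" and k: "k < n"
  shows "m dvd c k * D k"
proof -
  have "e k * y = (\<Sum>j<n. of_int (c j) * (e k * f j))"
    unfolding y by (simp add: sum_distrib_left mult.left_commute)
  then have "tr (e k * y) = (\<Sum>j<n. c j * tr (e k * f j))"
    using zbasisD(1)[OF e] zbasisD(1)[OF f] k by (simp only:) (rule tr_lincomb, auto intro: OK_closed)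
  also have "\<dots> = (\<Sum>j<n. if k = j then c j * D j else 0)" using diag k by (intro sum.cong) auto
  also have "\<dots> = c k * D k" using k by simp
  finally show ?thesis using m[OF zbasisD(1)[OF e k]] by simp
qed

lemma diag_trace_dvd:
  assumes e: "zbasis e" and f: "zbasis f"
    and diag: "\<forall>i<n. \<forall>j<n. tr (e i * f j) = (if i = j then D i else 0)"
    and k: "k < n" and x: "x \<in> OK"
  shows "D k dvd tr (x * f k)"
proof -
  obtain c :: "nat \<Rightarrow> int" where c: "x = (\<Sum>i<n. of_int (c i) * e i)" using zbasisD(2)[OF e x] by (rule exE)
  have "x * f k = (\<Sum>i<n. of_int (c i) * (e i * f k))" unfolding c by (simp add: sum_distrib_right mult.assoc)
  then have "tr (x * f k) = (\<Sum>i<n. c i * tr (e i * f k))"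
    using zbasisD(1)[OF e] zbasisD(1)[OF f] k by (simp only:) (rule tr_lincomb, auto intro: OK_closed)
  also have "\<dots> = (\<Sum>i<n. if i = k then c i * D i else 0)" using diag k by (intro sum.cong) auto
  also have "\<dots> = c k * D k" using k by simp
  finally show ?thesis by simp
qed

lemma prime_power_dvd_mult:
  fixes q :: int
  assumes "Factorial_Ring.prime q" "q ^ v dvd c * D" "\<not> q ^ v dvd D"
  shows "q dvd c"
proof (rule ccontr)
  assume "\<not> q dvd c"
  then have "Rings.coprime (q ^ v) c"
    using assms(1) by (intro coprime_power_left_iff[THEN iffD2] disjI1) (rule prime_imp_coprime)
  then show False using assms(2,3) by (simp add: coprime_dvd_mult_right_iff)
qed

text \<open>Multiplication by \<open>f k\<^sub>0\<close> has rank one modulo \<open>q\<close>, so its trace modulo \<open>q\<close>, which vanishes,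
  is the eigenvalue of \<open>f k\<^sub>0\<close>.\<close>

lemma diag_square:
  assumes q: "Factorial_Ring.prime q" and e: "zbasis e" and f: "zbasis f"
    and diag: "\<forall>i<n. \<forall>j<n. tr (e i * f j) = (if i = j then D i else 0)"
    and k0: "k0 < n" and v: "v \<ge> 1" "q ^ v dvd D k0"
    and others: "\<And>k. k < n \<Longrightarrow> k \<noteq> k0 \<Longrightarrow> \<not> q ^ v dvd D k"
  shows "f k0 * f k0 \<in> pO q"
proof -
  define u where "u = f k0"
  have uO: "u \<in> OK" using zbasisD(1)[OF f k0] by (simp add: u_def)
  have tru: "q ^ v dvd tr (x * u)" if "x \<in> OK" for x
    using diag_trace_dvd[OF e f diag k0 that] v(2) dvd_trans by (auto simp: u_def)
  have "\<exists>a::int. u * x - of_int a * u \<in> pO q" if x: "x \<in> OK" for x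
  proof -
    have yO: "u * x \<in> OK" using uO x by (rule OK_closed(5))
    obtain c :: "nat \<Rightarrow> int" where c: "u * x = (\<Sum>i<n. of_int (c i) * f i)" using zbasisD(2)[OF f yO] by (rule exE)
    have dvd: "q ^ v dvd c k * D k" if "k < n" for k
    proof (rule diag_coords[OF e f diag c _ that])
      fix x' assume "x' \<in> OK"
      then show "q ^ v dvd tr (x' * (u * x))" using tru[of "x' * x"] x by (simp add: OK_closed mult_ac)
    qed
    have "q dvd c k" if "k < n" "k \<noteq> k0" for k
      by (rule prime_power_dvd_mult[OF q dvd[OF that(1)] others[OF that]])
    then have "(\<Sum>i<n. of_int (if i = k0 then 0 else c i) * f i) \<in> pO q"
      using zbasisD(1)[OF f] by (intro pO_sum pO_dvd) auto
    moreover have "(\<Sum>i<n. of_int (if i = k0 then 0 else c i) * f i) = u * x - of_int (c k0) * u"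
      unfolding c by (subst sum_update[OF k0, of _ "\<lambda>i. of_int (c i) * f i"]) (auto simp: u_def)
    ultimately show ?thesis by auto
  qed
  then obtain g :: "'a \<Rightarrow> int" where g: "\<And>x. x \<in> OK \<Longrightarrow> u * x - of_int (g x) * u \<in> pO q" by metis
  have add: "addmod q g"
    unfolding addmod_def
  proof (intro ballI)
    fix x y assume xy: "x \<in> OK" "y \<in> OK"
    have "(u * x - of_int (g x) * u) + (u * y - of_int (g y) * u) - (u * (x + y) - of_int (g (x + y)) * u) \<in> pO q"
      using xy by (intro pO_add pO_diff g OK_closed)
    also have "(u * x - of_int (g x) * u) + (u * y - of_int (g y) * u) - (u * (x + y) - of_int (g (x + y)) * u) =
        of_int (g (x + y) - (g x + g y)) * f k0"
      by (simp add: u_def algebra_simps)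
    finally show "q dvd g (x + y) - (g x + g y)" by (rule pO_basis_element[OF f _ k0])
  qed
  have t1: "q dvd tr u - (\<Sum>j\<in>{()}. g u)"
    by (rule trace_mod[of u "{()}" q "\<lambda>_. g" "\<lambda>_. u"]) (use uO add g in auto)
  \<comment> \<open>The trace of \<open>u\<close> is its pairing with 1, hence divisible by
    \<open>D k0\<close> up to its \<open>q\<close>-part.\<close>
  have t2: "q dvd tr u"
  proof (rule dvd_trans)
    show "q dvd q ^ v" using v(1) by (simp add: dvd_power)
    show "q ^ v dvd tr u" using tru[OF OK_closed(2)] by simp
  qed
  from dvd_diff[OF t2 t1] have "q dvd g u" by simp
  then have "of_int (g u) * u \<in> pO q" using uO by (rule pO_dvd)
  then have "(u * u - of_int (g u) * u) + of_int (g u) * u \<in> pO q" using g[OF uO] by (intro pO_add)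
  then show ?thesis by (simp add: u_def)
qed

text \<open>Write \<open>u = f k0\<close> and \<open>u^2 = 2 x\<close>. Every trace of a multiple of
  \<open>u^2\<close> is divisible by 8, so those of multiples of \<open>x\<close> are divisible by
  4; the other elementary divisors being odd, \<open>x\<close> is an integer multiple of
  \<open>u\<close> modulo 4. Then \<open>u / 2\<close> satisfies a monic quadratic equation and is
  integral, which is impossible for a member of an integral basis.\<close>

lemma diag_not_eight:
  assumes e: "zbasis e" and f: "zbasis f"
    and diag: "\<forall>i<n. \<forall>j<n. tr (e i * f j) = (if i = j then D i else 0)"
    and k0: "k0 < n" and v: "8 dvd D k0" and others: "\<And>k. k < n \<Longrightarrow> k \<noteq> k0 \<Longrightarrow> odd (D k)"
  shows False
proof -
  define u where "u = f k0"
  have uO: "u \<in> OK" using zbasisD(1)[OF f k0] by (simp add: u_def)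
  have "f k0 * f k0 \<in> pO 2"
  proof (rule diag_square[OF _ e f diag k0, where v = 3])
    show "\<not> 2 ^ 3 dvd D k" if "k < n" "k \<noteq> k0" for k
      using others[OF that] dvd_trans[of 2 "2 ^ 3" "D k"] by auto
  qed (use v in auto)
  then obtain x where x: "x \<in> OK" "u * u = 2 * x" by (auto simp: u_def elim: pO_E)
  obtain c :: "nat \<Rightarrow> int" where c: "x = (\<Sum>i<n. of_int (c i) * f i)" using zbasisD(2)[OF f x(1)] by (rule exE)
  have dvd: "4 dvd c k * D k" if "k < n" for k
  proof (rule diag_coords[OF e f diag c _ that])
    fix y assume y: "y \<in> OK"
    have "8 dvd tr ((y * u) * u)"
      using diag_trace_dvd[OF e f diag k0, of "y * u"] y uO v dvd_trans by (auto simp: u_def OK_closed)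
    moreover have "(y * u) * u = of_int 2 * (y * x)" using x(2) by (simp add: mult_ac)
    ultimately have "2 * 4 dvd 2 * tr (y * x)" using tr_scale[of "y * x" 2] y x(1) by (simp add: OK_closed)
    then show "4 dvd tr (y * x)" by (subst (asm) dvd_mult_cancel_left) simp
  qed
  have "4 dvd c k" if "k < n" "k \<noteq> k0" for k
  proof -
    have "2 ^ 2 dvd c k * D k" using dvd[OF that(1)] by simp
    moreover have "Rings.coprime (2 ^ 2) (D k)"
      by (intro coprime_power_left_iff[THEN iffD2] disjI1) (use others[OF that] in simp)
    ultimately have "2 ^ 2 dvd c k" by (simp only: coprime_dvd_mult_left_iff)
    then show ?thesis by simp
  qed
  then have "(\<Sum>i<n. of_int (if i = k0 then 0 else c i) * f i) \<in> pO 4"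
    using zbasisD(1)[OF f] by (intro pO_sum pO_dvd) auto
  moreover have "(\<Sum>i<n. of_int (if i = k0 then 0 else c i) * f i) = x - of_int (c k0) * u"
    unfolding c by (subst sum_update[OF k0, of _ "\<lambda>i. of_int (c i) * f i"]) (auto simp: u_def)
  ultimately have "x - of_int (c k0) * u \<in> pO 4" by simp
  then obtain z where z: "z \<in> OK" "x - of_int (c k0) * u = of_int 4 * z" using pO_E by metis
  have "(u / 2)\<^sup>2 = of_int (c k0) * (u / 2) + 2 * z"
  proof -
    have "u * u = 2 * (of_int (c k0) * u + 4 * z)" using x(2) z(2) by (simp add: algebra_simps)
    then show ?thesis by (simp add: power2_eq_square field_simps)
  qed
  moreover have "algebraic_int (2 * z)" using OK_closed(5)[OF OK_closed(7)[of 2] z(1)] by (simp add: OK_iff)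
  ultimately have "algebraic_int (u / 2)" by (rule algebraic_int_if_quadratic)
  moreover have "u / 2 \<in> K" using OK_K[OF uO] subfield_set_of_int[OF K, of 2] by (intro K_closed(8)) auto
  ultimately have "u / 2 \<in> OK" by (simp add: OK_iff)
  then have "of_int 1 * f k0 \<in> pO 2" using pO_I[of "u / 2" 2] by (simp add: u_def)
  then have "2 dvd (1::int)" by (rule pO_basis_element[OF f _ k0])
  then show False by simp
qed

end

section \<open>Tame primes\<close>

text \<open>The prime ideal is described by its closure properties in the type; the residue field
  appears only through congruences modulo \<open>P\<close>.\<close>

locale prime_above = emb_field K n \<sigma> for K :: "'a::field_char_0 set" and n \<sigma> +
  fixes p :: nat and P :: "'a set"
  assumes p: "Factorial_Ring.prime p" and P_OK: "P \<subseteq> ring_of_integers K"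
    and P_add: "x \<in> P \<Longrightarrow> y \<in> P \<Longrightarrow> x + y \<in> P"
    and P_mult: "x \<in> P \<Longrightarrow> y \<in> ring_of_integers K \<Longrightarrow> x * y \<in> P"
    and p_P: "of_nat p \<in> P" and one_notin_P: "1 \<notin> P"
    and P_prime: "x \<in> ring_of_integers K \<Longrightarrow> y \<in> ring_of_integers K \<Longrightarrow> x * y \<in> P \<Longrightarrow> x \<in> P \<or> y \<in> P"
begin

lemma P_OK': "x \<in> P \<Longrightarrow> x \<in> OK"
  using P_OK by blast

lemma P_mult': "x \<in> OK \<Longrightarrow> y \<in> P \<Longrightarrow> x * y \<in> P"
  using P_mult by (metis mult.commute)

lemma P_0: "0 \<in> P"
  using P_mult[OF p_P OK_closed(1)] by simp

lemma P_minus: "x \<in> P \<Longrightarrow> - x \<in> P"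
  using P_mult[of x "- 1"] OK_closed(6)[OF OK_closed(2)] by simp

lemma P_diff: "x \<in> P \<Longrightarrow> y \<in> P \<Longrightarrow> x - y \<in> P"
  using P_add[of x "- y"] P_minus[of y] by simp

lemma P_sum: "(\<And>i. i \<in> I \<Longrightarrow> f i \<in> P) \<Longrightarrow> (\<Sum>i\<in>I. f i) \<in> P"
  by (induction I rule: infinite_finite_induct) (auto intro: P_add P_0)

lemma pO_P: "x \<in> pO (int p) \<Longrightarrow> x \<in> P"
  using P_mult[OF p_P] by (auto elim!: pO_E)

lemma P_int: "of_int k \<in> P \<longleftrightarrow> int p dvd k"
proof
  assume "int p dvd k"
  then show "of_int k \<in> P" using pO_P[OF pO_dvd[OF _ OK_closed(2)], of k] by simp
next
  assume k: "of_int k \<in> P"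
  show "int p dvd k"
  proof (rule ccontr)
    assume "\<not> int p dvd k"
    then have "Rings.coprime (int p) k" using p by (intro prime_imp_coprime) auto
    then obtain u v where uv: "u * int p + v * k = 1" using bezout_int[of "int p" k] by auto
    have "of_int u * of_nat p + of_int v * of_int k \<in> P"
      by (intro P_add P_mult' OK_closed p_P k)
    also have "of_int u * of_nat p + of_int v * of_int k = (of_int (u * int p + v * k) :: 'a)" by simp
    finally show False using uv one_notin_P by simp
  qed
qed

section \<open>Congruences modulo P and the Frobenius map of the residue field\<close>

lemma cg_sym: "x - y \<in> P \<Longrightarrow> y - x \<in> P"
  using P_minus[of "x - y"] by simp

lemma cg_trans: "x - y \<in> P \<Longrightarrow> y - z \<in> P \<Longrightarrow> x - z \<in> P"
  using P_add[of "x - y" "y - z"] by simp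

lemma cg_mult:
  assumes "a - b \<in> P" "c - d \<in> P" "b \<in> OK" "c \<in> OK"
  shows "a * c - b * d \<in> P"
proof -
  have "(a - b) * c + b * (c - d) \<in> P" using assms by (intro P_add P_mult P_mult')
  then show ?thesis by (simp add: algebra_simps)
qed

lemma cg_power: "a - b \<in> P \<Longrightarrow> a \<in> OK \<Longrightarrow> b \<in> OK \<Longrightarrow> a ^ k - b ^ k \<in> P"
  by (induction k) (auto simp: P_0 intro!: cg_mult OK_closed)

lemma cg_sum: "(\<And>i. i \<in> I \<Longrightarrow> f i - g i \<in> P) \<Longrightarrow> (\<Sum>i\<in>I. f i) - (\<Sum>i\<in>I. g i) \<in> P"
  unfolding sum_subtractf[symmetric] by (rule P_sum)

lemma cg_P: "x - y \<in> P \<Longrightarrow> y \<in> P \<Longrightarrow> x \<in> P"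
  using P_add[of "x - y" y] by simp

lemma P_prime_power: "x \<in> OK \<Longrightarrow> x ^ k \<in> P \<Longrightarrow> x \<in> P"
  by (induction k) (use one_notin_P P_prime[of x] OK_closed(9) in auto)

lemma P_power: "x \<in> P \<Longrightarrow> k > 0 \<Longrightarrow> x ^ k \<in> P"
  by (cases k) (auto intro: P_mult OK_closed P_OK')

text \<open>Pigeonhole on powers. It yields the inverses modulo \<open>P\<close> and, later, a bound
  on the powers of \<open>P\<close> that contain \<open>p\<close>.\<close>

lemma power_repeat:
  assumes "finite R" "\<forall>x\<in>OK. \<exists>r\<in>R. x - r \<in> pO q" and x: "x \<in> OK"
  shows "\<exists>i j. i < j \<and> j \<le> card R \<and> x ^ i - x ^ j \<in> pO q"
proof -
  have "\<forall>i. \<exists>r\<in>R. x ^ i - r \<in> pO q" using assms(2) OK_closed(9)[OF x] by blast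
  then obtain r where r: "\<And>i. r i \<in> R" "\<And>i. x ^ i - r i \<in> pO q" by metis
  have "card (r ` {..card R}) \<le> card R" using r(1) assms(1) by (intro card_mono) auto
  then have "\<not> inj_on r {..card R}" by (intro pigeonhole) auto
  then obtain i j where ij: "i \<le> card R" "j \<le> card R" "i \<noteq> j" "r i = r j" by (auto simp: inj_on_def)
  have *: "x ^ i - x ^ j \<in> pO q" if "r i = r j" for i j
    using pO_diff[OF r(2)[of i] r(2)[of j]] that by simp
  show ?thesis
  proof (cases "i < j")
    case True
    then show ?thesis using ij *[of i j] by (intro exI[of _ i] exI[of _ j]) auto
  next
    case False
    then show ?thesis using ij *[of j i] by (intro exI[of _ j] exI[of _ i]) auto
  qed
qed

lemma p_pos: "int p > 0"
  using prime_gt_0_nat[OF p] by simp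

text \<open>A finite domain is a field: from \<open>x ^ i\<close> congruent to \<open>x ^ j\<close>
  with \<open>i < j\<close>, cancelling \<open>x ^ i\<close> leaves a positive power of
  \<open>x\<close> congruent to 1.\<close>

lemma ex_inverse:
  assumes x: "x \<in> OK" "x \<notin> P"
  shows "\<exists>y\<in>OK. x * y - 1 \<in> P"
proof -
  obtain R where R: "finite R" "R \<subseteq> OK" "\<forall>x\<in>OK. \<exists>r\<in>R. x - r \<in> pO (int p)"
    using finite_residues[OF p_pos] .
  obtain i j where ij: "i < j" "x ^ i - x ^ j \<in> pO (int p)"
    using power_repeat[OF R(1,3) x(1)] by blast
  have j: "j = i + Suc (j - i - 1)" using ij(1) by simp
  have "x ^ j = x ^ i * (x * x ^ (j - i - 1))" by (subst j) (simp add: power_add)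
  then have "x ^ i * (1 - x * x ^ (j - i - 1)) \<in> P" using pO_P[OF ij(2)] by (simp add: algebra_simps)
  then have "x ^ i \<in> P \<or> 1 - x * x ^ (j - i - 1) \<in> P" using x(1) by (intro P_prime OK_closed)
  then have "1 - x * x ^ (j - i - 1) \<in> P" using P_prime_power x by blast
  then have "x * x ^ (j - i - 1) - 1 \<in> P" by (rule cg_sym)
  then show ?thesis using OK_closed(9)[OF x(1)] by blast
qed

lemma frob_add:
  assumes x: "x \<in> OK" and y: "y \<in> OK"
  shows "(x + y) ^ p - (x ^ p + y ^ p) \<in> P"
proof -
  have p2: "p \<ge> 2" using p by (rule prime_ge_2_nat)
  define t where "t k = of_nat (p choose k) * x ^ k * y ^ (p - k)" for k
  have "(x + y) ^ p = (\<Sum>k\<le>p. t k)" unfolding t_def by (rule binomial_ring)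
  also have "{..p} = insert 0 (insert p {1..<p})" using p2 by auto
  also have "(\<Sum>k\<in>insert 0 (insert p {1..<p}). t k) = t 0 + (t p + (\<Sum>k\<in>{1..<p}. t k))"
    using p2 by (subst sum.insert) auto
  finally have "(x + y) ^ p - (x ^ p + y ^ p) = (\<Sum>k\<in>{1..<p}. t k)" by (simp add: t_def)
  also have "\<dots> \<in> P"
  proof (rule P_sum)
    fix k assume k: "k \<in> {1..<p}"
    then have "p dvd p choose k" using p by (intro dvd_choose_prime) auto
    then have "of_int (int (p choose k)) * (x ^ k * y ^ (p - k)) \<in> pO (int p)"
      using x y by (intro pO_dvd OK_closed) (simp add: int_dvd_int_iff)
    then show "t k \<in> P" using pO_P by (simp add: t_def mult.assoc)
  qed
  finally show ?thesis .
qed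

lemma frob_add_pow:
  assumes x: "x \<in> OK" and y: "y \<in> OK"
  shows "(x + y) ^ (p ^ j) - (x ^ (p ^ j) + y ^ (p ^ j)) \<in> P"
proof (induction j)
  case (Suc j)
  have "((x + y) ^ (p ^ j)) ^ p - (x ^ (p ^ j) + y ^ (p ^ j)) ^ p \<in> P"
    using Suc x y by (intro cg_power OK_closed)
  moreover have "(x ^ (p ^ j) + y ^ (p ^ j)) ^ p - ((x ^ (p ^ j)) ^ p + (y ^ (p ^ j)) ^ p) \<in> P"
    using x y by (intro frob_add OK_closed)
  ultimately have "((x + y) ^ (p ^ j)) ^ p - ((x ^ (p ^ j)) ^ p + (y ^ (p ^ j)) ^ p) \<in> P" by (rule cg_trans)
  then show ?case by (simp flip: power_mult add: mult.commute)
qed (simp add: P_0)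

lemma frob_sum:
  assumes "\<And>i. i \<in> I \<Longrightarrow> f i \<in> OK"
  shows "(\<Sum>i\<in>I. f i) ^ p - (\<Sum>i\<in>I. f i ^ p) \<in> P"
  using assms
proof (induction I rule: infinite_finite_induct)
  case (insert i I)
  have "(f i + (\<Sum>i\<in>I. f i)) ^ p - (f i ^ p + (\<Sum>i\<in>I. f i) ^ p) \<in> P"
    using insert by (intro frob_add OK_sum) auto
  moreover have "(\<Sum>i\<in>I. f i) ^ p - (\<Sum>i\<in>I. f i ^ p) \<in> P" using insert by auto
  ultimately have "((f i + (\<Sum>i\<in>I. f i)) ^ p - (f i ^ p + (\<Sum>i\<in>I. f i) ^ p)) +
      ((\<Sum>i\<in>I. f i) ^ p - (\<Sum>i\<in>I. f i ^ p)) \<in> P" by (rule P_add)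
  then show ?case using insert.hyps by (simp add: algebra_simps)
qed (use prime_gt_0_nat[OF p] P_0 in \<open>simp_all add: zero_power\<close>)

text \<open>The predicate under \<open>SOME\<close> depends only on the class of \<open>x\<close>
  modulo \<open>P\<close>, so one representative per class is selected.\<close>

definition rep :: "'a \<Rightarrow> 'a" where
  "rep x = (SOME r. r \<in> OK \<and> x - r \<in> P)"

lemma rep: "x \<in> OK \<Longrightarrow> rep x \<in> OK" "x \<in> OK \<Longrightarrow> x - rep x \<in> P"
proof -
  assume "x \<in> OK"
  then have "x \<in> OK \<and> x - x \<in> P" using P_0 by simp
  then have "rep x \<in> OK \<and> x - rep x \<in> P" unfolding rep_def by (rule someI)
  then show "rep x \<in> OK" "x - rep x \<in> P" by auto
qed

lemma rep_eqI: "x - y \<in> P \<Longrightarrow> rep x = rep y"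
proof -
  assume xy: "x - y \<in> P"
  have "x - r \<in> P \<longleftrightarrow> y - r \<in> P" for r using cg_trans[OF cg_sym[OF xy]] cg_trans[OF xy] by blast
  then show ?thesis by (simp add: rep_def)
qed

lemma rep_eqD: "x \<in> OK \<Longrightarrow> y \<in> OK \<Longrightarrow> rep x = rep y \<Longrightarrow> x - y \<in> P"
  using cg_trans[of x "rep x" y] rep(2)[of x] cg_sym[OF rep(2)[of y]] by simp

lemma rep_rep: "x \<in> rep ` OK \<Longrightarrow> rep x = x"
  using rep_eqI rep(2) by (metis cg_sym imageE)

lemma finite_rep: "finite (rep ` OK)"
proof -
  obtain R where R: "finite R" "R \<subseteq> OK" "\<forall>x\<in>OK. \<exists>r\<in>R. x - r \<in> pO (int p)"
    using finite_residues[OF p_pos] .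
  have "rep ` OK \<subseteq> rep ` R"
  proof
    fix y assume "y \<in> rep ` OK"
    then obtain x where x: "x \<in> OK" "y = rep x" by auto
    then obtain r where r: "r \<in> R" "x - r \<in> pO (int p)" using R(3) by blast
    have "rep x = rep r" by (rule rep_eqI[OF pO_P[OF r(2)]])
    then show "y \<in> rep ` R" using x r(1) by blast
  qed
  then show ?thesis using R(1) by (rule finite_subset[OF _ finite_imageI])
qed

text \<open>Two powers of Frobenius coincide on the finite residue field. As Frobenius is additive
  and injective modulo \<open>P\<close>, the smaller power cancels and a positive power is the
  identity.\<close>

lemma ex_frobenius_order: "\<exists>f. f \<ge> 1 \<and> (\<forall>x\<in>OK. x ^ (p ^ f) - x \<in> P)"
proof -
  define F where "F i = restrict (\<lambda>r. rep (r ^ (p ^ i))) (rep ` OK)" for i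
  have "range F \<subseteq> PiE (rep ` OK) (\<lambda>_. rep ` OK)"
    using rep(1) by (auto simp: F_def intro!: imageI OK_closed)
  then have "finite (range F)" using finite_PiE[OF finite_rep finite_rep] by (rule finite_subset)
  then have "\<not> inj F" using finite_imageD infinite_UNIV_nat by blast
  then obtain i j where ij: "F i = F j" "i < j" unfolding inj_on_def by (metis nat_neq_iff)
  define m where "m = j - i"
  have "x ^ (p ^ m) - x \<in> P" if x: "x \<in> OK" for x
  proof -
    define r where "r = rep x"
    have r: "r \<in> OK" "x - r \<in> P" using rep[OF x] by (auto simp: r_def)
    have "F i r = F j r" using ij(1) by simp
    then have "rep (r ^ (p ^ i)) = rep (r ^ (p ^ j))" using x by (simp add: F_def r_def)
    then have "r ^ (p ^ i) - r ^ (p ^ j) \<in> P" using r(1) by (intro rep_eqD OK_closed)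
    moreover have "x ^ (p ^ i) - r ^ (p ^ i) \<in> P" "r ^ (p ^ j) - x ^ (p ^ j) \<in> P"
      using r x by (auto intro!: cg_power cg_sym[OF r(2)])
    ultimately have "x ^ (p ^ i) - x ^ (p ^ j) \<in> P" using cg_trans by blast
    then have 1: "x ^ (p ^ j) - x ^ (p ^ i) \<in> P" by (rule cg_sym)
    have "p ^ j = p ^ m * p ^ i" using ij(2) by (simp add: m_def flip: power_add)
    then have e: "x ^ (p ^ j) = (x ^ (p ^ m)) ^ (p ^ i)" by (simp add: power_mult)
    have "((x ^ (p ^ m) - x) + x) ^ (p ^ i) - ((x ^ (p ^ m) - x) ^ (p ^ i) + x ^ (p ^ i)) \<in> P"
      using x by (intro frob_add_pow OK_closed)
    then have "x ^ (p ^ j) - ((x ^ (p ^ m) - x) ^ (p ^ i) + x ^ (p ^ i)) \<in> P" by (simp add: e)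
    from P_diff[OF 1 this] have "(x ^ (p ^ m) - x) ^ (p ^ i) \<in> P" by (simp add: algebra_simps)
    then show ?thesis using x by (intro P_prime_power[of "x ^ (p ^ m) - x"] OK_closed)
  qed
  then show ?thesis using ij(2) by (intro exI[of _ m]) (auto simp: m_def)
qed

text \<open>The order of Frobenius on the residue field, that is, the degree of the residue field
  over the prime field.\<close>

definition f_deg :: nat where
  "f_deg = (LEAST f. f \<ge> 1 \<and> (\<forall>x\<in>OK. x ^ (p ^ f) - x \<in> P))"

lemma f_deg: "f_deg \<ge> 1" "x \<in> OK \<Longrightarrow> x ^ (p ^ f_deg) - x \<in> P"
  using LeastI_ex[OF ex_frobenius_order] unfolding f_deg_def by auto

lemma f_deg_least:
  assumes "0 < j" "j < f_deg"
  shows "\<exists>x\<in>OK. x ^ (p ^ j) - x \<notin> P"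
  using not_less_Least[of j "\<lambda>f. f \<ge> 1 \<and> (\<forall>x\<in>OK. x ^ (p ^ f) - x \<in> P)"] assms
  unfolding f_deg_def by auto

section \<open>Character sums and the trace of the residue field\<close>

definition C :: "'a set" where "C = rep ` OK - P"

definition inv_mod :: "'a \<Rightarrow> 'a" where
  "inv_mod x = (SOME y. y \<in> OK \<and> x * y - 1 \<in> P)"

lemma C: "c \<in> C \<Longrightarrow> c \<in> OK" "c \<in> C \<Longrightarrow> c \<notin> P" "c \<in> C \<Longrightarrow> rep c = c" "finite C"
proof -
  show "c \<in> C \<Longrightarrow> c \<in> OK" using rep(1) by (auto simp: C_def)
  show "c \<in> C \<Longrightarrow> c \<notin> P" by (simp add: C_def)
  show "c \<in> C \<Longrightarrow> rep c = c" by (rule rep_rep) (simp add: C_def)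
  show "finite C" unfolding C_def by (rule finite_Diff[OF finite_rep])
qed

lemma rep_C: "x \<in> OK \<Longrightarrow> x \<notin> P \<Longrightarrow> rep x \<in> C"
  unfolding C_def using cg_P[OF rep(2)] by blast

lemma inv_mod: "x \<in> OK \<Longrightarrow> x \<notin> P \<Longrightarrow> inv_mod x \<in> OK" "x \<in> OK \<Longrightarrow> x \<notin> P \<Longrightarrow> x * inv_mod x - 1 \<in> P"
proof -
  assume "x \<in> OK" "x \<notin> P"
  then have "\<exists>y. y \<in> OK \<and> x * y - 1 \<in> P" using ex_inverse by blast
  then have "inv_mod x \<in> OK \<and> x * inv_mod x - 1 \<in> P" unfolding inv_mod_def by (rule someI_ex)
  then show "inv_mod x \<in> OK" "x * inv_mod x - 1 \<in> P" by auto
qed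

lemma inv_mod_unique:
  assumes "x * a - 1 \<in> P" "x * b - 1 \<in> P" "a \<in> OK" "b \<in> OK"
  shows "a - b \<in> P"
  using P_diff[OF P_mult'[OF assms(4,1)] P_mult'[OF assms(3,2)]] by (simp add: algebra_simps)

text \<open>Adding 1 permutes the residues, so summing over all of them shows that their number lies
  in \<open>P\<close>. Removing the class of 0 leaves \<open>C\<close>, whose size is therefore -1
  modulo \<open>p\<close>.\<close>

lemma card_C: "int p dvd int (card C) + 1"
proof -
  let ?D = "rep ` OK"
  have D: "r \<in> OK" if "r \<in> ?D" for r using rep(1) that by auto
  have D1: "r + 1 \<in> OK" if "r \<in> ?D" for r using D[OF that] by (intro OK_closed)
  have inj: "inj_on (\<lambda>r. rep (r + 1)) ?D"
  proof (rule inj_onI)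
    fix r s assume rs: "r \<in> ?D" "s \<in> ?D" "rep (r + 1) = rep (s + 1)"
    then have "r - s \<in> P" using rep_eqD[OF D1 D1, of r s] by simp
    then show "r = s" using rep_eqI[of r s] rep_rep[OF rs(1)] rep_rep[OF rs(2)] by simp
  qed
  have "(\<lambda>r. rep (r + 1)) ` ?D = ?D"
    by (rule endo_inj_surj[OF finite_rep _ inj]) (use D1 in blast)
  then have "(\<Sum>r\<in>?D. r) = (\<Sum>r\<in>?D. rep (r + 1))"
    using sum.reindex[OF inj, of "\<lambda>r. r"] by (simp add: o_def)
  moreover have "(\<Sum>r\<in>?D. r + 1) - (\<Sum>r\<in>?D. rep (r + 1)) \<in> P"
    by (rule cg_sum) (rule rep(2)[OF D1])
  moreover have "(\<Sum>r\<in>?D. r + 1) = (\<Sum>r\<in>?D. r) + of_nat (card ?D)" by (simp add: sum.distrib)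
  ultimately have "of_nat (card ?D) \<in> P" by simp
  then have "of_int (int (card ?D)) \<in> P" by simp
  then have dvd: "int p dvd int (card ?D)" by (subst (asm) P_int)
  have "rep 0 \<in> P" using rep(2)[OF OK_closed(1)] P_minus[of "0 - rep 0"] by simp
  have "?D = insert (rep 0) C"
  proof
    show "?D \<subseteq> insert (rep 0) C"
    proof
      fix r assume r: "r \<in> ?D"
      show "r \<in> insert (rep 0) C"
      proof (cases "r \<in> P")
        case True
        then show ?thesis using rep_eqI[of r 0] rep_rep[OF r] by simp
      qed (use r in \<open>auto simp: C_def\<close>)
    qed
    show "insert (rep 0) C \<subseteq> ?D" using OK_closed(1) by (auto simp: C_def)
  qed
  moreover have "rep 0 \<notin> C" using \<open>rep 0 \<in> P\<close> by (simp add: C_def)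
  ultimately have "card ?D = card C + 1" using C(4) by simp
  then show ?thesis using dvd by (simp add: add.commute)
qed

text \<open>The sum of the character \<open>c ^ (1 - p^j)\<close> over the nonzero residues.\<close>

definition S_sum :: "nat \<Rightarrow> 'a" where
  "S_sum j = (\<Sum>c\<in>C. c * inv_mod c ^ (p ^ j))"

lemma S_sum_OK: "S_sum j \<in> OK"
  unfolding S_sum_def by (intro OK_sum OK_closed C inv_mod)

lemma S_sum_0: "S_sum 0 - of_nat (card C) \<in> P"
proof -
  have "(\<Sum>c\<in>C. c * inv_mod c) - (\<Sum>c\<in>C. 1) \<in> P"
    by (rule cg_sum) (intro inv_mod C)
  then show ?thesis by (simp add: S_sum_def)
qed

text \<open>For \<open>0 < j < f_deg\<close> the character is nontrivial, by minimality of
  \<open>f_deg\<close>. Replacing \<open>c\<close> by \<open>c * d\<close> permutes the residues and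
  multiplies the sum by the value at \<open>d\<close>, which is not 1 modulo
  \<open>P\<close>.\<close>

lemma S_sum_pos:
  assumes j: "0 < j" "j < f_deg"
  shows "S_sum j \<in> P"
proof -
  obtain x0 where x0: "x0 \<in> OK" "x0 ^ (p ^ j) - x0 \<notin> P" using f_deg_least[OF j] by blast
  have pj: "p ^ j > 0" using prime_gt_0_nat[OF p] by simp
  have x0P: "x0 \<notin> P" using x0(2) P_diff P_power[OF _ pj] by blast
  define d where "d = rep x0"
  have d: "d \<in> C" unfolding d_def by (rule rep_C[OF x0(1) x0P])
  note dO = C(1)[OF d] and dP = C(2)[OF d]
  have dj: "d ^ (p ^ j) - d \<notin> P"
  proof
    assume *: "d ^ (p ^ j) - d \<in> P"
    have x0d: "x0 - d \<in> P" unfolding d_def using rep(2)[OF x0(1)] .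
    have "x0 ^ (p ^ j) - d ^ (p ^ j) \<in> P" using x0d x0(1) dO by (rule cg_power)
    then have "x0 ^ (p ^ j) - x0 \<in> P" using * cg_sym[OF x0d] cg_trans by blast
    then show False using x0(2) by simp
  qed
  define h where "h c = c * inv_mod c ^ (p ^ j)" for c
  have cd: "c * d \<in> OK" "c * d \<notin> P" if "c \<in> C" for c
    using C(1,2)[OF that] dO dP P_prime OK_closed(5) by blast+
  have inj: "inj_on (\<lambda>c. rep (c * d)) C"
  proof (rule inj_onI)
    fix a b assume ab: "a \<in> C" "b \<in> C" "rep (a * d) = rep (b * d)"
    then have "a * d - b * d \<in> P" using rep_eqD cd by blast
    then have "(a - b) * d \<in> P" by (simp add: algebra_simps)
    then have "a - b \<in> P" using P_prime[of "a - b" d] dO dP C(1) ab OK_closed(4) by blast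
    then show "a = b" using rep_eqI[of a b] C(3)[OF ab(1)] C(3)[OF ab(2)] by simp
  qed
  have "(\<lambda>c. rep (c * d)) ` C = C"
    by (rule endo_inj_surj[OF C(4) _ inj]) (use cd rep_C in blast)
  then have "S_sum j = (\<Sum>c\<in>C. h (rep (c * d)))"
    using sum.reindex[OF inj, of h] by (simp add: S_sum_def h_def o_def)
  also have "(\<Sum>c\<in>C. h (rep (c * d))) - (\<Sum>c\<in>C. h c * (d * inv_mod d ^ (p ^ j))) \<in> P"
  proof (rule cg_sum)
    fix c assume c: "c \<in> C"
    define r where "r = rep (c * d)"
    have r: "r \<in> OK" "r \<notin> P" "c * d - r \<in> P"
      using C(1,2)[OF rep_C[OF cd[OF c]]] rep(2)[OF cd(1)[OF c]] by (auto simp: r_def)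
    have I: "inv_mod c \<in> OK" "inv_mod d \<in> OK" "inv_mod r \<in> OK"
      using inv_mod(1) C c d r by auto
    have "(c * inv_mod c) * (d * inv_mod d) - 1 * 1 \<in> P"
      using inv_mod(2) C c d I by (intro cg_mult OK_closed) auto
    moreover have "(r - c * d) * (inv_mod c * inv_mod d) \<in> P"
      using cg_sym[OF r(3)] I by (intro P_mult OK_closed)
    ultimately have "(r - c * d) * (inv_mod c * inv_mod d) + ((c * inv_mod c) * (d * inv_mod d) - 1 * 1) \<in> P"
      by (intro P_add)
    then have "r * (inv_mod c * inv_mod d) - 1 \<in> P" by (simp add: algebra_simps)
    then have "inv_mod r - inv_mod c * inv_mod d \<in> P"
      by (rule inv_mod_unique[OF inv_mod(2)[OF r(1,2)] _ I(3) OK_closed(5)[OF I(1,2)]])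
    then have "inv_mod r ^ (p ^ j) - (inv_mod c * inv_mod d) ^ (p ^ j) \<in> P"
      using I by (intro cg_power OK_closed)
    from cg_mult[OF cg_sym[OF r(3)] this cd(1)[OF c] OK_closed(9)[OF I(3)]]
    have "r * inv_mod r ^ (p ^ j) - (c * d) * (inv_mod c * inv_mod d) ^ (p ^ j) \<in> P" .
    then show "h (rep (c * d)) - h c * (d * inv_mod d ^ (p ^ j)) \<in> P"
      by (simp add: h_def r_def power_mult_distrib mult_ac)
  qed
  finally have "S_sum j - S_sum j * (d * inv_mod d ^ (p ^ j)) \<in> P"
    by (simp add: S_sum_def h_def sum_distrib_right)
  then have "S_sum j * (1 - d * inv_mod d ^ (p ^ j)) \<in> P" by (simp add: algebra_simps)
  then have "S_sum j \<in> P \<or> 1 - d * inv_mod d ^ (p ^ j) \<in> P"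
    by (intro P_prime OK_closed S_sum_OK inv_mod dO dP)
  moreover have "1 - d * inv_mod d ^ (p ^ j) \<notin> P"
  proof
    assume "1 - d * inv_mod d ^ (p ^ j) \<in> P"
    then have 1: "(1 - d * inv_mod d ^ (p ^ j)) * d ^ (p ^ j) \<in> P" using dO by (intro P_mult OK_closed)
    have "(d * inv_mod d) ^ (p ^ j) - 1 ^ (p ^ j) \<in> P"
      using dO dP by (intro cg_power inv_mod OK_closed)
    then have 2: "d * ((d * inv_mod d) ^ (p ^ j) - 1) \<in> P" using dO by (intro P_mult') simp_all
    from P_add[OF 1 2] have "d ^ (p ^ j) - d \<in> P" by (simp add: algebra_simps power_mult_distrib)
    then show False using dj by simp
  qed
  ultimately show ?thesis by blast
qed

text \<open>A lift of the trace from the residue field to the prime field, as the sum of the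
  Frobenius conjugates.\<close>

definition TF :: "'a \<Rightarrow> 'a" where
  "TF x = (\<Sum>j<f_deg. x ^ (p ^ j))"

lemma TF_OK: "x \<in> OK \<Longrightarrow> TF x \<in> OK"
  unfolding TF_def by (intro OK_sum OK_closed)

lemma TF_add: "x \<in> OK \<Longrightarrow> y \<in> OK \<Longrightarrow> TF (x + y) - (TF x + TF y) \<in> P"
  unfolding TF_def sum.distrib[symmetric] by (rule cg_sum) (rule frob_add_pow)

lemma TF_P: "x \<in> P \<Longrightarrow> TF x \<in> P"
  unfolding TF_def using prime_gt_0_nat[OF p] by (intro P_sum P_power) auto

lemma TF_frob: "x \<in> OK \<Longrightarrow> TF x ^ p - TF x \<in> P"
proof -
  assume x: "x \<in> OK"
  have "TF x ^ p - (\<Sum>j<f_deg. (x ^ (p ^ j)) ^ p) \<in> P"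
    unfolding TF_def using x by (intro frob_sum OK_closed)
  moreover have "(\<Sum>j<f_deg. (x ^ (p ^ j)) ^ p) = (\<Sum>j<f_deg. x ^ (p ^ Suc j))"
    by (simp flip: power_mult add: mult.commute)
  moreover have "(\<Sum>j<f_deg. x ^ (p ^ Suc j)) = TF x + (x ^ (p ^ f_deg) - x)"
  proof -
    have "TF x + x ^ (p ^ f_deg) = x + (\<Sum>j<f_deg. x ^ (p ^ Suc j))"
      using sum.lessThan_Suc_shift[of "\<lambda>j. x ^ (p ^ j)" f_deg] by (simp add: TF_def)
    moreover have "s = a + (b - x)" if "a + b = x + s" for a b s :: 'a
      using that by (metis add_diff_cancel_left' add_diff_eq)
    ultimately show ?thesis by blast
  qed
  ultimately have "TF x ^ p - (TF x + (x ^ (p ^ f_deg) - x)) \<in> P" by simp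
  from P_add[OF this f_deg(2)[OF x]] show ?thesis by (simp add: algebra_simps)
qed

text \<open>Expanding \<open>TF\<close> turns the sum over \<open>c\<close> into a combination of
  the \<open>x ^ (p^j)\<close> with the character sums as coefficients. Only \<open>j = 0\<close>
  survives, with coefficient \<open>card C\<close>, which is -1. So the identity of the residue
  field is minus a sum of rank one operators indexed by the nonzero residues, and no basis over the
  prime field has to be chosen.\<close>

lemma TF_identity:
  assumes x: "x \<in> OK"
  shows "x + (\<Sum>c\<in>C. c * TF (inv_mod c * x)) \<in> P"
proof -
  have "(\<Sum>c\<in>C. c * TF (inv_mod c * x)) = (\<Sum>j<f_deg. S_sum j * x ^ (p ^ j))"
    unfolding TF_def S_sum_def sum_distrib_left sum_distrib_right
    by (subst sum.swap) (simp add: power_mult_distrib mult_ac)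
  also have "{..<f_deg} = insert 0 {1..<f_deg}" using f_deg(1) by auto
  also have "(\<Sum>j\<in>insert 0 {1..<f_deg}. S_sum j * x ^ (p ^ j)) = S_sum 0 * x + (\<Sum>j\<in>{1..<f_deg}. S_sum j * x ^ (p ^ j))"
    by simp
  finally have eq: "x + (\<Sum>c\<in>C. c * TF (inv_mod c * x)) =
      (S_sum 0 - of_nat (card C)) * x + of_int (int (card C) + 1) * x + (\<Sum>j\<in>{1..<f_deg}. S_sum j * x ^ (p ^ j))"
    by (simp add: algebra_simps)
  have "of_int (int (card C) + 1) \<in> P" using card_C by (simp only: P_int)
  then show ?thesis
    unfolding eq using x by (intro P_add P_sum P_mult OK_closed S_sum_0 S_sum_pos) auto
qed

lemma synthetic_div_OK:
  assumes "\<forall>i. Polynomial.coeff g i \<in> OK" and r: "r \<in> OK"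
  shows "poly g r \<in> OK" "Polynomial.coeff (synthetic_div g r) i \<in> OK"
proof -
  have "poly g r \<in> OK \<and> (\<forall>i. Polynomial.coeff (synthetic_div g r) i \<in> OK)"
    using assms(1)
  proof (induction g)
    case (pCons a g)
    have "a \<in> OK" using pCons.prems[rule_format, of 0] by simp
    moreover have "\<forall>i. Polynomial.coeff g i \<in> OK"
      using pCons.prems by (auto dest: spec[of _ "Suc _"])
    ultimately show ?case using pCons.IH r by (auto simp: OK_closed coeff_pCons split: nat.splits)
  qed (simp add: OK_closed)
  then show "poly g r \<in> OK" "Polynomial.coeff (synthetic_div g r) i \<in> OK" by auto
qed

text \<open>Roots in the domain \<open>OK\<close> modulo \<open>P\<close> are split off one at a
  time; \<open>synthetic_div\<close> keeps the coefficients in \<open>OK\<close> and the quotient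
  monic.\<close>

lemma poly_roots_mod:
  assumes "\<forall>i. Polynomial.coeff g i \<in> OK" "lead_coeff g = 1" "finite A" "A \<subseteq> OK"
    and "card A > Polynomial.degree g" "\<forall>r\<in>A. poly g r \<in> P"
    and "\<forall>r\<in>A. \<forall>s\<in>A. r \<noteq> s \<longrightarrow> r - s \<notin> P"
  shows False
  using assms
proof (induction "Polynomial.degree g" arbitrary: g A)
  case 0
  then have "g = 1" by (metis degree_0_id lead_coeff_pCons(1) one_pCons pCons_0_0 degree_eq_zeroE lead_coeff_pCons(2))
  moreover obtain r where "r \<in> A" using 0 by fastforce
  ultimately show ?case using 0 one_notin_P by auto
next
  case (Suc d)
  have "A \<noteq> {}" using Suc.prems(5) by auto
  then obtain r where r: "r \<in> A" by blast
  then have rO: "r \<in> OK" using Suc.prems(4) by blast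
  define g' where "g' = synthetic_div g r"
  have deg: "Polynomial.degree g' = d" using Suc.hyps(2) by (simp add: g'_def degree_synthetic_div)
  have eq: "[:-r, 1:] * g' + [:poly g r:] = g" unfolding g'_def by (rule synthetic_div_correct')
  have "Polynomial.coeff g (Suc d) = Polynomial.coeff ([:-r, 1:] * g' + [:poly g r:]) (Suc d)" using eq by simp
  also have "\<dots> = Polynomial.coeff g' d"
    using deg by (simp add: coeff_eq_0)
  finally have lead: "lead_coeff g' = 1" using Suc.prems(2) Suc.hyps(2) deg by simp
  show ?case
  proof (rule Suc.hyps(1)[of g' "A - {r}"])
    show "\<forall>i. Polynomial.coeff g' i \<in> OK" unfolding g'_def using synthetic_div_OK(2)[OF Suc.prems(1) rO] by blast
    show "Polynomial.degree g' < card (A - {r})" using Suc.prems(3,5) Suc.hyps(2) deg r by simp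
    show "\<forall>s\<in>A - {r}. poly g' s \<in> P"
    proof
      fix s assume s: "s \<in> A - {r}"
      then have sO: "s \<in> OK" using Suc.prems(4) by blast
      have "poly g s = (s - r) * poly g' s + poly g r"
        using arg_cong[OF eq, of "\<lambda>q. poly q s"] by (simp add: algebra_simps)
      moreover have "poly g s - poly g r \<in> P" using Suc.prems(6) s r by (intro P_diff) auto
      ultimately have "(s - r) * poly g' s \<in> P" by simp
      moreover have "poly g' s \<in> OK"
        using synthetic_div_OK(1)[OF _ sO, of g'] synthetic_div_OK(2)[OF Suc.prems(1) rO] by (simp add: g'_def)
      ultimately show "poly g' s \<in> P"
        using P_prime[of "s - r" "poly g' s"] Suc.prems(7) s r sO rO OK_closed(4) by blast
    qed
  qed (use Suc.prems deg lead in auto)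
qed

lemma fermat_mod: "of_nat m ^ p - of_nat m \<in> P"
proof (induction m)
  case (Suc m)
  have "(of_nat m + 1) ^ p - (of_nat m ^ p + 1 ^ p) \<in> P" by (intro frob_add OK_closed)
  from P_add[OF this Suc] show ?case by (simp add: algebra_simps)
qed (use prime_gt_0_nat[OF p] P_0 in \<open>simp add: zero_power\<close>)

text \<open>The polynomial \<open>X^p - X\<close> already has the \<open>p\<close> incongruent roots
  0, ..., p - 1; \<open>t\<close> would be one too many.\<close>

lemma frob_fixed_int:
  assumes t: "t \<in> OK" "t ^ p - t \<in> P"
  shows "\<exists>m::int. t - of_int m \<in> P"
proof (rule ccontr)
  assume no: "\<not> (\<exists>m::int. t - of_int m \<in> P)"
  have no_nat: "t - of_nat m \<notin> P" for m
  proof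
    assume "t - of_nat m \<in> P"
    then have "t - of_int (int m) \<in> P" by simp
    then show False using no by blast
  qed
  have p2: "p \<ge> 2" using p by (rule prime_ge_2_nat)
  define g :: "'a poly" where "g = Polynomial.monom 1 p - Polynomial.monom 1 1"
  define B :: "'a set" where "B = of_nat ` {..<p}"
  have tB: "t \<notin> B"
    using no_nat P_0 by (auto simp: B_def) (metis cancel_comm_monoid_add_class.diff_cancel)
  have "card B = p" unfolding B_def by (subst card_image) (auto simp: inj_on_def)
  then have cardA: "card (insert t B) = Suc p" using tB by (simp add: B_def)
  have deg: "Polynomial.degree g = p"
  proof (rule antisym)
    show "Polynomial.degree g \<le> p" unfolding g_def using p2
      by (intro degree_diff_le) (auto intro: order_trans[OF degree_monom_le])
    have "Polynomial.coeff g p \<noteq> 0" using p2 by (simp add: g_def)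
    then show "p \<le> Polynomial.degree g" by (rule le_degree)
  qed
  have poly: "poly g x = x ^ p - x" for x by (simp add: g_def poly_monom)
  have incong: "of_nat i - of_nat j \<notin> P" if "i < p" "j < p" "i \<noteq> j" for i j
  proof
    assume "of_nat i - of_nat j \<in> P"
    then have "of_int (int i - int j) \<in> P" by simp
    then have "int p dvd int i - int j" by (simp only: P_int)
    moreover have "\<bar>int i - int j\<bar> < int p" using that by auto
    ultimately have "int i - int j = 0" by (metis dvd_imp_le_int leD abs_of_nat)
    then show False using that by simp
  qed
  show False
  proof (rule poly_roots_mod[of g "insert t B"])
    show "\<forall>i. Polynomial.coeff g i \<in> OK" by (auto simp: g_def OK_closed)
    show "lead_coeff g = 1" unfolding deg using p2 by (simp add: g_def)
    show "insert t B \<subseteq> OK" using t(1) by (auto simp: B_def OK_closed)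
    show "\<forall>r\<in>insert t B. poly g r \<in> P" using t(2) fermat_mod by (auto simp: poly B_def)
    show "\<forall>r\<in>insert t B. \<forall>s\<in>insert t B. r \<noteq> s \<longrightarrow> r - s \<notin> P"
      using no_nat cg_sym incong by (auto simp: B_def)
  qed (use cardA deg in \<open>auto simp: B_def\<close>)
qed

text \<open>An integer representing the trace of the residue class of \<open>x\<close>, well defined
  modulo \<open>p\<close> only.\<close>

definition ti :: "'a \<Rightarrow> int" where
  "ti x = (SOME m. TF x - of_int m \<in> P)"

lemma ti: "x \<in> OK \<Longrightarrow> TF x - of_int (ti x) \<in> P"
  unfolding ti_def by (rule someI_ex) (rule frob_fixed_int[OF TF_OK TF_frob])

lemma ti_add: "addmod (int p) ti"
  unfolding addmod_def
proof (intro ballI)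
  fix x y assume xy: "x \<in> OK" "y \<in> OK"
  have "(TF (x + y) - (TF x + TF y)) - (TF (x + y) - of_int (ti (x + y))) +
      ((TF x - of_int (ti x)) + (TF y - of_int (ti y))) \<in> P"
    using xy by (intro P_add P_diff ti TF_add OK_closed)
  then have "of_int (ti (x + y) - (ti x + ti y)) \<in> P" by (simp add: algebra_simps)
  then show "int p dvd ti (x + y) - (ti x + ti y)" by (simp only: P_int)
qed

lemma ti_P: "x \<in> P \<Longrightarrow> int p dvd ti x"
proof -
  assume x: "x \<in> P"
  have "TF x - (TF x - of_int (ti x)) \<in> P" by (intro P_diff TF_P ti x P_OK')
  then show ?thesis by (simp add: P_int)
qed

lemma ti_cong: "u - v \<in> P \<Longrightarrow> u \<in> OK \<Longrightarrow> v \<in> OK \<Longrightarrow> int p dvd ti u - ti v"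
proof -
  assume uv: "u - v \<in> P" "u \<in> OK" "v \<in> OK"
  have "int p dvd ti (u - v) - (ti (u - v) - (ti u - ti v))"
    by (intro dvd_diff ti_P[OF uv(1)] addmod_diff[OF ti_add uv(2,3)])
  then show ?thesis by simp
qed

lemma ti_identity:
  assumes x: "x \<in> OK"
  shows "x + (\<Sum>c\<in>C. of_int (ti (inv_mod c * x)) * c) \<in> P"
proof -
  have "(\<Sum>c\<in>C. of_int (ti (inv_mod c * x)) * c) - (\<Sum>c\<in>C. c * TF (inv_mod c * x)) \<in> P"
  proof (rule cg_sum)
    fix c assume c: "c \<in> C"
    have "c * (of_int (ti (inv_mod c * x)) - TF (inv_mod c * x)) \<in> P"
      using c x C by (intro P_mult' cg_sym[OF ti] OK_closed inv_mod)
    then show "of_int (ti (inv_mod c * x)) * c - c * TF (inv_mod c * x) \<in> P" by (simp add: algebra_simps)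
  qed
  from P_add[OF this TF_identity[OF x]] show ?thesis by (simp add: algebra_simps)
qed

text \<open>If the trace vanished identically, \<open>ti_identity\<close> at 1 would put 1 into
  \<open>P\<close>.\<close>

lemma ti_nonzero: "\<exists>x\<in>OK. \<not> int p dvd ti x"
proof (rule ccontr)
  assume "\<not> (\<exists>x\<in>OK. \<not> int p dvd ti x)"
  then have all: "int p dvd ti x" if "x \<in> OK" for x using that by blast
  have "(\<Sum>c\<in>C. of_int (ti (inv_mod c * 1)) * c) \<in> P"
  proof (rule P_sum)
    fix c assume c: "c \<in> C"
    then have "int p dvd ti (inv_mod c * 1)" using C by (intro all OK_closed inv_mod)
    then show "of_int (ti (inv_mod c * 1)) * c \<in> P" using pO_P[OF pO_dvd] C(1)[OF c] by blast
  qed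
  from P_diff[OF ti_identity[OF OK_closed(2)] this] show False using one_notin_P by simp
qed

end

text \<open>\<open>y\<close> plays the role of the inverse of a uniformizer: it maps
  \<open>P\<close> into \<open>OK\<close>, and \<open>y * \<pi>\<close> is a unit modulo
  \<open>P\<close> with inverse \<open>a'\<close>. Such a \<open>y\<close> is constructed in the
  proof of \<open>tame\<close>.\<close>

locale prime_uniformizer = prime_above K n \<sigma> p P
  for K :: "'a::field_char_0 set" and n \<sigma> p P +
  fixes y \<pi> a' :: 'a
  assumes y_P: "x \<in> P \<Longrightarrow> y * x \<in> ring_of_integers K" and \<pi>: "\<pi> \<in> P" and y\<pi>: "y * \<pi> \<notin> P"
    and a': "a' \<in> ring_of_integers K" "y * \<pi> * a' - 1 \<in> P"
begin

text \<open>Since \<open>y\<close> has valuation \<open>-1\<close> at \<open>P\<close> and \<open>y P \<subseteq> O\<close>, the set \<open>J k\<close> is the ideal \<open>P\<^sup>k\<close>.\<close>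

definition J :: "nat \<Rightarrow> 'a set" where
  "J k = {x \<in> OK. \<forall>j\<le>k. y ^ j * x \<in> OK}"

lemma \<pi>_OK: "\<pi> \<in> OK"
  using P_OK'[OF \<pi>] .

lemma y\<pi>_OK: "y * \<pi> \<in> OK"
  using y_P[OF \<pi>] .

lemma J_I: "x \<in> OK \<Longrightarrow> (\<And>j. j \<le> k \<Longrightarrow> y ^ j * x \<in> OK) \<Longrightarrow> x \<in> J k"
  by (simp add: J_def)

lemma J_OK: "x \<in> J k \<Longrightarrow> x \<in> OK"
  by (simp add: J_def)

lemma J_D: "x \<in> J k \<Longrightarrow> j \<le> k \<Longrightarrow> y ^ j * x \<in> OK"
  by (simp add: J_def)

lemma J_0: "J 0 = OK"
  by (auto simp: J_def)

lemma J_add: "a \<in> J k \<Longrightarrow> b \<in> J k \<Longrightarrow> a + b \<in> J k"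
  by (rule J_I) (simp_all add: OK_closed(3) J_OK J_D distrib_left)

lemma J_diff: "a \<in> J k \<Longrightarrow> b \<in> J k \<Longrightarrow> a - b \<in> J k"
  by (rule J_I) (simp_all add: OK_closed(4) J_OK J_D right_diff_distrib)

lemma J_mult: "a \<in> J k \<Longrightarrow> b \<in> OK \<Longrightarrow> a * b \<in> J k"
proof (rule J_I)
  assume ab: "a \<in> J k" "b \<in> OK"
  then show "a * b \<in> OK" using J_OK OK_closed(5) by blast
  fix j assume "j \<le> k"
  then have "(y ^ j * a) * b \<in> OK" using ab J_D OK_closed(5) by blast
  then show "y ^ j * (a * b) \<in> OK" by (simp only: mult.assoc)
qed

lemma J_Suc: "x \<in> J (Suc k) \<Longrightarrow> x \<in> J k"
  by (rule J_I) (simp_all add: J_OK J_D)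

text \<open>\<open>(y * \<pi>) * x = \<pi> * (y * x)\<close> lies in \<open>P\<close>, and
  \<open>y * \<pi>\<close> does not.\<close>

lemma y_OK_P: "x \<in> OK \<Longrightarrow> y * x \<in> OK \<Longrightarrow> x \<in> P"
proof -
  assume x: "x \<in> OK" "y * x \<in> OK"
  have "\<pi> * (y * x) \<in> P" using P_mult[OF \<pi> x(2)] .
  then have "(y * \<pi>) * x \<in> P" by (simp add: mult_ac)
  then show ?thesis using P_prime[OF y\<pi>_OK x(1)] y\<pi> by blast
qed

lemma J_mult_P: "x \<in> J k \<Longrightarrow> b \<in> P \<Longrightarrow> x * b \<in> J (Suc k)"
proof (rule J_I)
  assume x: "x \<in> J k" and b: "b \<in> P"
  show "x * b \<in> OK" using OK_closed(5)[OF J_OK[OF x] P_OK'[OF b]] .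
  fix j assume j: "j \<le> Suc k"
  show "y ^ j * (x * b) \<in> OK"
  proof (cases "j \<le> k")
    case True
    then show ?thesis using OK_closed(5)[OF J_D[OF x True] P_OK'[OF b]] by (simp only: mult.assoc)
  next
    case False
    then have j: "j = Suc k" using j by simp
    have eq: "y ^ Suc k * (x * b) = (y ^ k * x) * (y * b)" by (simp add: mult_ac)
    show ?thesis unfolding j eq by (rule OK_closed(5)[OF J_D[OF x order_refl] y_P[OF b]])
  qed
qed

lemma \<pi>_power_J: "x \<in> OK \<Longrightarrow> \<pi> ^ k * x \<in> J k"
proof (induction k)
  case (Suc k)
  then have "(\<pi> ^ k * x) * \<pi> \<in> J (Suc k)" using J_mult_P[OF _ \<pi>] by blast
  then show ?case by (simp add: mult_ac)
qed (simp add: J_0)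

lemma ideal_prod_J:
  "ideal_prod (subring_of_type OK) (J k) P = J (Suc k)" (is "?I = _")
proof
  show "?I \<subseteq> J (Suc k)"
  proof
    fix x assume "x \<in> ?I"
    then show "x \<in> J (Suc k)"
    proof (induction rule: ideal_prod.induct)
      case (prod i j)
      then show ?case using J_mult_P by simp
    next
      case (sum s1 s2)
      then show ?case using J_add by simp
    qed
  qed
  show "J (Suc k) \<subseteq> ?I"
  proof
    fix x assume x: "x \<in> J (Suc k)"
    have xk: "x \<in> J k" using J_Suc[OF x] .
    have yx: "y * x \<in> J k"
    proof (rule J_I)
      show "y * x \<in> OK" using J_D[OF x, of 1] by simp
      show "y ^ j * (y * x) \<in> OK" if "j \<le> k" for j
        using J_D[OF x, of "Suc j"] that by (simp add: mult_ac)
    qed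
    \<comment> \<open>The decomposition
      \<open>x = (y * x * a') * \<pi> + x * (1 - y * \<pi> * a')\<close> has its first summand in
      \<open>J k\<close> times \<open>P\<close> because \<open>y * x\<close> is in
      \<open>J k\<close>, and its second because \<open>a'\<close> inverts \<open>y * \<pi>\<close>
      modulo \<open>P\<close>.\<close>
    have 1: "(y * x * a') * \<pi> \<in> ?I"
      using ideal_prod.prod[of "y * x * a'" "J k" \<pi> P "subring_of_type OK"] J_mult[OF yx a'(1)] \<pi> by simp
    have b: "1 - y * \<pi> * a' \<in> P" using cg_sym[OF a'(2)] .
    have 2: "x * (1 - y * \<pi> * a') \<in> ?I"
      using ideal_prod.prod[of x "J k" "1 - y * \<pi> * a'" P "subring_of_type OK"] xk b by simp
    have "(y * x * a') * \<pi> + x * (1 - y * \<pi> * a') \<in> ?I"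
      using ideal_prod.sum[OF 1 2] by simp
    then show "x \<in> ?I" by (simp add: algebra_simps)
  qed
qed

text \<open>The bridge to \<open>ramification_index\<close>, which is stated with the powers of
  \<open>ideals_set\<close>.\<close>

lemma ideal_power_J: "P [^]\<^bsub>ideals_set (subring_of_type OK)\<^esub> k = J k"
proof (induction k)
  case 0
  then show ?case by (simp add: nat_pow_def ideals_set_def J_0)
next
  case (Suc k)
  then show ?case using ideal_prod_J[of k] by (simp add: nat_pow_def ideals_set_def)
qed

text \<open>Makes the \<open>GREATEST\<close> in \<open>ramification_index\<close> attained. If
  \<open>\<pi>^i - \<pi>^j = p z\<close> and \<open>p\<close> were in \<open>J e\<close> for some
  \<open>e > i\<close>, then \<open>y\<close> times \<open>(y \<pi>)^i (1 - \<pi>^(j-i))\<close>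
  would be integral, which puts the latter product into \<open>P\<close>; but neither of its factors
  is there.\<close>

lemma p_J_bound: "\<exists>b. \<forall>e. of_nat p \<in> J e \<longrightarrow> e \<le> b"
proof -
  obtain R where R: "finite R" "R \<subseteq> OK" "\<forall>x\<in>OK. \<exists>r\<in>R. x - r \<in> pO (int p)"
    using finite_residues[OF p_pos] .
  obtain i j where ij: "i < j" "j \<le> card R" "\<pi> ^ i - \<pi> ^ j \<in> pO (int p)"
    using power_repeat[OF R(1,3) \<pi>_OK] by (elim exE conjE)
  obtain z where z: "z \<in> OK" "\<pi> ^ i - \<pi> ^ j = of_nat p * z" using pO_E[OF ij(3)] by (metis of_int_of_nat_eq)
  define c where "c = (y * \<pi>) ^ i * (1 - \<pi> ^ (j - i))"
  have cO: "c \<in> OK" unfolding c_def by (intro OK_closed y\<pi>_OK \<pi>_OK)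
  have "e \<le> card R" if e: "of_nat p \<in> J e" for e
  proof (rule ccontr)
    assume "\<not> e \<le> card R"
    then have "Suc i \<le> e" using ij by simp
    then have 1: "(y ^ Suc i * of_nat p) * z \<in> OK" using J_D[OF e] z(1) OK_closed(5) by blast
    have "(y ^ Suc i * of_nat p) * z = y * c"
    proof -
      have "\<pi> ^ j = \<pi> ^ i * \<pi> ^ (j - i)" using ij(1) by (simp flip: power_add)
      then have "of_nat p * z = \<pi> ^ i * (1 - \<pi> ^ (j - i))" using z(2) by (simp add: algebra_simps)
      then show ?thesis by (simp add: c_def power_mult_distrib mult_ac)
    qed
    with 1 have "y * c \<in> OK" by (simp only:)
    then have "c \<in> P" by (rule y_OK_P[OF cO])
    then have "(y * \<pi>) ^ i \<in> P \<or> 1 - \<pi> ^ (j - i) \<in> P"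
      unfolding c_def by (intro P_prime OK_closed y\<pi>_OK \<pi>_OK)
    moreover have "(y * \<pi>) ^ i \<notin> P" using P_prime_power[OF y\<pi>_OK] y\<pi> by blast
    moreover have "1 - \<pi> ^ (j - i) \<notin> P"
    proof
      assume "1 - \<pi> ^ (j - i) \<in> P"
      moreover have "\<pi> ^ (j - i) \<in> P" using ij(1) by (intro P_power \<pi>) simp
      ultimately have "(1 - \<pi> ^ (j - i)) + \<pi> ^ (j - i) \<in> P" by (rule P_add)
      then show False using one_notin_P by simp
    qed
    ultimately show False by blast
  qed
  then show ?thesis by (intro exI[of _ "card R"]) simp
qed

text \<open>The filtration of \<open>OK\<close> by the \<open>J i\<close> has layers isomorphic to
  the residue field, and multiplication by \<open>u\<close> has trace \<open>ti u\<close> on each of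
  them. The \<open>g i c\<close> are the coefficients at \<open>\<pi> ^ i * c\<close> of an
  expansion modulo \<open>J k\<close>, so the last clause says that the trace on the quotient by
  \<open>J k\<close> is \<open>k\<close> times \<open>ti u\<close>. The bound
  \<open>k \<le> e\<close> ensures that \<open>p\<close> lies in \<open>J k\<close>, so that
  coefficients modulo \<open>p\<close> make sense.\<close>

lemma chain:
  assumes p_e: "of_nat p \<in> J e" and "k \<le> e"
  shows "\<exists>g :: nat \<Rightarrow> 'a \<Rightarrow> 'a \<Rightarrow> int.
    (\<forall>i<k. \<forall>c\<in>C. addmod (int p) (g i c) \<and> (\<forall>x\<in>J k. int p dvd g i c x)) \<and>
    (\<forall>x\<in>OK. x - (\<Sum>i<k. \<Sum>c\<in>C. of_int (g i c x) * (\<pi> ^ i * c)) \<in> J k) \<and>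
    (\<forall>u\<in>OK. int p dvd (\<Sum>i<k. \<Sum>c\<in>C. g i c (u * (\<pi> ^ i * c))) - int k * ti u)"
  using \<open>k \<le> e\<close>
proof (induction k)
  case 0
  then show ?case by (simp add: J_0)
next
  case (Suc k)
  have ke: "k \<le> e" "Suc k \<le> e" using Suc.prems by auto
  from Suc.IH[OF ke(1)] obtain g :: "nat \<Rightarrow> 'a \<Rightarrow> 'a \<Rightarrow> int" where
    g: "\<forall>i<k. \<forall>c\<in>C. addmod (int p) (g i c) \<and> (\<forall>x\<in>J k. int p dvd g i c x)"
      "\<forall>x\<in>OK. x - (\<Sum>i<k. \<Sum>c\<in>C. of_int (g i c x) * (\<pi> ^ i * c)) \<in> J k"
      "\<forall>u\<in>OK. int p dvd (\<Sum>i<k. \<Sum>c\<in>C. g i c (u * (\<pi> ^ i * c))) - int k * ti u"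
    by (elim exE conjE)
  define s where "s x = (\<Sum>i<k. \<Sum>c\<in>C. of_int (g i c x) * (\<pi> ^ i * c))" for x
  define r where "r x = x - s x" for x
  \<comment> \<open>Multiplication by \<open>\<kappa>\<close> maps \<open>J k\<close> into
    \<open>OK\<close> and \<open>J (Suc k)\<close> into \<open>P\<close>, and it inverts
    \<open>\<pi> ^ k\<close> modulo \<open>P\<close>.\<close>
  define \<kappa> where "\<kappa> = y ^ k * a' ^ k"
  have rJ: "r x \<in> J k" if "x \<in> OK" for x unfolding r_def s_def using bspec[OF g(2) that] .
  have \<kappa>J: "\<kappa> * x \<in> OK" if "x \<in> J k" for x
  proof -
    have "(y ^ k * x) * a' ^ k \<in> OK" using J_D[OF that order_refl] OK_closed(9)[OF a'(1)] by (rule OK_closed(5))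
    then show ?thesis by (simp add: \<kappa>_def mult_ac)
  qed
  have \<kappa>P: "\<kappa> * x \<in> P" if "x \<in> J (Suc k)" for x
  proof -
    have "y * (y ^ k * x) \<in> OK" using J_D[OF that, of "Suc k"] by (simp add: mult_ac)
    then have "y ^ k * x \<in> P" using J_D[OF that, of k] by (intro y_OK_P) auto
    then have "(y ^ k * x) * a' ^ k \<in> P" using OK_closed(9)[OF a'(1)] by (rule P_mult)
    then show ?thesis by (simp add: \<kappa>_def mult_ac)
  qed
  have p_Suc: "of_nat p \<in> J (Suc k)" using p_e ke(2) by (simp add: J_def)
  have pO_J: "x \<in> J (Suc k)" if x: "x \<in> pO (int p)" for x
  proof -
    obtain z where "z \<in> OK" "x = of_int (int p) * z" using pO_E[OF x] .
    then show ?thesis using J_mult[OF p_Suc, of z] by simp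
  qed
  have termO: "\<pi> ^ i * c \<in> OK" if "c \<in> C" for i c using OK_closed(5)[OF OK_closed(9)[OF \<pi>_OK] C(1)[OF that]] .
  have s_add: "s (x + x') - (s x + s x') \<in> pO (int p)" if x: "x \<in> OK" "x' \<in> OK" for x x'
  proof -
    have "s (x + x') - (s x + s x') =
        (\<Sum>i<k. \<Sum>c\<in>C. of_int (g i c (x + x') - (g i c x + g i c x')) * (\<pi> ^ i * c))"
      unfolding s_def sum.distrib[symmetric] sum_subtractf[symmetric]
      by (intro sum.cong refl) (simp add: algebra_simps)
    also have "\<dots> \<in> pO (int p)"
    proof (intro pO_sum pO_dvd termO)
      fix i c assume "i \<in> {..<k}" "c \<in> C"
      then have "addmod (int p) (g i c)" using g(1) by blast
      then show "int p dvd g i c (x + x') - (g i c x + g i c x')" using x by (rule addmodD)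
    qed auto
    finally show ?thesis .
  qed
  have s_J: "s x \<in> pO (int p)" if x: "x \<in> J k" for x
    unfolding s_def
  proof (intro pO_sum pO_dvd termO)
    fix i c assume "i \<in> {..<k}" "c \<in> C"
    then show "int p dvd g i c x" using g(1) x by blast
  qed auto
  \<comment> \<open>The residue identity is applied to the remainder \<open>r x\<close> and not to
    \<open>x\<close>, since \<open>\<kappa>\<close> makes only elements of \<open>J k\<close>
    integral. The sign is the one in \<open>ti_identity\<close>.\<close>
  define h where "h c x = - ti (inv_mod c * (\<kappa> * r x))" for c x
  have hO: "inv_mod c * (\<kappa> * r x) \<in> OK" if "c \<in> C" "x \<in> OK" for c x
    using OK_closed(5)[OF inv_mod(1)[OF C(1)[OF that(1)] C(2)[OF that(1)]] \<kappa>J[OF rJ[OF that(2)]]] by simp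
  have iO: "inv_mod c \<in> OK" if "c \<in> C" for c using inv_mod(1) C(1)[OF that] C(2)[OF that] by blast
  have h_add: "addmod (int p) (h c)" if c: "c \<in> C" for c
    unfolding addmod_def
  proof (intro ballI)
    fix x x' assume x: "x \<in> OK" "x' \<in> OK"
    have xx: "x + x' \<in> OK" using OK_closed(3)[OF x] .
    define A where "A = inv_mod c * (\<kappa> * r x)"
    define A' where "A' = inv_mod c * (\<kappa> * r x')"
    define B where "B = inv_mod c * (\<kappa> * r (x + x'))"
    have AO: "A \<in> OK" "A' \<in> OK" "B \<in> OK"
      unfolding A_def A'_def B_def using hO[OF c] x xx by blast+
    have "inv_mod c * (\<kappa> * (s (x + x') - (s x + s x'))) \<in> P"
      using iO[OF c] \<kappa>P[OF pO_J[OF s_add[OF x]]] by (rule P_mult')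
    also have "inv_mod c * (\<kappa> * (s (x + x') - (s x + s x'))) = A + A' - B"
      by (simp add: A_def A'_def B_def r_def algebra_simps)
    finally have "A + A' - B \<in> P" .
    from ti_cong[OF this OK_closed(3)[OF AO(1,2)] AO(3)] have "int p dvd ti (A + A') - ti B" .
    from dvd_diff[OF this addmodD[OF ti_add AO(1,2)]]
    show "int p dvd h c (x + x') - (h c x + h c x')"
      by (simp add: h_def A_def A'_def B_def algebra_simps)
  qed
  have h_J: "int p dvd h c x" if c: "c \<in> C" and x: "x \<in> J (Suc k)" for c x
  proof -
    have "r x \<in> J (Suc k)" unfolding r_def using x pO_J[OF s_J[OF J_Suc[OF x]]] by (rule J_diff)
    then have "inv_mod c * (\<kappa> * r x) \<in> P" by (rule P_mult'[OF iO[OF c] \<kappa>P])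
    then show ?thesis using ti_P by (simp add: h_def)
  qed
  have \<kappa>\<pi>: "\<kappa> * \<pi> ^ k - 1 \<in> P"
  proof -
    have "(y * \<pi> * a') ^ k - 1 ^ k \<in> P"
      by (rule cg_power[OF a'(2) OK_closed(5)[OF y\<pi>_OK a'(1)] OK_closed(2)])
    then show ?thesis by (simp add: \<kappa>_def power_mult_distrib mult_ac)
  qed
  have rem: "r x - (\<Sum>c\<in>C. of_int (h c x) * (\<pi> ^ k * c)) \<in> J (Suc k)" if x: "x \<in> OK" for x
  proof -
    define \<rho> where "\<rho> = \<kappa> * r x - (\<Sum>c\<in>C. of_int (h c x) * c)"
    have "\<kappa> * r x + (\<Sum>c\<in>C. of_int (ti (inv_mod c * (\<kappa> * r x))) * c) \<in> P"
      using \<kappa>J[OF rJ[OF x]] by (rule ti_identity)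
    then have \<rho>P: "\<rho> \<in> P" by (simp add: \<rho>_def h_def sum_negf)
    have sumh: "(\<Sum>c\<in>C. of_int (h c x) * (\<pi> ^ k * c)) = \<pi> ^ k * (\<kappa> * r x - \<rho>)"
      by (simp add: \<rho>_def sum_distrib_left mult_ac)
    have "r x - (\<Sum>c\<in>C. of_int (h c x) * (\<pi> ^ k * c)) = r x * (1 - \<kappa> * \<pi> ^ k) + (\<pi> ^ k * 1) * \<rho>"
      unfolding sumh by (simp add: algebra_simps)
    also have "\<dots> \<in> J (Suc k)"
      by (intro J_add J_mult_P rJ x cg_sym[OF \<kappa>\<pi>] \<pi>_power_J OK_closed(2) \<rho>P)
    finally show ?thesis .
  qed
  define g' where "g' i = (if i < k then g i else h)" for i
  have split: "(\<Sum>i<Suc k. \<Sum>c\<in>C. F i c) = (\<Sum>i<k. \<Sum>c\<in>C. F i c) + (\<Sum>c\<in>C. F k c)"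
    for F :: "nat \<Rightarrow> 'a \<Rightarrow> 'b::comm_monoid_add" by simp
  have "\<forall>i<Suc k. \<forall>c\<in>C. addmod (int p) (g' i c) \<and> (\<forall>x\<in>J (Suc k). int p dvd g' i c x)"
  proof (intro allI impI ballI conjI)
    fix i c assume i: "i < Suc k" and c: "c \<in> C"
    show "addmod (int p) (g' i c)" using g(1) h_add[OF c] c by (simp add: g'_def)
    fix x assume "x \<in> J (Suc k)"
    then show "int p dvd g' i c x" using g(1) h_J[OF c] c J_Suc by (simp add: g'_def)
  qed
  moreover have "\<forall>x\<in>OK. x - (\<Sum>i<Suc k. \<Sum>c\<in>C. of_int (g' i c x) * (\<pi> ^ i * c)) \<in> J (Suc k)"
  proof
    fix x assume x: "x \<in> OK"
    have "x - (\<Sum>i<Suc k. \<Sum>c\<in>C. of_int (g' i c x) * (\<pi> ^ i * c)) =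
        r x - (\<Sum>c\<in>C. of_int (h c x) * (\<pi> ^ k * c))"
      unfolding split r_def s_def g'_def by simp
    then show "x - (\<Sum>i<Suc k. \<Sum>c\<in>C. of_int (g' i c x) * (\<pi> ^ i * c)) \<in> J (Suc k)"
      using rem[OF x] by simp
  qed
  moreover have "\<forall>u\<in>OK. int p dvd (\<Sum>i<Suc k. \<Sum>c\<in>C. g' i c (u * (\<pi> ^ i * c))) - int (Suc k) * ti u"
  proof
    fix u assume u: "u \<in> OK"
    \<comment> \<open>The argument already lies in \<open>J k\<close>, where the earlier
      coefficients vanish modulo \<open>p\<close>; so its remainder is itself up to
      \<open>pO\<close>, and \<open>\<kappa>\<close> and \<open>inv_mod c\<close> reduce it to
      \<open>u\<close>.\<close>
    have hc: "int p dvd h c (u * (\<pi> ^ k * c)) - (- ti u)" if c: "c \<in> C" for c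
    proof -
      define x where "x = u * (\<pi> ^ k * c)"
      have xO: "x \<in> OK" unfolding x_def using u termO[OF c] by (rule OK_closed(5))
      have uc: "u * c \<in> OK" using u C(1)[OF c] by (rule OK_closed(5))
      have "\<pi> ^ k * (u * c) \<in> J k" using uc by (rule \<pi>_power_J)
      then have xJ: "x \<in> J k" by (simp add: x_def mult_ac)
      have 1: "inv_mod c * (\<kappa> * s x) \<in> P" using iO[OF c] \<kappa>P[OF pO_J[OF s_J[OF xJ]]] by (rule P_mult')
      have 2: "(\<kappa> * \<pi> ^ k - 1) * (u * c * inv_mod c) \<in> P"
        by (rule P_mult[OF \<kappa>\<pi> OK_closed(5)[OF uc iO[OF c]]])
      have 3: "(c * inv_mod c - 1) * u \<in> P" using inv_mod(2)[OF C(1)[OF c] C(2)[OF c]] u by (rule P_mult)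
      from P_diff[OF P_add[OF 2 3] 1] have "inv_mod c * (\<kappa> * r x) - u \<in> P"
        by (simp add: r_def x_def algebra_simps)
      from ti_cong[OF this hO[OF c xO] u] have "int p dvd ti (inv_mod c * (\<kappa> * r x)) - ti u" .
      then have "int p dvd - (ti (inv_mod c * (\<kappa> * r x)) - ti u)" by (simp only: dvd_minus_iff)
      then show ?thesis by (simp add: h_def x_def)
    qed
    have 1: "int p dvd (\<Sum>c\<in>C. h c (u * (\<pi> ^ k * c)) - (- ti u))" by (rule dvd_sum) (rule hc)
    \<comment> \<open>The new layer contributes \<open>card C\<close> terms congruent to
      \<open>- ti u\<close>, that is, \<open>ti u\<close> in total modulo \<open>p\<close>.\<close>
    have 2: "int p dvd (int (card C) + 1) * ti u" using card_C by (rule dvd_mult2)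
    have 3: "int p dvd (\<Sum>i<k. \<Sum>c\<in>C. g i c (u * (\<pi> ^ i * c))) - int k * ti u" using bspec[OF g(3) u] .
    have "(\<Sum>i<Suc k. \<Sum>c\<in>C. g' i c (u * (\<pi> ^ i * c))) - int (Suc k) * ti u =
        ((\<Sum>i<k. \<Sum>c\<in>C. g i c (u * (\<pi> ^ i * c))) - int k * ti u) +
        ((\<Sum>c\<in>C. h c (u * (\<pi> ^ k * c)) - (- ti u)) - (int (card C) + 1) * ti u)"
      unfolding split g'_def by (simp add: sum.distrib algebra_simps)
    also have "int p dvd \<dots>" by (rule dvd_add[OF 3 dvd_diff[OF 1 2]])
    finally show "int p dvd (\<Sum>i<Suc k. \<Sum>c\<in>C. g' i c (u * (\<pi> ^ i * c))) - int (Suc k) * ti u" .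
  qed
  ultimately show ?case by (intro exI[of _ g'] conjI)
qed

text \<open>Modulo \<open>p\<close>, multiplication by \<open>w = z * u\<close> factors through the
  quotient by \<open>J e\<close>, so its trace is \<open>e * ti w\<close>. The left side vanishes by
  hypothesis.\<close>

lemma trace_ramified:
  assumes p_e: "of_nat p \<in> J e" and z: "z \<in> OK" "z \<notin> P" and zJ: "\<And>x. x \<in> J e \<Longrightarrow> z * x \<in> pO (int p)"
    and tr: "\<And>x. x \<in> OK \<Longrightarrow> int p dvd tr (z * x)"
  shows "p dvd e"
proof -
  from chain[OF p_e order_refl] obtain g :: "nat \<Rightarrow> 'a \<Rightarrow> 'a \<Rightarrow> int" where
    g: "\<forall>i<e. \<forall>c\<in>C. addmod (int p) (g i c) \<and> (\<forall>x\<in>J e. int p dvd g i c x)"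
      "\<forall>x\<in>OK. x - (\<Sum>i<e. \<Sum>c\<in>C. of_int (g i c x) * (\<pi> ^ i * c)) \<in> J e"
      "\<forall>u\<in>OK. int p dvd (\<Sum>i<e. \<Sum>c\<in>C. g i c (u * (\<pi> ^ i * c))) - int e * ti u"
    by (elim exE conjE)
  obtain x0 where x0: "x0 \<in> OK" "\<not> int p dvd ti x0" using ti_nonzero by (elim bexE)
  \<comment> \<open>Chosen so that \<open>z * u\<close> is congruent to \<open>x0\<close>, an
    element of nonzero residue trace.\<close>
  define u where "u = inv_mod z * x0"
  have uO: "u \<in> OK" unfolding u_def using inv_mod(1)[OF z] x0(1) by (rule OK_closed(5))
  define w where "w = z * u"
  have wO: "w \<in> OK" unfolding w_def using z(1) uO by (rule OK_closed(5))
  have termO: "\<pi> ^ i * c \<in> OK" if "c \<in> C" for i c using OK_closed(5)[OF OK_closed(9)[OF \<pi>_OK] C(1)[OF that]] .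
  have "int p dvd tr w - (\<Sum>j\<in>{..<e} \<times> C. g (fst j) (snd j) (w * (\<pi> ^ fst j * snd j)))"
  proof (rule trace_mod[OF wO])
    show "finite ({..<e} \<times> C)" using C(4) by simp
    show "addmod (int p) (g (fst j) (snd j))" if "j \<in> {..<e} \<times> C" for j
      using g(1) that by (auto simp: mem_Times_iff)
    show "w * (\<pi> ^ fst j * snd j) \<in> OK" if "j \<in> {..<e} \<times> C" for j
      by (rule OK_closed(5)[OF wO termO]) (use that in auto)
    fix x assume x: "x \<in> OK"
    have "(\<Sum>j\<in>{..<e} \<times> C. of_int (g (fst j) (snd j) x) * (w * (\<pi> ^ fst j * snd j))) =
        (\<Sum>i<e. \<Sum>c\<in>C. of_int (g i c x) * (w * (\<pi> ^ i * c)))"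
      by (simp add: sum.cartesian_product split_def)
    also have "\<dots> = w * (\<Sum>i<e. \<Sum>c\<in>C. of_int (g i c x) * (\<pi> ^ i * c))"
      by (simp add: sum_distrib_left mult_ac)
    finally have eq: "w * x - (\<Sum>j\<in>{..<e} \<times> C. of_int (g (fst j) (snd j) x) * (w * (\<pi> ^ fst j * snd j))) =
        (z * (x - (\<Sum>i<e. \<Sum>c\<in>C. of_int (g i c x) * (\<pi> ^ i * c)))) * u"
      by (simp add: w_def algebra_simps)
    show "w * x - (\<Sum>j\<in>{..<e} \<times> C. of_int (g (fst j) (snd j) x) * (w * (\<pi> ^ fst j * snd j))) \<in> pO (int p)"
      unfolding eq by (rule pO_mult[OF zJ[OF bspec[OF g(2) x]] uO])
  qed
  also have "(\<Sum>j\<in>{..<e} \<times> C. g (fst j) (snd j) (w * (\<pi> ^ fst j * snd j))) =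
      (\<Sum>i<e. \<Sum>c\<in>C. g i c (w * (\<pi> ^ i * c)))"
    by (simp add: sum.cartesian_product split_def)
  finally have 1: "int p dvd tr w - (\<Sum>i<e. \<Sum>c\<in>C. g i c (w * (\<pi> ^ i * c)))" .
  have 2: "int p dvd (\<Sum>i<e. \<Sum>c\<in>C. g i c (w * (\<pi> ^ i * c))) - int e * ti w" using bspec[OF g(3) wO] .
  have 3: "int p dvd tr w" unfolding w_def by (rule tr[OF uO])
  from dvd_diff[OF 3 dvd_add[OF 1 2]] have dvd: "int p dvd int e * ti w" by simp
  have "(z * inv_mod z - 1) * x0 \<in> P" using inv_mod(2)[OF z] x0(1) by (rule P_mult)
  then have "w - x0 \<in> P" by (simp add: w_def u_def algebra_simps)
  from ti_cong[OF this wO x0(1)] have 4: "int p dvd ti w - ti x0" .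
  have "\<not> int p dvd ti w"
  proof
    assume "int p dvd ti w"
    from dvd_diff[OF this 4] have "int p dvd ti x0" by simp
    then show False using x0(2) by blast
  qed
  moreover have "Factorial_Ring.prime (int p)" using p by simp
  ultimately have "int p dvd int e" using dvd prime_dvd_mult_iff by blast
  then show ?thesis by simp
qed

end

section \<open>Divisibility of traces at tame primes\<close>

context emb_field
begin

lemma cring_OK: "cring (subring_of_type OK)"
proof (rule cringI)
  show "abelian_group (subring_of_type OK)"
  proof (rule abelian_groupI)
    fix x assume "x \<in> carrier (subring_of_type OK)"
    then show "\<exists>y\<in>carrier (subring_of_type OK). y \<oplus>\<^bsub>subring_of_type OK\<^esub> x = \<zero>\<^bsub>subring_of_type OK\<^esub>"
      using OK_closed(6)[of x] by (intro bexI[of _ "- x"]) simp_all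
  qed (simp_all add: OK_closed add.assoc add.commute)
  show "comm_monoid (subring_of_type OK)"
    by (rule comm_monoidI) (simp_all add: OK_closed mult.assoc mult.commute)
qed (simp add: distrib_right)

lemma primeideal_OK:
  assumes "P \<subseteq> OK" "0 \<in> P" "\<And>x y. x \<in> P \<Longrightarrow> y \<in> P \<Longrightarrow> x + y \<in> P"
    "\<And>x y. x \<in> P \<Longrightarrow> y \<in> OK \<Longrightarrow> x * y \<in> P" "1 \<notin> P"
    "\<And>x y. x \<in> OK \<Longrightarrow> y \<in> OK \<Longrightarrow> x * y \<in> P \<Longrightarrow> x \<in> P \<or> y \<in> P"
  shows "primeideal P (subring_of_type OK)"
proof (rule primeidealI[OF idealI])
  interpret R: cring "subring_of_type OK" by (rule cring_OK)
  show "cring (subring_of_type OK)" "ring (subring_of_type OK)" by unfold_locales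
  show "subgroup P (add_monoid (subring_of_type OK))"
  proof (rule group.subgroupI)
    show "group (add_monoid (subring_of_type OK))" by (rule R.a_group)
    show "P \<noteq> {}" using assms(2) by blast
    fix a assume a: "a \<in> P"
    then have aO: "a \<in> OK" using assms(1) by blast
    have m1: "- 1 \<in> OK" using OK_closed(6)[OF OK_closed(2)] .
    have "- a \<in> P" using assms(4)[OF a m1] by simp
    moreover have "\<ominus>\<^bsub>subring_of_type OK\<^esub> a = - a"
      by (rule R.minus_equality) (use aO OK_closed(6)[OF aO] in simp_all)
    ultimately show "inv\<^bsub>add_monoid (subring_of_type OK)\<^esub> a \<in> P" by (simp add: a_inv_def)
    fix b assume "b \<in> P"
    then show "a \<otimes>\<^bsub>add_monoid (subring_of_type OK)\<^esub> b \<in> P" using assms(3)[OF a] by simp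
  qed (use assms(1) in simp)
  show "x \<otimes>\<^bsub>subring_of_type OK\<^esub> a \<in> P" if "a \<in> P" "x \<in> carrier (subring_of_type OK)" for a x
    using assms(4)[of a x] that by (simp add: mult.commute)
  show "a \<otimes>\<^bsub>subring_of_type OK\<^esub> x \<in> P" if "a \<in> P" "x \<in> carrier (subring_of_type OK)" for a x
    using assms(4)[of a x] that by simp
  show "carrier (subring_of_type OK) \<noteq> P" using assms(5) OK_closed(2) by auto
  show "a \<in> P \<or> b \<in> P"
    if "a \<in> carrier (subring_of_type OK)" "b \<in> carrier (subring_of_type OK)"
      "a \<otimes>\<^bsub>subring_of_type OK\<^esub> b \<in> P" for a b
    using assms(6)[of a b] that by simp
qed

text \<open>In classical terms, the different has exponent \<open>e - 1\<close> at a tame prime, so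
  that \<open>Y / p^2\<close> in the dual of \<open>OK\<close> forces \<open>Y / p\<close> to be
  integral. Here a counterexample \<open>Y\<close> is turned into a prime \<open>P\<close> with an
  inverse uniformizer and an element satisfying \<open>trace_ramified\<close>, so that
  \<open>p\<close> divides the ramification index.\<close>

lemma tame:
  assumes tame: "no_wild_ramification K" and p: "Factorial_Ring.prime p" and Y: "Y \<in> OK"
    and tr: "\<And>x. x \<in> OK \<Longrightarrow> (int p)\<^sup>2 dvd tr (Y * x)"
  shows "Y \<in> pO (int p)"
proof (rule ccontr)
  assume Yp: "Y \<notin> pO (int p)"
  have p0: "int p > 0" using prime_gt_0_nat[OF p] by simp
  obtain R where R: "finite R" "R \<subseteq> OK" "\<forall>x\<in>OK. \<exists>r\<in>R. x - r \<in> pO (int p)"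
    using finite_residues[OF p0] .
  \<comment> \<open>A multiple of \<open>Y\<close> with largest annihilator modulo \<open>p\<close>
    has a prime annihilator, the usual construction of an associated prime. Annihilators are
    compared on the finite set \<open>R\<close> of representatives.\<close>
  define Q where "Q z \<longleftrightarrow> z \<in> OK \<and> (\<exists>c\<in>OK. z = Y * c) \<and> z \<notin> pO (int p)" for z
  define Ann where "Ann z = {r \<in> R. r * z \<in> pO (int p)}" for z
  have QY: "Q Y" unfolding Q_def using Y Yp OK_closed(2) by (intro conjI bexI[of _ 1]) simp_all
  have "card (Ann z) < Suc (card R)" for z
    using card_mono[OF R(1), of "Ann z"] by (auto simp: Ann_def less_Suc_eq_le)
  then have "\<exists>z. Q z \<and> (\<forall>z'. Q z' \<longrightarrow> card (Ann z') \<le> card (Ann z))"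
    using Lattices_Big.ex_has_greatest_nat[of Q Y "\<lambda>z. card (Ann z)" "Suc (card R)"] QY by simp
  then obtain z where z': "Q z \<and> (\<forall>z'. Q z' \<longrightarrow> card (Ann z') \<le> card (Ann z))" by (rule exE)
  have Qz: "Q z" using z' by (rule conjunct1)
  have zmax: "card (Ann z') \<le> card (Ann z)" if "Q z'" for z' using z'[THEN conjunct2, rule_format, OF that] .
  have zO: "z \<in> OK" and zp: "z \<notin> pO (int p)" using Qz by (auto simp: Q_def)
  obtain c where c: "c \<in> OK" "z = Y * c" using Qz by (auto simp: Q_def)
  define P where "P = {x \<in> OK. x * z \<in> pO (int p)}"
  have pP: "of_nat p \<in> P" unfolding P_def using pO_I[OF zO, of "int p"] by (simp add: OK_closed)
  have P_prime: "a \<in> P \<or> b \<in> P" if ab: "a \<in> OK" "b \<in> OK" "a * b \<in> P" for a b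
  proof (rule ccontr)
    assume no: "\<not> (a \<in> P \<or> b \<in> P)"
    have azO: "a * z \<in> OK" using ab(1) zO by (rule OK_closed(5))
    have "a * z = Y * (a * c)" by (simp add: c(2) mult_ac)
    moreover have "a * c \<in> OK" using ab(1) c(1) by (rule OK_closed(5))
    ultimately have Qaz: "Q (a * z)" unfolding Q_def using no ab(1) azO by (auto simp: P_def)
    have sub: "Ann z \<subseteq> Ann (a * z)"
    proof
      fix r assume "r \<in> Ann z"
      then have r: "r \<in> R" "r * z \<in> pO (int p)" by (auto simp: Ann_def)
      have "(r * z) * a \<in> pO (int p)" using r(2) ab(1) by (rule pO_mult)
      then show "r \<in> Ann (a * z)" using r(1) by (simp add: Ann_def mult_ac)
    qed
    have "finite (Ann (a * z))" using R(1) by (simp add: Ann_def)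
    then have eq: "Ann z = Ann (a * z)" using sub zmax[OF Qaz] by (rule card_seteq)
    obtain r where r: "r \<in> R" "b - r \<in> pO (int p)" using bspec[OF R(3) ab(2)] by (rule bexE)
    have "(a * b) * z \<in> pO (int p)" using ab(3) by (simp add: P_def)
    from pO_diff[OF this pO_mult[OF r(2) azO]] have "r * (a * z) \<in> pO (int p)" by (simp add: algebra_simps)
    then have "r \<in> Ann z" using r(1) eq by (simp add: Ann_def)
    then have "r * z \<in> pO (int p)" by (simp add: Ann_def)
    from pO_add[OF this pO_mult[OF r(2) zO]] have "b * z \<in> pO (int p)" by (simp add: algebra_simps)
    then show False using no ab(2) by (simp add: P_def)
  qed
  have P_add: "a + b \<in> P" if "a \<in> P" "b \<in> P" for a b
    using that pO_add[of "a * z" "int p" "b * z"] OK_closed(3)[of a b] by (simp add: P_def distrib_right)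
  have P_mult: "a * b \<in> P" if "a \<in> P" "b \<in> OK" for a b
    using that pO_mult[of "a * z" "int p" b] OK_closed(5)[of a b] by (simp add: P_def mult_ac)
  have P_OK: "P \<subseteq> OK" by (auto simp: P_def)
  have one: "1 \<notin> P" using zp by (simp add: P_def)
  interpret prime_above K n \<sigma> p P
    by unfold_locales (use p P_OK P_add P_mult pP one P_prime in auto)
  \<comment> \<open>\<open>P\<close> annihilates \<open>z\<close> modulo \<open>p\<close>, so this
    quotient maps \<open>P\<close> into \<open>OK\<close> without being integral itself.\<close>
  define y where "y = z / of_nat p"
  have p_ne: "(of_nat p :: 'a) \<noteq> 0" using p0 by simp
  have py: "of_nat p * y = z" using p_ne by (simp add: y_def)
  have yP: "y * x \<in> OK" if "x \<in> P" for x
  proof -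
    have "x * z \<in> pO (int p)" using that by (simp add: P_def)
    then obtain t where t: "t \<in> OK" "x * z = of_int (int p) * t" by (rule pO_E)
    have "y * x = t" using t(2) p_ne by (simp add: y_def field_simps)
    then show ?thesis using t(1) by simp
  qed
  have yK: "y \<in> K" unfolding y_def using OK_K[OF zO] OK_K[OF OK_closed(8)] by (rule K_closed(8))
  \<comment> \<open>Otherwise \<open>y\<close> would preserve the finitely generated group
    \<open>P\<close>, hence be integral, and \<open>z\<close> would lie in \<open>p\<close> times
    \<open>OK\<close>.\<close>
  have "\<exists>\<pi>\<in>P. y * \<pi> \<notin> P"
  proof (rule ccontr)
    assume "\<not> (\<exists>\<pi>\<in>P. y * \<pi> \<notin> P)"
    then have inv: "y * x \<in> P" if "x \<in> P" for x using that by blast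
    obtain w where w: "zbasis w" using ex_zbasis by (rule exE)
    define V where "V = insert (of_nat p) ((\<lambda>k. of_nat p * w k) ` {..<n} \<union> (R \<inter> P))"
    have finV: "finite V" using R(1) by (simp add: V_def)
    have VP: "v \<in> P" if "v \<in> V" for v
      using that pP zbasisD(1)[OF w] P_mult[OF pP] by (auto simp: V_def)
    have span: "x \<in> zspan V" if x: "x \<in> P" for x
    proof -
      obtain r where r: "r \<in> R" "x - r \<in> pO (int p)" using bspec[OF R(3) P_OK'[OF x]] by (rule bexE)
      obtain t where t: "t \<in> OK" "x - r = of_int (int p) * t" using pO_E[OF r(2)] .
      have "x - (x - r) \<in> P" using x pO_P[OF r(2)] by (rule P_diff)
      then have "r \<in> V" using r(1) by (simp add: V_def)
      obtain k :: "nat \<Rightarrow> int" where k: "t = (\<Sum>i<n. of_int (k i) * w i)" using zbasisD(2)[OF w t(1)] by (rule exE)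
      have "x = r + (\<Sum>i<n. of_int (k i) * (of_nat p * w i))"
        using t(2) by (simp add: k sum_distrib_left algebra_simps)
      also have "\<dots> \<in> zspan V"
        using \<open>r \<in> V\<close> by (intro zspan_add zspan_sum zspan_scale zspan_base[OF finV]) (auto simp: V_def)
      finally show ?thesis .
    qed
    have "algebraic_int y"
      by (rule algebraic_int_if_zspan_invariant[OF finV, of "of_nat p"])
         (use p_ne span inv VP in \<open>auto simp: V_def\<close>)
    then have "y \<in> OK" using yK by (simp add: OK_iff)
    from pO_I[OF this, of "int p"] show False using zp py by simp
  qed
  then obtain \<pi> where \<pi>: "\<pi> \<in> P" "y * \<pi> \<notin> P" by (rule bexE)
  define a where "a = y * \<pi>"
  have aO: "a \<in> OK" and aP: "a \<notin> P" using yP[OF \<pi>(1)] \<pi>(2) by (auto simp: a_def)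
  obtain a' where a': "a' \<in> OK" "a * a' - 1 \<in> P" using ex_inverse[OF aO aP] by (rule bexE)
  interpret prime_uniformizer K n \<sigma> p P y \<pi> a'
    by unfold_locales (use yP \<pi> a' in \<open>auto simp: a_def\<close>)
  define e where "e = ramification_index K p P"
  have e_eq: "e = (GREATEST e. of_nat p \<in> J e)"
    unfolding e_def ramification_index_def ideal_power_J ..
  obtain b where b: "\<forall>e. of_nat p \<in> J e \<longrightarrow> e \<le> b" using p_J_bound by (rule exE)
  have "of_nat p \<in> J 0" by (simp add: J_0 OK_closed)
  then have p_e: "of_nat p \<in> J e" unfolding e_eq by (rule GreatestI_nat) (use b in blast)
  have max: "of_nat p \<notin> J (Suc e)"
  proof
    assume "of_nat p \<in> J (Suc e)"
    then have "Suc e \<le> e" unfolding e_eq by (rule Greatest_le_nat) (use b in blast)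
    then show False by simp
  qed
  \<comment> \<open>By maximality of \<open>e\<close> this is outside \<open>P\<close>, while
    \<open>s\<close> times an element of \<open>J e\<close> is divisible by \<open>p\<close>: it
    projects \<open>OK\<close> modulo \<open>p\<close> to its part at \<open>P\<close>.\<close>
  define s where "s = y ^ e * of_nat p"
  have sO: "s \<in> OK" unfolding s_def by (rule J_D[OF p_e order_refl])
  have sP: "s \<notin> P"
  proof
    assume "s \<in> P"
    then have "y * s \<in> OK" by (rule yP)
    moreover have "y ^ Suc e * of_nat p = y * s" by (simp add: s_def mult_ac)
    ultimately have *: "y ^ Suc e * of_nat p \<in> OK" by (simp only:)
    have "of_nat p \<in> J (Suc e)"
    proof (rule J_I)
      fix j assume j: "j \<le> Suc e"
      show "y ^ j * of_nat p \<in> OK"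
      proof (cases "j = Suc e")
        case False
        then show ?thesis using J_D[OF p_e, of j] j by simp
      qed (use * in simp)
    qed (rule OK_closed(8))
    then show False using max by simp
  qed
  have asO: "a * s \<in> OK" using aO sO by (rule OK_closed(5))
  have asP: "a * s \<notin> P" using P_prime[OF aO sO] aP sP by blast
  \<comment> \<open>\<open>p * a * x\<close> is a multiple of \<open>Y\<close>, so of the two
    factors \<open>p\<close> in the hypothesis one remains.\<close>
  have tra: "int p dvd tr (a * x)" if x: "x \<in> OK" for x
  proof -
    have cx: "c * (\<pi> * x) \<in> OK" using c(1) P_OK'[OF \<pi>(1)] x by (intro OK_closed(5))
    have "of_int (int p) * (a * x) = (of_nat p * y) * (\<pi> * x)" by (simp add: a_def mult_ac)
    also have "\<dots> = Y * (c * (\<pi> * x))" unfolding py c(2) by (simp add: mult_ac)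
    finally have eq: "of_int (int p) * (a * x) = Y * (c * (\<pi> * x))" .
    have "int p * tr (a * x) = tr (Y * (c * (\<pi> * x)))"
      by (rule tr_scale[OF OK_closed(5)[OF aO x], of "int p", unfolded eq, symmetric])
    then have "(int p)\<^sup>2 dvd int p * tr (a * x)" using tr[OF cx] by simp
    then have "int p * int p dvd int p * tr (a * x)" by (simp add: power2_eq_square)
    then show ?thesis using p0 by (subst (asm) dvd_mult_cancel_left) simp
  qed
  have "p dvd e"
  proof (rule trace_ramified[OF p_e asO asP])
    fix x assume x: "x \<in> J e"
    have "of_int (int p) * (y ^ e * x) \<in> pO (int p)" using J_D[OF x order_refl] by (rule pO_I)
    then have "(of_int (int p) * (y ^ e * x)) * a \<in> pO (int p)" using aO by (rule pO_mult)
    then show "a * s * x \<in> pO (int p)" by (simp add: s_def mult_ac)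
  next
    fix x assume x: "x \<in> OK"
    have "s * x \<in> OK" using sO x by (rule OK_closed(5))
    from tra[OF this] show "int p dvd tr (a * s * x)" by (simp add: mult.assoc)
  qed
  moreover have "primeideal P (subring_of_type OK)"
    by (rule primeideal_OK) (use P_OK P_0 P_add P_mult one P_prime in auto)
  ultimately show False
    using tame pP p unfolding no_wild_ramification_def e_def by blast
qed

end

section \<open>Isometries of trace lattices\<close>

text \<open>Since \<open>\<sigma>\<close> is a homomorphism on \<open>K\<close> only, the
  determinant is expanded over permutations and every intermediate value is checked to lie in
  \<open>K\<close>.\<close>

lemma (in field_hom_on) det_hom:
  assumes f: "\<And>i j. i < n \<Longrightarrow> j < n \<Longrightarrow> f i j \<in> K"
  shows "det (mat n n (\<lambda>(i, j). f i j)) \<in> K"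
    and "\<sigma> (det (mat n n (\<lambda>(i, j). f i j))) = det (mat n n (\<lambda>(i, j). \<sigma> (f i j)))"
proof -
  have entry: "f i (q i) \<in> K" if "q permutes {0..<n}" "i < n" for q i
    using f[OF that(2), of "q i"] permutes_in_image[OF that(1), of i] that(2) by simp
  have prodK: "(\<Prod>i = 0..<n. f i (q i)) \<in> K" if "q permutes {0..<n}" for q
    by (rule subfield_set_prod[OF K]) (use entry[OF that] in auto)
  have sg: "(signof q :: 'a) \<in> K" for q :: "nat \<Rightarrow> nat"
    by (rule subfield_set_of_int[OF K])
  have det: "det (mat n n (\<lambda>(i, j). g i j)) = (\<Sum>q | q permutes {0..<n}. signof q * (\<Prod>i = 0..<n. g i (q i)))"
    for g :: "nat \<Rightarrow> nat \<Rightarrow> 'c::comm_ring_1"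
    unfolding det_def
    by (auto intro!: sum.cong prod.cong arg_cong2[of _ _ _ _ "(*)"] simp: permutes_in_image)
  show "det (mat n n (\<lambda>(i, j). f i j)) \<in> K"
    unfolding det using sg prodK by (intro subfield_set_sum[OF K] subfield_setD(4)[OF K]) auto
  have "\<sigma> (det (mat n n (\<lambda>(i, j). f i j))) =
      (\<Sum>q | q permutes {0..<n}. \<sigma> (signof q * (\<Prod>i = 0..<n. f i (q i))))"
    unfolding det using sg prodK by (intro sum subfield_setD(4)[OF K]) auto
  also have "\<dots> = (\<Sum>q | q permutes {0..<n}. signof q * (\<Prod>i = 0..<n. \<sigma> (f i (q i))))"
  proof (rule sum.cong)
    fix q assume "q \<in> {q. q permutes {0..<n}}"
    then have q: "q permutes {0..<n}" by simp
    have "\<sigma> (signof q * (\<Prod>i = 0..<n. f i (q i))) = \<sigma> (signof q) * \<sigma> (\<Prod>i = 0..<n. f i (q i))"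
      by (rule mult[OF sg prodK[OF q]])
    also have "\<sigma> (signof q) = signof q" by (rule of_int)
    also have "\<sigma> (\<Prod>i = 0..<n. f i (q i)) = (\<Prod>i = 0..<n. \<sigma> (f i (q i)))"
      by (rule prod) (use entry[OF q] in auto)
    finally show "\<sigma> (signof q * (\<Prod>i = 0..<n. f i (q i))) = signof q * (\<Prod>i = 0..<n. \<sigma> (f i (q i)))" .
  qed simp
  finally show "\<sigma> (det (mat n n (\<lambda>(i, j). f i j))) = det (mat n n (\<lambda>(i, j). \<sigma> (f i j)))"
    unfolding det .
qed

context emb_field
begin

text \<open>A further embedding would be the one of number n + 1 on a field spanned by
  \<open>n\<close> elements.\<close>

lemma embedding_cases:
  assumes \<rho>: "hom_on K (\<rho> :: 'a \<Rightarrow> complex)"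
  shows "\<exists>i<n. \<forall>x\<in>K. \<rho> x = \<sigma> i x"
proof (rule ccontr)
  assume no: "\<not> (\<exists>i<n. \<forall>x\<in>K. \<rho> x = \<sigma> i x)"
  define \<chi> where "\<chi> i = (if i < n then \<sigma> i else \<rho>)" for i
  obtain w where w: "qbasis K n w" using ex_qbasis by (rule exE)
  have "card {..n} \<le> n"
  proof (rule card_homs_le[of "{..n}" K \<chi> n w])
    show "hom_on K (\<chi> i)" if "i \<in> {..n}" for i using hom \<rho> by (simp add: \<chi>_def)
    show "\<exists>x\<in>K. \<chi> i x \<noteq> \<chi> j x" if "i \<in> {..n}" "j \<in> {..n}" "i \<noteq> j" for i j
    proof (cases "i < n"; cases "j < n")
      assume "i < n" "j < n"
      then show ?thesis using distinct[of i j] that by (simp add: \<chi>_def)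
    next
      assume ij: "i < n" "\<not> j < n"
      then obtain x where "x \<in> K" "\<rho> x \<noteq> \<sigma> i x" using no by blast
      then show ?thesis using ij by (intro bexI[of _ x]) (simp_all add: \<chi>_def eq_commute)
    next
      assume ij: "\<not> i < n" "j < n"
      then show ?thesis using no by (auto simp: \<chi>_def)
    next
      assume "\<not> i < n" "\<not> j < n"
      then show ?thesis using that by simp
    qed
  qed (use K qbasisD[OF w] in simp_all)
  then show False by simp
qed

lemma qbasis_image:
  assumes w: "qbasis K n w" and i: "i < n"
  shows "subfield_set (\<sigma> i ` K)" "qbasis (\<sigma> i ` K) n (\<lambda>k. \<sigma> i (w k))"
proof -
  interpret field_hom_on K "\<sigma> i" using h[OF i] .
  show "subfield_set (\<sigma> i ` K)"
    unfolding subfield_set_def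
  proof (intro conjI ballI)
    show "1 \<in> \<sigma> i ` K" using one K_closed(1) by (metis imageI)
    fix x assume x: "x \<in> \<sigma> i ` K"
    then obtain a where a: "x = \<sigma> i a" "a \<in> K" by (rule imageE)
    show "- x \<in> \<sigma> i ` K" using minus[OF a(2)] a K_closed(5) by (metis imageI)
    show "inverse x \<in> \<sigma> i ` K" using inverse_hom[OF a(2)] a K_closed(6) by (metis imageI)
    fix y assume y: "y \<in> \<sigma> i ` K"
    then obtain b where b: "y = \<sigma> i b" "b \<in> K" by (rule imageE)
    show "x + y \<in> \<sigma> i ` K" using add[OF a(2) b(2)] a b K_closed(3) by (metis imageI)
    show "x * y \<in> \<sigma> i ` K" using mult[OF a(2) b(2)] a b K_closed(4) by (metis imageI)
  qed
  show "qbasis (\<sigma> i ` K) n (\<lambda>k. \<sigma> i (w k))"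
    unfolding qbasis_def
  proof (intro conjI allI impI ballI)
    show "\<sigma> i (w k) \<in> \<sigma> i ` K" if "k < n" for k using qbasisD(1)[OF w that] by (rule imageI)
    fix x assume "x \<in> \<sigma> i ` K"
    then obtain a where a: "x = \<sigma> i a" "a \<in> K" by (rule imageE)
    obtain c :: "nat \<Rightarrow> rat" where c: "a = (\<Sum>k<n. of_rat (c k) * w k)" using qbasisD(2)[OF w a(2)] by (rule exE)
    have "x = (\<Sum>k<n. of_rat (c k) * \<sigma> i (w k))"
      unfolding a(1) c by (rule lincomb) (use qbasisD(1)[OF w] in auto)
    then show "\<exists>c::nat \<Rightarrow> rat. x = (\<Sum>k<n. of_rat (c k) * \<sigma> i (w k))" by (intro exI[of _ c])
  qed
qed

end

text \<open>Both degrees are \<open>n\<close>, so the matrix of \<open>f\<close> in rational bases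
  is square; injectivity makes it invertible.\<close>

lemma hom_into_bij:
  assumes K: "emb_field K n \<sigma>" and L: "emb_field L n \<tau>"
    and f: "hom_on K f" "f ` K \<subseteq> L"
  shows "bij_betw f K L"
proof -
  interpret K: emb_field K n \<sigma> by (rule K)
  interpret L: emb_field L n \<tau> by (rule L)
  interpret f: field_hom_on K f by unfold_locales (use K.K f in auto)
  obtain w where w: "qbasis K n w" using K.ex_qbasis by (rule exE)
  obtain b where b: "qbasis L n b" using L.ex_qbasis by (rule exE)
  have wK: "w k \<in> K" if "k < n" for k using qbasisD(1)[OF w that] .
  have bL: "b k \<in> L" if "k < n" for k using qbasisD(1)[OF b that] .
  have "\<exists>c::nat \<Rightarrow> rat. f (w k) = (\<Sum>l<n. of_rat (c l) * b l)" if "k < n" for k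
    using qbasisD(2)[OF b, of "f (w k)"] f(2) wK[OF that] by auto
  then obtain M :: "nat \<Rightarrow> nat \<Rightarrow> rat" where M: "\<And>k. k < n \<Longrightarrow> f (w k) = (\<Sum>l<n. of_rat (M k l) * b l)"
    by metis
  have fsum: "f (\<Sum>k<n. of_rat (c k) * w k) = (\<Sum>l<n. of_rat (\<Sum>k<n. c k * M k l) * b l)" for c :: "nat \<Rightarrow> rat"
  proof -
    have "f (\<Sum>k<n. of_rat (c k) * w k) = (\<Sum>k<n. of_rat (c k) * f (w k))"
      by (rule f.lincomb) (use wK in auto)
    also have "\<dots> = (\<Sum>k<n. \<Sum>l<n. of_rat (c k * M k l) * b l)"
    proof (rule sum.cong)
      fix k assume "k \<in> {..<n}"
      then have "of_rat (c k) * f (w k) = of_rat (c k) * (\<Sum>l<n. of_rat (M k l) * b l)" using M[of k] by simp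
      also have "\<dots> = (\<Sum>l<n. of_rat (c k * M k l) * b l)"
        by (simp only: sum_distrib_left of_rat_mult mult.assoc)
      finally show "of_rat (c k) * f (w k) = (\<Sum>l<n. of_rat (c k * M k l) * b l)" .
    qed simp
    also have "\<dots> = (\<Sum>l<n. of_rat (\<Sum>k<n. c k * M k l) * b l)"
      by (subst sum.swap) (simp add: sum_distrib_right of_rat_sum)
    finally show ?thesis .
  qed
  have det: "det (mat n n (\<lambda>(k, l). M k l)) \<noteq> 0"
  proof (rule det_nonzero_if_rows_independent)
    fix c :: "nat \<Rightarrow> rat"
    assume c: "(\<Sum>k<n. c k * M k l) = 0" if "l < n" for l
    have "f (\<Sum>k<n. of_rat (c k) * w k) = 0" unfolding fsum using c by simp
    then have "(\<Sum>k<n. of_rat (c k) * w k) = 0"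
      by (subst (asm) f.eq_0_iff) (intro subfield_set_sum[OF K.K] K.K_closed(4) subfield_set_of_rat[OF K.K] wK, auto)
    then have "(\<Sum>k<n. of_rat (c k) * w k) = (\<Sum>k<n. of_rat 0 * w k)" by simp
    then show "\<forall>i<n. c i = 0" using K.coords_unique[OF w, of c "\<lambda>_. 0"] by blast
  qed
  obtain R where R: "\<forall>i<n. \<forall>j<n. (\<Sum>k<n. M i k * R k j) = of_bool (i = j)"
    "\<forall>k<n. \<forall>l<n. (\<Sum>i<n. R k i * M i l) = of_bool (k = l)"
    using inverse_if_det_nonzero[OF det] .
  have "x \<in> f ` K" if x: "x \<in> L" for x
  proof -
    obtain d :: "nat \<Rightarrow> rat" where d: "x = (\<Sum>l<n. of_rat (d l) * b l)" using qbasisD(2)[OF b x] by (rule exE)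
    define c where "c k = (\<Sum>m<n. d m * R m k)" for k
    have "(\<Sum>k<n. c k * M k l) = d l" if "l < n" for l
    proof -
      have "(\<Sum>k<n. c k * M k l) = (\<Sum>m<n. d m * (\<Sum>k<n. R m k * M k l))"
        unfolding c_def sum_distrib_left sum_distrib_right by (subst sum.swap) (simp add: mult.assoc)
      also have "\<dots> = (\<Sum>m<n. d m * of_bool (m = l))" by (rule sum.cong) (use R(2) that in auto)
      also have "\<dots> = d l" using that by simp
      finally show ?thesis .
    qed
    then have "x = f (\<Sum>k<n. of_rat (c k) * w k)" unfolding d fsum by (intro sum.cong) auto
    moreover have "(\<Sum>k<n. of_rat (c k) * w k) \<in> K"
      by (intro subfield_set_sum[OF K.K] K.K_closed(4) subfield_set_of_rat[OF K.K] wK) auto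
    ultimately show ?thesis by (rule image_eqI)
  qed
  then show ?thesis using f.inj f(2) by (auto simp: bij_betw_def)
qed

lemma nf_iso_if_embedded:
  assumes K: "emb_field K n \<sigma>" and L: "emb_field L n \<tau>" and ij: "i < n" "j < n"
    and sub: "\<sigma> i ` K \<subseteq> \<tau> j ` L"
  shows "nf_iso K L"
proof -
  interpret K: emb_field K n \<sigma> by (rule K)
  interpret L: emb_field L n \<tau> by (rule L)
  interpret s: field_hom_on K "\<sigma> i" using K.h[OF ij(1)] .
  interpret t: field_hom_on L "\<tau> j" using L.h[OF ij(2)] .
  define f where "f x = the_inv_into L (\<tau> j) (\<sigma> i x)" for x
  have f: "f x \<in> L" "\<tau> j (f x) = \<sigma> i x" if "x \<in> K" for x
    unfolding f_def using the_inv_into_into[OF t.inj, of "\<sigma> i x" L] f_the_inv_into_f[OF t.inj, of "\<sigma> i x"] sub that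
    by auto
  have eqI: "u = v" if "u \<in> L" "v \<in> L" "\<tau> j u = \<tau> j v" for u v
    using inj_onD[OF t.inj that(3) that(1,2)] .
  have "hom_on K f"
    unfolding hom_on_def
  proof (intro conjI ballI)
    show "f 1 = 1"
      by (rule eqI) (use f[OF K.K_closed(1)] L.K_closed(1) s.one t.one in auto)
    fix x z assume xz: "x \<in> K" "z \<in> K"
    show "f (x + z) = f x + f z"
      by (rule eqI) (use f xz K.K_closed(3) L.K_closed(3) in \<open>auto simp: t.add s.add\<close>)
    show "f (x * z) = f x * f z"
      by (rule eqI) (use f xz K.K_closed(4) L.K_closed(4) in \<open>auto simp: t.mult s.mult\<close>)
  qed
  moreover from this have "bij_betw f K L"
    by (rule hom_into_bij[OF K L]) (use f(1) in auto)
  ultimately show ?thesis unfolding nf_iso_iff by (intro exI[of _ f]) simp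
qed

text \<open>Composition with \<open>f\<close> permutes the embeddings, so traces are preserved;
  integrality is preserved because integer equations are.\<close>

lemma trace_lattice_iso_if_nf_iso:
  assumes K: "emb_field K n \<sigma>" and L: "emb_field L n \<tau>" and iso: "nf_iso K L"
  shows "trace_lattice_iso K L"
proof -
  interpret K: emb_field K n \<sigma> by (rule K)
  interpret L: emb_field L n \<tau> by (rule L)
  obtain f where f: "hom_on K f \<and> bij_betw f K L" using iso unfolding nf_iso_iff by (rule exE)
  then have fh: "hom_on K f" and fb: "bij_betw f K L" by simp_all
  interpret f: field_hom_on K f by unfold_locales (use K.K fh in auto)
  have fL: "f x \<in> L" if "x \<in> K" for x using fb that by (auto simp: bij_betw_def)
  have comp: "hom_on K (\<lambda>x. \<tau> j (f x))" if "j < n" for j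
  proof -
    interpret t: field_hom_on L "\<tau> j" using L.h[OF that] .
    show ?thesis unfolding hom_on_def by (simp add: f.one t.one f.add f.mult t.add t.mult fL)
  qed
  have "\<exists>i<n. \<forall>x\<in>K. \<tau> j (f x) = \<sigma> i x" if "j < n" for j using K.embedding_cases[OF comp[OF that]] .
  then obtain s where s: "\<And>j. j < n \<Longrightarrow> s j < n \<and> (\<forall>x\<in>K. \<tau> j (f x) = \<sigma> (s j) x)" by metis
  have inj: "inj_on s {..<n}"
  proof (rule inj_onI)
    fix j k assume jk: "j \<in> {..<n}" "k \<in> {..<n}" "s j = s k"
    show "j = k"
    proof (rule ccontr)
      assume "j \<noteq> k"
      then obtain y where y: "y \<in> L" "\<tau> j y \<noteq> \<tau> k y" using L.distinct[of j k] jk by auto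
      obtain x where "x \<in> K" "y = f x" using y(1) fb by (auto simp: bij_betw_def)
      then show False using y(2) s[of j] s[of k] jk by auto
    qed
  qed
  have "s ` {..<n} = {..<n}" by (rule endo_inj_surj[OF _ _ inj]) (use s in auto)
  have trace: "nf_trace L (f x) = nf_trace K x" if x: "x \<in> K" for x
  proof -
    have "(of_rat (nf_trace L (f x)) :: complex) = (\<Sum>j<n. \<tau> j (f x))" by (rule L.trace_eq[OF fL[OF x]])
    also have "\<dots> = (\<Sum>j<n. \<sigma> (s j) x)" by (rule sum.cong) (use s x in auto)
    also have "\<dots> = (\<Sum>i\<in>s ` {..<n}. \<sigma> i x)" by (simp add: sum.reindex[OF inj])
    also have "\<dots> = of_rat (nf_trace K x)" unfolding \<open>s ` {..<n} = {..<n}\<close> by (rule K.trace_eq[OF x, symmetric])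
    finally show ?thesis by simp
  qed
  have int: "f x \<in> L.OK \<longleftrightarrow> x \<in> K.OK" if "x \<in> K" for x
    using f.algebraic_int_iff[OF that] fL[OF that] that by (simp add: K.OK_iff L.OK_iff)
  have "bij_betw f K.OK L.OK"
    unfolding bij_betw_def
  proof
    show "inj_on f K.OK" using f.inj by (rule inj_on_subset) (auto simp: K.OK_iff)
    show "f ` K.OK = L.OK"
    proof
      show "f ` K.OK \<subseteq> L.OK" using int K.OK_K by blast
      show "L.OK \<subseteq> f ` K.OK"
      proof
        fix y assume y: "y \<in> L.OK"
        obtain x where x: "x \<in> K" "y = f x" using L.OK_K[OF y] fb by (auto simp: bij_betw_def)
        then have "x \<in> K.OK" using int y by simp
        then show "y \<in> f ` K.OK" using x(2) by blast
      qed
    qed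
  qed
  moreover have "\<forall>x\<in>K.OK. \<forall>y\<in>K.OK. f (x + y) = f x + f y" using f.add K.OK_K by blast
  moreover have "\<forall>x\<in>K.OK. \<forall>y\<in>K.OK. nf_trace L (f x * f y) = nf_trace K (x * y)"
    using trace f.mult K.OK_K K.K_closed(4) by metis
  ultimately show ?thesis unfolding trace_lattice_iso_def by (intro exI[of _ f] conjI)
qed

section \<open>The matrix of an isometry of trace lattices\<close>

locale lattice_iso = K: emb_field K n \<sigma> + L: emb_field L n \<tau>
  for K :: "'a::field_char_0 set" and n :: nat and \<sigma> :: "nat \<Rightarrow> 'a \<Rightarrow> complex"
    and L :: "'b::field_char_0 set" and \<tau> :: "nat \<Rightarrow> 'b \<Rightarrow> complex" +
  fixes \<phi> :: "'a \<Rightarrow> 'b"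
  assumes bij: "bij_betw \<phi> (ring_of_integers K) (ring_of_integers L)"
    and add: "\<And>x y. x \<in> ring_of_integers K \<Longrightarrow> y \<in> ring_of_integers K \<Longrightarrow> \<phi> (x + y) = \<phi> x + \<phi> y"
    and trace: "\<And>x y. x \<in> ring_of_integers K \<Longrightarrow> y \<in> ring_of_integers K \<Longrightarrow>
      nf_trace L (\<phi> x * \<phi> y) = nf_trace K (x * y)"
begin

lemma \<phi>_OK: "x \<in> K.OK \<Longrightarrow> \<phi> x \<in> L.OK"
  using bij by (auto simp: bij_betw_def)

lemma \<phi>_0: "\<phi> 0 = 0"
  using add[of 0 0] K.OK_closed(1) by simp

lemma \<phi>_minus: "x \<in> K.OK \<Longrightarrow> \<phi> (- x) = - \<phi> x"
  using add[of x "- x"] K.OK_closed(6)[of x] \<phi>_0 by (simp add: eq_neg_iff_add_eq_0 add.commute)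

lemma \<phi>_nat: "x \<in> K.OK \<Longrightarrow> \<phi> (of_nat k * x) = of_nat k * \<phi> x"
  by (induction k) (simp_all add: \<phi>_0 add K.OK_closed distrib_right)

lemma \<phi>_int: "x \<in> K.OK \<Longrightarrow> \<phi> (of_int k * x) = of_int k * \<phi> x"
proof (cases k rule: int_cases2)
  case (nonneg m)
  assume "x \<in> K.OK"
  then show ?thesis using \<phi>_nat[of x m] nonneg by simp
next
  case (nonpos m)
  assume x: "x \<in> K.OK"
  have "\<phi> (- (of_nat m * x)) = - \<phi> (of_nat m * x)" using x by (intro \<phi>_minus K.OK_closed)
  then show ?thesis using \<phi>_nat[OF x, of m] nonpos by simp
qed

lemma \<phi>_sum: "(\<And>i. i \<in> I \<Longrightarrow> f i \<in> K.OK) \<Longrightarrow> \<phi> (\<Sum>i\<in>I. f i) = (\<Sum>i\<in>I. \<phi> (f i))"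
  by (induction I rule: infinite_finite_induct) (simp_all add: \<phi>_0 add K.OK_sum)

lemma \<phi>_lincomb:
  "(\<And>i. i \<in> I \<Longrightarrow> f i \<in> K.OK) \<Longrightarrow> \<phi> (\<Sum>i\<in>I. of_int (c i) * f i) = (\<Sum>i\<in>I. of_int (c i) * \<phi> (f i))"
  by (subst \<phi>_sum) (simp_all add: \<phi>_int K.OK_closed)

lemma \<phi>_tr: "x \<in> K.OK \<Longrightarrow> y \<in> K.OK \<Longrightarrow> L.tr (\<phi> x * \<phi> y) = K.tr (x * y)"
  by (simp add: L.tr_def K.tr_def trace)

lemma \<phi>_zbasis:
  assumes w: "K.zbasis w"
  shows "L.zbasis (\<lambda>i. \<phi> (w i))"
proof -
  have "\<exists>c::nat \<Rightarrow> int. y = (\<Sum>i<n. of_int (c i) * \<phi> (w i))" if y: "y \<in> L.OK" for y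
  proof -
    obtain x where x: "x \<in> K.OK" "y = \<phi> x" using y bij by (auto simp: bij_betw_def)
    obtain c :: "nat \<Rightarrow> int" where c: "x = (\<Sum>i<n. of_int (c i) * w i)" using K.zbasisD(2)[OF w x(1)] by (rule exE)
    have "y = (\<Sum>i<n. of_int (c i) * \<phi> (w i))"
      unfolding x(2) c by (rule \<phi>_lincomb) (use K.zbasisD(1)[OF w] in auto)
    then show ?thesis by (intro exI[of _ c])
  qed
  then show ?thesis unfolding L.zbasis_def using \<phi>_OK K.zbasisD(1)[OF w] by simp
qed

definition w0 :: "nat \<Rightarrow> 'a" where "w0 = (SOME w. K.zbasis w)"

lemma w0: "K.zbasis w0"
  unfolding w0_def using K.ex_zbasis by (rule someI_ex)

lemma w0_OK: "k < n \<Longrightarrow> w0 k \<in> K.OK"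
  using K.zbasisD(1)[OF w0] .

definition v0 :: "nat \<Rightarrow> 'a" where
  "v0 = (SOME v. qbasis K n v \<and> (\<forall>k<n. \<forall>l<n. nf_trace K (w0 k * v l) = of_bool (k = l)) \<and>
     (\<forall>i<n. \<forall>j<n. (\<Sum>k<n. \<sigma> i (w0 k) * \<sigma> j (v k)) = of_bool (i = j)))"

lemma v0: "qbasis K n v0" "k < n \<Longrightarrow> l < n \<Longrightarrow> nf_trace K (w0 k * v0 l) = of_bool (k = l)"
  "i < n \<Longrightarrow> j < n \<Longrightarrow> (\<Sum>k<n. \<sigma> i (w0 k) * \<sigma> j (v0 k)) = of_bool (i = j)"
proof -
  obtain v where "qbasis K n v" "\<forall>k<n. \<forall>l<n. nf_trace K (w0 k * v l) = of_bool (k = l)"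
    "\<forall>i<n. \<forall>j<n. (\<Sum>k<n. \<sigma> i (w0 k) * \<sigma> j (v k)) = of_bool (i = j)"
    using K.dual_basis[OF K.zbasis_qbasis[OF w0]] .
  then have "\<exists>v. qbasis K n v \<and> (\<forall>k<n. \<forall>l<n. nf_trace K (w0 k * v l) = of_bool (k = l)) \<and>
     (\<forall>i<n. \<forall>j<n. (\<Sum>k<n. \<sigma> i (w0 k) * \<sigma> j (v k)) = of_bool (i = j))"
    by (intro exI[of _ v] conjI)
  from someI_ex[OF this]
  have *: "qbasis K n v0 \<and> (\<forall>k<n. \<forall>l<n. nf_trace K (w0 k * v0 l) = of_bool (k = l)) \<and>
     (\<forall>i<n. \<forall>j<n. (\<Sum>k<n. \<sigma> i (w0 k) * \<sigma> j (v0 k)) = of_bool (i = j))"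
    unfolding v0_def .
  show "qbasis K n v0" using * by (rule conjunct1)
  show "k < n \<Longrightarrow> l < n \<Longrightarrow> nf_trace K (w0 k * v0 l) = of_bool (k = l)" using * by simp
  show "i < n \<Longrightarrow> j < n \<Longrightarrow> (\<Sum>k<n. \<sigma> i (w0 k) * \<sigma> j (v0 k)) = of_bool (i = j)" using * by simp
qed

lemma v0_K: "k < n \<Longrightarrow> v0 k \<in> K"
  using qbasisD(1)[OF v0(1)] .

text \<open>The Casimir pairing of an embedding of \<open>L\<close> with one of \<open>K\<close>; as a matrix it is \<open>\<phi>\<close> in the
  coordinates given by the embeddings, hence orthogonal.\<close>

definition U :: "nat \<Rightarrow> nat \<Rightarrow> complex" where
  "U j i = (\<Sum>k<n. \<tau> j (\<phi> (w0 k)) * \<sigma> i (v0 k))"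

lemma U_apply:
  assumes j: "j < n" and x: "x \<in> K.OK"
  shows "\<tau> j (\<phi> x) = (\<Sum>i<n. U j i * \<sigma> i x)"
proof -
  obtain c :: "nat \<Rightarrow> int" where c: "x = (\<Sum>m<n. of_int (c m) * w0 m)" using K.zbasisD(2)[OF w0 x] by (rule exE)
  interpret t: field_hom_on L "\<tau> j" using L.h[OF j] .
  have base: "(\<Sum>i<n. U j i * \<sigma> i (w0 m)) = \<tau> j (\<phi> (w0 m))" if m: "m < n" for m
  proof -
    have "(\<Sum>i<n. U j i * \<sigma> i (w0 m)) = (\<Sum>k<n. \<tau> j (\<phi> (w0 k)) * (\<Sum>i<n. \<sigma> i (v0 k) * \<sigma> i (w0 m)))"
      unfolding U_def sum_distrib_left sum_distrib_right by (subst sum.swap) (simp add: mult.assoc)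
    also have "\<dots> = (\<Sum>k<n. \<tau> j (\<phi> (w0 k)) * of_bool (m = k))"
    proof (intro sum.cong refl arg_cong2[of _ _ _ _ "(*)"])
      fix k assume k: "k \<in> {..<n}"
      have "(\<Sum>i<n. \<sigma> i (v0 k) * \<sigma> i (w0 m)) = (\<Sum>i<n. \<sigma> i (w0 m * v0 k))"
        using field_hom_on.mult[OF K.h] K.OK_K[OF w0_OK[OF m]] v0_K k by (intro sum.cong) (simp_all add: mult.commute)
      also have "\<dots> = of_rat (nf_trace K (w0 m * v0 k))"
        using K.OK_K[OF w0_OK[OF m]] v0_K k by (intro K.trace_eq[symmetric] K.K_closed) auto
      finally show "(\<Sum>i<n. \<sigma> i (v0 k) * \<sigma> i (w0 m)) = of_bool (m = k)" using v0(2)[OF m, of k] k by simp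
    qed
    also have "\<dots> = \<tau> j (\<phi> (w0 m))" using m by simp
    finally show ?thesis .
  qed
  have "\<tau> j (\<phi> x) = \<tau> j (\<Sum>m<n. of_rat (of_int (c m)) * \<phi> (w0 m))"
    unfolding c using w0_OK by (subst \<phi>_lincomb) auto
  also have "\<dots> = (\<Sum>m<n. of_rat (of_int (c m)) * \<tau> j (\<phi> (w0 m)))"
    by (rule t.lincomb) (use w0_OK \<phi>_OK L.OK_K in auto)
  also have "\<dots> = (\<Sum>m<n. of_rat (of_int (c m)) * (\<Sum>i<n. U j i * \<sigma> i (w0 m)))"
    by (rule sum.cong) (use base in auto)
  also have "\<dots> = (\<Sum>i<n. U j i * (\<Sum>m<n. of_rat (of_int (c m)) * \<sigma> i (w0 m)))"
    unfolding sum_distrib_left by (subst sum.swap) (simp add: mult_ac)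
  also have "\<dots> = (\<Sum>i<n. U j i * \<sigma> i x)"
  proof (intro sum.cong refl arg_cong2[of _ _ _ _ "(*)"])
    fix i assume i: "i \<in> {..<n}"
    have "\<sigma> i (\<Sum>m<n. of_rat (of_int (c m)) * w0 m) = (\<Sum>m<n. of_rat (of_int (c m)) * \<sigma> i (w0 m))"
      by (rule field_hom_on.lincomb[OF K.h]) (use i w0_OK K.OK_K in auto)
    then show "(\<Sum>m<n. of_rat (of_int (c m)) * \<sigma> i (w0 m)) = \<sigma> i x" by (simp add: c)
  qed
  finally show ?thesis .
qed

text \<open>Invariance of the trace gives orthonormal columns, after expanding both traces over the
  embeddings and using duality of \<open>w0\<close> and \<open>v0\<close> twice. For a square matrix
  the rows are then orthonormal too.\<close>

lemma U_orthogonal: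
  assumes "j < n" "l < n"
  shows "(\<Sum>i<n. U j i * U l i) = of_bool (j = l)"
proof -
  have col: "(\<Sum>j<n. U j i * U j l) = of_bool (i = l)" if il: "i < n" "l < n" for i l
  proof -
    have "(\<Sum>j<n. U j i * U j l) =
        (\<Sum>j<n. \<Sum>k<n. \<Sum>m<n. (\<sigma> i (v0 k) * \<sigma> l (v0 m)) * (\<tau> j (\<phi> (w0 k)) * \<tau> j (\<phi> (w0 m))))"
      unfolding U_def sum_product by (simp add: mult_ac)
    also have "\<dots> = (\<Sum>k<n. \<Sum>j<n. \<Sum>m<n. (\<sigma> i (v0 k) * \<sigma> l (v0 m)) * (\<tau> j (\<phi> (w0 k)) * \<tau> j (\<phi> (w0 m))))"
      by (rule sum.swap)
    also have "\<dots> = (\<Sum>k<n. \<Sum>m<n. (\<sigma> i (v0 k) * \<sigma> l (v0 m)) * (\<Sum>j<n. \<tau> j (\<phi> (w0 k)) * \<tau> j (\<phi> (w0 m))))"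
      unfolding sum_distrib_left by (rule sum.cong[OF refl], rule sum.swap)
    also have "\<dots> = (\<Sum>k<n. \<Sum>m<n. (\<sigma> i (v0 k) * \<sigma> l (v0 m)) * (\<Sum>t<n. \<sigma> t (w0 k) * \<sigma> t (w0 m)))"
    proof (rule sum.cong[OF refl], rule sum.cong[OF refl], rule arg_cong2[of _ _ _ _ "(*)", OF refl])
      fix k m assume "k \<in> {..<n}" "m \<in> {..<n}"
      then have km: "w0 k \<in> K.OK" "w0 m \<in> K.OK" using w0_OK by auto
      have "(\<Sum>j<n. \<tau> j (\<phi> (w0 k)) * \<tau> j (\<phi> (w0 m))) = (\<Sum>j<n. \<tau> j (\<phi> (w0 k) * \<phi> (w0 m)))"
        by (rule sum.cong) (use field_hom_on.mult[OF L.h] km \<phi>_OK L.OK_K in auto)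
      also have "\<dots> = of_rat (nf_trace L (\<phi> (w0 k) * \<phi> (w0 m)))"
        using km \<phi>_OK L.OK_K by (intro L.trace_eq[symmetric] L.K_closed) auto
      also have "\<dots> = of_rat (nf_trace K (w0 k * w0 m))" using trace[OF km] by simp
      also have "\<dots> = (\<Sum>t<n. \<sigma> t (w0 k * w0 m))"
        using km K.OK_K by (intro K.trace_eq K.K_closed) auto
      also have "\<dots> = (\<Sum>t<n. \<sigma> t (w0 k) * \<sigma> t (w0 m))"
        by (rule sum.cong) (use field_hom_on.mult[OF K.h] km K.OK_K in auto)
      finally show "(\<Sum>j<n. \<tau> j (\<phi> (w0 k)) * \<tau> j (\<phi> (w0 m))) = (\<Sum>t<n. \<sigma> t (w0 k) * \<sigma> t (w0 m))" .
    qed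
    also have "\<dots> = (\<Sum>k<n. \<Sum>t<n. \<Sum>m<n. (\<sigma> t (w0 k) * \<sigma> i (v0 k)) * (\<sigma> t (w0 m) * \<sigma> l (v0 m)))"
      unfolding sum_distrib_left by (rule sum.cong[OF refl], subst sum.swap) (simp add: mult_ac)
    also have "\<dots> = (\<Sum>t<n. \<Sum>k<n. \<Sum>m<n. (\<sigma> t (w0 k) * \<sigma> i (v0 k)) * (\<sigma> t (w0 m) * \<sigma> l (v0 m)))"
      by (rule sum.swap)
    also have "\<dots> = (\<Sum>t<n. (\<Sum>k<n. \<sigma> t (w0 k) * \<sigma> i (v0 k)) * (\<Sum>m<n. \<sigma> t (w0 m) * \<sigma> l (v0 m)))"
      unfolding sum_product ..
    also have "\<dots> = (\<Sum>t<n. of_bool (t = i) * of_bool (t = l))"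
      by (rule sum.cong) (use v0(3) il in auto)
    also have "\<dots> = (\<Sum>t<n. if t = i then of_bool (i = l) else 0)" by (rule sum.cong) auto
    also have "\<dots> = of_bool (i = l)" using il by simp
    finally show ?thesis .
  qed
  then show ?thesis
    using right_inverse_if_left_inverse[of n "\<lambda>k i. U i k" U j l] assms by simp
qed

text \<open>The \<open>f k / D k\<close> are dual to the \<open>e k\<close>, and the Casimir element
  is the same for every pair of dual bases. The formula exhibits the denominators of
  \<open>U\<close>.\<close>

lemma U_diag:
  assumes e: "K.zbasis e" and f: "K.zbasis f"
    and diag: "\<forall>i<n. \<forall>j<n. K.tr (e i * f j) = (if i = j then D i else 0)"
    and D0: "\<And>i. i < n \<Longrightarrow> D i \<noteq> 0" and ij: "i < n" "j < n"
  shows "U j i = (\<Sum>k<n. \<tau> j (\<phi> (e k)) * \<sigma> i (f k) / of_int (D k))"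
proof -
  have eO: "e k \<in> K.OK" if "k < n" for k using K.zbasisD(1)[OF e that] .
  have fO: "f k \<in> K.OK" if "k < n" for k using K.zbasisD(1)[OF f that] .
  have left: "(\<Sum>i<n. (\<sigma> i (e k) / of_int (D k)) * \<sigma> i (f l)) = of_bool (k = l)" if kl: "k < n" "l < n" for k l
  proof -
    have "(\<Sum>i<n. (\<sigma> i (e k) / of_int (D k)) * \<sigma> i (f l)) = (\<Sum>i<n. \<sigma> i (e k * f l)) / of_int (D k)"
      unfolding sum_divide_distrib
      by (rule sum.cong) (use field_hom_on.mult[OF K.h] eO fO kl K.OK_K in auto)
    also have "(\<Sum>i<n. \<sigma> i (e k * f l)) = of_rat (nf_trace K (e k * f l))"
      using eO fO kl K.OK_K by (intro K.trace_eq[symmetric] K.K_closed) auto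
    also have "nf_trace K (e k * f l) = of_int (K.tr (e k * f l))"
      by (rule K.tr_eq[symmetric]) (use eO fO kl in \<open>auto intro: K.OK_closed\<close>)
    finally show ?thesis using diag D0 kl by auto
  qed
  have right: "(\<Sum>k<n. \<sigma> m (f k) * (\<sigma> i (e k) / of_int (D k))) = of_bool (m = i)" if "m < n" "i < n" for m i
    using right_inverse_if_left_inverse[of n "\<lambda>k i. \<sigma> i (e k) / of_int (D k)" "\<lambda>i l. \<sigma> i (f l)" m i] left that
    by simp
  have "(\<Sum>k<n. \<tau> j (\<phi> (e k)) * \<sigma> i (f k) / of_int (D k)) =
      (\<Sum>k<n. (\<Sum>m<n. U j m * \<sigma> m (e k)) * \<sigma> i (f k) / of_int (D k))"
    by (rule sum.cong) (use U_apply[OF ij(2)] eO in auto)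
  also have "\<dots> = (\<Sum>m<n. U j m * (\<Sum>k<n. \<sigma> i (f k) * (\<sigma> m (e k) / of_int (D k))))"
    unfolding sum_distrib_left sum_distrib_right sum_divide_distrib
    by (subst sum.swap) (simp add: mult_ac)
  also have "\<dots> = (\<Sum>m<n. U j m * of_bool (i = m))"
    by (intro sum.cong refl arg_cong2[of _ _ _ _ "(*)"]) (use right ij in auto)
  also have "\<dots> = U j i" using ij by simp
  finally show ?thesis by simp
qed

text \<open>Conjugation carries \<open>\<tau> j\<close> to some \<open>\<tau> c\<close> and,
  \<open>K\<close> being totally real, row \<open>j\<close> to row \<open>c\<close>. If
  \<open>c \<noteq> j\<close>, orthogonality of the two rows says that the sum of the squared
  absolute values of row \<open>j\<close> is 0, but its sum of squares is 1. In effect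
  \<open>L\<close> is totally real as well.\<close>

lemma U_real:
  assumes real: "\<And>i x. i < n \<Longrightarrow> x \<in> K \<Longrightarrow> \<sigma> i x \<in> \<real>" and ij: "i < n" "j < n"
  shows "U j i \<in> \<real>"
proof -
  interpret t: field_hom_on L "\<tau> j" using L.h[OF ij(2)] .
  have "hom_on L (\<lambda>x. cnj (\<tau> j x))" unfolding hom_on_def by (simp add: t.one t.add t.mult)
  then obtain c where c: "c < n" "\<forall>x\<in>L. cnj (\<tau> j x) = \<tau> c x" using L.embedding_cases by metis
  have U_c: "U c i = cnj (U j i)" if "i < n" for i
  proof -
    have "cnj (U j i) = (\<Sum>k<n. cnj (\<tau> j (\<phi> (w0 k))) * cnj (\<sigma> i (v0 k)))" by (simp add: U_def cnj_sum)
    also have "\<dots> = (\<Sum>k<n. \<tau> c (\<phi> (w0 k)) * \<sigma> i (v0 k))"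
    proof (intro sum.cong refl arg_cong2[of _ _ _ _ "(*)"])
      fix k assume k: "k \<in> {..<n}"
      then show "cnj (\<tau> j (\<phi> (w0 k))) = \<tau> c (\<phi> (w0 k))" using c(2) L.OK_K[OF \<phi>_OK[OF w0_OK]] by simp
      show "cnj (\<sigma> i (v0 k)) = \<sigma> i (v0 k)" using real[OF that v0_K] k by (simp add: Reals_cnj_iff)
    qed
    finally show ?thesis by (simp add: U_def)
  qed
  have "c = j"
  proof (rule ccontr)
    assume "c \<noteq> j"
    then have "0 = (\<Sum>i<n. U c i * U j i)" using U_orthogonal[OF c(1) ij(2)] by simp
    also have "\<dots> = (\<Sum>i<n. of_real ((cmod (U j i))\<^sup>2))"
      by (rule sum.cong) (simp_all add: U_c complex_norm_square mult.commute del: of_real_power)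
    finally have "(\<Sum>i<n. (cmod (U j i))\<^sup>2) = 0" by (metis of_real_eq_0_iff of_real_sum)
    then have "\<forall>i\<in>{..<n}. (cmod (U j i))\<^sup>2 = 0" by (subst (asm) sum_nonneg_eq_0_iff) auto
    then have "(\<Sum>i<n. U j i * U j i) = 0" by simp
    then show False using U_orthogonal[OF ij(2) ij(2)] by simp
  qed
  then show ?thesis using U_c[OF ij(1)] by (simp add: Reals_cnj_iff)
qed

text \<open>For fixed \<open>j\<close> the \<open>U j i\<close> are the eigenvalues of
  multiplication by the Casimir element, a matrix with entries in the image of \<open>L\<close>
  under \<open>\<tau> j\<close>. Their product is \<open>\<tau> j N\<close> for a determinant
  \<open>N\<close> in \<open>L\<close>, and the product over \<open>j\<close> is the norm of
  \<open>N\<close>.\<close>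

lemma U_norm_rational: "\<exists>q. (\<Prod>j<n. \<Prod>i<n. U j i) = of_rat q"
proof -
  have "\<exists>s::nat \<Rightarrow> nat \<Rightarrow> rat. \<forall>k<n. v0 m * v0 k = (\<Sum>r<n. of_rat (s k r) * v0 r)" if "m < n" for m
    by (rule K.mult_matrix[OF v0(1) v0_K[OF that]]) (rule exI)
  then obtain s :: "nat \<Rightarrow> nat \<Rightarrow> nat \<Rightarrow> rat"
    where s: "\<And>m k. m < n \<Longrightarrow> k < n \<Longrightarrow> v0 m * v0 k = (\<Sum>r<n. of_rat (s m k r) * v0 r)"
    by metis
  define M where "M k r = (\<Sum>m<n. of_rat (s m k r) * \<phi> (w0 m))" for k r
  have wL: "\<phi> (w0 m) \<in> L" if "m < n" for m using L.OK_K[OF \<phi>_OK[OF w0_OK[OF that]]] .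
  have M_L: "M k r \<in> L" for k r
    unfolding M_def
    by (intro subfield_set_sum[OF L.K] L.K_closed(4) subfield_set_of_rat[OF L.K] wL) auto
  define N where "N = det (mat n n (\<lambda>(k, r). M k r))"
  have prod: "(\<Prod>i<n. U j i) = \<tau> j N \<and> N \<in> L" if j: "j < n" for j
  proof -
    interpret t: field_hom_on L "\<tau> j" using L.h[OF j] .
    have "(\<Prod>i<n. U j i) = det (mat n n (\<lambda>(k, r). \<tau> j (M k r)))"
    proof (rule eigen_matrix(2)[symmetric, OF K.S_det[OF v0(1), unfolded K.S_mat_def]])
      fix i k assume ik: "i < n" "k < n"
      have "U j i * \<sigma> i (v0 k) = (\<Sum>m<n. \<tau> j (\<phi> (w0 m)) * (\<sigma> i (v0 m) * \<sigma> i (v0 k)))"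
        by (simp add: U_def sum_distrib_right mult.assoc)
      also have "\<dots> = (\<Sum>m<n. \<tau> j (\<phi> (w0 m)) * (\<Sum>r<n. of_rat (s m k r) * \<sigma> i (v0 r)))"
        by (intro sum.cong refl arg_cong2[of _ _ _ _ "(*)"] K.mult_matrix_eigen[OF v0(1) v0_K s ik]) auto
      also have "\<dots> = (\<Sum>r<n. (\<Sum>m<n. of_rat (s m k r) * \<tau> j (\<phi> (w0 m))) * \<sigma> i (v0 r))"
        unfolding sum_distrib_left sum_distrib_right by (subst sum.swap) (simp add: mult_ac)
      also have "\<dots> = (\<Sum>r<n. \<tau> j (M k r) * \<sigma> i (v0 r))"
      proof (intro sum.cong refl arg_cong2[of _ _ _ _ "(*)"])
        fix r
        show "(\<Sum>m<n. of_rat (s m k r) * \<tau> j (\<phi> (w0 m))) = \<tau> j (M k r)"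
          unfolding M_def by (rule t.lincomb[symmetric]) (use wL in auto)
      qed
      finally show "U j i * \<sigma> i (v0 k) = (\<Sum>r<n. \<tau> j (M k r) * \<sigma> i (v0 r))" .
    qed
    also have "\<dots> = \<tau> j N" unfolding N_def by (rule t.det_hom(2)[symmetric]) (rule M_L)
    finally show ?thesis using t.det_hom(1)[of n M] M_L by (simp add: N_def)
  qed
  have "N \<in> L" using prod[OF L.n_pos] by simp
  then obtain q where "(\<Prod>j<n. \<tau> j N) = of_rat q" using L.prod_embeddings by (elim exE[OF L.prod_embeddings])
  moreover have "(\<Prod>j<n. \<Prod>i<n. U j i) = (\<Prod>j<n. \<tau> j N)" by (rule prod.cong) (use prod in auto)
  ultimately show ?thesis by (intro exI[of _ q]) simp
qed

end

text \<open>The equality case of the inequality of means: the nonnegative numbers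
  \<open>z i - 1 - ln (z i)\<close> have sum at most 0, and each vanishes only at 1.\<close>

lemma sum_le_card_imp_eq_1:
  fixes z :: "'i \<Rightarrow> real"
  assumes I: "finite I" and pos: "\<And>i. i \<in> I \<Longrightarrow> z i > 0" and prod: "(\<Prod>i\<in>I. z i) \<ge> 1"
    and le: "(\<Sum>i\<in>I. z i) \<le> of_nat (card I)" and i: "i \<in> I"
  shows "z i = 1"
proof -
  have nz: "z i \<noteq> 0" if "i \<in> I" for i using pos[OF that] by simp
  have "(\<Sum>i\<in>I. ln (z i)) = ln (\<Prod>i\<in>I. z i)" by (rule ln_prod[symmetric]) (use I pos nz in auto)
  then have ln0: "(\<Sum>i\<in>I. ln (z i)) \<ge> 0" using prod by simp
  have nonneg: "z i - 1 - ln (z i) \<ge> 0" if "i \<in> I" for i using ln_le_minus_one[OF pos[OF that]] by simp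
  have "(\<Sum>i\<in>I. z i - 1 - ln (z i)) = (\<Sum>i\<in>I. z i) - of_nat (card I) - (\<Sum>i\<in>I. ln (z i))"
    by (simp add: sum_subtractf)
  then have "(\<Sum>i\<in>I. z i - 1 - ln (z i)) \<le> 0" using le ln0 by simp
  moreover have "(\<Sum>i\<in>I. z i - 1 - ln (z i)) \<ge> 0" by (rule sum_nonneg) (rule nonneg)
  ultimately have "(\<Sum>i\<in>I. z i - 1 - ln (z i)) = 0" by simp
  then have "z i - 1 - ln (z i) = 0" using sum_nonneg_eq_0_iff[OF I nonneg] i by simp
  then show ?thesis using ln_eq_minus_one[OF pos[OF i]] by simp
qed

section \<open>Entries of the matrix for non-isomorphic fields\<close>

locale sn_lattice_iso = lattice_iso K n \<sigma> L \<tau> \<phi> + sn: sn_field K n \<sigma> E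
  for K :: "'a::field_char_0 set" and n \<sigma> and L :: "'b::field_char_0 set" and \<tau> \<phi> E
begin

text \<open>Linear disjointness of \<open>K\<close> from a conjugate of \<open>L\<close>. By
  \<open>dichotomy\<close> a relation would embed a conjugate of \<open>K\<close> into this
  conjugate of \<open>L\<close>, and equal degrees turn that into an isomorphism.\<close>

lemma independent:
  assumes not: "\<not> nf_iso K L" and j: "j < n" and i: "i < n"
    and l: "\<And>k. k < n \<Longrightarrow> l k \<in> \<tau> j ` L" and 0: "(\<Sum>k<n. l k * \<sigma> i (v0 k)) = 0" and k: "k < n"
  shows "l k = 0"
proof (rule ccontr)
  assume lk: "l k \<noteq> 0"
  obtain b where b: "qbasis L n b" using L.ex_qbasis by (rule exE)
  have "\<exists>i<n. \<sigma> i ` K \<subseteq> \<tau> j ` L"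
    by (rule sn.dichotomy[OF L.qbasis_image[OF b j] v0(1) l i 0 k lk])
  then obtain i where i: "i < n" "\<sigma> i ` K \<subseteq> \<tau> j ` L" by (elim exE conjE)
  have "nf_iso K L"
    by (rule nf_iso_if_embedded[OF K.emb_field_axioms L.emb_field_axioms i(1) j i(2)])
  then show False using not by blast
qed

lemma U_nonzero:
  assumes not: "\<not> nf_iso K L" and ij: "i < n" "j < n"
  shows "U j i \<noteq> 0"
proof
  assume U0: "U j i = 0"
  have "\<tau> j (\<phi> (w0 k)) = 0" if k: "k < n" for k
  proof (rule independent[OF not ij(2,1) _ _ k])
    show "\<tau> j (\<phi> (w0 k)) \<in> \<tau> j ` L" if "k < n" for k
      using L.OK_K[OF \<phi>_OK[OF w0_OK[OF that]]] by (rule imageI)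
    show "(\<Sum>k<n. \<tau> j (\<phi> (w0 k)) * \<sigma> i (v0 k)) = 0" using U0 by (simp add: U_def)
  qed
  then have "(\<Sum>i<n. U j i * U j i) = 0" by (simp add: U_def)
  then show False using U_orthogonal[OF ij(2) ij(2)] by simp
qed

text \<open>As 1 has rational coordinates in \<open>v0\<close>, the difference
  \<open>U j i - r\<close> is again a combination of the \<open>\<sigma> i (v0 k)\<close> with
  coefficients in the conjugate of \<open>L\<close> that do not depend on \<open>i\<close>. If it
  vanishes for one \<open>i\<close>, the coefficients vanish, and with them the whole row of
  differences.\<close>

lemma U_row_constant:
  assumes not: "\<not> nf_iso K L" and ij: "i < n" "j < n" and r: "U j i = of_rat r" and m: "m < n"
  shows "U j m = of_rat r"
proof -
  obtain q :: "nat \<Rightarrow> rat" where q: "1 = (\<Sum>k<n. of_rat (q k) * v0 k)" using qbasisD(2)[OF v0(1) K.K_closed(1)] by (rule exE)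
  interpret t: field_hom_on L "\<tau> j" using L.h[OF ij(2)] .
  define l where "l k = \<tau> j (\<phi> (w0 k)) - of_rat (r * q k)" for k
  have one: "1 = (\<Sum>k<n. of_rat (q k) * \<sigma> i (v0 k))" if "i < n" for i
  proof -
    interpret s: field_hom_on K "\<sigma> i" using K.h[OF that] .
    have "\<sigma> i 1 = (\<Sum>k<n. of_rat (q k) * \<sigma> i (v0 k))"
      by (subst q, rule s.lincomb) (use v0_K in auto)
    then show ?thesis by (simp add: s.one)
  qed
  have sum_l: "(\<Sum>k<n. l k * \<sigma> i (v0 k)) = U j i - of_rat r" if i: "i < n" for i
  proof -
    have "(\<Sum>k<n. l k * \<sigma> i (v0 k)) = U j i - of_rat r * (\<Sum>k<n. of_rat (q k) * \<sigma> i (v0 k))"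
      unfolding l_def U_def left_diff_distrib sum_subtractf sum_distrib_left of_rat_mult mult.assoc ..
    then show ?thesis unfolding one[OF i, symmetric] by (simp only: mult_1_right)
  qed
  have "l k = 0" if k: "k < n" for k
  proof (rule independent[OF not ij(2,1) _ _ k])
    show "(\<Sum>k<n. l k * \<sigma> i (v0 k)) = 0" using sum_l[OF ij(1)] r by simp
    fix k assume k: "k < n"
    have wL: "\<phi> (w0 k) \<in> L" using L.OK_K[OF \<phi>_OK[OF w0_OK[OF k]]] .
    have qL: "of_rat (r * q k) \<in> L" by (rule subfield_set_of_rat[OF L.K])
    have "l k = \<tau> j (\<phi> (w0 k) - of_rat (r * q k))"
      unfolding l_def using t.diff[OF wL qL] t.of_rat[of "r * q k"] by simp
    then show "l k \<in> \<tau> j ` L" using L.K_closed(7)[OF wL qL] by (rule image_eqI)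
  qed
  then have "(\<Sum>k<n. l k * \<sigma> m (v0 k)) = 0" by simp
  then show ?thesis using sum_l[OF m] by simp
qed

theorem nf_iso_if_denominator:
  assumes real: "\<And>i x. i < n \<Longrightarrow> x \<in> K \<Longrightarrow> \<sigma> i x \<in> \<real>"
    and d: "d > 0" "d\<^sup>2 \<le> n" and int: "\<And>i j. i < n \<Longrightarrow> j < n \<Longrightarrow> algebraic_int (of_nat d * U j i)"
  shows "nf_iso K L"
proof (rule ccontr)
  assume not: "\<not> nf_iso K L"
  define u where "u j i = Re (U j i)" for j i
  have U: "U j i = of_real (u j i)" if "i < n" "j < n" for i j
    unfolding u_def using U_real[OF real that] by (simp add: of_real_Re)
  let ?I = "{..<n} \<times> {..<n}"
  define z where "z q = (of_nat d * u (fst q) (snd q))\<^sup>2" for q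
  have u0: "u j i \<noteq> 0" if "i < n" "j < n" for i j using U_nonzero[OF not that] U[OF that] by auto
  have zpos: "z q > 0" if "q \<in> ?I" for q
    using that u0[of "snd q" "fst q"] d(1) by (auto simp: z_def zero_less_power2)
  have prod_dU: "(\<Prod>j<n. \<Prod>i<n. of_nat d * U j i) \<in> \<int>"
  proof (rule rational_algebraic_int_is_int)
    show "algebraic_int (\<Prod>j<n. \<Prod>i<n. of_nat d * U j i)"
      by (intro algebraic_int_prod int) auto
    obtain q where "(\<Prod>j<n. \<Prod>i<n. U j i) = of_rat q" using U_norm_rational by (rule exE)
    then have "(\<Prod>j<n. \<Prod>i<n. of_nat d * U j i) = of_rat ((\<Prod>j<n. \<Prod>i<n. of_nat d) * q)"
      by (simp add: prod.distrib of_rat_mult of_rat_power)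
    then show "(\<Prod>j<n. \<Prod>i<n. of_nat d * U j i) \<in> \<rat>" by simp
  qed
  then obtain k where k: "(\<Prod>j<n. \<Prod>i<n. of_nat d * U j i) = of_int k" by (auto elim: Ints_cases)
  have "(\<Prod>j<n. \<Prod>i<n. of_nat d * U j i) = of_real (\<Prod>q\<in>?I. of_nat d * u (fst q) (snd q))"
    using U by (simp add: prod.cartesian_product split_def of_real_prod)
  then have "of_real (\<Prod>q\<in>?I. of_nat d * u (fst q) (snd q)) = (of_real (of_int k) :: complex)"
    using k by simp
  then have kr: "(\<Prod>q\<in>?I. of_nat d * u (fst q) (snd q)) = of_int k" by (simp only: of_real_eq_iff)
  have zprod: "(\<Prod>q\<in>?I. z q) = (of_int k)\<^sup>2"
    unfolding z_def kr[symmetric] by (rule prod_power_distrib[symmetric])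
  have "(\<Prod>q\<in>?I. z q) > 0" by (rule prod_pos) (rule zpos)
  then have "k \<noteq> 0" unfolding zprod by auto
  then have "1 \<le> k\<^sup>2" by (simp add: int_one_le_iff_zero_less)
  then have "1 \<le> (of_int (k\<^sup>2) :: real)" by linarith
  then have zprod1: "(\<Prod>q\<in>?I. z q) \<ge> 1" unfolding zprod by simp
  have row: "(\<Sum>i<n. (u j i)\<^sup>2) = 1" if j: "j < n" for j
  proof -
    have "(of_real (\<Sum>i<n. (u j i)\<^sup>2) :: complex) = (\<Sum>i<n. U j i * U j i)"
      using U j by (simp add: power2_eq_square)
    also have "\<dots> = of_real 1" using U_orthogonal[OF j j] by simp
    finally show ?thesis by (simp only: of_real_eq_iff)
  qed
  have "(\<Sum>q\<in>?I. z q) = (\<Sum>j<n. \<Sum>i<n. (of_nat d)\<^sup>2 * (u j i)\<^sup>2)"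
    by (simp add: z_def sum.cartesian_product split_def power_mult_distrib)
  also have "\<dots> = (\<Sum>j<n. (of_nat d)\<^sup>2 * (\<Sum>i<n. (u j i)\<^sup>2))" by (simp only: sum_distrib_left)
  also have "\<dots> = of_nat (d\<^sup>2 * n)" using row by simp
  also have "\<dots> \<le> of_nat (card ?I)" using d(2) by (subst of_nat_le_iff) simp
  finally have zsum: "(\<Sum>q\<in>?I. z q) \<le> of_nat (card ?I)" .
  have z1: "z q = 1" if "q \<in> ?I" for q
    by (rule sum_le_card_imp_eq_1[OF _ zpos zprod1 zsum that]) auto
  have "\<exists>r. r \<noteq> 0 \<and> U j 0 = of_rat r" if j: "j < n" for j
  proof -
    have "(of_nat d * u j 0)\<^sup>2 = 1" using z1[of "(j, 0)"] j by (simp add: z_def)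
    then have "of_nat d * u j 0 = 1 \<or> of_nat d * u j 0 = -1" by (simp add: power2_eq_1_iff)
    then have "u j 0 = of_rat (1 / of_nat d) \<or> u j 0 = of_rat (- (1 / of_nat d))"
      using d(1) by (auto simp: of_rat_divide of_rat_minus field_simps)
    then obtain r :: rat where r: "u j 0 = of_rat r" by blast
    have n0: "0 < n" using j by simp
    have "(of_real (of_rat r) :: complex) = of_rat r" by (cases r) (simp add: of_rat_rat)
    then have "U j 0 = of_rat r" using U[OF n0 j] r by simp
    moreover have "r \<noteq> 0" using u0[OF n0 j] r by auto
    ultimately show ?thesis by blast
  qed
  then obtain r where r: "\<And>j. j < n \<Longrightarrow> r j \<noteq> 0 \<and> U j 0 = of_rat (r j)" by metis
  have const: "U j i = of_rat (r j)" if "i < n" "j < n" for i j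
    using U_row_constant[OF not _ that(2) _ that(1), of 0 "r j"] r[OF that(2)] that by auto
  show False
  proof (cases "n = 1")
    \<comment> \<open>There is no second row to contradict orthogonality, but both images then
      contain only what the rationals give: every element of \<open>K\<close> is rational.\<close>
    case True
    then have 0: "0 < n" by simp
    obtain w where w: "qbasis K n w" using K.ex_qbasis by (rule exE)
    have "\<sigma> 0 ` K \<subseteq> \<tau> 0 ` L"
    proof
      fix y assume "y \<in> \<sigma> 0 ` K"
      then obtain x where x: "y = \<sigma> 0 x" "x \<in> K" by (rule imageE)
      obtain q where q: "x = of_rat q" using rat_field_elem[OF K.K w[unfolded True] x(2)] by (rule exE)
      have "y = \<tau> 0 (of_rat q)"
        unfolding x(1) q using field_hom_on.of_rat[OF K.h[OF 0]] field_hom_on.of_rat[OF L.h[OF 0]] by simp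
      then show "y \<in> \<tau> 0 ` L" using subfield_set_of_rat[OF L.K] by (rule image_eqI)
    qed
    then have "nf_iso K L"
      by (rule nf_iso_if_embedded[OF K.emb_field_axioms L.emb_field_axioms 0 0])
    then show False using not by blast
  next
    case False
    then have n2: "0 < n" "1 < n" using K.n_pos by auto
    have "(\<Sum>i<n. U 0 i * U 1 i) = (\<Sum>i<n. of_rat (r 0 * r 1))"
      by (rule sum.cong) (use const n2 in \<open>auto simp: of_rat_mult\<close>)
    also have "\<dots> = of_rat (of_nat n * (r 0 * r 1))" by (simp add: of_rat_mult)
    finally have "(of_rat (of_nat n * (r 0 * r 1)) :: complex) = 0" using U_orthogonal[OF n2] by simp
    then have "of_nat n * (r 0 * r 1) = 0" by (simp only: of_rat_eq_0_iff)
    then show False using r[OF n2(1)] r[OF n2(2)] n2 by simp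
  qed
qed

end

section \<open>Denominators of the Casimir pairing\<close>

text \<open>The ideal is generated by its least positive element \<open>g\<close>. Only primes
  dividing \<open>g\<close>, hence \<open>d\<close>, can prevent \<open>g\<close> from dividing
  \<open>t\<close>. This permits bounding denominators one prime at a time.\<close>

lemma mem_int_ideal_if_locally:
  fixes A :: "int set"
  assumes diff: "\<And>a b. a \<in> A \<Longrightarrow> b \<in> A \<Longrightarrow> a - b \<in> A" and scale: "\<And>k a. a \<in> A \<Longrightarrow> k * a \<in> A"
    and d: "d \<in> A" "d \<noteq> 0" and t: "t \<noteq> 0"
    and loc: "\<And>q. Factorial_Ring.prime q \<Longrightarrow> q dvd d \<Longrightarrow>
      \<exists>m\<in>A. m \<noteq> 0 \<and> multiplicity q m \<le> multiplicity q t"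
  shows "t \<in> A"
proof -
  define P where "P k \<longleftrightarrow> k > 0 \<and> int k \<in> A" for k
  define g where "g = (LEAST k. P k)"
  have "int (nat \<bar>d\<bar>) \<in> A"
  proof (cases "d \<ge> 0")
    case False
    then show ?thesis using scale[OF d(1), of "-1"] by simp
  qed (use d in simp)
  then have "P (nat \<bar>d\<bar>)" using d(2) by (simp add: P_def)
  then have "P g" unfolding g_def by (rule LeastI)
  then have g: "g > 0" "int g \<in> A" by (simp_all add: P_def)
  have gdvd: "int g dvd a" if a: "a \<in> A" for a
  proof (rule ccontr)
    assume n: "\<not> int g dvd a"
    define r where "r = a mod int g"
    have "r \<in> A" using diff[OF a scale[OF g(2), of "a div int g"]] by (simp add: r_def minus_div_mult_eq_mod)
    moreover have "r \<noteq> 0" "r \<ge> 0" "r < int g" using n g(1) by (simp_all add: r_def dvd_eq_mod_eq_0)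
    ultimately have "P (nat r)" "nat r < g" by (simp_all add: P_def)
    then show False unfolding g_def using not_less_Least by blast
  qed
  have "int g dvd t"
  proof (rule multiplicity_le_imp_dvd)
    show "int g \<noteq> 0" using g by simp
    fix q :: int assume q: "Factorial_Ring.prime q"
    show "multiplicity q (int g) \<le> multiplicity q t"
    proof (cases "q dvd int g")
      case False
      then show ?thesis by (simp add: not_dvd_imp_multiplicity_0)
    next
      case True
      then have "q dvd d" using gdvd[OF d(1)] by (rule dvd_trans)
      then obtain m where m: "m \<in> A" "m \<noteq> 0" "multiplicity q m \<le> multiplicity q t" using loc[OF q] by auto
      have "multiplicity q (int g) \<le> multiplicity q m" by (rule dvd_imp_multiplicity_le[OF gdvd[OF m(1)] m(2)])
      then show ?thesis using m(3) by simp
    qed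
  qed
  then obtain k where "t = int g * k" by (rule dvdE)
  then show ?thesis using scale[OF g(2), of k] by (simp add: mult.commute)
qed

context lattice_iso
begin

text \<open>The factor \<open>m k\<close> is charged separately for each summand of
  \<open>U_diag\<close>, so the product of all is taken; the common factor \<open>s\<close> is
  charged only once.\<close>

lemma U_multiple_algebraic_int:
  assumes e: "K.zbasis e" and f: "K.zbasis f"
    and diag: "\<forall>i<n. \<forall>j<n. K.tr (e i * f j) = (if i = j then D i else 0)"
    and D0: "\<And>i. i < n \<Longrightarrow> D i \<noteq> 0" and ij: "i < n" "j < n"
    and m: "\<And>k. k < n \<Longrightarrow> algebraic_int (of_int (m k * s) * (\<tau> j (\<phi> (e k)) * \<sigma> i (f k) / of_int (D k)))"
  shows "algebraic_int (of_int ((\<Prod>k<n. m k) * s) * U j i)"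
proof -
  have "of_int ((\<Prod>k<n. m k) * s) * (\<tau> j (\<phi> (e k)) * \<sigma> i (f k) / of_int (D k)) =
      of_int (\<Prod>l\<in>{..<n} - {k}. m l) * (of_int (m k * s) * (\<tau> j (\<phi> (e k)) * \<sigma> i (f k) / of_int (D k)))"
    if k: "k < n" for k
  proof -
    have "(\<Prod>l<n. m l) * s = (\<Prod>l\<in>{..<n} - {k}. m l) * (m k * s)"
      using k by (subst prod.remove[of _ k]) (simp_all add: mult_ac)
    then show ?thesis by (simp only: of_int_mult mult.assoc)
  qed
  moreover have "U j i = (\<Sum>k<n. \<tau> j (\<phi> (e k)) * \<sigma> i (f k) / of_int (D k))"
    by (rule U_diag[OF e f diag D0 ij])
  ultimately have "of_int ((\<Prod>k<n. m k) * s) * U j i =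
      (\<Sum>k<n. of_int (\<Prod>l\<in>{..<n} - {k}. m l) * (of_int (m k * s) * (\<tau> j (\<phi> (e k)) * \<sigma> i (f k) / of_int (D k))))"
    by (simp only: sum_distrib_left) (rule sum.cong, auto)
  moreover have "algebraic_int \<dots>"
    by (intro algebraic_int_sum algebraic_int_times algebraic_int_of_int m) auto
  ultimately show ?thesis by simp
qed

text \<open>If only one elementary divisor is divisible by \<open>q ^ Suc r\<close>, and exactly so, then the squares of
  the corresponding basis elements are divisible by \<open>q\<close>, which saves one factor \<open>q\<close>.\<close>

lemma U_local_denominator:
  assumes e: "K.zbasis e" and f: "K.zbasis f"
    and diag: "\<forall>i<n. \<forall>j<n. K.tr (e i * f j) = (if i = j then D i else 0)"
    and D0: "\<And>i. i < n \<Longrightarrow> D i \<noteq> 0" and ij: "i < n" "j < n"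
    and q: "Factorial_Ring.prime (q :: int)"
    and loc: "\<And>k. k < n \<Longrightarrow> multiplicity q (D k) \<le> r \<or>
      multiplicity q (D k) = Suc r \<and> (\<forall>l<n. l \<noteq> k \<longrightarrow> multiplicity q (D l) \<le> r)"
  shows "\<exists>m. \<not> q dvd m \<and> algebraic_int (of_int (m * q ^ r) * U j i)"
proof -
  interpret s: field_hom_on K "\<sigma> i" using K.h[OF ij(1)] .
  interpret t: field_hom_on L "\<tau> j" using L.h[OF ij(2)] .
  have q0: "q \<noteq> 0" and qu: "\<not> is_unit q" using q by auto
  \<comment> \<open>The part of \<open>D k\<close> prime to \<open>q\<close>; multiplying by it does
    not worsen the bound at \<open>q\<close>.\<close>
  define c where "c k = D k div q ^ multiplicity q (D k)" for k
  have c: "\<not> q dvd c k" "D k = q ^ multiplicity q (D k) * c k" if "k < n" for k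
    using multiplicity_decompose[OF D0[OF that] qu] multiplicity_dvd[of q "D k"] by (simp_all add: c_def)
  have eO: "e k \<in> K.OK" if "k < n" for k using K.zbasisD(1)[OF e that] .
  have fO: "f k \<in> K.OK" if "k < n" for k using K.zbasisD(1)[OF f that] .
  have s_int: "algebraic_int (\<sigma> i x)" if "x \<in> K.OK" for x
    using s.algebraic_int_iff that by (simp add: K.OK_iff)
  have t_int: "algebraic_int (\<tau> j x)" if "x \<in> L.OK" for x
    using t.algebraic_int_iff that by (simp add: L.OK_iff)
  \<comment> \<open>The roles of \<open>e\<close> and \<open>f\<close> are exchanged in
    \<open>L\<close>, because \<open>diag_square\<close> speaks about the second basis and is wanted
    for \<open>f k\<close> in \<open>K\<close> and for \<open>\<phi> (e k)\<close> in
    \<open>L\<close>.\<close>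
  have diagL: "\<forall>i<n. \<forall>j<n. L.tr (\<phi> (f i) * \<phi> (e j)) = (if i = j then D i else 0)"
  proof (intro allI impI)
    fix i j assume "i < n" "j < n"
    then show "L.tr (\<phi> (f i) * \<phi> (e j)) = (if i = j then D i else 0)"
      using \<phi>_tr[OF fO eO, of i j] diag by (simp add: mult.commute)
  qed
  have summand: "algebraic_int (of_int (c k * q ^ r) * (\<tau> j (\<phi> (e k)) * \<sigma> i (f k) / of_int (D k)))" if k: "k < n" for k
  proof (cases "multiplicity q (D k) \<le> r")
    case True
    define v where "v = multiplicity q (D k)"
    have D: "(of_int (D k) :: complex) = of_int q ^ v * of_int (c k)" using c(2)[OF k] by (metis of_int_mult of_int_power v_def)
    have c0: "c k \<noteq> 0" using c(1)[OF k] by auto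
    have "q ^ r = q ^ v * q ^ (r - v)" using True by (simp add: v_def flip: power_add)
    then have "of_int (c k * q ^ r) * (\<tau> j (\<phi> (e k)) * \<sigma> i (f k) / of_int (D k)) =
        of_int (q ^ (r - v)) * (\<tau> j (\<phi> (e k)) * \<sigma> i (f k))"
      using c0 q0 by (simp add: D field_simps)
    moreover have "algebraic_int \<dots>"
      by (rule algebraic_int_times[OF algebraic_int_of_int algebraic_int_times[OF t_int[OF \<phi>_OK[OF eO[OF k]]] s_int[OF fO[OF k]]]])
    ultimately show ?thesis by simp
  next
    case False
    then have v: "multiplicity q (D k) = Suc r" and others: "\<And>l. l < n \<Longrightarrow> l \<noteq> k \<Longrightarrow> multiplicity q (D l) \<le> r"
      using loc[OF k] by auto
    have pow: "q ^ Suc r dvd D l \<longleftrightarrow> Suc r \<le> multiplicity q (D l)" if "l < n" for l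
      by (rule power_dvd_iff_le_multiplicity[OF D0[OF that] qu])
    have dk: "q ^ Suc r dvd D k" using pow[OF k] v by simp
    have dl: "\<not> q ^ Suc r dvd D l" if "l < n" "l \<noteq> k" for l using pow[OF that(1)] others[OF that] by simp
    have "f k * f k \<in> K.pO q" by (rule K.diag_square[OF q e f diag k _ dk dl]) simp_all
    then obtain z where z: "z \<in> K.OK" "f k * f k = of_int q * z" by (rule K.pO_E)
    have "\<phi> (e k) * \<phi> (e k) \<in> L.pO q"
      by (rule L.diag_square[OF q \<phi>_zbasis[OF f] \<phi>_zbasis[OF e] diagL k _ dk dl]) simp_all
    then obtain y where y: "y \<in> L.OK" "\<phi> (e k) * \<phi> (e k) = of_int q * y" by (rule L.pO_E)
    have ss: "\<sigma> i (f k) * \<sigma> i (f k) = of_int q * \<sigma> i z"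
      using s.mult[OF K.OK_K[OF fO[OF k]] K.OK_K[OF fO[OF k]]] s.mult[OF subfield_set_of_int[OF K.K] K.OK_K[OF z(1)], of q]
      unfolding z(2) by (simp add: s.of_int)
    have tt: "\<tau> j (\<phi> (e k)) * \<tau> j (\<phi> (e k)) = of_int q * \<tau> j y"
      using t.mult[OF L.OK_K[OF \<phi>_OK[OF eO[OF k]]] L.OK_K[OF \<phi>_OK[OF eO[OF k]]]]
        t.mult[OF subfield_set_of_int[OF L.K] L.OK_K[OF y(1)], of q]
      unfolding y(2) by (simp add: t.of_int)
    \<comment> \<open>Each of the two squares supplies one factor \<open>q\<close>, so
      \<open>x^2\<close> is integral although only one \<open>q\<close> was divided out of the
      product.\<close>
    define x where "x = \<tau> j (\<phi> (e k)) * \<sigma> i (f k) / of_int q"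
    have "x\<^sup>2 = (\<tau> j (\<phi> (e k)) * \<tau> j (\<phi> (e k))) * (\<sigma> i (f k) * \<sigma> i (f k)) / (of_int q * of_int q)"
      by (simp add: x_def power2_eq_square)
    also have "\<dots> = \<tau> j y * \<sigma> i z" unfolding ss tt using q0 by simp
    finally have "x\<^sup>2 = of_int 0 * x + \<tau> j y * \<sigma> i z" by simp
    then have x: "algebraic_int x"
      by (rule algebraic_int_if_quadratic[OF _ algebraic_int_times[OF t_int[OF y(1)] s_int[OF z(1)]]])
    have D: "(of_int (D k) :: complex) = of_int q ^ Suc r * of_int (c k)" using c(2)[OF k] v by (metis of_int_mult of_int_power)
    have c0: "c k \<noteq> 0" using c(1)[OF k] by auto
    have "of_int (c k * q ^ r) * (\<tau> j (\<phi> (e k)) * \<sigma> i (f k) / of_int (D k)) = x"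
      using c0 q0 by (simp add: D x_def)
    then show ?thesis using x by simp
  qed
  have "algebraic_int (of_int ((\<Prod>k<n. c k) * q ^ r) * U j i)"
    by (rule U_multiple_algebraic_int[OF e f diag D0 ij]) (use summand in auto)
  moreover have "\<not> q dvd (\<Prod>k<n. c k)"
    using c(1) prime_dvd_prod_iff[of "{..<n}" q c] q by auto
  ultimately show ?thesis by (intro exI[of _ "\<Prod>k<n. c k"] conjI)
qed

text \<open>The integers clearing the denominator of \<open>U j i\<close> form an ideal, so the
  bounds at the single primes combine. At each prime \<open>t\<close> may lack one factor if the
  excess sits in a single elementary divisor.\<close>

lemma U_denominator:
  assumes e: "K.zbasis e" and f: "K.zbasis f"
    and diag: "\<forall>i<n. \<forall>j<n. K.tr (e i * f j) = (if i = j then D i else 0)"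
    and D0: "\<And>i. i < n \<Longrightarrow> D i \<noteq> 0" and ij: "i < n" "j < n" and t: "t \<noteq> 0"
    and loc: "\<And>q k. Factorial_Ring.prime (q :: int) \<Longrightarrow> q dvd (\<Prod>i<n. D i) \<Longrightarrow> k < n \<Longrightarrow>
      multiplicity q (D k) \<le> multiplicity q t \<or>
      multiplicity q (D k) = Suc (multiplicity q t) \<and> (\<forall>l<n. l \<noteq> k \<longrightarrow> multiplicity q (D l) \<le> multiplicity q t)"
  shows "algebraic_int (of_int t * U j i)"
proof -
  define A where "A = {m. algebraic_int (of_int m * U j i)}"
  have "t \<in> A"
  proof (rule mem_int_ideal_if_locally)
    show "a - b \<in> A" if "a \<in> A" "b \<in> A" for a b
      using algebraic_int_diff[of "of_int a * U j i" "of_int b * U j i"] that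
      by (simp add: A_def left_diff_distrib)
    show "k * a \<in> A" if "a \<in> A" for k a
      using algebraic_int_times[OF algebraic_int_of_int[of k], of "of_int a * U j i"] that
      by (simp add: A_def mult.assoc)
    have "algebraic_int (of_int ((\<Prod>k<n. D k) * 1) * U j i)"
    proof (rule U_multiple_algebraic_int[OF e f diag D0 ij])
      fix k assume k: "k < n"
      have eq: "of_int (D k * 1) * (\<tau> j (\<phi> (e k)) * \<sigma> i (f k) / of_int (D k)) = \<tau> j (\<phi> (e k)) * \<sigma> i (f k)"
        using D0[OF k] by simp
      have "algebraic_int (\<tau> j (\<phi> (e k)))"
        using field_hom_on.algebraic_int_iff[OF L.h[OF ij(2)]] \<phi>_OK[OF K.zbasisD(1)[OF e k]] by (simp add: L.OK_iff)
      moreover have "algebraic_int (\<sigma> i (f k))"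
        using field_hom_on.algebraic_int_iff[OF K.h[OF ij(1)]] K.zbasisD(1)[OF f k] by (simp add: K.OK_iff)
      ultimately show "algebraic_int (of_int (D k * 1) * (\<tau> j (\<phi> (e k)) * \<sigma> i (f k) / of_int (D k)))"
        unfolding eq by (rule algebraic_int_times)
    qed
    then show "(\<Prod>k<n. D k) \<in> A" by (simp add: A_def)
    show "(\<Prod>k<n. D k) \<noteq> 0" using D0 by simp
    show "t \<noteq> 0" by (rule t)
    fix q :: int assume q: "Factorial_Ring.prime q" "q dvd (\<Prod>k<n. D k)"
    define r where "r = multiplicity q t"
    have "\<exists>m. \<not> q dvd m \<and> algebraic_int (of_int (m * q ^ r) * U j i)"
      unfolding r_def by (rule U_local_denominator[OF e f diag D0 ij q(1) loc[OF q]])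
    then obtain m where m: "\<not> q dvd m" "algebraic_int (of_int (m * q ^ r) * U j i)" by (elim exE conjE)
    have q': "prime_elem q" "q \<noteq> 0" "\<not> is_unit q" using q(1) by auto
    have "multiplicity q (m * q ^ r) = multiplicity q m + r * multiplicity q q"
      using prime_elem_multiplicity_mult_distrib[OF q'(1), of m "q ^ r"]
        prime_elem_multiplicity_power_distrib[OF q'(1), of q r] q'(2) m(1) by auto
    then have "multiplicity q (m * q ^ r) = r"
      using not_dvd_imp_multiplicity_0[OF m(1)] multiplicity_self[OF q'(2,3)] by simp
    moreover have "m * q ^ r \<noteq> 0" using m(1) q(1) by auto
    moreover have "m * q ^ r \<in> A" using m(2) by (simp only: A_def mem_Collect_eq)
    ultimately show "\<exists>m\<in>A. m \<noteq> 0 \<and> multiplicity q m \<le> multiplicity q t"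
      unfolding r_def by (intro bexI[of _ "m * q ^ multiplicity q t"]) simp_all
  qed
  then show ?thesis by (simp add: A_def)
qed

end

lemma multiplicity_squarefree_le_1:
  fixes q m :: int
  assumes "squarefree m" and q: "Factorial_Ring.prime q"
  shows "multiplicity q m \<le> 1"
proof (rule ccontr)
  assume "\<not> multiplicity q m \<le> 1"
  then have "q\<^sup>2 dvd m" by (intro multiplicity_dvd') simp
  then have "q dvd 1" by (rule squarefreeD[OF assms(1)])
  then show False using q by auto
qed

lemma squarefree_int_if_nat:
  assumes "squarefree d"
  shows "squarefree (int d)"
proof (rule squarefreeI)
  fix x :: int assume "x\<^sup>2 dvd int d"
  moreover have "x\<^sup>2 = int (nat \<bar>x\<bar> ^ 2)" by simp
  ultimately have "nat \<bar>x\<bar> ^ 2 dvd d" by (simp only: int_dvd_int_iff)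
  then have "nat \<bar>x\<bar> dvd 1" by (rule squarefreeD[OF assms])
  then show "x dvd 1" by simp
qed

text \<open>The exponent 3 at 2 comes from discriminants \<open>4 * m\<close> with even squarefree
  \<open>m\<close>.\<close>

lemma multiplicity_fundamental_discriminant:
  fixes q :: int
  assumes D: "fundamental_discriminant D" and q: "Factorial_Ring.prime q"
  shows "multiplicity q D \<le> (if q = 2 then 3 else 1)"
proof -
  have "squarefree D \<or> (\<exists>m. D = 4 * m \<and> squarefree m)"
    using D unfolding fundamental_discriminant_def by blast
  then show ?thesis
  proof (elim disjE exE conjE)
    assume "squarefree D"
    from multiplicity_squarefree_le_1[OF this q] show ?thesis by auto
  next
    fix m assume m: "D = 4 * m" "squarefree m"
    have m0: "m \<noteq> 0" using m(2) by auto
    have "multiplicity q 4 = 2 * multiplicity q 2"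
      using prime_elem_multiplicity_power_distrib[OF prime_imp_prime_elem[OF q], of 2 2] by simp
    then have "multiplicity q D = 2 * multiplicity q 2 + multiplicity q m"
      using prime_elem_multiplicity_mult_distrib[OF prime_imp_prime_elem[OF q], of 4 m] m0 unfolding m(1) by simp
    moreover have "multiplicity q 2 = (if q = 2 then 1 else 0)"
    proof (cases "q = 2")
      case False
      then have "\<not> q dvd 2" using primes_dvd_imp_eq[OF q, of 2] by auto
      then show ?thesis using False by (simp add: not_dvd_imp_multiplicity_0)
    qed simp
    ultimately show ?thesis using multiplicity_squarefree_le_1[OF m(2) q] by auto
  qed
qed

lemma prime_intE:
  assumes "Factorial_Ring.prime (q :: int)"
  obtains p where "q = int p" "Factorial_Ring.prime p"
proof -
  have "q \<ge> 0 \<and> Factorial_Ring.prime (nat q)" by (rule iffD1[OF prime_int_nat_transfer assms])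
  then show ?thesis using that[of "nat q"] by simp
qed

text \<open>Otherwise all traces of multiples of \<open>f k\<close> would be divisible by the square
  of the prime, and \<open>tame\<close> would make a basis element divisible by the prime.\<close>

lemma (in emb_field) diag_tame:
  assumes nw: "no_wild_ramification K" and q: "Factorial_Ring.prime q"
    and e: "zbasis e" and f: "zbasis f"
    and diag: "\<forall>i<n. \<forall>j<n. tr (e i * f j) = (if i = j then D i else 0)" and k: "k < n"
  shows "\<not> q\<^sup>2 dvd D k"
proof
  assume dvd: "q\<^sup>2 dvd D k"
  obtain p where p: "q = int p" "Factorial_Ring.prime p" using q by (rule prime_intE)
  have "f k \<in> pO (int p)"
  proof (rule tame[OF nw p(2) zbasisD(1)[OF f k]])
    fix x assume x: "x \<in> OK"
    show "(int p)\<^sup>2 dvd tr (f k * x)"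
      using dvd_trans[OF dvd diag_trace_dvd[OF e f diag k x]] by (simp add: p(1) mult.commute)
  qed
  then have "of_int 1 * f k \<in> pO q" by (simp add: p(1))
  then have "q dvd 1" by (rule pO_basis_element[OF f _ k])
  then show False using q by auto
qed

lemma prime_dvd_rad:
  assumes "m > 0" "Factorial_Ring.prime p" "p dvd m"
  shows "p dvd rad m"
  unfolding rad_def using assms by (intro dvd_prodI) (auto simp: in_prime_factors_iff)

lemma rad_pos: "rad m > 0"
  unfolding rad_def by (intro prod_pos) (auto simp: in_prime_factors_iff prime_gt_0_nat)

text \<open>The valuations of the elementary divisors at a prime add up to that of the discriminant.
  So a large valuation in one divisor leaves little for the others, which is what
  \<open>U_denominator\<close> exploits.\<close>

lemma (in sn_lattice_iso) nf_iso_if_disc: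
  assumes real: "\<And>i x. i < n \<Longrightarrow> x \<in> K \<Longrightarrow> \<sigma> i x \<in> \<real>"
    and pos: "d\<^sub>s > 0" "d\<^sub>f > 0" and coprime: "coprime d\<^sub>s d\<^sub>f"
    and disc: "nf_disc K = int d\<^sub>s * int d\<^sub>f" and sqf: "squarefree d\<^sub>f"
    and d: "d = d\<^sub>s \<or> (no_wild_ramification K \<or> fundamental_discriminant (nf_disc K)) \<and> d = rad d\<^sub>s"
    and dn: "d\<^sup>2 \<le> n"
  shows "nf_iso K L"
proof -
  obtain e f D where e: "K.zbasis e" and f: "K.zbasis f"
    and diag: "\<forall>i<n. \<forall>j<n. K.tr (e i * f j) = (if i = j then D i else 0)"
    and prodD: "\<bar>\<Prod>i<n. D i\<bar> = \<bar>nf_disc K\<bar>" by (rule K.ex_diag_bases)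
  have "nf_disc K \<noteq> 0" using pos disc by simp
  then have "(\<Prod>i<n. D i) \<noteq> 0" using prodD by (metis abs_eq_0_iff)
  then have D0: "D i \<noteq> 0" if "i < n" for i using that by auto
  have d0: "d > 0" using d pos(1) rad_pos by auto
  have int: "algebraic_int (of_nat d * U j i)" if ij: "i < n" "j < n" for i j
  proof -
    have "algebraic_int (of_int (int d) * U j i)"
    proof (rule U_denominator[OF e f diag D0 ij])
      show "int d \<noteq> 0" using d0 by simp
      fix q :: int and k assume q: "Factorial_Ring.prime q" "q dvd (\<Prod>i<n. D i)" and k: "k < n"
      define v where "v l = multiplicity q (D l)" for l
      have q': "prime_elem q" "\<not> is_unit q" using q(1) by auto
      have "multiplicity q (\<Prod>i<n. D i) = multiplicity q (nf_disc K)"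
        using prodD by (auto simp: abs_eq_iff)
      moreover have "multiplicity q (\<Prod>i<n. D i) = (\<Sum>l<n. v l)"
        unfolding v_def by (rule prime_elem_multiplicity_prod_distrib) (use q' D0 in auto)
      ultimately have sum_v: "(\<Sum>l<n. v l) = multiplicity q (nf_disc K)" by simp
      have vk: "v k \<le> multiplicity q (nf_disc K)"
        unfolding sum_v[symmetric] by (rule member_le_sum) (use k in auto)
      have vkl: "v k + v l \<le> multiplicity q (nf_disc K)" if l: "l < n" "l \<noteq> k" for l
      proof -
        have "(\<Sum>l<n. v l) = v k + (\<Sum>l\<in>{..<n} - {k}. v l)" using k by (subst sum.remove[of _ k]) auto
        moreover have "v l \<le> (\<Sum>l\<in>{..<n} - {k}. v l)" by (rule member_le_sum) (use l in auto)
        ultimately show ?thesis using sum_v by simp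
      qed
      have mult: "multiplicity q (nf_disc K) = multiplicity q (int d\<^sub>s) + multiplicity q (int d\<^sub>f)"
        unfolding disc using q' pos by (intro prime_elem_multiplicity_mult_distrib) auto
      have df: "multiplicity q (int d\<^sub>f) \<le> 1"
        by (rule multiplicity_squarefree_le_1[OF squarefree_int_if_nat[OF sqf] q(1)])
      obtain p where p: "q = int p" "Factorial_Ring.prime p" using q(1) by (rule prime_intE)
      have "v k \<le> multiplicity q (int d) \<or>
        v k = Suc (multiplicity q (int d)) \<and> (\<forall>l<n. l \<noteq> k \<longrightarrow> v l \<le> multiplicity q (int d))"
      proof (cases "p dvd d\<^sub>s")
        \<comment> \<open>Outside \<open>d\<^sub>s\<close> the total valuation is at most 1: at most
          one elementary divisor is affected, and exactly once, which is the case of the saved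
          factor.\<close>
        case False
        then have "multiplicity q (int d\<^sub>s) = 0" unfolding p(1) by (intro not_dvd_imp_multiplicity_0) simp
        then have "multiplicity q (nf_disc K) \<le> 1" using df mult by simp
        then show ?thesis using vk vkl by (cases "v k") fastforce+
      next
        case True
        have "\<not> p dvd d\<^sub>f"
        proof
          assume "p dvd d\<^sub>f"
          then have "p dvd 1" using coprime True by (metis coprime_common_divisor_nat dvd_refl)
          then show False using p(2) by auto
        qed
        then have "multiplicity q (int d\<^sub>f) = 0" unfolding p(1) by (intro not_dvd_imp_multiplicity_0) simp
        then have disc_s: "multiplicity q (nf_disc K) = multiplicity q (int d\<^sub>s)" using mult by simp
        from d show ?thesis
        proof
          assume "d = d\<^sub>s"
          then show ?thesis using vk disc_s by simp
        next
          assume *: "(no_wild_ramification K \<or> fundamental_discriminant (nf_disc K)) \<and> d = rad d\<^sub>s"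
          then have "q dvd int d" using prime_dvd_rad[OF pos(1) p(2) True] by (simp add: p(1))
          then have m1: "multiplicity q (int d) \<ge> 1"
            using multiplicity_gt_zero_iff[of "int d" q] d0 q'(2) by simp
          from * have "no_wild_ramification K \<or> fundamental_discriminant (nf_disc K)" by simp
          then show ?thesis
          proof
            assume "no_wild_ramification K"
            from K.diag_tame[OF this q(1) e f diag k] have "v k < 2"
              using power_dvd_iff_le_multiplicity[OF D0[OF k] q'(2), of 2] by (simp add: v_def)
            then show ?thesis using m1 by simp
          next
            assume "fundamental_discriminant (nf_disc K)"
            \<comment> \<open>\<open>d\<close> supplies at least one factor \<open>q\<close>, and
              the total is at most 3. Valuation 1 is covered directly; valuation 2 leaves at most 1
              for every other divisor, so one factor is saved; valuation 3 forces
              \<open>q = 2\<close> and odd remaining divisors, which \<open>diag_not_eight\<close>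
              excludes.\<close>
            note fd = multiplicity_fundamental_discriminant[OF this q(1)]
            show ?thesis
            proof (cases "v k \<le> 2")
              case True
              have "v l \<le> 1" if "l < n" "l \<noteq> k" "v k = 2" for l
                using vkl[OF that(1,2)] that(3) fd by (simp split: if_splits)
              then show ?thesis using True m1 by (cases "v k \<le> multiplicity q (int d)") fastforce+
            next
              case False
              then have q2: "q = 2" and v3: "v k = 3" and m3: "multiplicity q (nf_disc K) = 3"
                using vk fd by (simp_all split: if_splits)
              have "2 ^ 3 dvd D k" unfolding q2[symmetric] by (rule multiplicity_dvd') (use v3 in \<open>simp add: v_def\<close>)
              then have "8 dvd D k" by simp
              moreover have "odd (D l)" if l: "l < n" "l \<noteq> k" for l
              proof -
                have "v l = 0" using vkl[OF l] v3 m3 by simp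
                then show ?thesis using multiplicity_eq_zero_iff[OF D0[OF l(1)] q'(2)] by (simp add: v_def q2)
              qed
              ultimately have False by (rule K.diag_not_eight[OF e f diag k])
              then show ?thesis ..
            qed
          qed
        qed
      qed
      then show "multiplicity q (D k) \<le> multiplicity q (int d) \<or> multiplicity q (D k) = Suc (multiplicity q (int d)) \<and>
        (\<forall>l<n. l \<noteq> k \<longrightarrow> multiplicity q (D l) \<le> multiplicity q (int d))"
        by (simp only: v_def)
    qed
    then show ?thesis by simp
  qed
  show ?thesis by (rule nf_iso_if_denominator[OF real d0 dn int])
qed

theorem theorem5p2:
  fixes K :: "'a::field_char_0 set" and L :: "'b::field_char_0 set"
    and n d\<^sub>s d\<^sub>f :: nat
  assumes "Sn_number_field n K"
    and "totally_real K"
    and "d\<^sub>s > 0" and "d\<^sub>f > 0" and "coprime d\<^sub>s d\<^sub>f"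
    and "nf_disc K = int d\<^sub>s * int d\<^sub>f"
    and "squarefree d\<^sub>f"
    and "Sn_number_field n L"
  shows "(n \<ge> d\<^sub>s\<^sup>2 \<longrightarrow> (trace_lattice_iso K L \<longleftrightarrow> nf_iso K L)) \<and>
    ((no_wild_ramification K \<or> fundamental_discriminant (nf_disc K)) \<and> n \<ge> (rad d\<^sub>s)\<^sup>2 \<longrightarrow>
       (trace_lattice_iso K L \<longleftrightarrow> nf_iso K L))"
proof -
  obtain \<sigma> E where "sn_field K n \<sigma> E" using Sn_number_field_imp_sn_field[OF assms(1)] .
  then interpret K: sn_field K n \<sigma> E .
  obtain \<tau> E' where "sn_field L n \<tau> E'" using Sn_number_field_imp_sn_field[OF assms(8)] .
  then interpret L: sn_field L n \<tau> E' .
  have real: "\<sigma> i x \<in> \<real>" if "i < n" "x \<in> K" for i x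
  proof -
    have "\<sigma> i \<in> embeddings K" unfolding embeddings_iff by (rule K.hom[OF that(1)])
    then have "\<sigma> i ` K \<subseteq> \<real>" using assms(2) by (simp add: totally_real_def)
    then show ?thesis using that(2) by blast
  qed
  \<comment> \<open>Both bounds on \<open>n\<close> are treated at once, with \<open>d\<close>
    standing for \<open>d\<^sub>s\<close> or \<open>rad d\<^sub>s\<close>.\<close>
  have iff: "trace_lattice_iso K L \<longleftrightarrow> nf_iso K L"
    if d: "d = d\<^sub>s \<or> (no_wild_ramification K \<or> fundamental_discriminant (nf_disc K)) \<and> d = rad d\<^sub>s"
      and dn: "d\<^sup>2 \<le> n" for d
  proof
    assume "nf_iso K L"
    then show "trace_lattice_iso K L"
      by (rule trace_lattice_iso_if_nf_iso[OF K.emb_field_axioms L.emb_field_axioms])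
  next
    assume "trace_lattice_iso K L"
    then obtain \<phi> where \<phi>: "bij_betw \<phi> (ring_of_integers K) (ring_of_integers L)"
      "\<forall>x\<in>ring_of_integers K. \<forall>y\<in>ring_of_integers K. \<phi> (x + y) = \<phi> x + \<phi> y"
      "\<forall>x\<in>ring_of_integers K. \<forall>y\<in>ring_of_integers K. nf_trace L (\<phi> x * \<phi> y) = nf_trace K (x * y)"
      unfolding trace_lattice_iso_def by (elim exE conjE)
    interpret sn_lattice_iso K n \<sigma> L \<tau> \<phi> E
    proof (unfold_locales)
      show "bij_betw \<phi> (ring_of_integers K) (ring_of_integers L)" by (rule \<phi>(1))
      show "\<phi> (x + y) = \<phi> x + \<phi> y" if "x \<in> ring_of_integers K" "y \<in> ring_of_integers K" for x y
        using bspec[OF bspec[OF \<phi>(2) that(1)] that(2)] .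
      show "nf_trace L (\<phi> x * \<phi> y) = nf_trace K (x * y)"
        if "x \<in> ring_of_integers K" "y \<in> ring_of_integers K" for x y
        using bspec[OF bspec[OF \<phi>(3) that(1)] that(2)] .
    qed
    show "nf_iso K L" by (rule nf_iso_if_disc[OF real assms(3-7) d dn])
  qed
  show ?thesis using iff[of d\<^sub>s] iff[of "rad d\<^sub>s"] by simp
qed

end
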